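(* The Koszul dual operad of the $2$-colored operad $\mathcal{LP}$ of Leibniz pairs is the operad $H_0(\mathcal{SC}^{\mathrm{vor}})$, i.e. $\mathcal{LP}^!=H_0(\mathcal{SC}^{\mathrm{vor}})$.
   Context: Work over a field $\mathbf k$ of characteristic $0$, with colors $\mathfrak c$ (closed) and $\mathfrak o$ (open). A $2$-colored operad $\mathcal P$ has components indexed by colored inputs and an output color, with symmetric group actions, compositions and units. $\mathcal F(E)$ is the free $2$-colored operad, $\mathcal F^{(2)}(E)$ its weight two part. $\mathcal{LP}=\mathcal F(E_{lp})/(R_{lp})$ is the binary quadratic operad whose algebras are Leibniz pairs (a Lie algebra $L$, an associative non-unital algebra $A$, a Lie morphism $L\to\mathrm{Der}(A)$): $E_{lp}$ is spanned by an antisymmetric $\mathfrak l_2\in E_{lp}(\mathfrak c,\mathfrak c;\mathfrak c)$, by $\mathfrak n_{0,2}\in E_{lp}(\mathfrak o,\mathfrak o;\mathfrak o)$ (regular representation) and by $\mathfrak n_{1,1}\in E_{lp}(\mathfrak c,\mathfrak o;\mathfrak o)$ and its transpose in $E_{lp}(\mathfrak o,\mathfrak c;\mathfrak o)$. Relations: Jacobi for $\mathfrak l_2$, associativity of $\mathfrak n_{0,2}$, $\mathfrak n_{1,1}(l,aa')=\mathfrak n_{1,1}(l,a)a'+a\,\mathfrak n_{1,1}(l,a')$, $\mathfrak n_{1,1}([l,l'],a)=\mathfrak n_{1,1}(l,\mathfrak n_{1,1}(l',a))-\mathfrak n_{1,1}(l',\mathfrak n_{1,1}(l,a))$. For $\mathcal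 P=\mathcal F(E)/(R)$ binary quadratic with $E$ finite dimensional, the Koszul dual operad is $\mathcal P^!=\mathcal F(E^\vee)/(R^\perp)$, where $E^\vee=E^*\otimes\mathrm{sgn}_2$ and $R^\perp$ is the orthogonal of $R$ under the induced (Ginzburg–Kapranov) pairing $\mathcal F^{(2)}(E)\otimes\mathcal F^{(2)}(E^\vee)\to\mathbf k$. $H_0(\mathcal{SC}^{\mathrm{vor}})$ is the degree $0$ homology over $\mathbf k$ of Voronov's swiss-cheese operad: $\mathcal{SC}^{\mathrm{vor}}(n,0;\mathfrak c)$ is the space of configurations of $n\ge1$ numbered disjoint little disks in the unit disk; $\mathcal{SC}^{\mathrm{vor}}(n,m;\mathfrak o)$, $m\ge1$, is the space of configurations of $2n+m$ disjoint little disks in the unit disk invariant under complex conjugation, with exactly $m$ numbered (open) disks fixed by conjugation and $n$ conjugate pairs of numbered (closed) disks; all other components are empty; composition is gluing (together with the conjugate configuration in the conjugate closed disk). It has a binary quadratic presentation with generators a symmetric $f_2$ (closed), $e_{0,2}$ (open, regular representation), $e_{1,1}$ (closed, open $\to$ open) and relations: associativity of $f_2$ and of $e_{0,2}$; $\rho(cc',a)=\rho(c,\rho(c',a))=\rho(c',\rho(c,a))$ and $\rho(c,aa')=\rho(c,a)a'=a\rho(c,a')$, where $\rho=e_{1,1}$. *)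

theory Defs
  imports
    "HOL-Analysis.Analysis"
    "HOL-Algebra.Algebraic_Closure_Type"
    "HOL-Library.Poly_Mapping"
    "HOL-Combinatorics.Permutations"
begin

section \<open>Modules\<close>

text \<open>
  Vector spaces are modules over the field of scalars \<open>'k\<close>, regarded as a ring record.
  The fields \<open>mult\<close> and \<open>one\<close> of a module record play no role.
\<close>

abbreviation scalars :: "'k::field ring" where
  "scalars \<equiv> ring_of_type_algebra"

abbreviation delta :: "'x \<Rightarrow> 'x \<Rightarrow>\<^sub>0 'k::field" where
  "delta x \<equiv> Poly_Mapping.single x 1"

definition free_module :: "'x set \<Rightarrow> ('k::field, 'x \<Rightarrow>\<^sub>0 'k) module" where
  "free_module S =
    \<lparr>carrier = {f. Poly_Mapping.keys f \<subseteq> S}, monoid.mult = undefined, one = undefined,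
     ring.zero = 0, add = (+), smult = (\<lambda>k. Poly_Mapping.map ((*) k))\<rparr>"

definition quot_module :: "('k::field, 'a) module \<Rightarrow> 'a set \<Rightarrow> ('k, 'a set) module" where
  "quot_module M N =
    \<lparr>carrier = a_rcosets\<^bsub>M\<^esub> N, monoid.mult = undefined, one = undefined,
     ring.zero = N, add = set_add M,
     smult = (\<lambda>k A. \<Union>a\<in>A. N +>\<^bsub>M\<^esub> (k \<odot>\<^bsub>M\<^esub> a))\<rparr>"

definition module_span :: "('k::field, 'a) module \<Rightarrow> 'a set \<Rightarrow> 'a set" where
  "module_span M U = (\<lambda>N. submodule N scalars M) hull U"


section \<open>Two-colored operads\<close>

datatype color = Closed | Open

text \<open>
  An operation with inputs \<open>cs\<close> and output \<open>c\<close> lives in the component \<open>(cs, c)\<close>; inputs are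
  numbered from \<open>0\<close>.  The symmetric groups act on the right: \<open>\<sigma>\<close> sends the component
  \<open>(cs, c)\<close> to \<open>(permute_list \<sigma> cs, c)\<close>, the new input \<open>i\<close> being the old input \<open>\<sigma> i\<close>.
  Composition is given by the partial compositions \<open>x \<circ>\<^sub>i y\<close>, where \<open>x\<close> is in \<open>(cs, c)\<close>
  and \<open>y\<close> in \<open>(ds, cs ! i)\<close>; the result lies in \<open>(splice_in cs i ds, c)\<close>.
  All operations take the components of their arguments as parameters, and are only
  meaningful on those components.
\<close>

definition splice_in :: "'c list \<Rightarrow> nat \<Rightarrow> 'c list \<Rightarrow> 'c list" where
  "splice_in cs i ds = take i cs @ ds @ drop (Suc i) cs"

record 'x set_operad =
  s_comp :: "color list \<Rightarrow> color \<Rightarrow> 'x set"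
  s_act :: "color list \<Rightarrow> color \<Rightarrow> (nat \<Rightarrow> nat) \<Rightarrow> 'x \<Rightarrow> 'x"
  s_circ :: "color list \<Rightarrow> color \<Rightarrow> nat \<Rightarrow> color list \<Rightarrow> 'x \<Rightarrow> 'x \<Rightarrow> 'x"
  s_unit :: "color \<Rightarrow> 'x"

record ('k, 'a) operad =
  o_comp :: "color list \<Rightarrow> color \<Rightarrow> ('k, 'a) module"
  o_act :: "color list \<Rightarrow> color \<Rightarrow> (nat \<Rightarrow> nat) \<Rightarrow> 'a \<Rightarrow> 'a"
  o_circ :: "color list \<Rightarrow> color \<Rightarrow> nat \<Rightarrow> color list \<Rightarrow> 'a \<Rightarrow> 'a \<Rightarrow> 'a"
  o_unit :: "color \<Rightarrow> 'a"

definition operad_iso :: "('k::field, 'a) operad \<Rightarrow> ('k, 'b) operad \<Rightarrow> bool"  (infix \<open>\<cong>\<^sub>o\<close> 50)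
  where "P \<cong>\<^sub>o Q \<longleftrightarrow>
    (\<exists>\<phi> :: color list \<Rightarrow> color \<Rightarrow> 'a \<Rightarrow> 'b.
      (\<forall>cs c. bij_betw (\<phi> cs c) (carrier (o_comp P cs c)) (carrier (o_comp Q cs c))) \<and>
      (\<forall>cs c. \<forall>x\<in>carrier (o_comp P cs c). \<forall>y\<in>carrier (o_comp P cs c).
        \<phi> cs c (x \<oplus>\<^bsub>o_comp P cs c\<^esub> y) = \<phi> cs c x \<oplus>\<^bsub>o_comp Q cs c\<^esub> \<phi> cs c y) \<and>
      (\<forall>cs c k. \<forall>x\<in>carrier (o_comp P cs c).
        \<phi> cs c (k \<odot>\<^bsub>o_comp P cs c\<^esub> x) = k \<odot>\<^bsub>o_comp Q cs c\<^esub> \<phi> cs c x) \<and>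
      (\<forall>cs c \<sigma>. \<forall>x\<in>carrier (o_comp P cs c). \<sigma> permutes {..<length cs} \<longrightarrow>
        \<phi> (permute_list \<sigma> cs) c (o_act P cs c \<sigma> x) = o_act Q cs c \<sigma> (\<phi> cs c x)) \<and>
      (\<forall>cs c i ds. i < length cs \<longrightarrow>
        (\<forall>x\<in>carrier (o_comp P cs c). \<forall>y\<in>carrier (o_comp P ds (cs ! i)).
          \<phi> (splice_in cs i ds) c (o_circ P cs c i ds x y) =
          o_circ Q cs c i ds (\<phi> cs c x) (\<phi> ds (cs ! i) y))) \<and>
      (\<forall>c. \<phi> [c] c (o_unit P c) = o_unit Q c))"

text \<open>The operad in vector spaces freely spanned, component by component, by an operad in sets.\<close>

definition linearization :: "'x set_operad \<Rightarrow> ('k::field, 'x \<Rightarrow>\<^sub>0 'k) operad" where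
  "linearization S =
    \<lparr>o_comp = (\<lambda>cs c. free_module (s_comp S cs c)),
     o_act = (\<lambda>cs c \<sigma> f. \<Sum>x\<in>Poly_Mapping.keys f.
       Poly_Mapping.single (s_act S cs c \<sigma> x) (Poly_Mapping.lookup f x)),
     o_circ = (\<lambda>cs c i ds f g. \<Sum>x\<in>Poly_Mapping.keys f. \<Sum>y\<in>Poly_Mapping.keys g.
       Poly_Mapping.single (s_circ S cs c i ds x y)
         (Poly_Mapping.lookup f x * Poly_Mapping.lookup g y)),
     o_unit = (\<lambda>c. Poly_Mapping.single (s_unit S c) 1)\<rparr>"

type_synonym 'a family = "color list \<Rightarrow> color \<Rightarrow> 'a set"

definition sub_collection :: "('k::field, 'a) operad \<Rightarrow> 'a family \<Rightarrow> bool" where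
  "sub_collection P J \<longleftrightarrow>
    (\<forall>cs c. submodule (J cs c) scalars (o_comp P cs c)) \<and>
    (\<forall>cs c \<sigma>. \<forall>x\<in>J cs c. \<sigma> permutes {..<length cs} \<longrightarrow>
      o_act P cs c \<sigma> x \<in> J (permute_list \<sigma> cs) c)"

definition operad_ideal :: "('k::field, 'a) operad \<Rightarrow> 'a family \<Rightarrow> bool" where
  "operad_ideal P J \<longleftrightarrow> sub_collection P J \<and>
    (\<forall>cs c i ds. i < length cs \<longrightarrow>
      (\<forall>x\<in>carrier (o_comp P cs c). \<forall>y\<in>carrier (o_comp P ds (cs ! i)).
        x \<in> J cs c \<or> y \<in> J ds (cs ! i) \<longrightarrow>
        o_circ P cs c i ds x y \<in> J (splice_in cs i ds) c))"

text \<open>Infima below are taken componentwise, in the lattice of families.\<close>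

definition sub_collection_gen :: "('k::field, 'a) operad \<Rightarrow> 'a family \<Rightarrow> 'a family" where
  "sub_collection_gen P U = Inf {J. sub_collection P J \<and> U \<le> J}"

definition ideal_gen :: "('k::field, 'a) operad \<Rightarrow> 'a family \<Rightarrow> 'a family" where
  "ideal_gen P U = Inf {J. operad_ideal P J \<and> U \<le> J}"

text \<open>
  In the quotient by an ideal \<open>J\<close>, an operation applied to cosets is the union of the cosets
  of its values on representatives, and this union is a single coset.
\<close>

definition quot_operad :: "('k::field, 'a) operad \<Rightarrow> 'a family \<Rightarrow> ('k, 'a set) operad" where
  "quot_operad P J =
    \<lparr>o_comp = (\<lambda>cs c. quot_module (o_comp P cs c) (J cs c)),
     o_act = (\<lambda>cs c \<sigma> A. \<Union>a\<in>A.
       J (permute_list \<sigma> cs) c +>\<^bsub>o_comp P (permute_list \<sigma> cs) c\<^esub> o_act P cs c \<sigma> a),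
     o_circ = (\<lambda>cs c i ds A B. \<Union>a\<in>A. \<Union>b\<in>B.
       J (splice_in cs i ds) c +>\<^bsub>o_comp P (splice_in cs i ds) c\<^esub> o_circ P cs c i ds a b),
     o_unit = (\<lambda>c. J [c] c +>\<^bsub>o_comp P [c] c\<^esub> o_unit P c)\<rparr>"


section \<open>Free operads on binary generators\<close>

text \<open>
  Binary generators: \<open>gens E c1 c2 c\<close> is \<open>E(c1, c2; c)\<close>, and \<open>swap E c1 c2 c\<close> is the action of
  the transposition, from \<open>E(c1, c2; c)\<close> to \<open>E(c2, c1; c)\<close>.
\<close>

record ('k, 'e) binary =
  gens :: "color \<Rightarrow> color \<Rightarrow> color \<Rightarrow> ('k, 'e) module"
  swap :: "color \<Rightarrow> color \<Rightarrow> color \<Rightarrow> 'e \<Rightarrow> 'e"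

text \<open>
  \<open>Leaf i\<close> is the input number \<open>i\<close>; \<open>Node c1 c2 e s t\<close> is \<open>e(s, t)\<close> with \<open>s\<close>, \<open>t\<close> of output
  colors \<open>c1\<close>, \<open>c2\<close>.
\<close>

datatype 'e tree = Leaf nat | Node color color 'e "'e tree" "'e tree"

primrec leaves :: "'e tree \<Rightarrow> nat list" where
  "leaves (Leaf i) = [i]"
| "leaves (Node c1 c2 e s t) = leaves s @ leaves t"

primrec weight :: "'e tree \<Rightarrow> nat" where
  "weight (Leaf i) = 0"
| "weight (Node c1 c2 e s t) = Suc (weight s + weight t)"

primrec relabel :: "(nat \<Rightarrow> nat) \<Rightarrow> 'e tree \<Rightarrow> 'e tree" where
  "relabel f (Leaf i) = Leaf (f i)"
| "relabel f (Node c1 c2 e s t) = Node c1 c2 e (relabel f s) (relabel f t)"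

text \<open>\<open>graft i m u t\<close> replaces leaf \<open>i\<close> of \<open>t\<close> by \<open>u\<close>, a tree with \<open>m\<close> leaves.\<close>

primrec graft :: "nat \<Rightarrow> nat \<Rightarrow> 'e tree \<Rightarrow> 'e tree \<Rightarrow> 'e tree" where
  "graft i m u (Leaf j) =
    (if j < i then Leaf j else if j = i then relabel (\<lambda>k. k + i) u else Leaf (j + m - 1))"
| "graft i m u (Node c1 c2 e s t) = Node c1 c2 e (graft i m u s) (graft i m u t)"

primrec well_colored :: "('k, 'e) binary \<Rightarrow> color list \<Rightarrow> color \<Rightarrow> 'e tree \<Rightarrow> bool" where
  "well_colored E cs c (Leaf i) \<longleftrightarrow> i < length cs \<and> cs ! i = c"
| "well_colored E cs c (Node c1 c2 e s t) \<longleftrightarrow>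
    e \<in> carrier (gens E c1 c2 c) \<and> well_colored E cs c1 s \<and> well_colored E cs c2 t"

definition tree_operad :: "('k, 'e) binary \<Rightarrow> 'e tree set_operad" where
  "tree_operad E =
    \<lparr>s_comp = (\<lambda>cs c. {t. well_colored E cs c t \<and> distinct (leaves t) \<and>
       set (leaves t) = {..<length cs}}),
     s_act = (\<lambda>cs c \<sigma>. relabel (inv_into UNIV \<sigma>)),
     s_circ = (\<lambda>cs c i ds s t. graft i (length ds) t s),
     s_unit = (\<lambda>c. Leaf 0)\<rparr>"

text \<open>
  The free operad: linear combinations of trees, modulo linearity in the vertices and
  compatibility of the symmetric action with that on the generators.
\<close>

definition free_rels :: "('k::field, 'e) binary \<Rightarrow> ('e tree \<Rightarrow>\<^sub>0 'k) family" where
  "free_rels E cs c =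
    {Poly_Mapping.single (Node c1 c2 (e \<oplus>\<^bsub>gens E c1 c2 c\<^esub> e') (Leaf 0) (Leaf 1)) 1
      - Poly_Mapping.single (Node c1 c2 e (Leaf 0) (Leaf 1)) 1
      - Poly_Mapping.single (Node c1 c2 e' (Leaf 0) (Leaf 1)) 1 | c1 c2 e e'.
      cs = [c1, c2] \<and> e \<in> carrier (gens E c1 c2 c) \<and> e' \<in> carrier (gens E c1 c2 c)} \<union>
    {Poly_Mapping.single (Node c1 c2 (k \<odot>\<^bsub>gens E c1 c2 c\<^esub> e) (Leaf 0) (Leaf 1)) 1
      - Poly_Mapping.single (Node c1 c2 e (Leaf 0) (Leaf 1)) k | c1 c2 k e.
      cs = [c1, c2] \<and> e \<in> carrier (gens E c1 c2 c)} \<union>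
    {Poly_Mapping.single (Node c1 c2 e (Leaf 1) (Leaf 0)) 1
      - Poly_Mapping.single (Node c2 c1 (swap E c1 c2 c e) (Leaf 0) (Leaf 1)) 1 | c1 c2 e.
      cs = [c2, c1] \<and> e \<in> carrier (gens E c1 c2 c)}"

definition free_ideal :: "('k::field, 'e) binary \<Rightarrow> ('e tree \<Rightarrow>\<^sub>0 'k) family" where
  "free_ideal E = ideal_gen (linearization (tree_operad E)) (free_rels E)"

definition free_operad :: "('k::field, 'e) binary \<Rightarrow> ('k, ('e tree \<Rightarrow>\<^sub>0 'k) set) operad" where
  "free_operad E = quot_operad (linearization (tree_operad E)) (free_ideal E)"

definition free_class ::
  "('k::field, 'e) binary \<Rightarrow> color list \<Rightarrow> color \<Rightarrow> ('e tree \<Rightarrow>\<^sub>0 'k) \<Rightarrow> ('e tree \<Rightarrow>\<^sub>0 'k) set" where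
  "free_class E cs c f =
    free_ideal E cs c +>\<^bsub>o_comp (linearization (tree_operad E)) cs c\<^esub> f"

definition weight_part :: "('k::field, 'e) binary \<Rightarrow> nat \<Rightarrow> ('e tree \<Rightarrow>\<^sub>0 'k) set family" where
  "weight_part E w cs c =
    {U \<in> carrier (o_comp (free_operad E) cs c). \<exists>f\<in>U. \<forall>t\<in>Poly_Mapping.keys f. weight t = w}"


section \<open>Quadratic data and Koszul duality\<close>

text \<open>
  Generators \<open>E\<close>, with finite dimensional components, together with relations \<open>R\<close>, a
  sub-collection of the weight two part of the free operad on \<open>E\<close>.
\<close>

type_synonym ('k, 'e) quadratic = "('k, 'e) binary \<times> ('e tree \<Rightarrow>\<^sub>0 'k) set family"

definition quadratic_operad ::
  "('k::field, 'e) quadratic \<Rightarrow> ('k, ('e tree \<Rightarrow>\<^sub>0 'k) set set) operad" where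
  "quadratic_operad D =
    quot_operad (free_operad (fst D)) (ideal_gen (free_operad (fst D)) (snd D))"

text \<open>
  The dual \<open>E\<^sup>* \<otimes> sgn\<^sub>2\<close>; functionals are extended by zero outside the component.  The sign
  representation is accounted for by the minus sign in the transposition.
\<close>

definition dual_gens :: "('k::field, 'e) binary \<Rightarrow> ('k, 'e \<Rightarrow> 'k) binary" where
  "dual_gens E =
    \<lparr>gens = (\<lambda>c1 c2 c.
       \<lparr>carrier = {\<phi>.
          (\<forall>x\<in>carrier (gens E c1 c2 c). \<forall>y\<in>carrier (gens E c1 c2 c).
            \<phi> (x \<oplus>\<^bsub>gens E c1 c2 c\<^esub> y) = \<phi> x + \<phi> y) \<and>
          (\<forall>k. \<forall>x\<in>carrier (gens E c1 c2 c). \<phi> (k \<odot>\<^bsub>gens E c1 c2 c\<^esub> x) = k * \<phi> x) \<and>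
          (\<forall>x. x \<notin> carrier (gens E c1 c2 c) \<longrightarrow> \<phi> x = 0)},
        monoid.mult = undefined, one = undefined, ring.zero = (\<lambda>x. 0),
        add = (\<lambda>\<phi> \<psi> x. \<phi> x + \<psi> x), smult = (\<lambda>k \<phi> x. k * \<phi> x)\<rparr>),
     swap = (\<lambda>c1 c2 c \<phi> x.
       if x \<in> carrier (gens E c2 c1 c) then - \<phi> (swap E c2 c1 c x) else 0)\<rparr>"

text \<open>
  A tree of weight two with output color \<open>c\<close> and leaves \<open>0, 1, 2\<close> represents the same element
  of the free operad as exactly one tree of the form \<open>e(f(i, j), k)\<close> with \<open>i < j\<close>, up to
  linearity in \<open>e\<close> and \<open>f\<close>.  It is encoded here as \<open>(d, k, e, f)\<close>, where \<open>d\<close> is the color of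
  the inner edge.
\<close>

fun comb_form :: "('k, 'e) binary \<Rightarrow> color \<Rightarrow> 'e tree \<Rightarrow> color \<times> nat \<times> 'e \<times> 'e" where
  "comb_form E c (Node d1 d2 e (Node a b f (Leaf i) (Leaf j)) (Leaf k)) =
    (d1, k, e, if i < j then f else swap E a b d1 f)"
| "comb_form E c (Node d1 d2 e (Leaf k) (Node a b f (Leaf i) (Leaf j))) =
    (d2, k, swap E d1 d2 c e, if i < j then f else swap E a b d2 f)"
| "comb_form E c t = undefined"

text \<open>
  The Ginzburg--Kapranov pairing.  On combs \<open>e(f(i, j), k)\<close> and \<open>\<phi>(\<psi>(i, j), k)\<close> with the same
  leaves and inner color it is \<open>sgn(i, j, k) \<phi>(e) \<psi>(f)\<close>, and combs of different shapes are
  orthogonal.  For \<open>i < j\<close> the permutation \<open>(i, j, k)\<close> of \<open>(0, 1, 2)\<close> has sign \<open>(-1) ^ k\<close>.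
\<close>

definition tree_pairing ::
  "('k::field, 'e) binary \<Rightarrow> color \<Rightarrow> 'e tree \<Rightarrow> ('e \<Rightarrow> 'k) tree \<Rightarrow> 'k" where
  "tree_pairing E c t u =
    (case (comb_form E c t, comb_form (dual_gens E) c u) of
      ((d, k, e, f), (d', k', \<phi>, \<psi>)) \<Rightarrow> if d = d' \<and> k = k' then (- 1) ^ k * \<phi> e * \<psi> f else 0)"

definition pairing ::
  "('k::field, 'e) binary \<Rightarrow> color \<Rightarrow> ('e tree \<Rightarrow>\<^sub>0 'k) \<Rightarrow> (('e \<Rightarrow> 'k) tree \<Rightarrow>\<^sub>0 'k) \<Rightarrow> 'k" where
  "pairing E c f g = (\<Sum>t\<in>Poly_Mapping.keys f. \<Sum>u\<in>Poly_Mapping.keys g.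
    Poly_Mapping.lookup f t * Poly_Mapping.lookup g u * tree_pairing E c t u)"

text \<open>The pairing depends only on the classes of its arguments in the free operads.\<close>

definition class_pairing ::
  "('k::field, 'e) binary \<Rightarrow> color \<Rightarrow> ('e tree \<Rightarrow>\<^sub>0 'k) set \<Rightarrow> (('e \<Rightarrow> 'k) tree \<Rightarrow>\<^sub>0 'k) set \<Rightarrow> 'k"
  where "class_pairing E c U Y = pairing E c (SOME f. f \<in> U) (SOME g. g \<in> Y)"

definition orthogonal ::
  "('k::field, 'e) quadratic \<Rightarrow> (('e \<Rightarrow> 'k) tree \<Rightarrow>\<^sub>0 'k) set family" where
  "orthogonal D cs c =
    {Y \<in> weight_part (dual_gens (fst D)) 2 cs c.
      \<forall>U\<in>snd D cs c. class_pairing (fst D) c U Y = 0}"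

definition koszul_dual ::
  "('k::field, 'e) quadratic \<Rightarrow> ('k, (('e \<Rightarrow> 'k) tree \<Rightarrow>\<^sub>0 'k) set set) operad" where
  "koszul_dual D = quadratic_operad (dual_gens (fst D), orthogonal D)"


section \<open>Leibniz pairs\<close>

text \<open>\<open>N02'\<close> and \<open>N11'\<close> are the transposes of \<open>N02\<close> and \<open>N11\<close>.\<close>

datatype lp_gen = L2 | N02 | N02' | N11 | N11'

fun lp_basis :: "color \<Rightarrow> color \<Rightarrow> color \<Rightarrow> lp_gen set" where
  "lp_basis Closed Closed Closed = {L2}"
| "lp_basis Open Open Open = {N02, N02'}"
| "lp_basis Closed Open Open = {N11}"
| "lp_basis Open Closed Open = {N11'}"
| "lp_basis _ _ _ = {}"

primrec lp_transpose :: "lp_gen \<Rightarrow> lp_gen \<Rightarrow>\<^sub>0 'k::field" where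
  "lp_transpose L2 = Poly_Mapping.single L2 (- 1)"
| "lp_transpose N02 = Poly_Mapping.single N02' 1"
| "lp_transpose N02' = Poly_Mapping.single N02 1"
| "lp_transpose N11 = Poly_Mapping.single N11' 1"
| "lp_transpose N11' = Poly_Mapping.single N11 1"

definition lp_gens :: "('k::field, lp_gen \<Rightarrow>\<^sub>0 'k) binary" where
  "lp_gens =
    \<lparr>gens = (\<lambda>c1 c2 c. free_module (lp_basis c1 c2 c)),
     swap = (\<lambda>c1 c2 c f. \<Sum>b\<in>Poly_Mapping.keys f.
       Poly_Mapping.map ((*) (Poly_Mapping.lookup f b)) (lp_transpose b))\<rparr>"

abbreviation lie :: "(lp_gen \<Rightarrow>\<^sub>0 'k::field) tree \<Rightarrow> (lp_gen \<Rightarrow>\<^sub>0 'k) tree \<Rightarrow> (lp_gen \<Rightarrow>\<^sub>0 'k) tree" where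
  "lie \<equiv> Node Closed Closed (Poly_Mapping.single L2 1)"

abbreviation prd :: "(lp_gen \<Rightarrow>\<^sub>0 'k::field) tree \<Rightarrow> (lp_gen \<Rightarrow>\<^sub>0 'k) tree \<Rightarrow> (lp_gen \<Rightarrow>\<^sub>0 'k) tree" where
  "prd \<equiv> Node Open Open (Poly_Mapping.single N02 1)"

abbreviation der :: "(lp_gen \<Rightarrow>\<^sub>0 'k::field) tree \<Rightarrow> (lp_gen \<Rightarrow>\<^sub>0 'k) tree \<Rightarrow> (lp_gen \<Rightarrow>\<^sub>0 'k) tree" where
  "der \<equiv> Node Closed Open (Poly_Mapping.single N11 1)"

definition lp_rels :: "((lp_gen \<Rightarrow>\<^sub>0 'k::field) tree \<Rightarrow>\<^sub>0 'k) family" where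
  "lp_rels cs c =
    (if cs = [Closed, Closed, Closed] \<and> c = Closed then
       {delta (lie (lie (Leaf 0) (Leaf 1)) (Leaf 2)) + delta (lie (lie (Leaf 1) (Leaf 2)) (Leaf 0))
        + delta (lie (lie (Leaf 2) (Leaf 0)) (Leaf 1))}
     else if cs = [Open, Open, Open] \<and> c = Open then
       {delta (prd (prd (Leaf 0) (Leaf 1)) (Leaf 2)) - delta (prd (Leaf 0) (prd (Leaf 1) (Leaf 2)))}
     else if cs = [Closed, Open, Open] \<and> c = Open then
       {delta (der (Leaf 0) (prd (Leaf 1) (Leaf 2))) - delta (prd (der (Leaf 0) (Leaf 1)) (Leaf 2))
        - delta (prd (Leaf 1) (der (Leaf 0) (Leaf 2)))}
     else if cs = [Closed, Closed, Open] \<and> c = Open then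
       {delta (der (lie (Leaf 0) (Leaf 1)) (Leaf 2)) - delta (der (Leaf 0) (der (Leaf 1) (Leaf 2)))
        + delta (der (Leaf 1) (der (Leaf 0) (Leaf 2)))}
     else {})"

text \<open>
  Quadratic data of the operad of Leibniz pairs, which is \<open>quadratic_operad LP\<close>.  The relations
  are, in this order, the Jacobi identity, associativity, and the two conditions saying that
  \<open>der\<close> is a Lie morphism to derivations.
\<close>

definition LP :: "('k::field, lp_gen \<Rightarrow>\<^sub>0 'k) quadratic" where
  "LP = (lp_gens, sub_collection_gen (free_operad lp_gens)
    (\<lambda>cs c. free_class lp_gens cs c ` lp_rels cs c))"


section \<open>Voronov's swiss-cheese operad\<close>

text \<open>
  A little disk is a pair of center and radius, standing for the embedding \<open>z \<mapsto> a + r z\<close> of the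
  unit disk.  Little disks may touch the unit circle and each other.
\<close>

type_synonym little_disk = "complex \<times> real"

definition disk_of :: "little_disk \<Rightarrow> complex set" where
  "disk_of p = ball (fst p) (snd p)"

text \<open>Configurations of \<open>n\<close> disks carry the product topology (on functions that are constantly
  \<open>undefined\<close> from \<open>n\<close> on).\<close>

definition disk_configs :: "nat \<Rightarrow> (nat \<Rightarrow> little_disk) set" where
  "disk_configs n =
    {p \<in> extensional {..<n}.
      (\<forall>i<n. snd (p i) > 0 \<and> disk_of (p i) \<subseteq> ball 0 1) \<and>
      (\<forall>i<n. \<forall>j<n. i \<noteq> j \<longrightarrow> disk_of (p i) \<inter> disk_of (p j) = {})}"

text \<open>
  For output color \<open>Open\<close>, a conjugation-invariant configuration is recorded by its numbered
  disks: the open ones, which are fixed by conjugation, and from each conjugate pair the closed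
  disk lying in the upper half plane.  Disjointness from the conjugate disks, which lie in the
  lower half plane, is then automatic for the closed disks, and for the open ones it follows by
  symmetry.
\<close>

definition sc_space :: "color list \<Rightarrow> color \<Rightarrow> (nat \<Rightarrow> little_disk) set" where
  "sc_space cs c =
    (case c of
      Closed \<Rightarrow> {p \<in> disk_configs (length cs). cs \<noteq> [] \<and> set cs \<subseteq> {Closed}}
    | Open \<Rightarrow> {p \<in> disk_configs (length cs). Open \<in> set cs \<and>
        (\<forall>i<length cs.
          (cs ! i = Open \<longrightarrow> cnj ` disk_of (p i) = disk_of (p i)) \<and>
          (cs ! i = Closed \<longrightarrow> disk_of (p i) \<subseteq> {z. Im z > 0}))})"

text \<open>
  Gluing into a closed disk also glues the conjugate configuration into the conjugate disk,
  which is not recorded.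
\<close>

definition disk_glue ::
  "nat \<Rightarrow> nat \<Rightarrow> (nat \<Rightarrow> little_disk) \<Rightarrow> (nat \<Rightarrow> little_disk) \<Rightarrow> nat \<Rightarrow> little_disk" where
  "disk_glue i m p q = (\<lambda>k.
    if k < i then p k
    else if k < i + m then
      (fst (p i) + of_real (snd (p i)) * fst (q (k - i)), snd (p i) * snd (q (k - i)))
    else p (k + 1 - m))"

definition SC_vor :: "(nat \<Rightarrow> little_disk) set_operad" where
  "SC_vor =
    \<lparr>s_comp = sc_space,
     s_act = (\<lambda>cs c \<sigma> p. p \<circ> \<sigma>),
     s_circ = (\<lambda>cs c i ds p q. disk_glue i (length ds) p q),
     s_unit = (\<lambda>c. (\<lambda>i. undefined)(0 := (0, 1)))\<rparr>"

text \<open>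
  Degree \<open>0\<close> singular homology with coefficients in \<open>'k\<close>: singular \<open>0\<close>-chains, that is, linear
  combinations of points, modulo boundaries of singular \<open>1\<close>-simplices, that is, of paths.
\<close>

definition boundaries0 :: "'x::topological_space set_operad \<Rightarrow> ('x \<Rightarrow>\<^sub>0 'k::field) family" where
  "boundaries0 T cs c = module_span (free_module (s_comp T cs c))
    {delta (pathfinish \<gamma>) - delta (pathstart \<gamma>) | \<gamma>. path \<gamma> \<and> path_image \<gamma> \<subseteq> s_comp T cs c}"

definition H0 :: "'x::topological_space set_operad \<Rightarrow> ('k::field, ('x \<Rightarrow>\<^sub>0 'k) set) operad" where
  "H0 T = quot_operad (linearization T) (boundaries0 T)"

end

theory Submission
  imports Defs
begin

text \<open>
  Both operads are compared with the linearization of the operad of words: an operation with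
  inputs \<open>cs\<close> is an order of the open inputs, and the closed inputs commute with everything.

  For the Koszul dual, a tree in the dual generators is evaluated to a signed word by
  multiplying the words of its subtrees.  In arity three the kernel of this evaluation is the
  orthogonal of the relations of \<open>LP\<close>, since the Ginzburg--Kapranov pairing with each relation is, up to a
  sign, a coefficient of the evaluation.  Modulo these arity three elements every tree reduces to a right
  comb which is determined by its word, so they generate the whole kernel.

  For the swiss-cheese operad, the open disks of a configuration are centered on the real line
  and their order is the word.  Configurations with equal words are joined by a path:
  the disks are shrunk and their centers moved, the open ones along straight lines and the closed
  ones along a path in the complexified line segment that avoids collisions.
\<close>

section \<open>Morphisms and quotients of operads\<close>

text \<open>Neither operad is mapped to the other: each is presented as the quotient of a larger
  operad by the kernel of a surjection onto words, so that no representatives have to be matched.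

  On the algebraic side the obstacle is that the Koszul dual is a quotient of a quotient, by the
  smallest ideal containing \<open>orthogonal LP\<close>. An arbitrary ideal above
  \<open>orthogonal LP\<close> is therefore pulled back to trees, and the normal form argument is
  run for every tree ideal that lies between the free relations together with the arity three
  kernel, and the whole kernel.

  That \<open>orthogonal LP\<close> is the arity three kernel is a matching of bases: up to a
  permutation of the inputs, each word of arity three belongs to one of the four relations. All
  signs stem from the minus in the transposition of \<open>dual_gens\<close>. With the generators
  dual to \<open>L2\<close>, \<open>N02\<close> and \<open>N11\<close>, every law becomes a
  congruence of two single trees with coefficient 1.\<close>

locale linear_operad =
  fixes P :: "('k::field, 'a) operad"
  assumes comp_module: "\<And>cs c. module scalars (o_comp P cs c)"
    and act_closed: "\<And>cs c \<sigma> x. \<lbrakk>\<sigma> permutes {..<length cs}; x \<in> carrier (o_comp P cs c)\<rbrakk> \<Longrightarrow>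
      o_act P cs c \<sigma> x \<in> carrier (o_comp P (permute_list \<sigma> cs) c)"
    and act_add: "\<And>cs c \<sigma> x y. \<lbrakk>\<sigma> permutes {..<length cs}; x \<in> carrier (o_comp P cs c);
      y \<in> carrier (o_comp P cs c)\<rbrakk> \<Longrightarrow> o_act P cs c \<sigma> (x \<oplus>\<^bsub>o_comp P cs c\<^esub> y) =
      o_act P cs c \<sigma> x \<oplus>\<^bsub>o_comp P (permute_list \<sigma> cs) c\<^esub> o_act P cs c \<sigma> y"
    and circ_closed: "\<And>cs c i ds x y. \<lbrakk>i < length cs; x \<in> carrier (o_comp P cs c);
      y \<in> carrier (o_comp P ds (cs ! i))\<rbrakk> \<Longrightarrow>
      o_circ P cs c i ds x y \<in> carrier (o_comp P (splice_in cs i ds) c)"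
    and circ_add_left: "\<And>cs c i ds x x' y. \<lbrakk>i < length cs; x \<in> carrier (o_comp P cs c);
      x' \<in> carrier (o_comp P cs c); y \<in> carrier (o_comp P ds (cs ! i))\<rbrakk> \<Longrightarrow>
      o_circ P cs c i ds (x \<oplus>\<^bsub>o_comp P cs c\<^esub> x') y =
      o_circ P cs c i ds x y \<oplus>\<^bsub>o_comp P (splice_in cs i ds) c\<^esub> o_circ P cs c i ds x' y"
    and circ_add_right: "\<And>cs c i ds x y y'. \<lbrakk>i < length cs; x \<in> carrier (o_comp P cs c);
      y \<in> carrier (o_comp P ds (cs ! i)); y' \<in> carrier (o_comp P ds (cs ! i))\<rbrakk> \<Longrightarrow>
      o_circ P cs c i ds x (y \<oplus>\<^bsub>o_comp P ds (cs ! i)\<^esub> y') =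
      o_circ P cs c i ds x y \<oplus>\<^bsub>o_comp P (splice_in cs i ds) c\<^esub> o_circ P cs c i ds x y'"
    and unit_closed: "\<And>c. o_unit P c \<in> carrier (o_comp P [c] c)"

text \<open>Closure of the operations is easily inherited by a quotient
  (\<open>closed_quot_operad\<close>) and is all that the isomorphism lemmas ask for, so that a
  quotient of a quotient can be treated.\<close>

definition closed_operad :: "('k::field, 'a) operad \<Rightarrow> bool" where
  "closed_operad P \<longleftrightarrow>
    (\<forall>cs c. abelian_group (o_comp P cs c)) \<and>
    (\<forall>cs c k. \<forall>x\<in>carrier (o_comp P cs c). k \<odot>\<^bsub>o_comp P cs c\<^esub> x \<in> carrier (o_comp P cs c)) \<and>
    (\<forall>cs c \<sigma>. \<forall>x\<in>carrier (o_comp P cs c). \<sigma> permutes {..<length cs} \<longrightarrow>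
      o_act P cs c \<sigma> x \<in> carrier (o_comp P (permute_list \<sigma> cs) c)) \<and>
    (\<forall>cs c i ds. i < length cs \<longrightarrow>
      (\<forall>x\<in>carrier (o_comp P cs c). \<forall>y\<in>carrier (o_comp P ds (cs ! i)).
        o_circ P cs c i ds x y \<in> carrier (o_comp P (splice_in cs i ds) c))) \<and>
    (\<forall>c. o_unit P c \<in> carrier (o_comp P [c] c))"

lemma closed_operadD:
  assumes "closed_operad P"
  shows "abelian_group (o_comp P cs c)"
    and "x \<in> carrier (o_comp P cs c) \<Longrightarrow> k \<odot>\<^bsub>o_comp P cs c\<^esub> x \<in> carrier (o_comp P cs c)"
    and "\<lbrakk>\<sigma> permutes {..<length cs}; x \<in> carrier (o_comp P cs c)\<rbrakk> \<Longrightarrow>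
      o_act P cs c \<sigma> x \<in> carrier (o_comp P (permute_list \<sigma> cs) c)"
    and "\<lbrakk>i < length cs; x \<in> carrier (o_comp P cs c); y \<in> carrier (o_comp P ds (cs ! i))\<rbrakk> \<Longrightarrow>
      o_circ P cs c i ds x y \<in> carrier (o_comp P (splice_in cs i ds) c)"
    and "o_unit P c \<in> carrier (o_comp P [c] c)"
  using assms unfolding closed_operad_def by simp_all

lemma scalars_simps [simp]:
  "carrier (scalars :: 'k::field ring) = UNIV"
  "a \<oplus>\<^bsub>scalars\<^esub> b = a + b" "a \<otimes>\<^bsub>scalars\<^esub> b = a * (b :: 'k)" "\<one>\<^bsub>scalars\<^esub> = (1 :: 'k)"
  by (simp_all add: ring_of_type_algebra_def)

lemma (in linear_operad) closed_operad: "closed_operad P"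
  unfolding closed_operad_def
  using comp_module act_closed circ_closed unit_closed module.smult_closed[OF comp_module]
  by (auto simp: module_def)

definition operad_map ::
  "('k::field, 'a) operad \<Rightarrow> ('k, 'b) operad \<Rightarrow> (color list \<Rightarrow> color \<Rightarrow> 'a \<Rightarrow> 'b) \<Rightarrow> bool" where
  "operad_map P Q F \<longleftrightarrow>
    (\<forall>cs c. \<forall>x\<in>carrier (o_comp P cs c). F cs c x \<in> carrier (o_comp Q cs c)) \<and>
    (\<forall>cs c. \<forall>x\<in>carrier (o_comp P cs c). \<forall>y\<in>carrier (o_comp P cs c).
      F cs c (x \<oplus>\<^bsub>o_comp P cs c\<^esub> y) = F cs c x \<oplus>\<^bsub>o_comp Q cs c\<^esub> F cs c y) \<and>
    (\<forall>cs c k. \<forall>x\<in>carrier (o_comp P cs c).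
      F cs c (k \<odot>\<^bsub>o_comp P cs c\<^esub> x) = k \<odot>\<^bsub>o_comp Q cs c\<^esub> F cs c x) \<and>
    (\<forall>cs c \<sigma>. \<forall>x\<in>carrier (o_comp P cs c). \<sigma> permutes {..<length cs} \<longrightarrow>
      F (permute_list \<sigma> cs) c (o_act P cs c \<sigma> x) = o_act Q cs c \<sigma> (F cs c x)) \<and>
    (\<forall>cs c i ds. i < length cs \<longrightarrow>
      (\<forall>x\<in>carrier (o_comp P cs c). \<forall>y\<in>carrier (o_comp P ds (cs ! i)).
        F (splice_in cs i ds) c (o_circ P cs c i ds x y) =
        o_circ Q cs c i ds (F cs c x) (F ds (cs ! i) y))) \<and>
    (\<forall>c. F [c] c (o_unit P c) = o_unit Q c)"

lemma operad_mapD: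
  assumes "operad_map P Q F"
  shows "x \<in> carrier (o_comp P cs c) \<Longrightarrow> F cs c x \<in> carrier (o_comp Q cs c)"
    and "\<lbrakk>x \<in> carrier (o_comp P cs c); y \<in> carrier (o_comp P cs c)\<rbrakk> \<Longrightarrow>
      F cs c (x \<oplus>\<^bsub>o_comp P cs c\<^esub> y) = F cs c x \<oplus>\<^bsub>o_comp Q cs c\<^esub> F cs c y"
    and "x \<in> carrier (o_comp P cs c) \<Longrightarrow>
      F cs c (k \<odot>\<^bsub>o_comp P cs c\<^esub> x) = k \<odot>\<^bsub>o_comp Q cs c\<^esub> F cs c x"
    and "\<lbrakk>\<sigma> permutes {..<length cs}; x \<in> carrier (o_comp P cs c)\<rbrakk> \<Longrightarrow>
      F (permute_list \<sigma> cs) c (o_act P cs c \<sigma> x) = o_act Q cs c \<sigma> (F cs c x)"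
    and "\<lbrakk>i < length cs; x \<in> carrier (o_comp P cs c); y \<in> carrier (o_comp P ds (cs ! i))\<rbrakk> \<Longrightarrow>
      F (splice_in cs i ds) c (o_circ P cs c i ds x y) =
      o_circ Q cs c i ds (F cs c x) (F ds (cs ! i) y)"
    and "F [c] c (o_unit P c) = o_unit Q c"
  using assms unfolding operad_map_def by simp_all

lemma operad_iso_iff:
  "P \<cong>\<^sub>o Q \<longleftrightarrow> (\<exists>F. operad_map P Q F \<and>
    (\<forall>cs c. bij_betw (F cs c) (carrier (o_comp P cs c)) (carrier (o_comp Q cs c))))"
proof -
  have maps: "\<forall>cs c. \<forall>x\<in>carrier (o_comp P cs c). \<phi> cs c x \<in> carrier (o_comp Q cs c)"
    if "\<forall>cs c. bij_betw (\<phi> cs c) (carrier (o_comp P cs c)) (carrier (o_comp Q cs c))" for \<phi>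
    using that by (meson bij_betw_apply)
  show ?thesis
    unfolding operad_iso_def operad_map_def
    by (intro iff_exI iffI; elim conjE; intro conjI; (assumption | (rule maps, assumption)))
qed

text \<open>The inverse respects an operation because \<open>F\<close> does and is injective on the
  carrier; closure of \<open>P\<close> places the operation on preimages in that carrier.\<close>

lemma operad_iso_sym:
  assumes "closed_operad P" and "P \<cong>\<^sub>o Q"
  shows "Q \<cong>\<^sub>o P"
proof -
  obtain F where F: "operad_map P Q F"
    and bij: "\<And>cs c. bij_betw (F cs c) (carrier (o_comp P cs c)) (carrier (o_comp Q cs c))"
    using assms(2) unfolding operad_iso_iff by blast
  define G where "G cs c = inv_into (carrier (o_comp P cs c)) (F cs c)" for cs c
  have bijG: "bij_betw (G cs c) (carrier (o_comp Q cs c)) (carrier (o_comp P cs c))" for cs c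
    unfolding G_def by (rule bij_betw_inv_into[OF bij])
  have Gc: "G cs c y \<in> carrier (o_comp P cs c)" if "y \<in> carrier (o_comp Q cs c)" for cs c y
    using bijG that by (rule bij_betw_apply)
  have FG: "F cs c (G cs c y) = y" if "y \<in> carrier (o_comp Q cs c)" for cs c y
    unfolding G_def by (rule bij_betw_inv_into_right[OF bij that])
  have GF: "G cs c z = x" if "x \<in> carrier (o_comp P cs c)" "F cs c x = z" for cs c x z
    unfolding G_def that(2)[symmetric] by (rule bij_betw_inv_into_left[OF bij that(1)])
  note P = closed_operadD[OF assms(1)] and D = operad_mapD[OF F]
  have "operad_map Q P G"
    unfolding operad_map_def
  proof (intro conjI allI ballI impI)
    fix cs c x y assume "x \<in> carrier (o_comp Q cs c)" "y \<in> carrier (o_comp Q cs c)"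
    then show "G cs c (x \<oplus>\<^bsub>o_comp Q cs c\<^esub> y) = G cs c x \<oplus>\<^bsub>o_comp P cs c\<^esub> G cs c y"
      by (intro GF) (simp_all add: D Gc FG P(1) abelian_groupE(1))
  next
    fix cs c k x assume "x \<in> carrier (o_comp Q cs c)"
    then show "G cs c (k \<odot>\<^bsub>o_comp Q cs c\<^esub> x) = k \<odot>\<^bsub>o_comp P cs c\<^esub> G cs c x"
      by (intro GF) (simp_all add: D Gc FG P)
  next
    fix cs c \<sigma> x assume "x \<in> carrier (o_comp Q cs c)" "\<sigma> permutes {..<length cs}"
    then show "G (permute_list \<sigma> cs) c (o_act Q cs c \<sigma> x) = o_act P cs c \<sigma> (G cs c x)"
      by (intro GF) (simp_all add: D Gc FG P)
  next
    fix cs c i ds x y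
    assume "i < length cs" "x \<in> carrier (o_comp Q cs c)" "y \<in> carrier (o_comp Q ds (cs ! i))"
    then show "G (splice_in cs i ds) c (o_circ Q cs c i ds x y) =
        o_circ P cs c i ds (G cs c x) (G ds (cs ! i) y)"
      by (intro GF) (simp_all add: D Gc FG P)
  next
    fix c show "G [c] c (o_unit Q c) = o_unit P c"
      by (intro GF) (simp_all add: D P)
  qed (rule Gc)
  then show ?thesis
    using bijG unfolding operad_iso_iff by blast
qed

lemma operad_iso_trans:
  assumes "P \<cong>\<^sub>o Q" and "Q \<cong>\<^sub>o R"
  shows "P \<cong>\<^sub>o R"
proof -
  obtain F where F: "operad_map P Q F"
    and bijF: "\<And>cs c. bij_betw (F cs c) (carrier (o_comp P cs c)) (carrier (o_comp Q cs c))"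
    using assms(1) unfolding operad_iso_iff by blast
  obtain G where G: "operad_map Q R G"
    and bijG: "\<And>cs c. bij_betw (G cs c) (carrier (o_comp Q cs c)) (carrier (o_comp R cs c))"
    using assms(2) unfolding operad_iso_iff by blast
  have "operad_map P R (\<lambda>cs c. G cs c \<circ> F cs c)"
    unfolding operad_map_def by (simp add: operad_mapD[OF F] operad_mapD[OF G])
  moreover have "bij_betw (G cs c \<circ> F cs c) (carrier (o_comp P cs c)) (carrier (o_comp R cs c))"
    for cs c by (rule bij_betw_trans[OF bijF bijG])
  ultimately show ?thesis
    unfolding operad_iso_iff by blast
qed

section \<open>First isomorphism theorem for operads\<close>

lemma coset_eq_fiber:
  assumes "abelian_group M" "abelian_group M'"
    and closed: "\<And>x. x \<in> carrier M \<Longrightarrow> F x \<in> carrier M'"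
    and add: "\<And>x y. \<lbrakk>x \<in> carrier M; y \<in> carrier M\<rbrakk> \<Longrightarrow> F (x \<oplus>\<^bsub>M\<^esub> y) = F x \<oplus>\<^bsub>M'\<^esub> F y"
    and a: "a \<in> carrier M"
  shows "{x \<in> carrier M. F x = \<zero>\<^bsub>M'\<^esub>} +>\<^bsub>M\<^esub> a = {b \<in> carrier M. F b = F a}"
proof -
  interpret M: abelian_group M by fact
  interpret M': abelian_group M' by fact
  have "\<exists>n\<in>carrier M. F n = \<zero>\<^bsub>M'\<^esub> \<and> b = n \<oplus>\<^bsub>M\<^esub> a" if b: "b \<in> carrier M" "F b = F a" for b
  proof (intro bexI conjI)
    let ?n = "b \<ominus>\<^bsub>M\<^esub> a"
    show n: "?n \<in> carrier M" using a b by simp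
    show eq: "b = ?n \<oplus>\<^bsub>M\<^esub> a"
      using a b by (simp add: M.minus_eq M.a_assoc M.l_neg)
    have "F ?n \<oplus>\<^bsub>M'\<^esub> F a = \<zero>\<^bsub>M'\<^esub> \<oplus>\<^bsub>M'\<^esub> F a"
      using add[OF n a] eq b(2) closed[OF a] by (metis M'.l_zero)
    then show "F ?n = \<zero>\<^bsub>M'\<^esub>"
      by (rule M'.add.right_cancel[OF closed[OF a] closed[OF n] M'.zero_closed, THEN iffD1])
  qed
  then show ?thesis
    using a by (auto simp: a_r_coset_def' add closed)
qed

text \<open>The map runs from \<open>Q\<close> to the quotient: a value is sent to its fiber, which
  is a coset of the kernel. In this direction no representatives are chosen and nothing has to be
  shown independent of them.\<close>

lemma operad_iso_quot_kernel:
  assumes P: "closed_operad P" and Q: "closed_operad Q" and F: "operad_map P Q F"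
    and surj: "\<And>cs c. carrier (o_comp Q cs c) \<subseteq> F cs c ` carrier (o_comp P cs c)"
    and J: "\<And>cs c. J cs c = {x \<in> carrier (o_comp P cs c). F cs c x = \<zero>\<^bsub>o_comp Q cs c\<^esub>}"
  shows "Q \<cong>\<^sub>o quot_operad P J"
proof -
  note Pc = closed_operadD[OF P] and Qc = closed_operadD[OF Q] and D = operad_mapD[OF F]
  define fib where "fib cs c v = {x \<in> carrier (o_comp P cs c). F cs c x = v}" for cs c v
  have coset: "J cs c +>\<^bsub>o_comp P cs c\<^esub> a = fib cs c (F cs c a)"
    if "a \<in> carrier (o_comp P cs c)" for cs c a
    unfolding J fib_def by (rule coset_eq_fiber[OF Pc(1) Qc(1)]) (simp_all add: D that)
  have ne: "\<exists>a\<in>carrier (o_comp P cs c). F cs c a = v" if "v \<in> carrier (o_comp Q cs c)" for cs c v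
    using surj[of cs c] that by auto
  \<comment> \<open>Operations of the quotient are unions over representatives; over a nonempty
    fiber the union of a constant family is its constant value.\<close>
  have UN_fib: "(\<Union>a\<in>fib cs c v. f a) = A"
    if "v \<in> carrier (o_comp Q cs c)"
      and "\<And>a. a \<in> carrier (o_comp P cs c) \<Longrightarrow> F cs c a = v \<Longrightarrow> f a = A" for cs c v A
    and f :: "'b \<Rightarrow> 'b set"
    using ne[OF that(1)] that(2) unfolding fib_def by auto
  have "operad_map Q (quot_operad P J) fib"
    unfolding operad_map_def quot_operad_def operad.select_convs quot_module_def
      partial_object.select_convs ring.select_convs module.select_convs
  proof (intro conjI allI ballI impI)
    fix cs c v assume "v \<in> carrier (o_comp Q cs c)"
    then obtain a where "a \<in> carrier (o_comp P cs c)" "F cs c a = v" using ne by blast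
    then show "fib cs c v \<in> a_rcosets\<^bsub>o_comp P cs c\<^esub> J cs c"
      using coset unfolding A_RCOSETS_def' by auto
  next
    fix cs c v w assume v: "v \<in> carrier (o_comp Q cs c)" and w: "w \<in> carrier (o_comp Q cs c)"
    interpret M: abelian_group "o_comp P cs c" by (rule Pc)
    interpret N: abelian_group "o_comp Q cs c" by (rule Qc)
    obtain a where a: "a \<in> carrier (o_comp P cs c)" "F cs c a = v" using v ne by blast
    have "x \<in> fib cs c v <+>\<^bsub>o_comp P cs c\<^esub> fib cs c w" if x: "x \<in> fib cs c (v \<oplus>\<^bsub>o_comp Q cs c\<^esub> w)" for x
    proof -
      let ?b = "x \<ominus>\<^bsub>o_comp P cs c\<^esub> a"
      have xc: "x \<in> carrier (o_comp P cs c)" "F cs c x = v \<oplus>\<^bsub>o_comp Q cs c\<^esub> w"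
        using x by (auto simp: fib_def)
      have b: "?b \<in> carrier (o_comp P cs c)" using xc a by simp
      have eq: "x = a \<oplus>\<^bsub>o_comp P cs c\<^esub> ?b"
        using xc a by (simp add: M.minus_eq M.a_lcomm[of a x] M.r_neg)
      have "v \<oplus>\<^bsub>o_comp Q cs c\<^esub> F cs c ?b = v \<oplus>\<^bsub>o_comp Q cs c\<^esub> w"
        using D(2)[OF a(1) b] eq xc a by simp
      then have "F cs c ?b = w"
        using v w D(1)[OF b] by simp
      then show ?thesis
        using eq a b unfolding set_add_def' fib_def by blast
    qed
    moreover have "fib cs c v <+>\<^bsub>o_comp P cs c\<^esub> fib cs c w \<subseteq> fib cs c (v \<oplus>\<^bsub>o_comp Q cs c\<^esub> w)"
      by (auto simp: set_add_def' fib_def D)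
    ultimately show "fib cs c (v \<oplus>\<^bsub>o_comp Q cs c\<^esub> w) = fib cs c v <+>\<^bsub>o_comp P cs c\<^esub> fib cs c w"
      by blast
  next
    fix cs c k v assume "v \<in> carrier (o_comp Q cs c)"
    then show "fib cs c (k \<odot>\<^bsub>o_comp Q cs c\<^esub> v) =
        (\<Union>a\<in>fib cs c v. J cs c +>\<^bsub>o_comp P cs c\<^esub> (k \<odot>\<^bsub>o_comp P cs c\<^esub> a))"
      by (intro UN_fib[symmetric]) (auto simp: coset Pc D)
  next
    fix cs c \<sigma> v assume "v \<in> carrier (o_comp Q cs c)" "\<sigma> permutes {..<length cs}"
    then show "fib (permute_list \<sigma> cs) c (o_act Q cs c \<sigma> v) =
        (\<Union>a\<in>fib cs c v. J (permute_list \<sigma> cs) c +>\<^bsub>o_comp P (permute_list \<sigma> cs) c\<^esub> o_act P cs c \<sigma> a)"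
      by (intro UN_fib[symmetric]) (auto simp: coset Pc D)
  next
    fix cs c i ds v w
    assume *: "i < length cs" "v \<in> carrier (o_comp Q cs c)" "w \<in> carrier (o_comp Q ds (cs ! i))"
    then show "fib (splice_in cs i ds) c (o_circ Q cs c i ds v w) =
        (\<Union>a\<in>fib cs c v. \<Union>b\<in>fib ds (cs ! i) w.
          J (splice_in cs i ds) c +>\<^bsub>o_comp P (splice_in cs i ds) c\<^esub> o_circ P cs c i ds a b)"
      by (intro UN_fib[symmetric]) (auto simp: coset Pc D intro!: UN_fib)
  next
    fix c show "fib [c] c (o_unit Q c) = J [c] c +>\<^bsub>o_comp P [c] c\<^esub> o_unit P c"
      by (simp add: coset Pc D)
  qed
  moreover have "bij_betw (fib cs c) (carrier (o_comp Q cs c))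
      (carrier (o_comp (quot_operad P J) cs c))" for cs c
  proof -
    have "inj_on (fib cs c) (carrier (o_comp Q cs c))"
    proof (rule inj_onI)
      fix v w assume "v \<in> carrier (o_comp Q cs c)" "fib cs c v = fib cs c w"
      then show "v = w" using ne[of v cs c] unfolding fib_def by blast
    qed
    moreover have "fib cs c ` carrier (o_comp Q cs c) = a_rcosets\<^bsub>o_comp P cs c\<^esub> J cs c"
    proof -
      have "fib cs c ` carrier (o_comp Q cs c) = (\<lambda>a. fib cs c (F cs c a)) ` carrier (o_comp P cs c)"
        using surj[of cs c] D(1) by auto
      also have "\<dots> = (\<lambda>a. J cs c +>\<^bsub>o_comp P cs c\<^esub> a) ` carrier (o_comp P cs c)"
        by (intro image_cong) (simp_all add: coset)
      finally show ?thesis unfolding A_RCOSETS_def' by auto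
    qed
    ultimately show ?thesis
      by (simp add: bij_betw_def quot_operad_def quot_module_def)
  qed
  ultimately show ?thesis
    unfolding operad_iso_iff by blast
qed

section \<open>Ideals, their intersections, and kernels\<close>

lemma operad_idealD:
  assumes "operad_ideal P J"
  shows "submodule (J cs c) scalars (o_comp P cs c)"
    and "\<lbrakk>\<sigma> permutes {..<length cs}; x \<in> J cs c\<rbrakk> \<Longrightarrow> o_act P cs c \<sigma> x \<in> J (permute_list \<sigma> cs) c"
    and "\<lbrakk>i < length cs; x \<in> J cs c; y \<in> carrier (o_comp P ds (cs ! i))\<rbrakk> \<Longrightarrow>
      o_circ P cs c i ds x y \<in> J (splice_in cs i ds) c"
    and "\<lbrakk>i < length cs; x \<in> carrier (o_comp P cs c); y \<in> J ds (cs ! i)\<rbrakk> \<Longrightarrow>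
      o_circ P cs c i ds x y \<in> J (splice_in cs i ds) c"
    and "J cs c \<subseteq> carrier (o_comp P cs c)"
    and "x \<in> J cs c \<Longrightarrow> x \<in> carrier (o_comp P cs c)"
proof -
  have "submodule (J cs c) scalars (o_comp P cs c)" for cs c
    using assms unfolding operad_ideal_def sub_collection_def by blast
  then have sub: "subgroup (J cs c) (add_monoid (o_comp P cs c))" for cs c
    by (simp add: submodule_def)
  have sub': "J cs c \<subseteq> carrier (o_comp P cs c)" for cs c
    using subgroup.subset[OF sub] by simp
  show "submodule (J cs c) scalars (o_comp P cs c)"
    and "\<lbrakk>\<sigma> permutes {..<length cs}; x \<in> J cs c\<rbrakk> \<Longrightarrow> o_act P cs c \<sigma> x \<in> J (permute_list \<sigma> cs) c"
    and "J cs c \<subseteq> carrier (o_comp P cs c)"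
    and "x \<in> J cs c \<Longrightarrow> x \<in> carrier (o_comp P cs c)"
    using assms sub' unfolding operad_ideal_def sub_collection_def by blast+
  show "\<lbrakk>i < length cs; x \<in> J cs c; y \<in> carrier (o_comp P ds (cs ! i))\<rbrakk> \<Longrightarrow>
      o_circ P cs c i ds x y \<in> J (splice_in cs i ds) c"
    and "\<lbrakk>i < length cs; x \<in> carrier (o_comp P cs c); y \<in> J ds (cs ! i)\<rbrakk> \<Longrightarrow>
      o_circ P cs c i ds x y \<in> J (splice_in cs i ds) c"
    using assms sub'[of cs c] sub'[of ds "cs ! i"] unfolding operad_ideal_def by blast+
qed

lemma (in linear_operad) comp_abelian_group: "abelian_group (o_comp P cs c)"
  using closed_operadD(1)[OF closed_operad] .

lemma (in linear_operad) ideal_subgroup: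
  "operad_ideal P J \<Longrightarrow> abelian_subgroup (J cs c) (o_comp P cs c)"
  using operad_idealD(1)[of P J cs c] comp_abelian_group
  by (intro abelian_subgroupI3) (auto simp: submodule_def intro: additive_subgroupI)

lemma submodule_Inter:
  assumes "module R M" "\<A> \<noteq> {}" "\<And>A. A \<in> \<A> \<Longrightarrow> submodule A R M"
  shows "submodule (\<Inter>\<A>) R M"
proof -
  interpret module R M by fact
  note E = submoduleE[OF assms(3)]
  have z: "\<zero>\<^bsub>M\<^esub> \<in> A" if "A \<in> \<A>" for A
    using assms(3)[OF that] subgroup.one_closed[of A "add_monoid M"] by (simp add: submodule_def)
  show ?thesis
    using assms(2) by (intro submoduleI) (auto simp: z dest: E)
qed

lemma (in linear_operad) operad_ideal_Inf:
  assumes "\<J> \<noteq> {}" "\<And>J. J \<in> \<J> \<Longrightarrow> operad_ideal P J"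
  shows "operad_ideal P (Inf \<J>)"
proof -
  have sub: "submodule ((Inf \<J>) cs c) scalars (o_comp P cs c)" for cs c
  proof -
    have "submodule (\<Inter>((\<lambda>J. J cs c) ` \<J>)) scalars (o_comp P cs c)"
      using assms(1) operad_idealD(1)[OF assms(2)] by (intro submodule_Inter comp_module) auto
    then show ?thesis by simp
  qed
  show ?thesis
    unfolding operad_ideal_def sub_collection_def
  proof (intro conjI allI ballI impI sub)
    fix cs c \<sigma> x assume "x \<in> (Inf \<J>) cs c" "\<sigma> permutes {..<length cs}"
    then show "o_act P cs c \<sigma> x \<in> (Inf \<J>) (permute_list \<sigma> cs) c"
      using operad_idealD(2)[OF assms(2)] by simp
  next
    fix cs c i ds x y
    assume "i < length cs" "x \<in> carrier (o_comp P cs c)" "y \<in> carrier (o_comp P ds (cs ! i))"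
      "x \<in> (Inf \<J>) cs c \<or> y \<in> (Inf \<J>) ds (cs ! i)"
    then show "o_circ P cs c i ds x y \<in> (Inf \<J>) (splice_in cs i ds) c"
      using operad_idealD(3,4)[OF assms(2)] by auto
  qed
qed

text \<open>Some ideal above \<open>U\<close> must be known: the infimum of the empty family is
  \<open>UNIV\<close> in every component, which need not lie in the carrier.\<close>

lemma (in linear_operad) operad_ideal_ideal_gen:
  assumes "operad_ideal P J" "U \<le> J"
  shows "operad_ideal P (ideal_gen P U)"
  unfolding ideal_gen_def using assms by (intro operad_ideal_Inf) auto

lemma ideal_gen_least: "operad_ideal P J \<Longrightarrow> U \<le> J \<Longrightarrow> ideal_gen P U \<le> J"
  unfolding ideal_gen_def by (rule Inf_lower) simp

lemma ideal_gen_upper: "U \<le> ideal_gen P U"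
  unfolding ideal_gen_def by (rule Inf_greatest) simp

lemma (in linear_operad) operad_ideal_kernel:
  assumes Q: "linear_operad Q" and F: "operad_map P Q F"
  shows "operad_ideal P (\<lambda>cs c. {x \<in> carrier (o_comp P cs c). F cs c x = \<zero>\<^bsub>o_comp Q cs c\<^esub>})"
proof -
  interpret Q: linear_operad Q by fact
  note D = operad_mapD[OF F] and Pc = closed_operadD[OF closed_operad]
    and Qc = closed_operadD[OF Q.closed_operad]
  have hom0: "F cs c \<zero>\<^bsub>o_comp P cs c\<^esub> = \<zero>\<^bsub>o_comp Q cs c\<^esub>"
    and homm: "x \<in> carrier (o_comp P cs c) \<Longrightarrow> F cs c x = \<zero>\<^bsub>o_comp Q cs c\<^esub> \<Longrightarrow>
      F cs c (\<ominus>\<^bsub>o_comp P cs c\<^esub> x) = \<zero>\<^bsub>o_comp Q cs c\<^esub>" for cs c x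
  proof -
    interpret M: abelian_group "o_comp P cs c" by (rule Pc)
    interpret N: abelian_group "o_comp Q cs c" by (rule Qc)
    have "F cs c \<zero>\<^bsub>o_comp P cs c\<^esub> \<oplus>\<^bsub>o_comp Q cs c\<^esub> F cs c \<zero>\<^bsub>o_comp P cs c\<^esub> =
        \<zero>\<^bsub>o_comp Q cs c\<^esub> \<oplus>\<^bsub>o_comp Q cs c\<^esub> F cs c \<zero>\<^bsub>o_comp P cs c\<^esub>"
      using D(2)[of "\<zero>\<^bsub>o_comp P cs c\<^esub>" cs c "\<zero>\<^bsub>o_comp P cs c\<^esub>"] D(1)[of _ cs c] by simp
    then show z: "F cs c \<zero>\<^bsub>o_comp P cs c\<^esub> = \<zero>\<^bsub>o_comp Q cs c\<^esub>"
      using N.add.right_cancel D(1) by (metis M.zero_closed N.zero_closed)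
    show "F cs c (\<ominus>\<^bsub>o_comp P cs c\<^esub> x) = \<zero>\<^bsub>o_comp Q cs c\<^esub>"
      if "x \<in> carrier (o_comp P cs c)" "F cs c x = \<zero>\<^bsub>o_comp Q cs c\<^esub>"
      using D(2)[of x cs c "\<ominus>\<^bsub>o_comp P cs c\<^esub> x"] that z D(1)[of "\<ominus>\<^bsub>o_comp P cs c\<^esub> x" cs c]
      by (simp add: M.r_neg)
  qed
  have sm0: "k \<odot>\<^bsub>o_comp Q cs c\<^esub> \<zero>\<^bsub>o_comp Q cs c\<^esub> = \<zero>\<^bsub>o_comp Q cs c\<^esub>" for k cs c
  proof -
    interpret N: module scalars "o_comp Q cs c" by (rule Q.comp_module)
    show ?thesis by (rule N.smult_r_null) simp
  qed
  \<comment> \<open>Additivity gives \<open>?z\<close> plus \<open>?z\<close> equal to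
    \<open>?z\<close>, which forces zero in a group; the same reasoning applies to both arguments of
    a composition.\<close>
  have act0: "o_act Q cs c \<sigma> \<zero>\<^bsub>o_comp Q cs c\<^esub> = \<zero>\<^bsub>o_comp Q (permute_list \<sigma> cs) c\<^esub>"
    if "\<sigma> permutes {..<length cs}" for cs c \<sigma>
    using D(4)[OF that, of "\<zero>\<^bsub>o_comp P cs c\<^esub>" c] 
  proof -
    interpret N: abelian_group "o_comp Q cs c" by (rule Qc)
    interpret N': abelian_group "o_comp Q (permute_list \<sigma> cs) c" by (rule Qc)
    let ?z = "o_act Q cs c \<sigma> \<zero>\<^bsub>o_comp Q cs c\<^esub>"
    have "?z \<oplus>\<^bsub>o_comp Q (permute_list \<sigma> cs) c\<^esub> ?z = ?z"
      using Q.act_add[OF that N.zero_closed N.zero_closed] by simp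
    then show ?thesis using Qc(3)[OF that N.zero_closed] by (simp add: N'.add.l_cancel_one)
  qed
  have circ0: "o_circ Q cs c i ds \<zero>\<^bsub>o_comp Q cs c\<^esub> y = \<zero>\<^bsub>o_comp Q (splice_in cs i ds) c\<^esub>"
    if "i < length cs" "y \<in> carrier (o_comp Q ds (cs ! i))" for cs c i ds y
  proof -
    interpret N: abelian_group "o_comp Q cs c" by (rule Qc)
    interpret N': abelian_group "o_comp Q (splice_in cs i ds) c" by (rule Qc)
    let ?z = "o_circ Q cs c i ds \<zero>\<^bsub>o_comp Q cs c\<^esub> y"
    have "?z \<oplus>\<^bsub>o_comp Q (splice_in cs i ds) c\<^esub> ?z = ?z"
      using Q.circ_add_left[OF that(1) N.zero_closed N.zero_closed that(2)] by simp
    then show ?thesis using Qc(4)[OF that(1) N.zero_closed that(2)] by (simp add: N'.add.l_cancel_one)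
  qed
  have circ0': "o_circ Q cs c i ds x \<zero>\<^bsub>o_comp Q ds (cs ! i)\<^esub> = \<zero>\<^bsub>o_comp Q (splice_in cs i ds) c\<^esub>"
    if "i < length cs" "x \<in> carrier (o_comp Q cs c)" for cs c i ds x
  proof -
    interpret N: abelian_group "o_comp Q ds (cs ! i)" by (rule Qc)
    interpret N': abelian_group "o_comp Q (splice_in cs i ds) c" by (rule Qc)
    let ?z = "o_circ Q cs c i ds x \<zero>\<^bsub>o_comp Q ds (cs ! i)\<^esub>"
    have "?z \<oplus>\<^bsub>o_comp Q (splice_in cs i ds) c\<^esub> ?z = ?z"
      using Q.circ_add_right[OF that N.zero_closed N.zero_closed] by simp
    then show ?thesis using Qc(4)[OF that N.zero_closed] by (simp add: N'.add.l_cancel_one)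
  qed
  have "submodule {x \<in> carrier (o_comp P cs c). F cs c x = \<zero>\<^bsub>o_comp Q cs c\<^esub>} scalars (o_comp P cs c)"
    for cs c
  proof -
    interpret M: module scalars "o_comp P cs c" by (rule comp_module)
    interpret N: abelian_group "o_comp Q cs c" by (rule Qc)
    show ?thesis
      by (rule M.submoduleI) (auto simp: hom0 homm D sm0)
  qed
  then show ?thesis
    unfolding operad_ideal_def sub_collection_def
    by (auto simp: D Pc act0 circ0 circ0')
qed

section \<open>Cosets of an ideal and the operations of the quotient\<close>

context linear_operad
begin

context
  fixes I :: "'a family"
  assumes I: "operad_ideal P I"
begin

lemma coset_eqI:
  assumes "a \<in> carrier (o_comp P cs c)" "n \<in> I cs c"
  shows "I cs c +>\<^bsub>o_comp P cs c\<^esub> (n \<oplus>\<^bsub>o_comp P cs c\<^esub> a) = I cs c +>\<^bsub>o_comp P cs c\<^esub> a"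
proof -
  interpret S: abelian_subgroup "I cs c" "o_comp P cs c" by (rule ideal_subgroup[OF I])
  show ?thesis
    using S.a_repr_independence[OF S.a_rcosI[OF assms(2) S.a_subset assms(1)] assms(1) S.a_subgroup]
    by simp
qed

lemma ideal_zero: "\<zero>\<^bsub>o_comp P cs c\<^esub> \<in> I cs c"
  using ideal_subgroup[OF I, of cs c] by (simp add: abelian_subgroup_def additive_subgroup.zero_closed)

lemma coset_self: "a \<in> carrier (o_comp P cs c) \<Longrightarrow> a \<in> I cs c +>\<^bsub>o_comp P cs c\<^esub> a"
proof -
  assume a: "a \<in> carrier (o_comp P cs c)"
  interpret S: abelian_subgroup "I cs c" "o_comp P cs c" by (rule ideal_subgroup[OF I])
  show "a \<in> I cs c +>\<^bsub>o_comp P cs c\<^esub> a"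
    using S.a_rcosI[OF ideal_zero S.a_subset a] a by simp
qed

text \<open>Well-definedness in the form that \<open>quot_operad\<close> calls for: if all
  representatives of a coset give the same value, the union over them is that value.\<close>

lemma UN_coset:
  assumes "a \<in> carrier (o_comp P cs c)" "\<And>n. n \<in> I cs c \<Longrightarrow> f (n \<oplus>\<^bsub>o_comp P cs c\<^esub> a) = A"
  shows "(\<Union>x\<in>I cs c +>\<^bsub>o_comp P cs c\<^esub> a. f x) = A"
proof -
  interpret S: abelian_subgroup "I cs c" "o_comp P cs c" by (rule ideal_subgroup[OF I])
  have "(\<Union>x\<in>I cs c +>\<^bsub>o_comp P cs c\<^esub> a. f x) = (\<Union>n\<in>I cs c. f (n \<oplus>\<^bsub>o_comp P cs c\<^esub> a))"
    by (simp add: a_r_coset_def')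
  also have "\<dots> = (\<Union>n\<in>I cs c. A)"
    by (intro SUP_cong) (simp_all add: assms(2))
  also have "\<dots> = A"
    using ideal_zero by auto
  finally show ?thesis .
qed

lemma quot_carrier:
  "carrier (o_comp (quot_operad P I) cs c) = (\<lambda>a. I cs c +>\<^bsub>o_comp P cs c\<^esub> a) ` carrier (o_comp P cs c)"
  by (auto simp: quot_operad_def quot_module_def A_RCOSETS_def')

lemma quot_zero: "\<zero>\<^bsub>o_comp (quot_operad P I) cs c\<^esub> = I cs c"
  by (simp add: quot_operad_def quot_module_def)

lemma quot_add:
  assumes "a \<in> carrier (o_comp P cs c)" "b \<in> carrier (o_comp P cs c)"
  shows "(I cs c +>\<^bsub>o_comp P cs c\<^esub> a) \<oplus>\<^bsub>o_comp (quot_operad P I) cs c\<^esub> (I cs c +>\<^bsub>o_comp P cs c\<^esub> b) =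
    I cs c +>\<^bsub>o_comp P cs c\<^esub> (a \<oplus>\<^bsub>o_comp P cs c\<^esub> b)"
proof -
  interpret S: abelian_subgroup "I cs c" "o_comp P cs c" by (rule ideal_subgroup[OF I])
  show ?thesis
    using S.a_rcos_sum[OF assms] by (simp add: quot_operad_def quot_module_def)
qed

lemma quot_smult:
  assumes "a \<in> carrier (o_comp P cs c)"
  shows "k \<odot>\<^bsub>o_comp (quot_operad P I) cs c\<^esub> (I cs c +>\<^bsub>o_comp P cs c\<^esub> a) =
    I cs c +>\<^bsub>o_comp P cs c\<^esub> (k \<odot>\<^bsub>o_comp P cs c\<^esub> a)"
proof -
  interpret M: module scalars "o_comp P cs c" by (rule comp_module)
  have "I cs c +>\<^bsub>o_comp P cs c\<^esub> (k \<odot>\<^bsub>o_comp P cs c\<^esub> (n \<oplus>\<^bsub>o_comp P cs c\<^esub> a)) =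
      I cs c +>\<^bsub>o_comp P cs c\<^esub> (k \<odot>\<^bsub>o_comp P cs c\<^esub> a)" if n: "n \<in> I cs c" for n
    using assms operad_idealD(6)[OF I n] M.submoduleE(4)[OF operad_idealD(1)[OF I] _ n]
    by (simp add: M.smult_r_distr coset_eqI)
  then show ?thesis
    unfolding quot_operad_def operad.select_convs quot_module_def module.select_convs
    by (intro UN_coset assms) simp
qed

lemma quot_act:
  assumes "\<sigma> permutes {..<length cs}" "a \<in> carrier (o_comp P cs c)"
  shows "o_act (quot_operad P I) cs c \<sigma> (I cs c +>\<^bsub>o_comp P cs c\<^esub> a) =
    I (permute_list \<sigma> cs) c +>\<^bsub>o_comp P (permute_list \<sigma> cs) c\<^esub> o_act P cs c \<sigma> a"
  unfolding quot_operad_def operad.select_convs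
  by (intro UN_coset assms) (simp add: act_add assms operad_idealD(6)[OF I] coset_eqI
      act_closed operad_idealD(2)[OF I])

lemma quot_circ:
  assumes "i < length cs" "a \<in> carrier (o_comp P cs c)" "b \<in> carrier (o_comp P ds (cs ! i))"
  shows "o_circ (quot_operad P I) cs c i ds (I cs c +>\<^bsub>o_comp P cs c\<^esub> a)
      (I ds (cs ! i) +>\<^bsub>o_comp P ds (cs ! i)\<^esub> b) =
    I (splice_in cs i ds) c +>\<^bsub>o_comp P (splice_in cs i ds) c\<^esub> o_circ P cs c i ds a b"
proof -
  interpret M: abelian_group "o_comp P cs c" by (rule comp_abelian_group)
  interpret M': abelian_group "o_comp P ds (cs ! i)" by (rule comp_abelian_group)
  have "I (splice_in cs i ds) c +>\<^bsub>o_comp P (splice_in cs i ds) c\<^esub>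
        o_circ P cs c i ds (n \<oplus>\<^bsub>o_comp P cs c\<^esub> a) (m \<oplus>\<^bsub>o_comp P ds (cs ! i)\<^esub> b) =
      I (splice_in cs i ds) c +>\<^bsub>o_comp P (splice_in cs i ds) c\<^esub> o_circ P cs c i ds a b"
    if "n \<in> I cs c" "m \<in> I ds (cs ! i)" for n m
  proof -
    have n: "n \<in> carrier (o_comp P cs c)" and m: "m \<in> carrier (o_comp P ds (cs ! i))"
      using that operad_idealD(6)[OF I] by blast+
    have na: "n \<oplus>\<^bsub>o_comp P cs c\<^esub> a \<in> carrier (o_comp P cs c)"
      using n assms by simp
    show ?thesis
      by (subst circ_add_right[OF assms(1) na m assms(3)],
          subst coset_eqI[OF circ_closed[OF assms(1) na assms(3)] operad_idealD(4)[OF I assms(1) na that(2)]],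
          subst circ_add_left[OF assms(1) n assms(2,3)],
          rule coset_eqI[OF circ_closed[OF assms] operad_idealD(3)[OF I assms(1) that(1) assms(3)]])
  qed
  then show ?thesis
    unfolding quot_operad_def operad.select_convs
    by (intro UN_coset assms) simp
qed

lemma quot_unit: "o_unit (quot_operad P I) c = I [c] c +>\<^bsub>o_comp P [c] c\<^esub> o_unit P c"
  by (simp add: quot_operad_def)

lemma closed_quot_operad: "closed_operad (quot_operad P I)"
  unfolding closed_operad_def
proof (intro conjI allI ballI impI)
  fix cs c
  interpret S: abelian_subgroup "I cs c" "o_comp P cs c" by (rule ideal_subgroup[OF I])
  have zero: "\<zero>\<^bsub>o_comp (quot_operad P I) cs c\<^esub> = I cs c +>\<^bsub>o_comp P cs c\<^esub> \<zero>\<^bsub>o_comp P cs c\<^esub>"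
    by (simp add: quot_zero S.a_subset)
  show "abelian_group (o_comp (quot_operad P I) cs c)"
  proof (rule abelian_groupI)
    fix x assume "x \<in> carrier (o_comp (quot_operad P I) cs c)"
    then obtain a where a: "a \<in> carrier (o_comp P cs c)" "x = I cs c +>\<^bsub>o_comp P cs c\<^esub> a"
      by (auto simp: quot_carrier)
    then show "\<exists>y\<in>carrier (o_comp (quot_operad P I) cs c).
        y \<oplus>\<^bsub>o_comp (quot_operad P I) cs c\<^esub> x = \<zero>\<^bsub>o_comp (quot_operad P I) cs c\<^esub>"
      by (intro bexI[of _ "I cs c +>\<^bsub>o_comp P cs c\<^esub> (\<ominus>\<^bsub>o_comp P cs c\<^esub> a)"])
        (auto simp: quot_carrier quot_add zero S.l_neg)
  qed (auto simp: quot_carrier quot_add zero S.a_ac)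
next
  fix cs c k x assume "x \<in> carrier (o_comp (quot_operad P I) cs c)"
  then show "k \<odot>\<^bsub>o_comp (quot_operad P I) cs c\<^esub> x \<in> carrier (o_comp (quot_operad P I) cs c)"
    using module.smult_closed[OF comp_module] by (auto simp: quot_carrier quot_smult)
next
  fix cs c \<sigma> x assume "x \<in> carrier (o_comp (quot_operad P I) cs c)" "\<sigma> permutes {..<length cs}"
  then show "o_act (quot_operad P I) cs c \<sigma> x
      \<in> carrier (o_comp (quot_operad P I) (permute_list \<sigma> cs) c)"
    by (auto simp: quot_carrier quot_act act_closed)
next
  fix cs c i ds x y
  assume "i < length cs" "x \<in> carrier (o_comp (quot_operad P I) cs c)"
    "y \<in> carrier (o_comp (quot_operad P I) ds (cs ! i))"
  then show "o_circ (quot_operad P I) cs c i ds x y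
      \<in> carrier (o_comp (quot_operad P I) (splice_in cs i ds) c)"
    by (auto simp: quot_carrier quot_circ circ_closed)
next
  fix c show "o_unit (quot_operad P I) c \<in> carrier (o_comp (quot_operad P I) [c] c)"
    by (auto simp: quot_carrier quot_unit unit_closed)
qed

text \<open>Lets an ideal of a quotient be studied upstairs; \<open>ideal_gen_orthogonal\<close>
  uses it to turn ideals of the free operad into ideals of trees.\<close>

lemma operad_ideal_preimage:
  assumes J: "operad_ideal (quot_operad P I) J"
  shows "operad_ideal P (\<lambda>cs c. {a \<in> carrier (o_comp P cs c). I cs c +>\<^bsub>o_comp P cs c\<^esub> a \<in> J cs c})"
proof -
  note JD = operad_idealD[OF J]
  have "submodule {a \<in> carrier (o_comp P cs c). I cs c +>\<^bsub>o_comp P cs c\<^esub> a \<in> J cs c} scalars (o_comp P cs c)"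
    for cs c
  proof -
    interpret M: module scalars "o_comp P cs c" by (rule comp_module)
    interpret S: abelian_subgroup "I cs c" "o_comp P cs c" by (rule ideal_subgroup[OF I])
    let ?Q = "o_comp (quot_operad P I) cs c"
    interpret Q: abelian_group ?Q by (rule closed_operadD[OF closed_quot_operad])
    interpret J: additive_subgroup "J cs c" ?Q
      using JD(1)[of cs c] by (auto simp: submodule_def intro: additive_subgroupI)
    have z: "I cs c +>\<^bsub>o_comp P cs c\<^esub> \<zero>\<^bsub>o_comp P cs c\<^esub> = \<zero>\<^bsub>?Q\<^esub>"
      by (simp add: quot_zero S.a_subset)
    have m: "I cs c +>\<^bsub>o_comp P cs c\<^esub> (\<ominus>\<^bsub>o_comp P cs c\<^esub> a) = \<ominus>\<^bsub>?Q\<^esub> (I cs c +>\<^bsub>o_comp P cs c\<^esub> a)"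
      if "a \<in> carrier (o_comp P cs c)" for a
    proof (rule Q.minus_equality[symmetric])
      show "(I cs c +>\<^bsub>o_comp P cs c\<^esub> (\<ominus>\<^bsub>o_comp P cs c\<^esub> a)) \<oplus>\<^bsub>?Q\<^esub> (I cs c +>\<^bsub>o_comp P cs c\<^esub> a) = \<zero>\<^bsub>?Q\<^esub>"
        using that z by (simp add: quot_add M.l_neg)
    qed (use that in \<open>auto simp: quot_carrier\<close>)
    show ?thesis
    proof (rule M.submoduleI)
      fix a assume "a \<in> {a \<in> carrier (o_comp P cs c). I cs c +>\<^bsub>o_comp P cs c\<^esub> a \<in> J cs c}"
      then show "\<ominus>\<^bsub>o_comp P cs c\<^esub> a \<in> {a \<in> carrier (o_comp P cs c). I cs c +>\<^bsub>o_comp P cs c\<^esub> a \<in> J cs c}"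
        by (simp add: m)
    next
      fix a b assume "a \<in> {a \<in> carrier (o_comp P cs c). I cs c +>\<^bsub>o_comp P cs c\<^esub> a \<in> J cs c}"
        "b \<in> {a \<in> carrier (o_comp P cs c). I cs c +>\<^bsub>o_comp P cs c\<^esub> a \<in> J cs c}"
      then show "a \<oplus>\<^bsub>o_comp P cs c\<^esub> b \<in> {a \<in> carrier (o_comp P cs c). I cs c +>\<^bsub>o_comp P cs c\<^esub> a \<in> J cs c}"
        by (simp flip: quot_add)
    next
      fix k a assume "a \<in> {a \<in> carrier (o_comp P cs c). I cs c +>\<^bsub>o_comp P cs c\<^esub> a \<in> J cs c}"
      then show "k \<odot>\<^bsub>o_comp P cs c\<^esub> a \<in> {a \<in> carrier (o_comp P cs c). I cs c +>\<^bsub>o_comp P cs c\<^esub> a \<in> J cs c}"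
        using submodule.smult_closed[OF JD(1)] by (simp flip: quot_smult)
    qed (use z in auto)
  qed
  then show ?thesis
    unfolding operad_ideal_def sub_collection_def
    by (auto simp: act_closed circ_closed JD quot_carrier simp flip: quot_act quot_circ)
qed

lemma operad_map_quot:
  assumes F: "operad_map P Q F"
    and const: "\<And>cs c a b. \<lbrakk>a \<in> carrier (o_comp P cs c); b \<in> I cs c +>\<^bsub>o_comp P cs c\<^esub> a\<rbrakk> \<Longrightarrow>
      F cs c b = F cs c a"
  shows "operad_map (quot_operad P I) Q (\<lambda>cs c A. F cs c (SOME a. a \<in> A))"
proof -
  have F': "F cs c (SOME b. b \<in> I cs c +>\<^bsub>o_comp P cs c\<^esub> a) = F cs c a"
    if "a \<in> carrier (o_comp P cs c)" for cs c a
    using const[OF that] someI[of "\<lambda>b. b \<in> I cs c +>\<^bsub>o_comp P cs c\<^esub> a", OF coset_self[OF that]]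
    by blast
  note D = operad_mapD[OF F] and Pc = closed_operadD[OF closed_operad]
  show ?thesis
    unfolding operad_map_def
  proof (intro conjI allI ballI impI)
    fix cs c x y assume "x \<in> carrier (o_comp (quot_operad P I) cs c)"
      "y \<in> carrier (o_comp (quot_operad P I) cs c)"
    then show "F cs c (SOME a. a \<in> x \<oplus>\<^bsub>o_comp (quot_operad P I) cs c\<^esub> y) =
        F cs c (SOME a. a \<in> x) \<oplus>\<^bsub>o_comp Q cs c\<^esub> F cs c (SOME a. a \<in> y)"
      by (auto simp: quot_carrier quot_add F' D abelian_groupE(1)[OF Pc(1)])
  qed (auto simp: quot_carrier quot_smult quot_act quot_circ quot_unit F' D Pc)
qed

end

end

section \<open>Linear extensions\<close>

definition smul :: "'k::field \<Rightarrow> ('x \<Rightarrow>\<^sub>0 'k) \<Rightarrow> ('x \<Rightarrow>\<^sub>0 'k)" where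
  "smul k = Poly_Mapping.map ((*) k)"

lemma lookup_smul [simp]: "Poly_Mapping.lookup (smul k f) x = k * Poly_Mapping.lookup f x"
  unfolding smul_def by transfer (simp add: when_def)

lemma smul_single [simp]: "smul k (Poly_Mapping.single x a) = Poly_Mapping.single x (k * a)"
  by (rule poly_mapping_eqI) (simp add: lookup_single when_def)

lemma smul_algebra [simp]:
  "smul k (f + g) = smul k f + smul k g" "smul (k + l) f = smul k f + smul l f"
  "smul k (smul l f) = smul (k * l) f" "smul 1 f = f" "smul 0 f = 0" "smul k 0 = 0"
  "smul k (- f) = - smul k f" "smul (- k) f = - smul k f" "smul k (f - g) = smul k f - smul k g"
  by (rule poly_mapping_eqI, simp add: lookup_add lookup_minus algebra_simps)+

lemma smul_sum: "smul k (\<Sum>x\<in>A. f x) = (\<Sum>x\<in>A. smul k (f x))"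
  by (rule poly_mapping_eqI) (simp add: lookup_sum sum_distrib_left)

lemma keys_smul: "Poly_Mapping.keys (smul k f) \<subseteq> Poly_Mapping.keys f"
  by (auto simp: in_keys_iff)

lemma keys_minus_subset: "Poly_Mapping.keys (f - g) \<subseteq> Poly_Mapping.keys f \<union> Poly_Mapping.keys (g :: 'x \<Rightarrow>\<^sub>0 'k::ab_group_add)"
  by (auto simp: in_keys_iff lookup_minus)

lemma keys_subsetI:
  fixes f g :: "'x \<Rightarrow>\<^sub>0 'k::field"
  assumes "Poly_Mapping.keys f \<subseteq> S"
  shows "Poly_Mapping.keys g \<subseteq> S \<Longrightarrow> Poly_Mapping.keys (f + g) \<subseteq> S"
    and "Poly_Mapping.keys g \<subseteq> S \<Longrightarrow> Poly_Mapping.keys (f - g) \<subseteq> S"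
    and "Poly_Mapping.keys (smul k f) \<subseteq> S"
  using assms keys_add[of f g] keys_minus_subset[of f g] keys_smul[of k f] by blast+

text \<open>The extension of a map on basis elements to the free module. Bilinear and trilinear
  extensions are nested uses of it.\<close>

definition lin :: "('x \<Rightarrow> 'y \<Rightarrow>\<^sub>0 'k::field) \<Rightarrow> ('x \<Rightarrow>\<^sub>0 'k) \<Rightarrow> ('y \<Rightarrow>\<^sub>0 'k)" where
  "lin h f = (\<Sum>x\<in>Poly_Mapping.keys f. smul (Poly_Mapping.lookup f x) (h x))"

lemma lin_superset:
  assumes "finite S" "Poly_Mapping.keys f \<subseteq> S"
  shows "lin h f = (\<Sum>x\<in>S. smul (Poly_Mapping.lookup f x) (h x))"
  unfolding lin_def using assms by (intro sum.mono_neutral_left) (auto simp: in_keys_iff)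

lemma lin_add [simp]: "lin h (f + g) = lin h f + lin h g"
proof -
  let ?S = "Poly_Mapping.keys f \<union> Poly_Mapping.keys g"
  have "Poly_Mapping.keys (f + g) \<subseteq> ?S" by (rule keys_add)
  then show ?thesis
    by (simp add: lin_superset[of ?S] lookup_add sum.distrib)
qed

lemma lin_smul [simp]: "lin h (smul k f) = smul k (lin h f)"
  using lin_superset[OF finite_keys keys_smul, of h k f] by (simp add: lin_def smul_sum)

lemma lin_zero [simp]: "lin h 0 = 0"
  by (simp add: lin_def)

lemma lin_single [simp]: "lin h (Poly_Mapping.single x a) = smul a (h x)"
  by (cases "a = 0") (simp_all add: lin_def)

lemma lin_uminus [simp]: "lin h (- f) = - lin h f"
  using lin_smul[of h "-1" f] by simp

lemma lin_diff [simp]: "lin h (f - g) = lin h f - lin h g"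
  using lin_add[of h f "- g"] by simp

lemma lin_sum: "lin h (\<Sum>x\<in>A. f x) = (\<Sum>x\<in>A. lin h (f x))"
  by (induction A rule: infinite_finite_induct) simp_all

lemma lin_cong: "(\<And>x. x \<in> Poly_Mapping.keys f \<Longrightarrow> h x = h' x) \<Longrightarrow> lin h f = lin h' f"
  by (simp add: lin_def)

lemma lin_lin: "lin g (lin h f) = lin (\<lambda>x. lin g (h x)) f"
  unfolding lin_def[of h] lin_def[of "\<lambda>x. lin g (h x)"] by (simp add: lin_sum)

lemma lin_delta [simp]: "lin delta f = f"
  by (rule poly_mapping_eqI) (auto simp: lin_def lookup_sum lookup_single when_def in_keys_iff)

lemma lin_fun_add [simp]: "lin (\<lambda>x. h x + h' x) f = lin h f + lin h' f"
  by (simp add: lin_def sum.distrib)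

lemma lin_fun_smul [simp]: "lin (\<lambda>x. smul k (h x)) f = smul k (lin h f)"
  by (simp add: lin_def smul_sum mult.commute)

lemma lin_fun_diff [simp]: "lin (\<lambda>x. h x - h' x) f = lin h f - lin h' f"
  by (simp add: lin_def sum_subtractf)

lemma lin_fun_zero [simp]: "lin (\<lambda>x. 0) f = 0"
  by (simp add: lin_def)

text \<open>Interchange of two finite sums: the arguments of a bilinear extension may be expanded in
  either order.\<close>

lemma lin_fun_lin: "lin (\<lambda>x. lin (\<lambda>y. h x y) g) f = lin (\<lambda>y. lin (\<lambda>x. h x y) f) g"
proof -
  have "lin (\<lambda>x. lin (\<lambda>y. h x y) g) f =
      (\<Sum>x\<in>Poly_Mapping.keys f. \<Sum>y\<in>Poly_Mapping.keys g.
        smul (Poly_Mapping.lookup f x * Poly_Mapping.lookup g y) (h x y))"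
    by (simp add: lin_def smul_sum)
  also have "\<dots> = lin (\<lambda>y. lin (\<lambda>x. h x y) f) g"
    by (subst sum.swap) (simp add: lin_def smul_sum mult.commute)
  finally show ?thesis .
qed

lemma keys_lin: "Poly_Mapping.keys (lin h f) \<subseteq> (\<Union>x\<in>Poly_Mapping.keys f. Poly_Mapping.keys (h x))"
  unfolding lin_def by (intro order_trans[OF Poly_Mapping.keys_sum] UN_mono keys_smul subset_refl)

lemma keys_linD: "(\<And>x. x \<in> Poly_Mapping.keys f \<Longrightarrow> Poly_Mapping.keys (h x) \<subseteq> A) \<Longrightarrow>
    Poly_Mapping.keys (lin h f) \<subseteq> A"
  by (rule order_trans[OF keys_lin UN_least])

section \<open>Free modules and their submodules\<close>

lemma free_module_simps [simp]:
  "carrier (free_module S) = {f. Poly_Mapping.keys f \<subseteq> S}"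
  "\<zero>\<^bsub>free_module S\<^esub> = 0" "f \<oplus>\<^bsub>free_module S\<^esub> g = f + g" "k \<odot>\<^bsub>free_module S\<^esub> f = smul k f"
  by (simp_all add: free_module_def smul_def)

lemma module_free_module: "module scalars (free_module S :: ('k::field, _) module)"
proof (rule moduleI)
  show "cring (scalars :: 'k ring)"
    by (rule cring_from_type_algebra)
  show "abelian_group (free_module S :: ('k, _) module)"
  proof (rule abelian_groupI)
    fix f :: "_ \<Rightarrow>\<^sub>0 'k"
    assume "f \<in> carrier (free_module S)"
    then show "\<exists>g\<in>carrier (free_module S). g \<oplus>\<^bsub>free_module S\<^esub> f = \<zero>\<^bsub>free_module S\<^esub>"
      by (intro bexI[of _ "- f"]) simp_all
  qed (simp_all add: keys_subsetI add.assoc add.commute)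
qed (simp_all add: keys_subsetI)

lemma submodule_free_moduleD:
  assumes "submodule N scalars (free_module S :: ('k::field, _) module)"
  shows "0 \<in> N" "f \<in> N \<Longrightarrow> g \<in> N \<Longrightarrow> f + g \<in> N" "f \<in> N \<Longrightarrow> smul k f \<in> N"
    "f \<in> N \<Longrightarrow> g \<in> N \<Longrightarrow> f - g \<in> N"
    "f \<in> N \<Longrightarrow> Poly_Mapping.keys f \<subseteq> S"
proof -
  have sub: "subgroup N (add_monoid (free_module S :: ('k, _) module))"
    using assms by (simp add: submodule_def)
  show "0 \<in> N" using subgroup.one_closed[OF sub] by simp
  show add: "f \<in> N \<Longrightarrow> g \<in> N \<Longrightarrow> f + g \<in> N" for f g
    using subgroup.m_closed[OF sub, of f g] by simp
  show sm: "f \<in> N \<Longrightarrow> smul k f \<in> N" for f k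
    using submodule.smult_closed[OF assms, of k f] by simp
  show "f \<in> N \<Longrightarrow> g \<in> N \<Longrightarrow> f - g \<in> N"
    using add[of f "smul (- 1) g"] sm[of g "- 1"] by simp
  show "f \<in> N \<Longrightarrow> Poly_Mapping.keys f \<subseteq> S"
    using subgroup.subset[OF sub] by auto
qed

lemma submodule_free_moduleI:
  assumes "N \<subseteq> {f. Poly_Mapping.keys f \<subseteq> S}" "0 \<in> N"
    "\<And>f g. f \<in> N \<Longrightarrow> g \<in> N \<Longrightarrow> f + g \<in> N" "\<And>f k. f \<in> N \<Longrightarrow> smul k f \<in> N"
  shows "submodule N scalars (free_module S :: ('k::field, _) module)"
proof -
  interpret module scalars "free_module S :: ('k, _) module" by (rule module_free_module)
  have inv: "\<ominus>\<^bsub>free_module S\<^esub> f = smul (- 1) f" if "f \<in> N" for f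
    using that assms(1) subset_trans[OF keys_smul[of "-1" f]]
    by (intro M.minus_equality) auto
  have "- f \<in> N" if "f \<in> N" for f
    using assms(4)[OF that, of "- 1"] by simp
  then show ?thesis
    by (intro submoduleI) (use assms inv in auto)
qed

lemma submodule_lin:
  assumes "submodule N scalars (free_module S)" "\<And>x. x \<in> Poly_Mapping.keys f \<Longrightarrow> h x \<in> N"
  shows "lin h f \<in> N"
proof -
  have "(\<Sum>x\<in>A. smul (Poly_Mapping.lookup f x) (h x)) \<in> N"
    if "finite A" "A \<subseteq> Poly_Mapping.keys f" for A
    using that
    by (induction A rule: finite_induct) (use submodule_free_moduleD[OF assms(1)] assms(2) in auto)
  then show ?thesis
    unfolding lin_def by simp
qed

lemma free_module_coset: "N +>\<^bsub>free_module S\<^esub> f = (\<lambda>n. n + f) ` N"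
  by (auto simp: a_r_coset_def')


section \<open>Linearizations of set operads\<close>

lemma linearization_simps:
  "o_comp (linearization S) cs c = free_module (s_comp S cs c)"
  "o_act (linearization S) cs c \<sigma> f = lin (\<lambda>x. delta (s_act S cs c \<sigma> x)) f"
  "o_circ (linearization S) cs c i ds f g = lin (\<lambda>x. lin (\<lambda>y. delta (s_circ S cs c i ds x y)) g) f"
  "o_unit (linearization S) c = delta (s_unit S c)"
  by (simp_all add: linearization_def lin_def smul_sum)

definition closed_set_operad :: "'x set_operad \<Rightarrow> bool" where
  "closed_set_operad S \<longleftrightarrow>
    (\<forall>cs c \<sigma>. \<forall>x\<in>s_comp S cs c. \<sigma> permutes {..<length cs} \<longrightarrow>
      s_act S cs c \<sigma> x \<in> s_comp S (permute_list \<sigma> cs) c) \<and>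
    (\<forall>cs c i ds. i < length cs \<longrightarrow> (\<forall>x\<in>s_comp S cs c. \<forall>y\<in>s_comp S ds (cs ! i).
      s_circ S cs c i ds x y \<in> s_comp S (splice_in cs i ds) c)) \<and>
    (\<forall>c. s_unit S c \<in> s_comp S [c] c)"

lemma linear_operad_linearization:
  assumes "closed_set_operad S"
  shows "linear_operad (linearization S :: ('k::field, _) operad)"
proof (rule linear_operad.intro, unfold linearization_simps free_module_simps mem_Collect_eq)
  show "module scalars (free_module (s_comp S cs c) :: ('k, _) module)" for cs c
    by (rule module_free_module)
qed (use assms in \<open>auto simp: closed_set_operad_def intro!: keys_linD\<close>, (meson subsetD)+)

text \<open>\<open>h\<close> may send a basis element to a combination, as the evaluation of trees
  does; linearity reduces all conditions to basis elements.\<close>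

lemma operad_map_lin:
  assumes S: "closed_set_operad S" and T: "closed_set_operad T"
    and comp: "\<And>cs c x. x \<in> s_comp S cs c \<Longrightarrow> Poly_Mapping.keys (h cs c x) \<subseteq> s_comp T cs c"
    and act: "\<And>cs c \<sigma> x. \<lbrakk>\<sigma> permutes {..<length cs}; x \<in> s_comp S cs c\<rbrakk> \<Longrightarrow>
      h (permute_list \<sigma> cs) c (s_act S cs c \<sigma> x) = o_act (linearization T) cs c \<sigma> (h cs c x)"
    and circ: "\<And>cs c i ds x y. \<lbrakk>i < length cs; x \<in> s_comp S cs c; y \<in> s_comp S ds (cs ! i)\<rbrakk> \<Longrightarrow>
      h (splice_in cs i ds) c (s_circ S cs c i ds x y) =
      o_circ (linearization T) cs c i ds (h cs c x) (h ds (cs ! i) y)"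
    and unit: "\<And>c. h [c] c (s_unit S c) = delta (s_unit T c)"
  shows "operad_map (linearization S :: ('k::field, _) operad) (linearization T) (\<lambda>cs c. lin (h cs c))"
  unfolding operad_map_def linearization_simps free_module_simps mem_Collect_eq
proof (intro conjI allI ballI impI)
  fix cs c \<sigma> and f :: "_ \<Rightarrow>\<^sub>0 'k"
  assume f: "f \<in> {f. Poly_Mapping.keys f \<subseteq> s_comp S cs c}" and \<sigma>: "\<sigma> permutes {..<length cs}"
  show "lin (h (permute_list \<sigma> cs) c) (lin (\<lambda>x. delta (s_act S cs c \<sigma> x)) f) =
      lin (\<lambda>x. delta (s_act T cs c \<sigma> x)) (lin (h cs c) f)"
    unfolding lin_lin
    by (rule lin_cong) (use f \<sigma> act in \<open>auto simp: linearization_simps\<close>)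
next
  fix cs c i ds and f g :: "_ \<Rightarrow>\<^sub>0 'k"
  assume i: "i < length cs" and f: "f \<in> {f. Poly_Mapping.keys f \<subseteq> s_comp S cs c}"
    and g: "g \<in> {f. Poly_Mapping.keys f \<subseteq> s_comp S ds (cs ! i)}"
  have "lin (h (splice_in cs i ds) c) (lin (\<lambda>x. lin (\<lambda>y. delta (s_circ S cs c i ds x y)) g) f) =
      lin (\<lambda>x. lin (\<lambda>y. h (splice_in cs i ds) c (s_circ S cs c i ds x y)) g) f"
    by (simp add: lin_lin)
  also have "\<dots> = lin (\<lambda>x. lin (\<lambda>y. o_circ (linearization T) cs c i ds (h cs c x) (h ds (cs ! i) y)) g) f"
    by (intro lin_cong circ i) (use f g in auto)
  also have "\<dots> = lin (\<lambda>x. lin (\<lambda>y. delta (s_circ T cs c i ds x y)) (lin (h ds (cs ! i)) g)) (lin (h cs c) f)"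
    unfolding linearization_simps lin_lin by (intro lin_cong) (rule lin_fun_lin)
  finally show "lin (h (splice_in cs i ds) c) (lin (\<lambda>x. lin (\<lambda>y. delta (s_circ S cs c i ds x y)) g) f) =
      lin (\<lambda>x. lin (\<lambda>y. delta (s_circ T cs c i ds x y)) (lin (h ds (cs ! i)) g)) (lin (h cs c) f)" .
qed (use comp unit in \<open>auto intro!: keys_linD\<close>, (meson subsetD)+)

section \<open>The operad of words\<close>

text \<open>Follows the leaf case of \<open>graft\<close> letter by letter, so that reading the
  leaves of a tree turns grafting into substitution (\<open>leaves_graft\<close>). A letter above
  \<open>i\<close> is positive, so \<open>j + m - 1\<close> loses nothing even for
  \<open>m = 0\<close>.\<close>

definition subst_letter :: "nat \<Rightarrow> nat \<Rightarrow> nat list \<Rightarrow> nat \<Rightarrow> nat list" where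
  "subst_letter i m v j = (if j < i then [j] else if j = i then map (\<lambda>k. k + i) v else [j + m - 1])"

definition subst_word :: "nat \<Rightarrow> nat \<Rightarrow> nat list \<Rightarrow> nat list \<Rightarrow> nat list" where
  "subst_word i m v w = concat (map (subst_letter i m v) w)"

lemma subst_word_simps [simp]:
  "subst_word i m v [] = []" "subst_word i m v (j # w) = subst_letter i m v j @ subst_word i m v w"
  "subst_word i m v (w @ w') = subst_word i m v w @ subst_word i m v w'"
  by (simp_all add: subst_word_def)

lemma set_subst_letter:
  assumes "set v \<subseteq> {..<m}"
  shows "set (subst_letter i m v j) = {k. if k < i then j = k else
    if k < i + m then j = i \<and> k - i \<in> set v else j = k + 1 - m}"
  using assms by (auto simp: subst_letter_def image_iff)
    (metis add.commute le_add_diff_inverse less_diff_conv not_less)+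

lemma set_subst_word:
  assumes "set v \<subseteq> {..<m}"
  shows "set (subst_word i m v w) = {k. if k < i then k \<in> set w else
    if k < i + m then i \<in> set w \<and> k - i \<in> set v else k + 1 - m \<in> set w}"
proof (induction w)
  case (Cons j w)
  show ?case
    unfolding subst_word_simps set_append set_subst_letter[OF assms] Cons.IH by auto
qed simp

lemma distinct_subst_word:
  assumes "set v \<subseteq> {..<m}" "distinct v" "distinct w"
  shows "distinct (subst_word i m v w)"
  using assms(3)
proof (induction w)
  case (Cons j w)
  have "distinct (subst_letter i m v j)"
    using assms(2) by (simp add: subst_letter_def distinct_map inj_on_def)
  moreover have "set (subst_letter i m v j) \<inter> set (subst_word i m v w) = {}"
    using Cons.prems unfolding set_subst_letter[OF assms(1)] set_subst_word[OF assms(1)]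
    by (auto split: if_splits)
  ultimately show ?case using Cons by simp
qed simp

lemma length_splice_in: "i < length cs \<Longrightarrow> length (splice_in cs i ds) = length cs + length ds - 1"
  by (simp add: splice_in_def)

lemma nth_splice_in:
  assumes "i < length cs"
  shows "splice_in cs i ds ! k = (if k < i then cs ! k else
    if k < i + length ds then ds ! (k - i) else cs ! (k + 1 - length ds))"
proof -
  have "Suc (i + (k - (i + length ds))) = Suc k - length ds" if "i + length ds \<le> k"
    using that by auto
  then show ?thesis
    using assms by (auto simp: splice_in_def nth_append min_def not_less)
qed

definition open_inputs :: "color list \<Rightarrow> nat set" where
  "open_inputs cs = {i. i < length cs \<and> cs ! i = Open}"

text \<open>One basis element for each order of the open inputs. For a closed output the word is
  empty and no input is open: this part is the non-unital commutative operad. An open output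
  requires an open input, in accordance with \<open>m \<ge> 1\<close> in the swiss-cheese operad;
  without closed inputs this part is the non-unital associative operad.\<close>

definition word_operad :: "nat list set_operad" where
  "word_operad =
    \<lparr>s_comp = (\<lambda>cs c. {w. distinct w \<and> set w = open_inputs cs \<and> (w = [] \<longleftrightarrow> c = Closed) \<and> cs \<noteq> []}),
     s_act = (\<lambda>cs c \<sigma>. map (inv_into UNIV \<sigma>)),
     s_circ = (\<lambda>cs c i ds w v. subst_word i (length ds) v w),
     s_unit = (\<lambda>c. case c of Closed \<Rightarrow> [] | Open \<Rightarrow> [0])\<rparr>"

lemma word_operad_simps [simp]:
  "s_comp word_operad cs c = {w. distinct w \<and> set w = open_inputs cs \<and> (w = [] \<longleftrightarrow> c = Closed) \<and> cs \<noteq> []}"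
  "s_act word_operad cs c \<sigma> = map (inv_into UNIV \<sigma>)"
  "s_circ word_operad cs c i ds w v = subst_word i (length ds) v w"
  "s_unit word_operad c = (case c of Closed \<Rightarrow> [] | Open \<Rightarrow> [0])"
  by (simp_all add: word_operad_def)

lemma permutes_lessThanD:
  assumes "\<sigma> permutes {..<n}"
  shows "\<sigma> (inv_into UNIV \<sigma> j) = j" "inv_into UNIV \<sigma> (\<sigma> j) = j" "\<sigma> j < n \<longleftrightarrow> j < n"
    "inv_into UNIV \<sigma> j < n \<longleftrightarrow> j < n" "inj (inv_into UNIV \<sigma>)"
  using permutes_inverses[OF assms] permutes_in_image[OF assms, of j]
    permutes_in_image[OF permutes_inv[OF assms], of j] permutes_inj[OF permutes_inv[OF assms]]
  by simp_all

lemma nth_permute_list: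
  "\<sigma> permutes {..<length cs} \<Longrightarrow> j < length cs \<Longrightarrow> permute_list \<sigma> cs ! j = cs ! \<sigma> j"
  by (rule permute_list_nth)

lemma open_inputs_permute:
  assumes "\<sigma> permutes {..<length cs}"
  shows "open_inputs (permute_list \<sigma> cs) = inv_into UNIV \<sigma> ` open_inputs cs"
proof -
  have "inv_into UNIV \<sigma> ` open_inputs cs = {j. \<sigma> j \<in> open_inputs cs}"
    by (auto simp: permutes_lessThanD[OF assms] intro: rev_image_eqI)
  then show ?thesis
    using assms by (auto simp: open_inputs_def nth_permute_list permutes_lessThanD[OF assms])
qed

lemma permute_list_nonempty: "cs \<noteq> [] \<Longrightarrow> permute_list \<sigma> cs \<noteq> []"
  by (metis length_permute_list length_0_conv)

lemma subst_letter_Nil: "subst_letter i m v j = [] \<longleftrightarrow> j = i \<and> v = []"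
  by (auto simp: subst_letter_def)

lemma subst_word_Nil: "subst_word i m v w = [] \<longleftrightarrow> (\<forall>j\<in>set w. j = i \<and> v = [])"
  by (induction w) (auto simp: subst_letter_Nil)

lemma open_inputs_less: "open_inputs cs \<subseteq> {..<length cs}"
  by (auto simp: open_inputs_def)

lemma open_inputs_splice:
  assumes "i < length cs" "ds \<noteq> []" "cs ! i = Open \<or> open_inputs ds = {}"
  shows "open_inputs (splice_in cs i ds) = {k. if k < i then k \<in> open_inputs cs else
    if k < i + length ds then i \<in> open_inputs cs \<and> k - i \<in> open_inputs ds else k + 1 - length ds \<in> open_inputs cs}"
proof -
  have "k < length cs + length ds - 1 \<longleftrightarrow> k + 1 - length ds < length cs" if "k \<ge> i + length ds" for k
    using that assms(2) by (cases ds) auto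
  then show ?thesis
    using assms unfolding open_inputs_def by (auto simp: length_splice_in nth_splice_in)
qed

lemma closed_word_operad: "closed_set_operad word_operad"
  unfolding closed_set_operad_def word_operad_simps
proof (intro conjI allI ballI impI)
  fix cs c \<sigma> w
  assume "w \<in> {w. distinct w \<and> set w = open_inputs cs \<and> (w = [] \<longleftrightarrow> c = Closed) \<and> cs \<noteq> []}"
    and \<sigma>: "\<sigma> permutes {..<length cs}"
  then show "map (inv_into UNIV \<sigma>) w \<in> {w. distinct w \<and> set w = open_inputs (permute_list \<sigma> cs) \<and>
      (w = [] \<longleftrightarrow> c = Closed) \<and> permute_list \<sigma> cs \<noteq> []}"
    using permutes_lessThanD(5)[OF \<sigma>]
    by (auto simp: open_inputs_permute distinct_map permute_list_nonempty intro: inj_on_subset)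
next
  fix cs :: "color list" and c i ds w v
  assume i: "i < length cs"
    and w: "w \<in> {w. distinct w \<and> set w = open_inputs cs \<and> (w = [] \<longleftrightarrow> c = Closed) \<and> cs \<noteq> []}"
    and v: "v \<in> {w. distinct w \<and> set w = open_inputs ds \<and> (w = [] \<longleftrightarrow> cs ! i = Closed) \<and> ds \<noteq> []}"
  have v': "set v \<subseteq> {..<length ds}" using v open_inputs_less by blast
  \<comment> \<open>A closed input receives the empty word, hence \<open>ds\<close> has no open
    inputs to be accounted for.\<close>
  have ds: "cs ! i = Open \<or> open_inputs ds = {}" using v by (cases "cs ! i") auto
  have "set (subst_word i (length ds) v w) = open_inputs (splice_in cs i ds)"
    using v w i ds by (simp add: set_subst_word[OF v'] open_inputs_splice)
  moreover have "subst_word i (length ds) v w = [] \<longleftrightarrow> c = Closed"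
  proof -
    have "v \<noteq> []" if "i \<in> set w" using that w v by (auto simp: open_inputs_def)
    then have "(\<forall>j\<in>set w. j = i \<and> v = []) \<longleftrightarrow> w = []" by (cases w) auto
    then show ?thesis using w by (simp add: subst_word_Nil)
  qed
  ultimately show "subst_word i (length ds) v w \<in> {w. distinct w \<and>
      set w = open_inputs (splice_in cs i ds) \<and> (w = [] \<longleftrightarrow> c = Closed) \<and> splice_in cs i ds \<noteq> []}"
    using distinct_subst_word[OF v'] v w by (auto simp: splice_in_def)
next
  fix c show "(case c of Closed \<Rightarrow> [] | Open \<Rightarrow> [0]) \<in> {w. distinct w \<and> set w = open_inputs [c] \<and>
      (w = [] \<longleftrightarrow> c = Closed) \<and> [c] \<noteq> []}"
    by (cases c) (auto simp: open_inputs_def)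
qed


section \<open>Trees and their evaluation in algebras\<close>

lemma tree_operad_simps [simp]:
  "s_comp (tree_operad E) cs c = {t. well_colored E cs c t \<and> distinct (leaves t) \<and>
     set (leaves t) = {..<length cs}}"
  "s_act (tree_operad E) cs c \<sigma> = relabel (inv_into UNIV \<sigma>)"
  "s_circ (tree_operad E) cs c i ds s t = graft i (length ds) t s"
  "s_unit (tree_operad E) c = Leaf 0"
  by (simp_all add: tree_operad_def)

lemma leaves_relabel [simp]: "leaves (relabel f t) = map f (leaves t)"
  by (induction t) simp_all

lemma leaves_not_Nil [simp]: "leaves t \<noteq> []"
  by (induction t) simp_all

lemma relabel_relabel [simp]: "relabel f (relabel g t) = relabel (f \<circ> g) t"
  by (induction t) simp_all

lemma relabel_cong: "(\<And>j. j \<in> set (leaves t) \<Longrightarrow> f j = g j) \<Longrightarrow> relabel f t = relabel g t"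
  by (induction t) simp_all

lemma relabel_id [simp]: "relabel (\<lambda>j. j) t = t"
  by (induction t) simp_all

lemma leaves_graft: "leaves (graft i m u t) = subst_word i m (leaves u) (leaves t)"
  by (induction t) (auto simp: subst_letter_def)

lemma well_colored_relabel:
  assumes "well_colored E cs c t"
    and "\<And>j. j \<in> set (leaves t) \<Longrightarrow> j < length cs \<Longrightarrow> f j < length ds \<and> ds ! f j = cs ! j"
  shows "well_colored E ds c (relabel f t)"
  using assms by (induction t arbitrary: c) auto

lemma well_colored_leaves: "well_colored E cs c t \<Longrightarrow> j \<in> set (leaves t) \<Longrightarrow> j < length cs"
  by (induction t arbitrary: c) auto

lemma well_colored_graft:
  assumes "i < length cs" "well_colored E cs c t" "well_colored E ds (cs ! i) u"
  shows "well_colored E (splice_in cs i ds) c (graft i (length ds) u t)"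
  using assms(2)
proof (induction t arbitrary: c)
  case (Leaf j)
  have "ds \<noteq> []"
    using well_colored_leaves[OF assms(3)] leaves_not_Nil[of u] by (metis hd_in_set list.size(3) not_less_zero)
  moreover have "well_colored E (splice_in cs i ds) (cs ! i) (relabel (\<lambda>k. k + i) u)"
    by (rule well_colored_relabel[OF assms(3)]) (use assms(1) in \<open>auto simp: length_splice_in nth_splice_in\<close>)
  ultimately show ?case
    using Leaf assms(1) by (cases ds) (auto simp: length_splice_in nth_splice_in not_less)
qed auto

lemma closed_tree_operad: "closed_set_operad (tree_operad E)"
  unfolding closed_set_operad_def tree_operad_simps
proof (intro conjI allI ballI impI)
  fix cs c \<sigma> t
  assume t: "t \<in> {t. well_colored E cs c t \<and> distinct (leaves t) \<and> set (leaves t) = {..<length cs}}"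
    and \<sigma>: "\<sigma> permutes {..<length cs}"
  have "well_colored E (permute_list \<sigma> cs) c (relabel (inv_into UNIV \<sigma>) t)"
    by (rule well_colored_relabel[of E cs])
      (use t \<sigma> permutes_lessThanD[OF \<sigma>] in \<open>auto simp: nth_permute_list\<close>)
  then show "relabel (inv_into UNIV \<sigma>) t \<in> {t. well_colored E (permute_list \<sigma> cs) c t \<and>
      distinct (leaves t) \<and> set (leaves t) = {..<length (permute_list \<sigma> cs)}}"
    using t permutes_image[OF permutes_inv[OF \<sigma>]] permutes_lessThanD(5)[OF \<sigma>]
    by (auto simp: distinct_map intro: inj_on_subset)
next
  fix cs :: "color list" and c i ds t u
  assume i: "i < length cs"
    and t: "t \<in> {t. well_colored E cs c t \<and> distinct (leaves t) \<and> set (leaves t) = {..<length cs}}"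
    and u: "u \<in> {t. well_colored E ds (cs ! i) t \<and> distinct (leaves t) \<and> set (leaves t) = {..<length ds}}"
  have lu: "set (leaves u) = {..<length ds}" and lt: "set (leaves t) = {..<length cs}"
    using t u by blast+
  have "ds \<noteq> []"
  proof
    assume "ds = []"
    with lu have "set (leaves u) = {}" by simp
    then show False by simp
  qed
  then have "set (subst_word i (length ds) (leaves u) (leaves t)) = {..<length (splice_in cs i ds)}"
  proof -
    have "(if k < i then k < length cs else if k < i + length ds then i < length cs \<and> k - i < length ds
        else k + 1 - length ds < length cs) \<longleftrightarrow> k < length cs + length ds - 1" for k
      using i \<open>ds \<noteq> []\<close> by (cases ds) auto
    then show ?thesis
      using i by (simp only: set_subst_word[OF eq_refl[OF lu]] lu lt length_splice_in lessThan_def mem_Collect_eq)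
  qed
  then show "graft i (length ds) u t \<in> {t. well_colored E (splice_in cs i ds) c t \<and>
      distinct (leaves t) \<and> set (leaves t) = {..<length (splice_in cs i ds)}}"
    using t u i lu by (simp add: leaves_graft distinct_subst_word well_colored_graft)
qed auto

text \<open>Evaluation in an algebra with basis \<open>'x\<close>, in which each generator
  \<open>e\<close> is a product \<open>B e\<close> given on basis elements and \<open>a\<close>
  supplies the inputs; the products obey no laws. It serves for words and again for the pairing
  (\<open>comb_product\<close>).\<close>

primrec eval_tree ::
  "('e \<Rightarrow> 'x \<Rightarrow> 'x \<Rightarrow> 'x \<Rightarrow>\<^sub>0 'k::field) \<Rightarrow> (nat \<Rightarrow> 'x \<Rightarrow>\<^sub>0 'k) \<Rightarrow> 'e tree \<Rightarrow> 'x \<Rightarrow>\<^sub>0 'k" where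
  "eval_tree B a (Leaf i) = a i"
| "eval_tree B a (Node c1 c2 e s t) = lin (\<lambda>x. lin (B e x) (eval_tree B a t)) (eval_tree B a s)"

lemma eval_tree_relabel: "eval_tree B a (relabel f t) = eval_tree B (\<lambda>j. a (f j)) t"
  by (induction t) simp_all

lemma eval_tree_cong:
  "(\<And>j. j \<in> set (leaves t) \<Longrightarrow> a j = a' j) \<Longrightarrow> eval_tree B a t = eval_tree B a' t"
  by (induction t) simp_all

lemma eval_tree_graft:
  "eval_tree B a (graft i m u t) =
    eval_tree B (\<lambda>j. if j < i then a j else if j = i then eval_tree B (\<lambda>k. a (k + i)) u else a (j + m - 1)) t"
  by (induction t) (simp_all add: eval_tree_relabel)

text \<open>Each input occurs once, so the evaluation is linear in it. This is what makes kernels of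
  evaluations absorb compositions in the inner argument.\<close>

lemma eval_tree_multilinear:
  assumes "distinct (leaves t)" "i \<in> set (leaves t)"
  shows "eval_tree B (a(i := lin h f)) t = lin (\<lambda>x. eval_tree B (a(i := h x)) t) f"
  using assms
proof (induction t)
  case (Node c1 c2 e s t)
  have upd: "eval_tree B (a(i := y)) u = eval_tree B a u" if "i \<notin> set (leaves u)" for y u
    by (rule eval_tree_cong) (use that in auto)
  consider "i \<in> set (leaves s)" "i \<notin> set (leaves t)" | "i \<in> set (leaves t)" "i \<notin> set (leaves s)"
    using Node.prems by auto
  then show ?case
  proof cases
    case 1
    then show ?thesis using Node.IH(1) Node.prems by (simp add: upd lin_lin del: fun_upd_apply)
  next
    case 2
    then have "eval_tree B (a(i := lin h f)) (Node c1 c2 e s t) =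
        lin (\<lambda>y. lin (\<lambda>x. lin (B e y) (eval_tree B (a(i := h x)) t)) f) (eval_tree B a s)"
      using Node.IH(2) Node.prems by (simp add: upd lin_lin del: fun_upd_apply)
    also have "\<dots> = lin (\<lambda>x. eval_tree B (a(i := h x)) (Node c1 c2 e s t)) f"
      using 2 by (subst lin_fun_lin) (simp add: upd del: fun_upd_apply)
    finally show ?thesis .
  qed
qed simp

text \<open>The linear extension of \<open>g\<close> is a homomorphism for all the products at once.
  Renumbering the letters of words and substituting for them are instances.\<close>

lemma eval_tree_hom:
  assumes "\<And>e x y. lin g (B e x y) = lin (\<lambda>x'. lin (B e x') (g y)) (g x)"
  shows "lin g (eval_tree B a t) = eval_tree B (\<lambda>j. lin g (a j)) t"
proof (induction t)
  case (Node c1 c2 e s t)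
  have "lin (\<lambda>x'. lin (\<lambda>y. lin (B e x') (g y)) f) h = lin (\<lambda>y. lin (\<lambda>x'. lin (B e x') (g y)) h) f" for f h
    by (rule lin_fun_lin)
  then show ?case
    by (simp add: lin_lin assms flip: Node.IH) (rule lin_fun_lin)
qed simp

section \<open>From dual trees to words\<close>

abbreviation lp_dual :: "('k::field, (lp_gen \<Rightarrow>\<^sub>0 'k) \<Rightarrow> 'k) binary" where
  "lp_dual \<equiv> dual_gens lp_gens"

lemma lp_gens_simps [simp]:
  "gens lp_gens c1 c2 c = free_module (lp_basis c1 c2 c)"
  "swap lp_gens c1 c2 c f = lin lp_transpose f"
  by (simp_all add: lp_gens_def lin_def smul_def)

lemma lp_dual_carrier:
  "\<phi> \<in> carrier (gens (lp_dual :: ('k::field, _) binary) c1 c2 c) \<longleftrightarrow>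
    (\<forall>f g. Poly_Mapping.keys f \<subseteq> lp_basis c1 c2 c \<longrightarrow> Poly_Mapping.keys g \<subseteq> lp_basis c1 c2 c \<longrightarrow>
      \<phi> (f + g) = \<phi> f + \<phi> g) \<and>
    (\<forall>k f. Poly_Mapping.keys f \<subseteq> lp_basis c1 c2 c \<longrightarrow> \<phi> (smul k f) = k * \<phi> f) \<and>
    (\<forall>f. \<not> Poly_Mapping.keys f \<subseteq> lp_basis c1 c2 c \<longrightarrow> \<phi> f = 0)"
  by (auto simp: dual_gens_def)

lemma lp_dual_simps [simp]:
  "(\<phi> \<oplus>\<^bsub>gens lp_dual c1 c2 c\<^esub> \<psi>) x = \<phi> x + \<psi> x" "(k \<odot>\<^bsub>gens lp_dual c1 c2 c\<^esub> \<phi>) x = k * \<phi> x"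
  by (simp_all add: dual_gens_def)

lemma lp_dual_support:
  assumes "\<phi> \<in> carrier (gens (lp_dual :: ('k::field, _) binary) c1 c2 c)" "b \<notin> lp_basis c1 c2 c"
  shows "\<phi> (Poly_Mapping.single b k) = 0"
proof (cases "k = 0")
  case True
  have "\<phi> (smul 0 0) = 0 * \<phi> 0"
    using assms(1) unfolding lp_dual_carrier by (metis empty_subsetI keys_zero)
  then show ?thesis using True by simp
next
  case False
  then show ?thesis using assms unfolding lp_dual_carrier by simp
qed

lemma lp_dual_single:
  assumes "\<phi> \<in> carrier (gens (lp_dual :: ('k::field, _) binary) c1 c2 c)"
  shows "\<phi> (Poly_Mapping.single b k) = k * \<phi> (delta b)"
proof (cases "b \<in> lp_basis c1 c2 c")
  case True
  then show ?thesis
    using assms[unfolded lp_dual_carrier, THEN conjunct2, THEN conjunct1, rule_format, of "delta b" k]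
    by simp
qed (simp add: lp_dual_support[OF assms])

lemma lp_dual_swap:
  "swap lp_dual c1 c2 c \<phi> (delta b) = (if b \<in> lp_basis c2 c1 c then - \<phi> (lp_transpose b) else 0)"
  by (simp add: dual_gens_def)

text \<open>
  The product of two words under a dual generator.  Through the color of its arguments the
  value of \<open>N11\<close> or \<open>N11'\<close> is only used when one of the words is empty, so that the order does
  not matter; the signs are those of the sign representation.
\<close>

definition word_product :: "((lp_gen \<Rightarrow>\<^sub>0 'k::field) \<Rightarrow> 'k) \<Rightarrow> nat list \<Rightarrow> nat list \<Rightarrow> nat list \<Rightarrow>\<^sub>0 'k" where
  "word_product \<phi> u v =
    Poly_Mapping.single (u @ v) (\<phi> (delta L2) + \<phi> (delta N02) + \<phi> (delta N11) - \<phi> (delta N11')) +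
    Poly_Mapping.single (v @ u) (- \<phi> (delta N02'))"

text \<open>A closed input becomes the empty word, the unit of concatenation; hence it commutes with
  everything.\<close>

definition word_input :: "color list \<Rightarrow> nat \<Rightarrow> nat list \<Rightarrow>\<^sub>0 'k::field" where
  "word_input cs i = delta (if cs ! i = Open then [i] else [])"

abbreviation word_eval ::
  "color list \<Rightarrow> ((lp_gen \<Rightarrow>\<^sub>0 'k::field) \<Rightarrow> 'k) tree \<Rightarrow> nat list \<Rightarrow>\<^sub>0 'k" where
  "word_eval cs \<equiv> eval_tree word_product (word_input cs)"

lemma keys_word_product:
  assumes "\<phi> \<in> carrier (gens (lp_dual :: ('k::field, _) binary) c1 c2 c)"
    and "w \<in> Poly_Mapping.keys (word_product \<phi> u v)"
  shows "(w = u @ v \<or> w = v @ u) \<and> lp_basis c1 c2 c \<noteq> {}"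
proof -
  note z = lp_dual_support[OF assms(1), of _ 1]
  have "lp_basis c1 c2 c \<noteq> {}"
  proof
    assume "lp_basis c1 c2 c = {}"
    then show False using assms(2) by (simp add: word_product_def z)
  qed
  moreover have "w = u @ v \<or> w = v @ u"
    using assms(2) unfolding word_product_def
    by (auto simp: in_keys_iff lookup_add lookup_single when_def split: if_splits)
  ultimately show ?thesis by blast
qed

text \<open>A vertex with closed output has closed inputs only, and one with open output has an open
  input; so emptiness of the word is decided by the output color. This invariant is what later steps
  know about the factors of \<open>word_product\<close>.\<close>

lemma keys_word_eval:
  assumes "well_colored (lp_dual :: ('k::field, _) binary) cs c t" "distinct (leaves t)"
    "w \<in> Poly_Mapping.keys (word_eval cs t)"
  shows "distinct w \<and> set w = {i \<in> set (leaves t). cs ! i = Open} \<and> (w = [] \<longleftrightarrow> c = Closed)"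
  using assms
proof (induction t arbitrary: c w)
  case (Leaf i)
  then show ?case by (cases "cs ! i") (auto simp: word_input_def)
next
  case (Node c1 c2 \<phi> s t)
  obtain u v where u: "u \<in> Poly_Mapping.keys (word_eval cs s)" and v: "v \<in> Poly_Mapping.keys (word_eval cs t)"
    and w: "w \<in> Poly_Mapping.keys (word_product \<phi> u v)"
    using Node.prems(3) subsetD[OF keys_lin] by (fastforce dest: subsetD[OF keys_lin])
  have "distinct u \<and> set u = {i \<in> set (leaves s). cs ! i = Open} \<and> (u = [] \<longleftrightarrow> c1 = Closed)"
    using Node.IH(1)[OF _ _ u, of c1] Node.prems by simp
  moreover have "distinct v \<and> set v = {i \<in> set (leaves t). cs ! i = Open} \<and> (v = [] \<longleftrightarrow> c2 = Closed)"
    using Node.IH(2)[OF _ _ v, of c2] Node.prems by simp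
  moreover have "(w = u @ v \<or> w = v @ u) \<and> lp_basis c1 c2 c \<noteq> {}"
    using Node.prems(1) keys_word_product w by (metis well_colored.simps(2))
  then have "w = u @ v \<or> w = v @ u" "c = Closed \<longleftrightarrow> c1 = Closed \<and> c2 = Closed"
    by (cases c1; cases c2; cases c; auto)+
  moreover have "set (leaves s) \<inter> set (leaves t) = {}"
    using Node.prems(2) by simp
  ultimately show ?case by auto
qed

lemma word_product_hom:
  "lin (\<lambda>w. delta (concat (map h w))) (word_product \<phi> u v) =
    lin (\<lambda>u'. lin (word_product \<phi> u') (delta (concat (map h v)))) (delta (concat (map h u)))"
  by (simp add: word_product_def)

lemma word_product_hom_map:
  "lin (\<lambda>w. delta (map h w)) (word_product \<phi> u v) =
    lin (\<lambda>u'. lin (word_product \<phi> u') (delta (map h v))) (delta (map h u))"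
  by (simp add: word_product_def)

lemma word_eval_relabel:
  assumes "\<And>i. i \<in> set (leaves t) \<Longrightarrow> ds ! f i = cs ! i"
  shows "word_eval ds (relabel f t) = lin (\<lambda>w. delta (map f w)) (word_eval cs t)"
  unfolding eval_tree_relabel eval_tree_hom[of "\<lambda>w. delta (map f w)", OF word_product_hom_map]
  by (rule eval_tree_cong) (simp add: word_input_def assms)

lemma word_eval_graft:
  assumes i: "i < length cs"
    and t: "t \<in> s_comp (tree_operad (lp_dual :: ('k::field, _) binary)) cs c"
    and u: "u \<in> s_comp (tree_operad lp_dual) ds (cs ! i)"
  shows "word_eval (splice_in cs i ds) (graft i (length ds) u t) =
    o_circ (linearization word_operad) cs c i ds (word_eval cs t) (word_eval ds u)"
proof -
  let ?m = "length ds" and ?cs = "splice_in cs i ds"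
  let ?g = "\<lambda>v w. delta (subst_word i ?m v w) :: _ \<Rightarrow>\<^sub>0 'k"
  \<comment> \<open>Substituting \<open>v\<close> for the letter \<open>i\<close> after the
    evaluation amounts to evaluating with the inputs \<open>a v\<close>. Only the value at
    \<open>i\<close> depends on \<open>v\<close>, so \<open>a []\<close> serves as reference for the
    other inputs.\<close>
  define a where "a v = (\<lambda>j. lin (?g v) (word_input cs j))" for v
  define shift where "shift v = (delta (map (\<lambda>k. k + i) v) :: _ \<Rightarrow>\<^sub>0 'k)" for v
  have leaves_t: "set (leaves t) = {..<length cs}" and leaves_u: "set (leaves u) = {..<length ds}"
    and dist: "distinct (leaves t)" "distinct (leaves u)"
    and wcu: "well_colored lp_dual ds (cs ! i) u"
    using t u by simp_all
  have "ds \<noteq> []"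
  proof
    assume "ds = []"
    with leaves_u have "set (leaves u) = {}" by simp
    then show False by simp
  qed
  have u_shift: "eval_tree word_product (\<lambda>k. word_input ?cs (k + i)) u = lin shift (word_eval ds u)"
    unfolding shift_def eval_tree_hom[of "\<lambda>w. delta (map (\<lambda>k. k + i) w)", OF word_product_hom_map]
    by (rule eval_tree_cong) (use i leaves_u in \<open>simp add: word_input_def nth_splice_in\<close>)
  have hom: "lin (?g v) (word_eval cs t) = eval_tree word_product (a v) t" for v
    unfolding a_def subst_word_def
    by (rule eval_tree_hom) (rule word_product_hom)
  have "word_eval ?cs (graft i ?m u t) =
      eval_tree word_product (\<lambda>j. if j < i then word_input ?cs j else if j = i then lin shift (word_eval ds u)
        else word_input ?cs (j + ?m - 1)) t"
    unfolding eval_tree_graft u_shift by simp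
  also have "\<dots> = eval_tree word_product ((a [])(i := lin shift (word_eval ds u))) t"
    by (rule eval_tree_cong) (use i leaves_t \<open>ds \<noteq> []\<close> in
      \<open>cases ds; auto simp: word_input_def nth_splice_in a_def subst_letter_def not_less\<close>)
  also have "\<dots> = lin (\<lambda>v. eval_tree word_product ((a [])(i := shift v)) t) (word_eval ds u)"
    using dist leaves_t i by (intro eval_tree_multilinear) auto
  also have "\<dots> = lin (\<lambda>v. eval_tree word_product (a v) t) (word_eval ds u)"
  \<comment> \<open>At a closed input \<open>i\<close> the value \<open>a v i\<close> is the empty
    word whatever \<open>v\<close>, so the two assignments agree only if \<open>v\<close> itself is
    empty; the color invariant of \<open>keys_word_eval\<close> provides this.\<close>
  proof (rule lin_cong)
    fix v assume v: "v \<in> Poly_Mapping.keys (word_eval ds u)"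
    have "v = [] \<longleftrightarrow> cs ! i = Closed"
      using keys_word_eval[OF wcu dist(2) v] by simp
    then show "eval_tree word_product ((a [])(i := shift v)) t = eval_tree word_product (a v) t"
      by (intro eval_tree_cong) (cases "cs ! i"; auto simp: a_def shift_def word_input_def subst_letter_def)
  qed
  also have "\<dots> = o_circ (linearization word_operad) cs c i ds (word_eval cs t) (word_eval ds u)"
    unfolding hom[symmetric] linearization_simps by (subst lin_fun_lin) simp
  finally show ?thesis .
qed

lemma operad_map_word_eval:
  "operad_map (linearization (tree_operad lp_dual) :: ('k::field, _) operad) (linearization word_operad)
    (\<lambda>cs c. lin (word_eval cs))"
proof (rule operad_map_lin[OF closed_tree_operad closed_word_operad])
  fix cs c and t :: "((lp_gen \<Rightarrow>\<^sub>0 'k) \<Rightarrow> 'k) tree"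
  assume t: "t \<in> s_comp (tree_operad lp_dual) cs c"
  show "Poly_Mapping.keys (word_eval cs t) \<subseteq> s_comp word_operad cs c"
  proof
    fix w assume w: "w \<in> Poly_Mapping.keys (word_eval cs t)"
    have l: "set (leaves t) = {..<length cs}" using t by simp
    have "cs \<noteq> []"
    proof
      assume "cs = []"
      with l have "set (leaves t) = {}" by simp
      then show False by simp
    qed
    then show "w \<in> s_comp word_operad cs c"
      using keys_word_eval[OF _ _ w, of c] t l by (simp add: open_inputs_def lessThan_def)
  qed
  fix \<sigma> assume \<sigma>: "\<sigma> permutes {..<length cs}"
  have "permute_list \<sigma> cs ! inv_into UNIV \<sigma> i = cs ! i" if "i \<in> set (leaves t)" for i
    using t that \<sigma> permutes_lessThanD[OF \<sigma>] by (simp add: nth_permute_list)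
  then show "word_eval (permute_list \<sigma> cs) (s_act (tree_operad lp_dual) cs c \<sigma> t) =
      o_act (linearization word_operad) cs c \<sigma> (word_eval cs t)"
    by (simp add: word_eval_relabel linearization_simps)
next
  fix cs :: "color list" and c i ds and s t :: "((lp_gen \<Rightarrow>\<^sub>0 'k) \<Rightarrow> 'k) tree"
  assume "i < length cs" "s \<in> s_comp (tree_operad lp_dual) cs c" "t \<in> s_comp (tree_operad lp_dual) ds (cs ! i)"
  then show "word_eval (splice_in cs i ds) (s_circ (tree_operad lp_dual) cs c i ds s t) =
      o_circ (linearization word_operad) cs c i ds (word_eval cs s) (word_eval ds t)"
    by (simp only: tree_operad_simps(3)) (rule word_eval_graft; simp)
next
  fix c show "word_eval [c] (s_unit (tree_operad lp_dual) c) = (delta (s_unit word_operad c) :: _ \<Rightarrow>\<^sub>0 'k)"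
    by (cases c) (simp_all add: word_input_def)
qed

lemma word_product_add: "word_product (\<lambda>x. \<phi> x + \<psi> x) u v = word_product \<phi> u v + word_product \<psi> u v"
  by (simp add: word_product_def single_add single_diff single_uminus algebra_simps)

lemma word_product_smult: "word_product (\<lambda>x. k * \<phi> x) u v = smul k (word_product \<phi> u v)"
  by (simp add: word_product_def algebra_simps)

text \<open>Transposing in \<open>dual_gens\<close> costs a minus sign. \<open>word_product\<close>
  carries the same sign on \<open>N02'\<close> and \<open>N11'\<close>, and for \<open>L2\<close>
  the antisymmetry of the bracket supplies a second one, so that its dual is symmetric.\<close>

lemma word_product_swap:
  assumes "\<phi> \<in> carrier (gens (lp_dual :: ('k::field, _) binary) c1 c2 c)"
    and "u = [] \<longleftrightarrow> c1 = Closed" "v = [] \<longleftrightarrow> c2 = Closed"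
  shows "word_product (swap lp_dual c1 c2 c \<phi>) v u = word_product \<phi> u v"
proof -
  note z = lp_dual_support[OF assms(1)] and k = lp_dual_single[OF assms(1)]
  have "swap lp_dual c1 c2 c \<phi> (delta b) = - \<phi> (lp_transpose b)"
    if "b \<in> lp_basis c2 c1 c" for b using that by (simp add: lp_dual_swap)
  moreover have "swap lp_dual c1 c2 c \<phi> (delta b) = 0"
    if "b \<notin> lp_basis c2 c1 c" for b using that by (simp add: lp_dual_swap)
  ultimately show ?thesis
    using assms(2,3) k[of L2 "- 1"]
    by (cases c1; cases c2; cases c) (simp_all add: word_product_def z add.commute)
qed

lemma word_eval_free_rels:
  assumes "f \<in> free_rels (lp_dual :: ('k::field, _) binary) cs c"
  shows "lin (word_eval cs) f = 0"
  using assms unfolding free_rels_def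
proof (elim UnE CollectE exE conjE)
  fix c1 c2 \<phi> \<psi>
  assume f: "f = delta (Node c1 c2 (\<phi> \<oplus>\<^bsub>gens lp_dual c1 c2 c\<^esub> \<psi>) (Leaf 0) (Leaf 1)) -
      delta (Node c1 c2 \<phi> (Leaf 0) (Leaf 1)) - delta (Node c1 c2 \<psi> (Leaf 0) (Leaf 1))"
  have "\<phi> \<oplus>\<^bsub>gens lp_dual c1 c2 c\<^esub> \<psi> = (\<lambda>x. \<phi> x + \<psi> x)" by auto
  then show ?thesis
    by (simp add: f word_product_add word_input_def)
next
  fix c1 c2 k \<phi>
  assume f: "f = delta (Node c1 c2 (k \<odot>\<^bsub>gens lp_dual c1 c2 c\<^esub> \<phi>) (Leaf 0) (Leaf 1)) -
      Poly_Mapping.single (Node c1 c2 \<phi> (Leaf 0) (Leaf 1)) k"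
  have "k \<odot>\<^bsub>gens lp_dual c1 c2 c\<^esub> \<phi> = (\<lambda>x. k * \<phi> x)" by auto
  then show ?thesis
    by (simp add: f word_product_smult word_input_def)
next
  fix c1 c2 \<phi>
  assume f: "f = delta (Node c1 c2 \<phi> (Leaf 1) (Leaf 0)) -
      delta (Node c2 c1 (swap lp_dual c1 c2 c \<phi>) (Leaf 0) (Leaf 1))"
    and cs: "cs = [c2, c1]" and "\<phi> \<in> carrier (gens lp_dual c1 c2 c)"
  then have "word_product (swap lp_dual c1 c2 c \<phi>) (if c2 = Open then [0] else []) (if c1 = Open then [1] else []) =
      word_product \<phi> (if c1 = Open then [1] else []) (if c2 = Open then [0] else [])"
    by (intro word_product_swap) (cases c1; cases c2; simp)+
  then show ?thesis
    by (cases c1; cases c2) (simp_all add: f cs word_input_def)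
qed

section \<open>Ideals of the tree operad and labelled trees\<close>

text \<open>
  To argue about subtrees, an ideal is extended to trees with arbitrary leaf labels \<open>S\<close>, colored
  by \<open>\<kappa>\<close>: a combination of such trees belongs to the extended ideal if renumbering its leaves
  produces an element of the ideal.  By equivariance the choice of the numbering does not matter.
\<close>

primrec colored :: "('k, 'e) binary \<Rightarrow> (nat \<Rightarrow> color) \<Rightarrow> color \<Rightarrow> 'e tree \<Rightarrow> bool" where
  "colored E \<kappa> c (Leaf i) \<longleftrightarrow> \<kappa> i = c"
| "colored E \<kappa> c (Node c1 c2 e s t) \<longleftrightarrow>
    e \<in> carrier (gens E c1 c2 c) \<and> colored E \<kappa> c1 s \<and> colored E \<kappa> c2 t"

definition labelled_trees :: "('k, 'e) binary \<Rightarrow> (nat \<Rightarrow> color) \<Rightarrow> nat set \<Rightarrow> color \<Rightarrow> 'e tree set" where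
  "labelled_trees E \<kappa> S c = {t. colored E \<kappa> c t \<and> distinct (leaves t) \<and> set (leaves t) = S}"

text \<open>Substitution at all leaves at once and without renumbering, a common form in which
  iterated grafts can be compared.\<close>

primrec tree_subst :: "(nat \<Rightarrow> 'e tree) \<Rightarrow> 'e tree \<Rightarrow> 'e tree" where
  "tree_subst f (Leaf i) = f i"
| "tree_subst f (Node c1 c2 e s t) = Node c1 c2 e (tree_subst f s) (tree_subst f t)"

lemma well_colored_iff:
  "well_colored E cs c t \<longleftrightarrow> set (leaves t) \<subseteq> {..<length cs} \<and> colored E (\<lambda>i. cs ! i) c t"
  by (induction t arbitrary: c) auto

lemma colored_relabel: "colored E \<kappa> c (relabel f t) = colored E (\<lambda>i. \<kappa> (f i)) c t"
  by (induction t arbitrary: c) auto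

lemma colored_cong: "(\<And>i. i \<in> set (leaves t) \<Longrightarrow> \<kappa> i = \<kappa>' i) \<Longrightarrow> colored E \<kappa> c t = colored E \<kappa>' c t"
  by (induction t arbitrary: c) auto

text \<open>Vertices record the colors of their inputs, so a tree with given output color fixes the
  colors of its leaves.\<close>

lemma colored_unique:
  "colored E \<kappa> c t \<Longrightarrow> colored E \<kappa>' c t \<Longrightarrow> i \<in> set (leaves t) \<Longrightarrow> \<kappa> i = \<kappa>' i"
  by (induction t arbitrary: c) auto

lemma colored_tree_subst:
  assumes "colored E \<kappa> c x" "\<And>i. i \<in> set (leaves x) \<Longrightarrow> colored E \<kappa>' (\<kappa> i) (f i)"
  shows "colored E \<kappa>' c (tree_subst f x)"
  using assms by (induction x arbitrary: c) auto

lemma set_leaves_tree_subst: "set (leaves (tree_subst f x)) = (\<Union>i\<in>set (leaves x). set (leaves (f i)))"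
  by (induction x) auto

lemma tree_subst_cong:
  "(\<And>i. i \<in> set (leaves x) \<Longrightarrow> f i = g i) \<Longrightarrow> tree_subst f x = tree_subst g x"
  by (induction x) simp_all

lemma tree_subst_tree_subst: "tree_subst f (tree_subst g x) = tree_subst (\<lambda>i. tree_subst f (g i)) x"
  by (induction x) simp_all

lemma relabel_tree_subst: "relabel f (tree_subst g x) = tree_subst (\<lambda>i. relabel f (g i)) x"
  by (induction x) simp_all

lemma graft_eq_tree_subst:
  "graft i m u x = tree_subst (\<lambda>j. if j < i then Leaf j else if j = i then relabel (\<lambda>k. k + i) u
    else Leaf (j + m - 1)) x"
  by (induction x) simp_all

lemma graft_closed:
  assumes "i < length cs" "x \<in> s_comp (tree_operad E) cs c" "y \<in> s_comp (tree_operad E) ds (cs ! i)"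
    "es = splice_in cs i ds"
  shows "graft i (length ds) y x \<in> s_comp (tree_operad E) es c"
  using closed_tree_operad[of E, unfolded closed_set_operad_def, THEN conjunct2, THEN conjunct1,
      rule_format, OF assms(1-3)] unfolding assms(4) tree_operad_simps(3) .

lemma numbering_ex:
  assumes "finite S"
  obtains \<rho> ds where "bij_betw \<rho> S {..<length ds}" "\<And>i. i \<in> S \<Longrightarrow> ds ! \<rho> i = (\<kappa> i :: color)"
proof -
  obtain \<rho> where \<rho>: "bij_betw \<rho> S {..<card S}"
    using ex_bij_betw_finite_nat[OF assms] by (auto simp: lessThan_atLeast0)
  define ds where "ds = map (\<lambda>k. \<kappa> (inv_into S \<rho> k)) [0..<card S]"
  have "ds ! \<rho> i = \<kappa> i" if "i \<in> S" for i
    using bij_betw_apply[OF \<rho> that] bij_betw_inv_into_left[OF \<rho> that] by (simp add: ds_def)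
  then show ?thesis
    using that[of \<rho> ds] \<rho> by (simp add: ds_def)
qed

locale tree_ideal =
  fixes E :: "('k::field, 'e) binary" and N :: "('e tree \<Rightarrow>\<^sub>0 'k) family"
  assumes ideal: "operad_ideal (linearization (tree_operad E)) N"
begin

abbreviation LT where "LT \<equiv> labelled_trees E"

lemma N_submodule: "submodule (N cs c) scalars (free_module (s_comp (tree_operad E) cs c))"
  using operad_idealD(1)[OF ideal, of cs c] by (simp add: linearization_simps)

lemmas N_rules = submodule_free_moduleD[OF N_submodule]

lemma N_act:
  "\<sigma> permutes {..<length cs} \<Longrightarrow> f \<in> N cs c \<Longrightarrow>
    lin (\<lambda>t. delta (relabel (inv_into UNIV \<sigma>) t)) f \<in> N (permute_list \<sigma> cs) c"
  using operad_idealD(2)[OF ideal] by (simp add: linearization_simps)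

lemma N_circ:
  assumes "i < length cs" "Poly_Mapping.keys f \<subseteq> s_comp (tree_operad E) cs c"
    "Poly_Mapping.keys g \<subseteq> s_comp (tree_operad E) ds (cs ! i)" "f \<in> N cs c \<or> g \<in> N ds (cs ! i)"
    "es = splice_in cs i ds"
  shows "lin (\<lambda>t. lin (\<lambda>u. delta (graft i (length ds) u t)) g) f \<in> N es c"
  using assms operad_idealD(3,4)[OF ideal, of i cs] by (auto simp: linearization_simps)

definition hat :: "(nat \<Rightarrow> color) \<Rightarrow> nat set \<Rightarrow> color \<Rightarrow> ('e tree \<Rightarrow>\<^sub>0 'k) \<Rightarrow> bool" where
  "hat \<kappa> S c f \<longleftrightarrow> Poly_Mapping.keys f \<subseteq> LT \<kappa> S c \<and>
    (\<forall>\<rho> ds. bij_betw \<rho> S {..<length ds} \<and> (\<forall>i\<in>S. ds ! \<rho> i = \<kappa> i) \<longrightarrow>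
      lin (\<lambda>t. delta (relabel \<rho> t)) f \<in> N ds c)"

lemma hat_keys: "hat \<kappa> S c f \<Longrightarrow> Poly_Mapping.keys f \<subseteq> LT \<kappa> S c"
  by (simp add: hat_def)

lemma hat_zero: "hat \<kappa> S c 0"
  by (simp add: hat_def N_rules)

lemma hat_add: "hat \<kappa> S c f \<Longrightarrow> hat \<kappa> S c g \<Longrightarrow> hat \<kappa> S c (f + g)"
  by (simp add: hat_def N_rules keys_subsetI)

lemma hat_smul: "hat \<kappa> S c f \<Longrightarrow> hat \<kappa> S c (smul k f)"
  by (simp add: hat_def N_rules keys_subsetI)

lemma hat_diff: "hat \<kappa> S c f \<Longrightarrow> hat \<kappa> S c g \<Longrightarrow> hat \<kappa> S c (f - g)"
  by (simp add: hat_def N_rules keys_subsetI)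

lemma hat_lin:
  assumes "\<And>x. x \<in> Poly_Mapping.keys f \<Longrightarrow> hat \<kappa> S c (h x)"
  shows "hat \<kappa> S c (lin h f)"
proof -
  have "hat \<kappa> S c (\<Sum>x\<in>A. smul (Poly_Mapping.lookup f x) (h x))"
    if "finite A" "A \<subseteq> Poly_Mapping.keys f" for A
    using that by (induction A rule: finite_induct) (auto intro: hat_zero hat_add hat_smul assms)
  then show ?thesis unfolding lin_def by simp
qed

lemma numbering_bij:
  assumes "t \<in> LT \<kappa> S c" "relabel \<rho> t \<in> s_comp (tree_operad E) ds c"
  shows "bij_betw \<rho> S {..<length ds}" "i \<in> S \<Longrightarrow> ds ! \<rho> i = \<kappa> i"
proof -
  have t: "colored E \<kappa> c t" "distinct (leaves t)" "set (leaves t) = S"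
    using assms(1) by (auto simp: labelled_trees_def)
  have r: "colored E (\<lambda>i. ds ! \<rho> i) c t" "distinct (map \<rho> (leaves t))" "\<rho> ` S = {..<length ds}"
    using assms(2) t(3) by (auto simp: well_colored_iff colored_relabel)
  show "bij_betw \<rho> S {..<length ds}"
    using r t by (simp add: bij_betw_def distinct_map)
  show "i \<in> S \<Longrightarrow> ds ! \<rho> i = \<kappa> i"
    using colored_unique[OF r(1) t(1)] t(3) by blast
qed

lemma relabel_numbering:
  assumes "t \<in> LT \<kappa> S c" "bij_betw \<rho> S {..<length ds}" "\<And>i. i \<in> S \<Longrightarrow> ds ! \<rho> i = \<kappa> i"
  shows "relabel \<rho> t \<in> s_comp (tree_operad E) ds c"
proof -
  have t: "colored E \<kappa> c t" "distinct (leaves t)" "set (leaves t) = S"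
    using assms(1) by (auto simp: labelled_trees_def)
  have "colored E (\<lambda>i. ds ! \<rho> i) c t"
    using t(1) colored_cong[of t "\<lambda>i. ds ! \<rho> i" \<kappa>] assms(3) t(3) by blast
  moreover have "\<rho> ` S = {..<length ds}" "inj_on \<rho> S"
    using assms(2) by (simp_all add: bij_betw_def)
  ultimately show ?thesis
    using t by (simp add: well_colored_iff colored_relabel distinct_map)
qed

text \<open>Two numberings of the same labels differ by a permutation, under which the ideal is
  stable; one numbering therefore decides membership.\<close>

lemma hat_numbered:
  assumes keys: "Poly_Mapping.keys f \<subseteq> LT \<kappa> S c"
    and \<rho>: "\<And>t. t \<in> Poly_Mapping.keys f \<Longrightarrow> relabel \<rho> t \<in> s_comp (tree_operad E) ds c"
    and N: "lin (\<lambda>t. delta (relabel \<rho> t)) f \<in> N ds c"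
  shows "hat \<kappa> S c f"
\<comment> \<open>A tree in the support witnesses that \<open>\<rho>\<close> numbers
  \<open>S\<close> with matching colors; for \<open>f = 0\<close> there is none.\<close>
proof (cases "f = 0")
  case False
  then have "Poly_Mapping.keys f \<noteq> {}"
    by (metis equals0D in_keys_iff lookup_zero poly_mapping_eqI)
  then obtain t0 where t0: "t0 \<in> Poly_Mapping.keys f" by blast
  have t0': "t0 \<in> LT \<kappa> S c" using keys t0 by blast
  note bij = numbering_bij(1)[OF t0' \<rho>[OF t0]] and col = numbering_bij(2)[OF t0' \<rho>[OF t0]]
  have "lin (\<lambda>t. delta (relabel \<rho>' t)) f \<in> N ds' c"
    if bij': "bij_betw \<rho>' S {..<length ds'}" and col': "\<And>i. i \<in> S \<Longrightarrow> ds' ! \<rho>' i = \<kappa> i" for \<rho>' ds'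
  proof -
    have len: "length ds' = length ds"
      using bij_betw_same_card[OF bij] bij_betw_same_card[OF bij'] by simp
    \<comment> \<open>The permutation with \<open>\<sigma> \<circ> \<rho>' = \<rho>\<close> on
      \<open>S\<close>, continued by the identity.\<close>
    define \<sigma> where "\<sigma> j = (if j < length ds then \<rho> (inv_into S \<rho>' j) else j)" for j
    have "bij_betw (\<rho> \<circ> inv_into S \<rho>') {..<length ds} {..<length ds}"
      using bij_betw_trans[OF bij_betw_inv_into[OF bij'] bij] len by simp
    then have "bij_betw \<sigma> {..<length ds} {..<length ds}"
      by (rule bij_betw_cong[THEN iffD1, rotated]) (simp add: \<sigma>_def)
    then have \<sigma>: "\<sigma> permutes {..<length ds}"
      by (rule bij_imp_permutes) (simp add: \<sigma>_def)
    have \<sigma>\<rho>': "\<sigma> (\<rho>' i) = \<rho> i" if "i \<in> S" for i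
      using that bij_betw_apply[OF bij' that] bij_betw_inv_into_left[OF bij' that] len
      by (simp add: \<sigma>_def)
    have inv: "inv_into UNIV \<sigma> (\<rho> i) = \<rho>' i" if "i \<in> S" for i
      using permutes_lessThanD(2)[OF \<sigma>, of "\<rho>' i"] \<sigma>\<rho>'[OF that] by simp
    have "permute_list \<sigma> ds = ds'"
    proof (rule nth_equalityI)
      fix j assume "j < length (permute_list \<sigma> ds)"
      then have "j \<in> \<rho>' ` S" using bij' len by (simp add: bij_betw_def)
      then obtain i where i: "i \<in> S" "j = \<rho>' i" by blast
      then show "permute_list \<sigma> ds ! j = ds' ! j"
        using \<sigma>\<rho>'[OF i(1)] nth_permute_list[OF \<sigma>, of j] bij_betw_apply[OF bij' i(1)] len col col'
        by simp
    qed (simp add: len)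
    moreover have "lin (\<lambda>t. delta (relabel (inv_into UNIV \<sigma>) t)) (lin (\<lambda>t. delta (relabel \<rho> t)) f) =
        lin (\<lambda>t. delta (relabel \<rho>' t)) f"
      unfolding lin_lin
    proof (rule lin_cong)
      fix t assume "t \<in> Poly_Mapping.keys f"
      then have "set (leaves t) = S" using keys by (auto simp: labelled_trees_def)
      then have "relabel (inv_into UNIV \<sigma> \<circ> \<rho>) t = relabel \<rho>' t"
        by (intro relabel_cong) (simp add: inv)
      then show "lin (\<lambda>t. delta (relabel (inv_into UNIV \<sigma>) t)) (delta (relabel \<rho> t)) = delta (relabel \<rho>' t)"
        by simp
    qed
    ultimately show ?thesis
      using N_act[OF \<sigma> N] by simp
  qed
  then show ?thesis using keys by (simp add: hat_def)
qed (simp add: hat_zero)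

text \<open>The later input is grafted first, since grafting at \<open>1\<close> leaves the index
  \<open>0\<close> in place. The labels of \<open>s\<close> are numbered first; those of
  \<open>t\<close> follow, shifted by \<open>length es1\<close>.\<close>

lemma subst2_std:
  assumes x: "x \<in> s_comp (tree_operad E) [c1, c2] c"
    and s: "s \<in> LT \<kappa> S1 c1" and t: "t \<in> LT \<kappa> S2 c2" and disj: "S1 \<inter> S2 = {}"
    and num: "bij_betw \<rho>1 S1 {..<length es1}" "\<And>i. i \<in> S1 \<Longrightarrow> es1 ! \<rho>1 i = \<kappa> i"
      "bij_betw \<rho>2 S2 {..<length es2}" "\<And>i. i \<in> S2 \<Longrightarrow> es2 ! \<rho>2 i = \<kappa> i"
    and \<rho>: "\<rho> = (\<lambda>i. if i \<in> S1 then \<rho>1 i else \<rho>2 i + length es1)"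
  shows "relabel \<rho> (tree_subst (\<lambda>i. [s, t] ! i) x) =
      graft 0 (length es1) (relabel \<rho>1 s) (graft 1 (length es2) (relabel \<rho>2 t) x)" (is ?eq)
    and "relabel \<rho> (tree_subst (\<lambda>i. [s, t] ! i) x) \<in> s_comp (tree_operad E) (es1 @ es2) c" (is ?std)
    and "tree_subst (\<lambda>i. [s, t] ! i) x \<in> LT \<kappa> (S1 \<union> S2) c"
proof -
  have s': "relabel \<rho>1 s \<in> s_comp (tree_operad E) es1 c1"
    by (rule relabel_numbering[OF s]) (use num in auto)
  have t': "relabel \<rho>2 t \<in> s_comp (tree_operad E) es2 c2"
    by (rule relabel_numbering[OF t]) (use num in auto)
  have ls: "set (leaves s) = S1" and lt: "set (leaves t) = S2"
    using s t by (auto simp: labelled_trees_def)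
  have lx: "set (leaves x) = {0, 1}" using x by (simp add: lessThan_Suc insert_commute)
  have \<rho>s: "relabel \<rho> s = relabel \<rho>1 s"
    by (rule relabel_cong) (simp add: ls \<rho>)
  have \<rho>t: "relabel \<rho> t = relabel ((\<lambda>k. k + length es1) \<circ> \<rho>2) t"
    by (rule relabel_cong) (use disj in \<open>auto simp: lt \<rho>\<close>)
  have lin_leaf: "tree_subst (\<lambda>j. if j = 0 then A else Leaf (j + length es1 - 1)) (relabel (\<lambda>k. Suc (\<rho>2 k)) u) =
      relabel (\<lambda>k. \<rho>2 k + length es1) u" for A u
    by (induction u) simp_all
  show ?eq
    unfolding relabel_tree_subst graft_eq_tree_subst[of _ _ _ x] graft_eq_tree_subst[of 0] tree_subst_tree_subst
    by (rule tree_subst_cong) (auto simp: lx \<rho>s \<rho>t lin_leaf o_def)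
  have *: "graft 1 (length es2) (relabel \<rho>2 t) x \<in> s_comp (tree_operad E) (c1 # es2) c"
    by (rule graft_closed[OF _ x]) (use t' in \<open>simp_all add: splice_in_def\<close>)
  have "graft 0 (length es1) (relabel \<rho>1 s) (graft 1 (length es2) (relabel \<rho>2 t) x)
      \<in> s_comp (tree_operad E) (es1 @ es2) c"
    by (rule graft_closed[OF _ *]) (use s' in \<open>simp_all add: splice_in_def\<close>)
  then show std: ?std
    unfolding \<open>?eq\<close> .
  have "distinct (leaves (tree_subst (\<lambda>i. [s, t] ! i) x))"
    using std by (simp add: distinct_map)
  moreover have "colored E \<kappa> c (tree_subst (\<lambda>i. [s, t] ! i) x)"
  proof (rule colored_tree_subst[of E "\<lambda>i. [c1, c2] ! i"])
    show "colored E (\<lambda>i. [c1, c2] ! i) c x"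
      using x by (simp add: well_colored_iff)
    show "colored E \<kappa> ([c1, c2] ! i) ([s, t] ! i)" if "i \<in> set (leaves x)" for i
      using that s t unfolding lx by (auto simp: labelled_trees_def)
  qed
  ultimately show "tree_subst (\<lambda>i. [s, t] ! i) x \<in> LT \<kappa> (S1 \<union> S2) c"
    by (simp add: labelled_trees_def set_leaves_tree_subst lx ls lt)
qed

text \<open>Serves two ends: with \<open>f\<close> in the ideal it transports an arity two relation
  to subtrees, and with \<open>F\<close> or \<open>G\<close> in the extended ideal it makes the
  latter compatible with forming a vertex.\<close>

lemma hat_subst2:
  assumes x: "Poly_Mapping.keys f \<subseteq> s_comp (tree_operad E) [c1, c2] c"
    and F: "Poly_Mapping.keys F \<subseteq> LT \<kappa> S1 c1" and G: "Poly_Mapping.keys G \<subseteq> LT \<kappa> S2 c2"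
    and disj: "S1 \<inter> S2 = {}" and fin: "finite S1" "finite S2"
    and N: "f \<in> N [c1, c2] c \<or> hat \<kappa> S1 c1 F \<or> hat \<kappa> S2 c2 G"
  shows "hat \<kappa> (S1 \<union> S2) c (lin (\<lambda>x. lin (\<lambda>s. lin (\<lambda>t. delta (tree_subst (\<lambda>i. [s, t] ! i) x)) G) F) f)"
    (is "hat _ _ _ ?f")
proof -
  obtain \<rho>1 es1 where 1: "bij_betw \<rho>1 S1 {..<length es1}" "\<And>i. i \<in> S1 \<Longrightarrow> es1 ! \<rho>1 i = \<kappa> i"
    using numbering_ex[OF fin(1), of \<kappa>] by blast
  obtain \<rho>2 es2 where 2: "bij_betw \<rho>2 S2 {..<length es2}" "\<And>i. i \<in> S2 \<Longrightarrow> es2 ! \<rho>2 i = \<kappa> i"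
    using numbering_ex[OF fin(2), of \<kappa>] by blast
  define \<rho> where "\<rho> = (\<lambda>i. if i \<in> S1 then \<rho>1 i else \<rho>2 i + length es1)"
  note std = subst2_std[OF _ _ _ disj 1 2 \<rho>_def]
  have kx: "\<exists>x s t. x \<in> Poly_Mapping.keys f \<and> s \<in> Poly_Mapping.keys F \<and> t \<in> Poly_Mapping.keys G \<and>
      y = tree_subst (\<lambda>i. [s, t] ! i) x" if "y \<in> Poly_Mapping.keys ?f" for y
    using that by (fastforce dest!: subsetD[OF keys_lin])
  let ?F = "lin (\<lambda>t. delta (relabel \<rho>1 t)) F" and ?G = "lin (\<lambda>t. delta (relabel \<rho>2 t)) G"
  let ?g = "lin (\<lambda>t. lin (\<lambda>u. delta (graft 1 (length es2) u t)) ?G) f"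
  have kF: "Poly_Mapping.keys ?F \<subseteq> s_comp (tree_operad E) es1 c1"
    by (rule keys_linD) (use relabel_numbering[OF _ 1] F in auto)
  have kG: "Poly_Mapping.keys ?G \<subseteq> s_comp (tree_operad E) es2 c2"
    by (rule keys_linD) (use relabel_numbering[OF _ 2] G in auto)
  have kg: "Poly_Mapping.keys ?g \<subseteq> s_comp (tree_operad E) (c1 # es2) c"
  proof (intro keys_linD)
    fix t u assume "t \<in> Poly_Mapping.keys f" "u \<in> Poly_Mapping.keys ?G"
    then have t: "t \<in> s_comp (tree_operad E) [c1, c2] c" and u: "u \<in> s_comp (tree_operad E) es2 ([c1, c2] ! 1)"
      using x kG by auto
    show "Poly_Mapping.keys (delta (graft 1 (length es2) u t)) \<subseteq> s_comp (tree_operad E) (c1 # es2) c"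
      using graft_closed[OF _ t u] by (simp add: splice_in_def del: tree_operad_simps)
  qed
  have gN: "?g \<in> N (c1 # es2) c" if "f \<in> N [c1, c2] c \<or> ?G \<in> N es2 c2"
    by (rule N_circ[of 1 "[c1, c2]"]) (use x kG that in \<open>simp_all add: splice_in_def\<close>)
  have "lin (\<lambda>t. lin (\<lambda>u. delta (graft 0 (length es1) u t)) ?F) ?g \<in> N (es1 @ es2) c"
  proof (rule N_circ[of 0 "c1 # es2"])
    show "?g \<in> N (c1 # es2) c \<or> ?F \<in> N es1 ((c1 # es2) ! 0)"
      using N gN 1 2 by (auto simp: hat_def)
  qed (use kF kg in \<open>simp_all add: splice_in_def\<close>)
  also have "lin (\<lambda>t. lin (\<lambda>u. delta (graft 0 (length es1) u t)) ?F) ?g =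
      lin (\<lambda>x. lin (\<lambda>t. lin (\<lambda>s. delta (graft 0 (length es1) (relabel \<rho>1 s)
        (graft 1 (length es2) (relabel \<rho>2 t) x))) F) G) f"
    by (simp add: lin_lin)
  also have "\<dots> = lin (\<lambda>x. lin (\<lambda>s. lin (\<lambda>t. delta (graft 0 (length es1) (relabel \<rho>1 s)
        (graft 1 (length es2) (relabel \<rho>2 t) x))) G) F) f"
    by (intro lin_cong) (rule lin_fun_lin)
  also have "\<dots> = lin (\<lambda>x. lin (\<lambda>s. lin (\<lambda>t. delta (relabel \<rho> (tree_subst (\<lambda>i. [s, t] ! i) x))) G) F) f"
    by (intro lin_cong arg_cong[where f = delta] std(1)[symmetric]) (use x F G in blast)+
  also have "\<dots> = lin (\<lambda>y. delta (relabel \<rho> y)) ?f"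
    by (simp add: lin_lin)
  finally have "lin (\<lambda>y. delta (relabel \<rho> y)) ?f \<in> N (es1 @ es2) c" .
  then show ?thesis
  proof (rule hat_numbered[rotated 2])
    show "Poly_Mapping.keys ?f \<subseteq> LT \<kappa> (S1 \<union> S2) c"
      using kx std(3) x F G by blast
    show "relabel \<rho> y \<in> s_comp (tree_operad E) (es1 @ es2) c" if "y \<in> Poly_Mapping.keys ?f" for y
      using kx[OF that] std(2) x F G by blast
  qed
qed

text \<open>Transports arity three relations to subtrees. As with two inputs, grafting proceeds from
  the last input to the first.\<close>

lemma hat_subst3:
  assumes f: "f \<in> N [c0, c1, c2] c"
    and r: "r \<in> LT \<kappa> S0 c0" and s: "s \<in> LT \<kappa> S1 c1" and t: "t \<in> LT \<kappa> S2 c2"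
    and disj: "S0 \<inter> S1 = {}" "S0 \<inter> S2 = {}" "S1 \<inter> S2 = {}"
  shows "hat \<kappa> (S0 \<union> S1 \<union> S2) c (lin (\<lambda>x. delta (tree_subst (\<lambda>i. [r, s, t] ! i) x)) f)" (is "hat _ _ _ ?f")
proof -
  have lr: "set (leaves r) = S0" and ls: "set (leaves s) = S1" and lt: "set (leaves t) = S2"
    using r s t by (auto simp: labelled_trees_def)
  have fin: "finite S0" "finite S1" "finite S2"
    unfolding lr[symmetric] ls[symmetric] lt[symmetric] by simp_all
  obtain \<rho>0 es0 where 0: "bij_betw \<rho>0 S0 {..<length es0}" "\<And>i. i \<in> S0 \<Longrightarrow> es0 ! \<rho>0 i = \<kappa> i"
    using numbering_ex[OF fin(1), of \<kappa>] by blast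
  obtain \<rho>1 es1 where 1: "bij_betw \<rho>1 S1 {..<length es1}" "\<And>i. i \<in> S1 \<Longrightarrow> es1 ! \<rho>1 i = \<kappa> i"
    using numbering_ex[OF fin(2), of \<kappa>] by blast
  obtain \<rho>2 es2 where 2: "bij_betw \<rho>2 S2 {..<length es2}" "\<And>i. i \<in> S2 \<Longrightarrow> es2 ! \<rho>2 i = \<kappa> i"
    using numbering_ex[OF fin(3), of \<kappa>] by blast
  define \<rho> where "\<rho> = (\<lambda>i. if i \<in> S0 then \<rho>0 i else if i \<in> S1 then \<rho>1 i + length es0
    else \<rho>2 i + length es1 + length es0)"
  let ?r = "relabel \<rho>0 r" and ?s = "relabel \<rho>1 s" and ?t = "relabel \<rho>2 t"
  let ?g2 = "\<lambda>x. graft 2 (length es2) ?t x"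
  let ?g1 = "\<lambda>x. graft 1 (length es1) ?s (?g2 x)"
  let ?g0 = "\<lambda>x. graft 0 (length es0) ?r (?g1 x)"
  have r': "?r \<in> s_comp (tree_operad E) es0 c0" by (rule relabel_numbering[OF r 0])
  have s': "?s \<in> s_comp (tree_operad E) es1 c1" by (rule relabel_numbering[OF s 1])
  have t': "?t \<in> s_comp (tree_operad E) es2 c2" by (rule relabel_numbering[OF t 2])
  have kf: "Poly_Mapping.keys f \<subseteq> s_comp (tree_operad E) [c0, c1, c2] c"
    using N_rules(5)[OF f] .
  have g2: "?g2 x \<in> s_comp (tree_operad E) ([c0, c1] @ es2) c"
    if "x \<in> s_comp (tree_operad E) [c0, c1, c2] c" for x
    by (rule graft_closed[OF _ that]) (use t' in \<open>simp_all add: splice_in_def\<close>)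
  have g1: "?g1 x \<in> s_comp (tree_operad E) (c0 # es1 @ es2) c"
    if "x \<in> s_comp (tree_operad E) [c0, c1, c2] c" for x
    by (rule graft_closed[OF _ g2[OF that]]) (use s' in \<open>simp_all add: splice_in_def\<close>)
  have g0: "?g0 x \<in> s_comp (tree_operad E) (es0 @ es1 @ es2) c"
    if "x \<in> s_comp (tree_operad E) [c0, c1, c2] c" for x
    by (rule graft_closed[OF _ g1[OF that]]) (use r' in \<open>simp_all add: splice_in_def\<close>)
  have \<rho>r: "relabel \<rho> r = ?r"
    by (rule relabel_cong) (simp add: lr \<rho>_def)
  have \<rho>s: "relabel \<rho> s = relabel ((\<lambda>k. k + length es0) \<circ> \<rho>1) s"
    by (rule relabel_cong) (use disj in \<open>auto simp: ls \<rho>_def\<close>)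
  have \<rho>t: "relabel \<rho> t = relabel ((\<lambda>k. k + length es1 + length es0) \<circ> \<rho>2) t"
    by (rule relabel_cong) (use disj in \<open>auto simp: lt \<rho>_def\<close>)
  have sub1: "tree_subst (\<lambda>j. if j < 1 then Leaf j else if j = 1 then A else Leaf (j + length es1 - 1))
      (relabel (\<lambda>k. k + 2) u) = relabel (\<lambda>k. k + length es1 + 1) u" for A u
    by (induction u) simp_all
  have sub0: "tree_subst (\<lambda>j. if j < 0 then Leaf j else if j = 0 then A else Leaf (j + length es0 - 1))
      (relabel (\<lambda>k. k + m + 1) u) = relabel (\<lambda>k. k + m + length es0) u" for A u m
    by (induction u) simp_all
  have eq: "relabel \<rho> (tree_subst (\<lambda>i. [r, s, t] ! i) x) = ?g0 x"
    if x: "x \<in> s_comp (tree_operad E) [c0, c1, c2] c" for x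
  proof -
    have lx: "set (leaves x) = {0, 1, 2}"
      using x by (simp add: lessThan_Suc insert_commute numeral_2_eq_2)
    have "relabel \<rho> ([r, s, t] ! i) =
        tree_subst (\<lambda>j. if j < 0 then Leaf j else if j = 0 then relabel (\<lambda>k. k + 0) ?r else Leaf (j + length es0 - 1))
        (tree_subst (\<lambda>j. if j < 1 then Leaf j else if j = 1 then relabel (\<lambda>k. k + 1) ?s else Leaf (j + length es1 - 1))
        (if i < 2 then Leaf i else if i = 2 then relabel (\<lambda>k. k + 2) ?t else Leaf (i + length es2 - 1)))"
      if i: "i \<in> {0, 1, 2}" for i
    proof -
      consider "i = 0" | "i = 1" | "i = 2" using i by blast
      then show ?thesis
      proof cases
        case 1
        then show ?thesis by (simp add: \<rho>r)
      next
        case 2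
        then show ?thesis using sub0[of _ 0 ?s] by (simp add: \<rho>s o_def)
      next
        case 3
        then show ?thesis using sub0[of _ "length es1" ?t] sub1[of _ ?t]
          by (simp add: \<rho>t o_def del: One_nat_def)
      qed
    qed
    then show ?thesis
      unfolding graft_eq_tree_subst[of _ _ _ x] graft_eq_tree_subst[of 1] graft_eq_tree_subst[of 0]
        tree_subst_tree_subst relabel_tree_subst
      by (intro tree_subst_cong) (simp only: lx)
  qed
  have "lin (\<lambda>x. lin (\<lambda>u. delta (graft 2 (length es2) u x)) (delta ?t)) f \<in> N ([c0, c1] @ es2) c"
    by (rule N_circ[OF _ kf]) (use t' f in \<open>simp_all add: splice_in_def\<close>)
  then have 2: "lin (\<lambda>x. delta (?g2 x)) f \<in> N ([c0, c1] @ es2) c" by simp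
  have "lin (\<lambda>x. lin (\<lambda>u. delta (graft 1 (length es1) u x)) (delta ?s)) (lin (\<lambda>x. delta (?g2 x)) f)
      \<in> N (c0 # es1 @ es2) c"
    by (rule N_circ[OF _ N_rules(5)[OF 2]]) (use s' 2 in \<open>simp_all add: splice_in_def\<close>)
  then have 1: "lin (\<lambda>x. delta (?g1 x)) f \<in> N (c0 # es1 @ es2) c" by (simp add: lin_lin)
  have "lin (\<lambda>x. lin (\<lambda>u. delta (graft 0 (length es0) u x)) (delta ?r)) (lin (\<lambda>x. delta (?g1 x)) f)
      \<in> N (es0 @ es1 @ es2) c"
    by (rule N_circ[OF _ N_rules(5)[OF 1]]) (use r' 1 in \<open>simp_all add: splice_in_def\<close>)
  then have "lin (\<lambda>x. delta (?g0 x)) f \<in> N (es0 @ es1 @ es2) c" by (simp add: lin_lin)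
  also have "lin (\<lambda>x. delta (?g0 x)) f =
      lin (\<lambda>x. delta (relabel \<rho> (tree_subst (\<lambda>i. [r, s, t] ! i) x))) f"
    by (intro lin_cong arg_cong[where f = delta] eq[symmetric]) (use kf in blast)
  finally have N: "lin (\<lambda>y. delta (relabel \<rho> y)) ?f \<in> N (es0 @ es1 @ es2) c" by (simp add: lin_lin)
  have kx: "\<exists>x\<in>s_comp (tree_operad E) [c0, c1, c2] c. y = tree_subst (\<lambda>i. [r, s, t] ! i) x"
    if "y \<in> Poly_Mapping.keys ?f" for y
    using subsetD[OF keys_lin that] kf by auto
  show ?thesis
  proof (rule hat_numbered[OF _ _ N])
    show std: "relabel \<rho> y \<in> s_comp (tree_operad E) (es0 @ es1 @ es2) c" if "y \<in> Poly_Mapping.keys ?f" for y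
      using kx[OF that] g0 eq by metis
    show "Poly_Mapping.keys ?f \<subseteq> LT \<kappa> (S0 \<union> S1 \<union> S2) c"
    proof
      fix y assume y: "y \<in> Poly_Mapping.keys ?f"
      obtain x where x: "x \<in> s_comp (tree_operad E) [c0, c1, c2] c" "y = tree_subst (\<lambda>i. [r, s, t] ! i) x"
        using kx[OF y] by blast
      have lx: "set (leaves x) = {0, 1, 2}"
        using x(1) by (simp add: lessThan_Suc insert_commute numeral_2_eq_2)
      have "distinct (leaves y)"
        using std[OF y] by (simp add: distinct_map)
      moreover have "colored E \<kappa> c y"
        unfolding x(2)
      proof (rule colored_tree_subst[of E "\<lambda>i. [c0, c1, c2] ! i"])
        show "colored E (\<lambda>i. [c0, c1, c2] ! i) c x"
          using x(1) by (simp add: well_colored_iff)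
        show "colored E \<kappa> ([c0, c1, c2] ! i) ([r, s, t] ! i)" if "i \<in> set (leaves x)" for i
          using that r s t unfolding lx by (auto simp: labelled_trees_def)
      qed
      ultimately show "y \<in> LT \<kappa> (S0 \<union> S1 \<union> S2) c"
        by (simp add: labelled_trees_def x(2) set_leaves_tree_subst lx lr ls lt Un_assoc)
    qed
  qed
qed

end

section \<open>Normal forms\<close>

text \<open>The coordinate functionals, that is, the basis dual to \<open>lp_basis\<close>,
  continued by zero as \<open>dual_gens\<close> prescribes.\<close>

definition lp_coord :: "color \<Rightarrow> color \<Rightarrow> color \<Rightarrow> lp_gen \<Rightarrow> (lp_gen \<Rightarrow>\<^sub>0 'k::field) \<Rightarrow> 'k" where
  "lp_coord c1 c2 c b f = (if Poly_Mapping.keys f \<subseteq> lp_basis c1 c2 c then Poly_Mapping.lookup f b else 0)"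

text \<open>\<open>com\<close>, \<open>mul\<close> and \<open>act\<close>, dual to
  \<open>L2\<close>, \<open>N02\<close> and \<open>N11\<close>, play the parts of
  \<open>f_2\<close>, \<open>e_{0,2}\<close> and \<open>e_{1,1}\<close> in the presentation of the
  swiss-cheese operad.\<close>

abbreviation com :: "((lp_gen \<Rightarrow>\<^sub>0 'k::field) \<Rightarrow> 'k) tree \<Rightarrow> ((lp_gen \<Rightarrow>\<^sub>0 'k) \<Rightarrow> 'k) tree \<Rightarrow> ((lp_gen \<Rightarrow>\<^sub>0 'k) \<Rightarrow> 'k) tree" where
  "com \<equiv> Node Closed Closed (lp_coord Closed Closed Closed L2)"

abbreviation mul :: "((lp_gen \<Rightarrow>\<^sub>0 'k::field) \<Rightarrow> 'k) tree \<Rightarrow> ((lp_gen \<Rightarrow>\<^sub>0 'k) \<Rightarrow> 'k) tree \<Rightarrow> ((lp_gen \<Rightarrow>\<^sub>0 'k) \<Rightarrow> 'k) tree" where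
  "mul \<equiv> Node Open Open (lp_coord Open Open Open N02)"

abbreviation act :: "((lp_gen \<Rightarrow>\<^sub>0 'k::field) \<Rightarrow> 'k) tree \<Rightarrow> ((lp_gen \<Rightarrow>\<^sub>0 'k) \<Rightarrow> 'k) tree \<Rightarrow> ((lp_gen \<Rightarrow>\<^sub>0 'k) \<Rightarrow> 'k) tree" where
  "act \<equiv> Node Closed Open (lp_coord Closed Open Open N11)"

lemma lp_coord_carrier [simp]:
  "lp_coord c1 c2 c b \<in> carrier (gens (lp_dual :: ('k::field, _) binary) c1 c2 c)"
  unfolding lp_dual_carrier by (auto simp: lp_coord_def lookup_add keys_subsetI)

lemma word_product_coord [simp]:
  "word_product (lp_coord Closed Closed Closed L2) u v = delta (u @ v)"
  "word_product (lp_coord Open Open Open N02) u v = delta (u @ v)"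
  "word_product (lp_coord Closed Open Open N11) u v = delta (u @ v)"
  by (simp_all add: word_product_def lp_coord_def lookup_single)

text \<open>Spanning trees of arity two. The duals of \<open>N02'\<close> and \<open>N11'\<close>
  are traded for \<open>mul\<close> and \<open>act\<close> with exchanged leaves, so that the rest
  of the argument has to deal with three generators only.\<close>

fun corollas :: "color \<Rightarrow> color \<Rightarrow> color \<Rightarrow> ((lp_gen \<Rightarrow>\<^sub>0 'k::field) \<Rightarrow> 'k) tree set" where
  "corollas Closed Closed Closed = {com (Leaf 0) (Leaf 1)}"
| "corollas Open Open Open = {mul (Leaf 0) (Leaf 1), mul (Leaf 1) (Leaf 0)}"
| "corollas Closed Open Open = {act (Leaf 0) (Leaf 1)}"
| "corollas Open Closed Open = {act (Leaf 1) (Leaf 0)}"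
| "corollas _ _ _ = {}"

lemma poly_mapping_keys_1: "Poly_Mapping.keys g \<subseteq> {b} \<Longrightarrow> g = Poly_Mapping.single b (Poly_Mapping.lookup g b)"
  by (rule poly_mapping_eqI) (auto simp: lookup_single when_def in_keys_iff)

lemma poly_mapping_keys_2:
  assumes "Poly_Mapping.keys g \<subseteq> {b, b'}" "b \<noteq> b'"
  shows "g = Poly_Mapping.single b (Poly_Mapping.lookup g b) + Poly_Mapping.single b' (Poly_Mapping.lookup g b')"
proof (rule poly_mapping_eqI)
  fix x show "Poly_Mapping.lookup g x = Poly_Mapping.lookup (Poly_Mapping.single b (Poly_Mapping.lookup g b) +
      Poly_Mapping.single b' (Poly_Mapping.lookup g b')) x"
    using assms by (cases "x \<in> Poly_Mapping.keys g") (auto simp: lookup_add lookup_single when_def in_keys_iff)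
qed

lemma lp_dual_expansion:
  assumes \<phi>: "\<phi> \<in> carrier (gens (lp_dual :: ('k::field, _) binary) c1 c2 c)"
  shows "lp_basis c1 c2 c = {} \<Longrightarrow> \<phi> = 0 \<odot>\<^bsub>gens lp_dual c1 c2 c\<^esub> \<phi>"
    and "lp_basis c1 c2 c = {b} \<Longrightarrow>
      \<phi> = \<phi> (delta b) \<odot>\<^bsub>gens lp_dual c1 c2 c\<^esub> lp_coord c1 c2 c b"
    and "lp_basis c1 c2 c = {b, b'} \<Longrightarrow> b \<noteq> b' \<Longrightarrow>
      \<phi> = (\<phi> (delta b) \<odot>\<^bsub>gens lp_dual c1 c2 c\<^esub> lp_coord c1 c2 c b) \<oplus>\<^bsub>gens lp_dual c1 c2 c\<^esub>
        (\<phi> (delta b') \<odot>\<^bsub>gens lp_dual c1 c2 c\<^esub> lp_coord c1 c2 c b')"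
proof -
  have out: "\<phi> g = 0" if "\<not> Poly_Mapping.keys g \<subseteq> lp_basis c1 c2 c" for g
    using \<phi> that unfolding lp_dual_carrier by blast
  have add: "\<phi> (f + g) = \<phi> f + \<phi> g"
    if "Poly_Mapping.keys f \<subseteq> lp_basis c1 c2 c" "Poly_Mapping.keys g \<subseteq> lp_basis c1 c2 c" for f g
    using \<phi> that unfolding lp_dual_carrier by blast
  note single = lp_dual_single[OF \<phi>]
  show "\<phi> = 0 \<odot>\<^bsub>gens lp_dual c1 c2 c\<^esub> \<phi>" if e: "lp_basis c1 c2 c = {}"
  proof
    fix g
    have "\<phi> g = 0"
    proof (cases "g = 0")
      case True then show ?thesis using single[of undefined 0] by simp
    next
      case False
      then have "\<not> Poly_Mapping.keys g \<subseteq> {}"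
        using poly_mapping_eqI[of g 0] by (auto simp: in_keys_iff)
      then show ?thesis using out e by simp
    qed
    then show "\<phi> g = (0 \<odot>\<^bsub>gens lp_dual c1 c2 c\<^esub> \<phi>) g" by simp
  qed
  show "\<phi> = \<phi> (delta b) \<odot>\<^bsub>gens lp_dual c1 c2 c\<^esub> lp_coord c1 c2 c b" if e: "lp_basis c1 c2 c = {b}"
  proof
    fix g show "\<phi> g = (\<phi> (delta b) \<odot>\<^bsub>gens lp_dual c1 c2 c\<^esub> lp_coord c1 c2 c b) g"
    proof (cases "Poly_Mapping.keys g \<subseteq> lp_basis c1 c2 c")
      case True
      have "\<phi> g = Poly_Mapping.lookup g b * \<phi> (delta b)"
        using arg_cong[OF poly_mapping_keys_1[OF True[unfolded e]], of \<phi>] single[of b "Poly_Mapping.lookup g b"] by (rule trans)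
      then show ?thesis using True by (simp add: lp_coord_def)
    qed (simp add: out lp_coord_def)
  qed
  show "\<phi> = (\<phi> (delta b) \<odot>\<^bsub>gens lp_dual c1 c2 c\<^esub> lp_coord c1 c2 c b) \<oplus>\<^bsub>gens lp_dual c1 c2 c\<^esub>
        (\<phi> (delta b') \<odot>\<^bsub>gens lp_dual c1 c2 c\<^esub> lp_coord c1 c2 c b')"
    if e: "lp_basis c1 c2 c = {b, b'}" and ne: "b \<noteq> b'"
  proof
    fix g show "\<phi> g = ((\<phi> (delta b) \<odot>\<^bsub>gens lp_dual c1 c2 c\<^esub> lp_coord c1 c2 c b) \<oplus>\<^bsub>gens lp_dual c1 c2 c\<^esub>
        (\<phi> (delta b') \<odot>\<^bsub>gens lp_dual c1 c2 c\<^esub> lp_coord c1 c2 c b')) g"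
    proof (cases "Poly_Mapping.keys g \<subseteq> lp_basis c1 c2 c")
      case True
      have "\<phi> g = \<phi> (Poly_Mapping.single b (Poly_Mapping.lookup g b) + Poly_Mapping.single b' (Poly_Mapping.lookup g b'))"
        using arg_cong[OF poly_mapping_keys_2[OF True[unfolded e] ne], of \<phi>] .
      also have "\<dots> = Poly_Mapping.lookup g b * \<phi> (delta b) + Poly_Mapping.lookup g b' * \<phi> (delta b')"
        using e by (subst add) (auto simp: single[of _ "Poly_Mapping.lookup g _"])
      finally show ?thesis using True by (simp add: lp_coord_def)
    qed (simp add: out lp_coord_def)
  qed
qed

text \<open>For \<open>L2\<close> the signs of \<open>lp_transpose\<close> and of
  \<open>dual_gens\<close> cancel, which makes \<open>com\<close> commutative; the other
  transpositions keep the sign of \<open>dual_gens\<close>.\<close>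

lemma lp_coord_swap:
  "swap (lp_dual :: ('k::field, _) binary) Closed Closed Closed (lp_coord Closed Closed Closed L2) =
    lp_coord Closed Closed Closed L2"
  "swap (lp_dual :: ('k::field, _) binary) Open Open Open (lp_coord Open Open Open N02) =
    (- 1) \<odot>\<^bsub>gens lp_dual Open Open Open\<^esub> lp_coord Open Open Open N02'"
  "swap (lp_dual :: ('k::field, _) binary) Closed Open Open (lp_coord Closed Open Open N11) =
    (- 1) \<odot>\<^bsub>gens lp_dual Open Closed Open\<^esub> lp_coord Open Closed Open N11'"
proof -
  show "swap (lp_dual :: ('k, _) binary) Closed Closed Closed (lp_coord Closed Closed Closed L2) =
    lp_coord Closed Closed Closed L2"
  proof
    fix g :: "lp_gen \<Rightarrow>\<^sub>0 'k"
    show "swap lp_dual Closed Closed Closed (lp_coord Closed Closed Closed L2) g = lp_coord Closed Closed Closed L2 g"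
    proof (cases "Poly_Mapping.keys g \<subseteq> {L2}")
      case True
      obtain k where "g = Poly_Mapping.single L2 k" by (rule that[OF poly_mapping_keys_1[OF True]])
      then show ?thesis by (simp add: dual_gens_def lp_coord_def)
    qed (simp add: dual_gens_def lp_coord_def)
  qed
  show "swap (lp_dual :: ('k, _) binary) Open Open Open (lp_coord Open Open Open N02) =
    (- 1) \<odot>\<^bsub>gens lp_dual Open Open Open\<^esub> lp_coord Open Open Open N02'"
  proof
    fix g :: "lp_gen \<Rightarrow>\<^sub>0 'k"
    show "swap lp_dual Open Open Open (lp_coord Open Open Open N02) g =
        ((- 1) \<odot>\<^bsub>gens lp_dual Open Open Open\<^esub> lp_coord Open Open Open N02') g"
    proof (cases "Poly_Mapping.keys g \<subseteq> {N02, N02'}")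
      case True
      obtain k l where g: "g = Poly_Mapping.single N02 k + Poly_Mapping.single N02' l"
        by (rule that[OF poly_mapping_keys_2[OF True]]) simp
      have "Poly_Mapping.keys (Poly_Mapping.single N02' k + Poly_Mapping.single N02 l) \<subseteq> {N02, N02'}"
        by (intro keys_subsetI) simp_all
      then show ?thesis using True
        by (simp add: dual_gens_def lp_coord_def g lookup_add lookup_single)
    qed (simp add: dual_gens_def lp_coord_def)
  qed
  show "swap (lp_dual :: ('k, _) binary) Closed Open Open (lp_coord Closed Open Open N11) =
    (- 1) \<odot>\<^bsub>gens lp_dual Open Closed Open\<^esub> lp_coord Open Closed Open N11'"
  proof
    fix g :: "lp_gen \<Rightarrow>\<^sub>0 'k"
    show "swap lp_dual Closed Open Open (lp_coord Closed Open Open N11) g =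
        ((- 1) \<odot>\<^bsub>gens lp_dual Open Closed Open\<^esub> lp_coord Open Closed Open N11') g"
    proof (cases "Poly_Mapping.keys g \<subseteq> {N11'}")
      case True
      obtain k where "g = Poly_Mapping.single N11' k" by (rule that[OF poly_mapping_keys_1[OF True]])
      then show ?thesis by (simp add: dual_gens_def lp_coord_def)
    qed (simp add: dual_gens_def lp_coord_def)
  qed
qed

text \<open>An ideal bounded below by the free relations and the arity three part of the kernel, and
  above by the kernel; \<open>kernel_in_ideal\<close> concludes that it is the whole kernel. The
  locale is used for \<open>word_kernel\<close> itself, to have the normal forms available, and for
  the intersection of \<open>word_kernel\<close> with the preimage of an arbitrary ideal above
  \<open>orthogonal LP\<close>.\<close>

locale quadratic_ideal = tree_ideal "lp_dual :: ('k::field, (lp_gen \<Rightarrow>\<^sub>0 'k) \<Rightarrow> 'k) binary" N for N +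
  assumes rels: "f \<in> free_rels lp_dual cs c \<Longrightarrow> f \<in> N cs c"
    and quad: "\<lbrakk>length cs = 3; Poly_Mapping.keys f \<subseteq> s_comp (tree_operad lp_dual) cs c;
      lin (word_eval cs) f = 0\<rbrakk> \<Longrightarrow> f \<in> N cs c"
    and kernel: "f \<in> N cs c \<Longrightarrow> lin (word_eval cs) f = 0"
begin

lemma rel_add:
  assumes "\<phi> \<in> carrier (gens lp_dual c1 c2 c)" "\<psi> \<in> carrier (gens lp_dual c1 c2 c)"
  shows "delta (Node c1 c2 (\<phi> \<oplus>\<^bsub>gens lp_dual c1 c2 c\<^esub> \<psi>) (Leaf 0) (Leaf 1)) -
    delta (Node c1 c2 \<phi> (Leaf 0) (Leaf 1)) - delta (Node c1 c2 \<psi> (Leaf 0) (Leaf 1)) \<in> N [c1, c2] c"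
  by (rule rels) (use assms in \<open>unfold free_rels_def, blast\<close>)

lemma rel_smul:
  assumes "\<phi> \<in> carrier (gens lp_dual c1 c2 c)"
  shows "delta (Node c1 c2 (k \<odot>\<^bsub>gens lp_dual c1 c2 c\<^esub> \<phi>) (Leaf 0) (Leaf 1)) -
    Poly_Mapping.single (Node c1 c2 \<phi> (Leaf 0) (Leaf 1)) k \<in> N [c1, c2] c"
  by (rule rels) (use assms in \<open>unfold free_rels_def, blast\<close>)

lemma rel_swap:
  assumes "\<phi> \<in> carrier (gens lp_dual c1 c2 c)"
  shows "delta (Node c1 c2 \<phi> (Leaf 1) (Leaf 0)) -
    delta (Node c2 c1 (swap lp_dual c1 c2 c \<phi>) (Leaf 0) (Leaf 1)) \<in> N [c2, c1] c"
  by (rule rels) (use assms in \<open>unfold free_rels_def, blast\<close>)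

lemma corolla_expansion:
  assumes \<phi>: "\<phi> \<in> carrier (gens lp_dual c1 c2 c)"
  shows "\<exists>f. Poly_Mapping.keys f \<subseteq> corollas c1 c2 c \<and>
    delta (Node c1 c2 \<phi> (Leaf 0) (Leaf 1)) - f \<in> N [c1, c2] c"
proof -
  note ex = lp_dual_expansion[OF \<phi>]
  have swap': "Poly_Mapping.single (Node c1 c2 ((- 1) \<odot>\<^bsub>gens lp_dual c1 c2 c\<^esub> lp_coord c1 c2 c b') (Leaf 0) (Leaf 1)) k -
      Poly_Mapping.single (Node c2 c1 (lp_coord c2 c1 c b) (Leaf 1) (Leaf 0)) k \<in> N [c1, c2] c"
    if "swap (lp_dual :: ('k, _) binary) c2 c1 c (lp_coord c2 c1 c b) = (- 1) \<odot>\<^bsub>gens lp_dual c1 c2 c\<^esub> lp_coord c1 c2 c b'"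
    for b b' k
    using N_rules(3)[OF rel_swap[OF lp_coord_carrier, of c2 c1 c b], of "- k"] unfolding that
    by (simp add: single_uminus algebra_simps)
  have neg: "Poly_Mapping.single (Node c1 c2 ((- 1) \<odot>\<^bsub>gens lp_dual c1 c2 c\<^esub> lp_coord c1 c2 c b) (Leaf 0) (Leaf 1)) k +
      Poly_Mapping.single (Node c1 c2 (lp_coord c1 c2 c b) (Leaf 0) (Leaf 1)) k \<in> N [c1, c2] c" for b k
    using N_rules(3)[OF rel_smul[OF lp_coord_carrier, of c1 c2 c "- 1" b], of k] by (simp add: single_uminus)
  have swapped: "Poly_Mapping.single (Node c1 c2 (lp_coord c1 c2 c b') (Leaf 0) (Leaf 1)) k +
      Poly_Mapping.single (Node c2 c1 (lp_coord c2 c1 c b) (Leaf 1) (Leaf 0)) k \<in> N [c1, c2] c"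
    if "swap (lp_dual :: ('k, _) binary) c2 c1 c (lp_coord c2 c1 c b) = (- 1) \<odot>\<^bsub>gens lp_dual c1 c2 c\<^esub> lp_coord c1 c2 c b'"
    for b b' k
    using N_rules(4)[OF neg[of b' k] swap'[OF that, of k]] by simp
  show ?thesis
  proof (cases "lp_basis c1 c2 c = {}")
    \<comment> \<open>Here \<open>\<phi>\<close> is the zero functional; writing it as
      \<open>0\<close> times itself lets the scalar relation kill the corolla.\<close>
    case True
    then show ?thesis
      using rel_smul[OF \<phi>, of 0] ex(1) by (intro exI[of _ 0]) simp
  next
    case False
    then consider "c1 = Closed" "c2 = Closed" "c = Closed" | "c1 = Closed" "c2 = Open" "c = Open"
      | "c1 = Open" "c2 = Closed" "c = Open" | "c1 = Open" "c2 = Open" "c = Open"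
      by (cases c1; cases c2; cases c) auto
    then show ?thesis
    proof cases
      case 1
      let ?k = "\<phi> (delta L2)"
      show ?thesis
        using rel_smul[OF lp_coord_carrier, of c1 c2 c ?k L2] ex(2)[of L2] 1
        by (intro exI[of _ "Poly_Mapping.single (com (Leaf 0) (Leaf 1)) ?k"]) simp
    next
      case 2
      let ?k = "\<phi> (delta N11)"
      show ?thesis
        using rel_smul[OF lp_coord_carrier, of c1 c2 c ?k N11] ex(2)[of N11] 2
        by (intro exI[of _ "Poly_Mapping.single (act (Leaf 0) (Leaf 1)) ?k"]) simp
    next
      case 3
      let ?k = "\<phi> (delta N11')"
      have "delta (Node c1 c2 \<phi> (Leaf 0) (Leaf 1)) + Poly_Mapping.single (act (Leaf 1) (Leaf 0)) ?k \<in> N [c1, c2] c"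
        using N_rules(2)[OF rel_smul[OF lp_coord_carrier, of c1 c2 c ?k N11'] swapped[of N11 N11' ?k]]
          ex(2)[of N11'] 3 by (simp add: lp_coord_swap)
      then show ?thesis
        using 3 by (intro exI[of _ "Poly_Mapping.single (act (Leaf 1) (Leaf 0)) (- ?k)"]) (simp add: single_uminus)
    next
      case 4
      let ?k = "\<phi> (delta N02)" and ?l = "\<phi> (delta N02')"
      let ?K = "?k \<odot>\<^bsub>gens lp_dual c1 c2 c\<^esub> lp_coord c1 c2 c N02"
      let ?L = "?l \<odot>\<^bsub>gens lp_dual c1 c2 c\<^esub> lp_coord c1 c2 c N02'"
      have sm: "m \<odot>\<^bsub>gens lp_dual c1 c2 c\<^esub> lp_coord c1 c2 c b \<in> carrier (gens lp_dual c1 c2 c)" for m b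
        unfolding lp_dual_carrier by (auto simp: lp_coord_def lookup_add keys_subsetI algebra_simps)
      have "\<phi> = ?K \<oplus>\<^bsub>gens lp_dual c1 c2 c\<^esub> ?L"
        by (rule ex(3)) (simp_all add: 4)
      then have "delta (Node c1 c2 \<phi> (Leaf 0) (Leaf 1)) - delta (Node c1 c2 ?K (Leaf 0) (Leaf 1)) -
          delta (Node c1 c2 ?L (Leaf 0) (Leaf 1)) \<in> N [c1, c2] c"
        using rel_add[OF sm[of ?k N02] sm[of ?l N02']] by simp
      note N_rules(2)[OF this N_rules(2)[OF rel_smul[OF lp_coord_carrier, of c1 c2 c ?k N02]
          N_rules(2)[OF rel_smul[OF lp_coord_carrier, of c1 c2 c ?l N02'] swapped[of N02 N02' ?l]]]]
      then have "delta (Node c1 c2 \<phi> (Leaf 0) (Leaf 1)) - (Poly_Mapping.single (mul (Leaf 0) (Leaf 1)) ?k -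
          Poly_Mapping.single (mul (Leaf 1) (Leaf 0)) ?l) \<in> N [c1, c2] c"
        using 4 by (simp add: lp_coord_swap algebra_simps)
      then show ?thesis
        using 4 by (intro exI[of _ "Poly_Mapping.single (mul (Leaf 0) (Leaf 1)) ?k -
          Poly_Mapping.single (mul (Leaf 1) (Leaf 0)) ?l"] conjI)
          (simp_all add: keys_subsetI)
    qed
  qed
qed

end

section \<open>Rewriting single trees modulo the ideal\<close>

context quadratic_ideal
begin

definition proper :: "(nat \<Rightarrow> color) \<Rightarrow> color \<Rightarrow> ((lp_gen \<Rightarrow>\<^sub>0 'k) \<Rightarrow> 'k) tree \<Rightarrow> bool" where
  "proper \<kappa> c t \<longleftrightarrow> colored lp_dual \<kappa> c t \<and> distinct (leaves t)"

lemma proper_simps [simp]: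
  "proper \<kappa> c (Leaf i) \<longleftrightarrow> \<kappa> i = c"
  "proper \<kappa> c (Node c1 c2 \<phi> s t) \<longleftrightarrow> \<phi> \<in> carrier (gens lp_dual c1 c2 c) \<and> proper \<kappa> c1 s \<and>
    proper \<kappa> c2 t \<and> set (leaves s) \<inter> set (leaves t) = {}"
  by (auto simp: proper_def)

lemma labelled_trees_iff: "t \<in> LT \<kappa> S c \<longleftrightarrow> proper \<kappa> c t \<and> set (leaves t) = S"
  by (auto simp: labelled_trees_def proper_def)

text \<open>Congruence of single trees. The laws among \<open>com\<close>, \<open>mul\<close> and
  \<open>act\<close> have coefficient 1, so the reduction of products of normal forms is a rewriting
  of trees and involves no combinations.\<close>

definition equiv_tree where
  "equiv_tree \<kappa> c s t \<longleftrightarrow> proper \<kappa> c s \<and> proper \<kappa> c t \<and> set (leaves t) = set (leaves s) \<and>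
    hat \<kappa> (set (leaves s)) c (delta s - delta t)"

lemma equiv_refl: "proper \<kappa> c t \<Longrightarrow> equiv_tree \<kappa> c t t"
  by (simp add: equiv_tree_def hat_zero)

lemma equiv_sym: "equiv_tree \<kappa> c s t \<Longrightarrow> equiv_tree \<kappa> c t s"
  using hat_smul[of \<kappa> "set (leaves s)" c "delta s - delta t" "- 1"]
  by (simp add: equiv_tree_def single_uminus)

lemma equiv_proper: "equiv_tree \<kappa> c s t \<Longrightarrow> proper \<kappa> c t"
  by (simp add: equiv_tree_def)

lemma equiv_trans [trans]: "equiv_tree \<kappa> c s t \<Longrightarrow> equiv_tree \<kappa> c t u \<Longrightarrow> equiv_tree \<kappa> c s u"
  using hat_add[of \<kappa> "set (leaves s)" c "delta s - delta t" "delta t - delta u"]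
  by (simp add: equiv_tree_def)

lemma hat_node:
  assumes \<phi>: "\<phi> \<in> carrier (gens lp_dual c1 c2 c)" and disj: "S1 \<inter> S2 = {}" "finite S1" "finite S2"
    and F: "Poly_Mapping.keys F \<subseteq> LT \<kappa> S1 c1" and G: "Poly_Mapping.keys G \<subseteq> LT \<kappa> S2 c2"
    and N: "hat \<kappa> S1 c1 F \<or> hat \<kappa> S2 c2 G"
  shows "hat \<kappa> (S1 \<union> S2) c (lin (\<lambda>s. lin (\<lambda>t. delta (Node c1 c2 \<phi> s t)) G) F)"
  using hat_subst2[of "delta (Node c1 c2 \<phi> (Leaf 0) (Leaf 1))" c1 c2 c, OF _ F G disj] \<phi> N
  by (simp add: lessThan_Suc insert_commute)

lemma equiv_node:
  assumes \<phi>: "\<phi> \<in> carrier (gens lp_dual c1 c2 c)" and s: "equiv_tree \<kappa> c1 s s'" and t: "equiv_tree \<kappa> c2 t t'"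
    and disj: "set (leaves s) \<inter> set (leaves t) = {}"
  shows "equiv_tree \<kappa> c (Node c1 c2 \<phi> s t) (Node c1 c2 \<phi> s' t')"
proof -
  let ?S1 = "set (leaves s)" and ?S2 = "set (leaves t)"
  have p: "proper \<kappa> c1 s" "proper \<kappa> c1 s'" "set (leaves s') = ?S1"
    "proper \<kappa> c2 t" "proper \<kappa> c2 t'" "set (leaves t') = ?S2"
    using s t by (simp_all add: equiv_tree_def)
  have "hat \<kappa> (?S1 \<union> ?S2) c (lin (\<lambda>s. lin (\<lambda>t. delta (Node c1 c2 \<phi> s t)) (delta t)) (delta s - delta s'))"
    by (rule hat_node[OF \<phi> disj])
      (use s p in \<open>simp_all add: equiv_tree_def labelled_trees_iff keys_subsetI\<close>)
  moreover have "hat \<kappa> (?S1 \<union> ?S2) c (lin (\<lambda>s. lin (\<lambda>t. delta (Node c1 c2 \<phi> s t)) (delta t - delta t')) (delta s'))"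
    by (rule hat_node[OF \<phi> disj])
      (use t p in \<open>simp_all add: equiv_tree_def labelled_trees_iff keys_subsetI\<close>)
  ultimately have "hat \<kappa> (?S1 \<union> ?S2) c (delta (Node c1 c2 \<phi> s t) - delta (Node c1 c2 \<phi> s' t'))"
    using hat_add by fastforce
  then show ?thesis
    using p \<phi> disj by (simp add: equiv_tree_def)
qed

lemma equiv_node_right:
  assumes "proper \<kappa> c (Node c1 c2 \<phi> s t)" "equiv_tree \<kappa> c2 t t'"
  shows "equiv_tree \<kappa> c (Node c1 c2 \<phi> s t) (Node c1 c2 \<phi> s t')"
  using assms by (intro equiv_node equiv_refl) simp_all

text \<open>The difference of two arity three trees with the same word lies in the kernel, hence in
  the ideal by \<open>quad\<close>. Each law in three arguments below is thus obtained by comparing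
  two words.\<close>

lemma equiv_subst3:
  assumes "x \<in> s_comp (tree_operad lp_dual) [c0, c1, c2] c" "y \<in> s_comp (tree_operad lp_dual) [c0, c1, c2] c"
    and "word_eval [c0, c1, c2] x = word_eval [c0, c1, c2] y"
    and "proper \<kappa> c0 r" "proper \<kappa> c1 s" "proper \<kappa> c2 t"
    and "set (leaves r) \<inter> set (leaves s) = {}" "set (leaves r) \<inter> set (leaves t) = {}"
      "set (leaves s) \<inter> set (leaves t) = {}"
    and px: "proper \<kappa> c (tree_subst (\<lambda>i. [r, s, t] ! i) x)"
    and py: "proper \<kappa> c (tree_subst (\<lambda>i. [r, s, t] ! i) y)"
  shows "equiv_tree \<kappa> c (tree_subst (\<lambda>i. [r, s, t] ! i) x) (tree_subst (\<lambda>i. [r, s, t] ! i) y)"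
proof -
  have "delta x - delta y \<in> N [c0, c1, c2] c"
    by (rule quad) (use assms in \<open>simp_all add: keys_subsetI\<close>)
  then have "hat \<kappa> (set (leaves r) \<union> set (leaves s) \<union> set (leaves t)) c
      (delta (tree_subst (\<lambda>i. [r, s, t] ! i) x) - delta (tree_subst (\<lambda>i. [r, s, t] ! i) y))"
    using hat_subst3[of "delta x - delta y" c0 c1 c2 c r \<kappa> "set (leaves r)" s "set (leaves s)" t "set (leaves t)"] assms
    by (simp add: labelled_trees_iff)
  moreover have "set (leaves (tree_subst (\<lambda>i. [r, s, t] ! i) z)) = set (leaves r) \<union> set (leaves s) \<union> set (leaves t)"
    if "z \<in> s_comp (tree_operad lp_dual) [c0, c1, c2] c" for z
  proof -
    have "set (leaves z) = {0, 1, 2}"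
      using that by (simp add: lessThan_Suc insert_commute numeral_2_eq_2)
    then show ?thesis by (simp add: set_leaves_tree_subst Un_assoc)
  qed
  ultimately show ?thesis
    using assms by (simp add: equiv_tree_def del: tree_operad_simps)
qed

text \<open>This law and the five after it are the relations of the swiss-cheese presentation,
  written so that the right-hand side is a right comb with closed arguments outermost.\<close>

lemma com_assoc:
  "proper \<kappa> Closed (com (com r s) t) \<Longrightarrow> equiv_tree \<kappa> Closed (com (com r s) t) (com r (com s t))"
  using equiv_subst3[of "com (com (Leaf 0) (Leaf 1)) (Leaf 2)" Closed Closed Closed Closed
      "com (Leaf 0) (com (Leaf 1) (Leaf 2))" \<kappa> r s t]
  by (simp add: word_input_def lessThan_Suc insert_commute Int_Un_distrib Int_Un_distrib2 numeral_2_eq_2)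

lemma mul_assoc:
  "proper \<kappa> Open (mul (mul r s) t) \<Longrightarrow> equiv_tree \<kappa> Open (mul (mul r s) t) (mul r (mul s t))"
  using equiv_subst3[of "mul (mul (Leaf 0) (Leaf 1)) (Leaf 2)" Open Open Open Open
      "mul (Leaf 0) (mul (Leaf 1) (Leaf 2))" \<kappa> r s t]
  by (simp add: word_input_def lessThan_Suc insert_commute Int_Un_distrib Int_Un_distrib2 numeral_2_eq_2)

lemma act_com:
  "proper \<kappa> Open (act (com r s) t) \<Longrightarrow> equiv_tree \<kappa> Open (act (com r s) t) (act r (act s t))"
  using equiv_subst3[of "act (com (Leaf 0) (Leaf 1)) (Leaf 2)" Closed Closed Open Open
      "act (Leaf 0) (act (Leaf 1) (Leaf 2))" \<kappa> r s t]
  by (simp add: word_input_def lessThan_Suc insert_commute Int_Un_distrib Int_Un_distrib2 numeral_2_eq_2)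

lemma act_commute:
  "proper \<kappa> Open (act r (act s t)) \<Longrightarrow> equiv_tree \<kappa> Open (act r (act s t)) (act s (act r t))"
  using equiv_subst3[of "act (Leaf 0) (act (Leaf 1) (Leaf 2))" Closed Closed Open Open
      "act (Leaf 1) (act (Leaf 0) (Leaf 2))" \<kappa> r s t]
  by (simp add: word_input_def lessThan_Suc insert_commute Int_Un_distrib Int_Un_distrib2 numeral_2_eq_2 Int_commute)

lemma mul_act_left:
  "proper \<kappa> Open (mul (act r s) t) \<Longrightarrow> equiv_tree \<kappa> Open (mul (act r s) t) (act r (mul s t))"
  using equiv_subst3[of "mul (act (Leaf 0) (Leaf 1)) (Leaf 2)" Closed Open Open Open
      "act (Leaf 0) (mul (Leaf 1) (Leaf 2))" \<kappa> r s t]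
  by (simp add: word_input_def lessThan_Suc insert_commute Int_Un_distrib Int_Un_distrib2 numeral_2_eq_2)

lemma mul_act_right:
  "proper \<kappa> Open (mul s (act r t)) \<Longrightarrow> equiv_tree \<kappa> Open (mul s (act r t)) (act r (mul s t))"
  using equiv_subst3[of "mul (Leaf 1) (act (Leaf 0) (Leaf 2))" Closed Open Open Open
      "act (Leaf 0) (mul (Leaf 1) (Leaf 2))" \<kappa> r s t]
  by (simp add: word_input_def lessThan_Suc insert_commute Int_Un_distrib Int_Un_distrib2 numeral_2_eq_2 Int_commute)

text \<open>A law in two arguments, hence not covered by \<open>quad\<close>; it comes from the free
  relations, as the dual of \<open>L2\<close> is fixed by the transposition.\<close>

lemma com_commute:
  assumes "proper \<kappa> Closed (com s t)"
  shows "equiv_tree \<kappa> Closed (com s t) (com t s)"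
proof -
  let ?x = "com (Leaf 1) (Leaf 0)" and ?y = "com (Leaf 0) (Leaf 1)"
  have "hat \<kappa> (set (leaves t) \<union> set (leaves s)) Closed
      (lin (\<lambda>x. lin (\<lambda>u. lin (\<lambda>v. delta (tree_subst (\<lambda>i. [u, v] ! i) x)) (delta s)) (delta t)) (delta ?x - delta ?y))"
    using hat_subst2[of "delta ?x - delta ?y" Closed Closed Closed "delta t" \<kappa> "set (leaves t)" "delta s" "set (leaves s)"]
      assms rel_swap[OF lp_coord_carrier, of Closed Closed Closed L2]
    by (simp add: labelled_trees_iff lp_coord_swap keys_subsetI lessThan_Suc insert_commute Int_commute)
  then show ?thesis
    using assms by (simp add: equiv_tree_def Int_commute Un_commute)
qed

lemma leaves_foldr [simp]: "leaves (foldr (\<lambda>x. Node c1 c2 \<phi> (Leaf x)) xs t) = xs @ leaves t"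
  by (induction xs) simp_all

lemma equiv_foldr:
  assumes "equiv_tree \<kappa> c s t" "proper \<kappa> c (foldr (\<lambda>x. Node c1 c \<phi> (Leaf x)) xs s)"
  shows "equiv_tree \<kappa> c (foldr (\<lambda>x. Node c1 c \<phi> (Leaf x)) xs s) (foldr (\<lambda>x. Node c1 c \<phi> (Leaf x)) xs t)"
  using assms(2)
proof (induction xs)
  case (Cons x xs)
  then have "equiv_tree \<kappa> c (foldr (\<lambda>x. Node c1 c \<phi> (Leaf x)) xs s) (foldr (\<lambda>x. Node c1 c \<phi> (Leaf x)) xs t)"
    by simp
  then show ?case using equiv_node_right Cons.prems by simp
qed (simp add: assms)

text \<open>Moves the leaves of a right comb in the first argument out one at a time; instances of
  \<open>law\<close> are \<open>com_assoc\<close>, \<open>act_com\<close>, \<open>mul_assoc\<close>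
  and \<open>mul_act_left\<close>.\<close>

lemma equiv_push:
  assumes law: "\<And>x s. proper \<kappa> c (Node a1 a2 \<phi> (Node b1 b2 \<psi> (Leaf x) s) t) \<Longrightarrow>
      equiv_tree \<kappa> c (Node a1 a2 \<phi> (Node b1 b2 \<psi> (Leaf x) s) t) (Node d1 c \<theta> (Leaf x) (Node a1 a2 \<phi> s t))"
    and "proper \<kappa> c (Node a1 a2 \<phi> (foldr (\<lambda>x. Node b1 b2 \<psi> (Leaf x)) xs s) t)"
  shows "equiv_tree \<kappa> c (Node a1 a2 \<phi> (foldr (\<lambda>x. Node b1 b2 \<psi> (Leaf x)) xs s) t)
    (foldr (\<lambda>x. Node d1 c \<theta> (Leaf x)) xs (Node a1 a2 \<phi> s t))"
  using assms(2)
proof (induction xs)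
  case Nil
  then show ?case by (simp add: equiv_refl)
next
  case (Cons x xs)
  let ?s = "foldr (\<lambda>x. Node b1 b2 \<psi> (Leaf x)) xs s"
  have 1: "equiv_tree \<kappa> c (Node a1 a2 \<phi> (Node b1 b2 \<psi> (Leaf x) ?s) t) (Node d1 c \<theta> (Leaf x) (Node a1 a2 \<phi> ?s t))"
    using Cons.prems by (intro law) simp
  then have p: "proper \<kappa> c (Node d1 c \<theta> (Leaf x) (Node a1 a2 \<phi> ?s t))"
    by (rule equiv_proper)
  then have "equiv_tree \<kappa> c (Node a1 a2 \<phi> ?s t) (foldr (\<lambda>x. Node d1 c \<theta> (Leaf x)) xs (Node a1 a2 \<phi> s t))"
    by (intro Cons.IH) simp
  then have "equiv_tree \<kappa> c (Node d1 c \<theta> (Leaf x) (Node a1 a2 \<phi> ?s t))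
      (Node d1 c \<theta> (Leaf x) (foldr (\<lambda>x. Node d1 c \<theta> (Leaf x)) xs (Node a1 a2 \<phi> s t)))"
    by (rule equiv_node_right[OF p])
  from equiv_trans[OF 1 this] show ?case by simp
qed

text \<open>Left-commutativity suffices to bring any leaf of the spine to the top, whatever tree
  \<open>t\<close> ends the comb.\<close>

lemma equiv_front:
  assumes comm: "\<And>x y t. proper \<kappa> c (Node d1 c \<theta> (Leaf x) (Node d1 c \<theta> (Leaf y) t)) \<Longrightarrow>
      equiv_tree \<kappa> c (Node d1 c \<theta> (Leaf x) (Node d1 c \<theta> (Leaf y) t)) (Node d1 c \<theta> (Leaf y) (Node d1 c \<theta> (Leaf x) t))"
    and "proper \<kappa> c (foldr (\<lambda>x. Node d1 c \<theta> (Leaf x)) xs t)" "x \<in> set xs"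
  shows "equiv_tree \<kappa> c (foldr (\<lambda>x. Node d1 c \<theta> (Leaf x)) xs t)
    (foldr (\<lambda>x. Node d1 c \<theta> (Leaf x)) (x # remove1 x xs) t)"
  using assms(2,3)
proof (induction xs)
  case (Cons y xs)
  show ?case
  proof (cases "x = y")
    case True
    then show ?thesis using equiv_refl[OF Cons.prems(1)] by simp
  next
    case False
    let ?K = "\<lambda>xs. foldr (\<lambda>x. Node d1 c \<theta> (Leaf x)) xs t"
    have "equiv_tree \<kappa> c (?K xs) (?K (x # remove1 x xs))"
      using Cons False by auto
    then have "equiv_tree \<kappa> c (?K (y # xs)) (?K (y # x # remove1 x xs))"
      using Cons.prems(1) equiv_node_right by simp
    moreover have "equiv_tree \<kappa> c (?K (y # x # remove1 x xs)) (?K (x # y # remove1 x xs))"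
      using equiv_proper[OF calculation] comm by simp
    ultimately have "equiv_tree \<kappa> c (?K (y # xs)) (?K (x # y # remove1 x xs))"
      by (rule equiv_trans)
    then show ?thesis using False by simp
  qed
qed simp

lemma equiv_permute:
  assumes comm: "\<And>x y t. proper \<kappa> c (Node d1 c \<theta> (Leaf x) (Node d1 c \<theta> (Leaf y) t)) \<Longrightarrow>
      equiv_tree \<kappa> c (Node d1 c \<theta> (Leaf x) (Node d1 c \<theta> (Leaf y) t)) (Node d1 c \<theta> (Leaf y) (Node d1 c \<theta> (Leaf x) t))"
    and "proper \<kappa> c (foldr (\<lambda>x. Node d1 c \<theta> (Leaf x)) xs t)" "mset xs = mset ys"
  shows "equiv_tree \<kappa> c (foldr (\<lambda>x. Node d1 c \<theta> (Leaf x)) xs t) (foldr (\<lambda>x. Node d1 c \<theta> (Leaf x)) ys t)"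
  using assms(2,3)
proof (induction ys arbitrary: xs)
  case Nil
  then show ?case by (simp add: equiv_refl)
next
  case (Cons y ys)
  have y: "y \<in> set xs" using Cons.prems(2) by (metis list.set_intros(1) set_mset_mset)
  note 1 = equiv_front[OF comm Cons.prems(1) y]
  then have p: "proper \<kappa> c (foldr (\<lambda>x. Node d1 c \<theta> (Leaf x)) (y # remove1 y xs) t)"
    by (rule equiv_proper)
  have "mset (remove1 y xs) = mset ys" using Cons.prems(2) by simp
  then have "equiv_tree \<kappa> c (foldr (\<lambda>x. Node d1 c \<theta> (Leaf x)) (remove1 y xs) t) (foldr (\<lambda>x. Node d1 c \<theta> (Leaf x)) ys t)"
    using p by (intro Cons.IH) auto
  then have "equiv_tree \<kappa> c (foldr (\<lambda>x. Node d1 c \<theta> (Leaf x)) (y # remove1 y xs) t)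
      (foldr (\<lambda>x. Node d1 c \<theta> (Leaf x)) (y # ys) t)"
    using equiv_node_right p by simp
  with 1 show ?case by (rule equiv_trans)
qed

end

lemma mset_sorted_list_Un:
  assumes "finite A" "finite B" "A \<inter> B = {}"
  shows "mset (sorted_list_of_set A) + mset (sorted_list_of_set B) = mset (sorted_list_of_set (A \<union> B))"
proof -
  have "mset (sorted_list_of_set S) = mset_set S" if "finite S" for S :: "'a set"
    using mset_set_set[of "sorted_list_of_set S"] that by simp
  then show ?thesis using assms by (simp add: mset_set_Union)
qed

section \<open>Right combs indexed by words\<close>

context quadratic_ideal
begin

abbreviation coms :: "nat list \<Rightarrow> ((lp_gen \<Rightarrow>\<^sub>0 'k) \<Rightarrow> 'k) tree \<Rightarrow> ((lp_gen \<Rightarrow>\<^sub>0 'k) \<Rightarrow> 'k) tree" where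
  "coms \<equiv> foldr (\<lambda>x. com (Leaf x))"

abbreviation muls :: "nat list \<Rightarrow> ((lp_gen \<Rightarrow>\<^sub>0 'k) \<Rightarrow> 'k) tree \<Rightarrow> ((lp_gen \<Rightarrow>\<^sub>0 'k) \<Rightarrow> 'k) tree" where
  "muls \<equiv> foldr (\<lambda>x. mul (Leaf x))"

abbreviation acts :: "nat list \<Rightarrow> ((lp_gen \<Rightarrow>\<^sub>0 'k) \<Rightarrow> 'k) tree \<Rightarrow> ((lp_gen \<Rightarrow>\<^sub>0 'k) \<Rightarrow> 'k) tree" where
  "acts \<equiv> foldr (\<lambda>x. act (Leaf x))"

text \<open>At most one comb for each word: closed leaves are put in increasing order, open leaves
  keep the order of the word. The last leaf is separate because a right comb ends in a leaf; this
  also excludes closed forms on an empty set of labels.\<close>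

fun normal_forms :: "(nat \<Rightarrow> color) \<Rightarrow> nat set \<Rightarrow> color \<Rightarrow> ((lp_gen \<Rightarrow>\<^sub>0 'k) \<Rightarrow> 'k) tree set" where
  "normal_forms \<kappa> S Closed = {coms xs (Leaf y) | xs y. xs @ [y] = sorted_list_of_set S \<and> (\<forall>i\<in>S. \<kappa> i = Closed)}"
| "normal_forms \<kappa> S Open = {acts (sorted_list_of_set {i \<in> S. \<kappa> i = Closed}) (muls w (Leaf z)) | w z.
    distinct (w @ [z]) \<and> set (w @ [z]) = {i \<in> S. \<kappa> i = Open}}"

lemma proper_coms: "proper \<kappa> Closed (coms xs t) \<longleftrightarrow> (\<forall>x\<in>set xs. \<kappa> x = Closed) \<and> distinct xs \<and>
    set xs \<inter> set (leaves t) = {} \<and> proper \<kappa> Closed t"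
  by (induction xs) auto

lemma proper_muls: "proper \<kappa> Open (muls xs t) \<longleftrightarrow> (\<forall>x\<in>set xs. \<kappa> x = Open) \<and> distinct xs \<and>
    set xs \<inter> set (leaves t) = {} \<and> proper \<kappa> Open t"
  by (induction xs) auto

lemma proper_acts: "proper \<kappa> Open (acts xs t) \<longleftrightarrow> (\<forall>x\<in>set xs. \<kappa> x = Closed) \<and> distinct xs \<and>
    set xs \<inter> set (leaves t) = {} \<and> proper \<kappa> Open t"
  by (induction xs) auto

lemma normal_forms_subset:
  assumes "finite S"
  shows "normal_forms \<kappa> S c \<subseteq> LT \<kappa> S c"
proof (cases c)
  case Closed
  show ?thesis
  proof
    fix t assume "t \<in> normal_forms \<kappa> S c"
    then obtain xs y where t: "t = coms xs (Leaf y)" and xs: "xs @ [y] = sorted_list_of_set S"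
      and cl: "\<forall>i\<in>S. \<kappa> i = Closed"
      using Closed by auto
    have "set (xs @ [y]) = S" "distinct (xs @ [y])"
      unfolding xs using assms by simp_all
    then show "t \<in> LT \<kappa> S c"
      using cl by (auto simp: labelled_trees_iff t Closed proper_coms)
  qed
next
  case Open
  show ?thesis
  proof
    fix t assume "t \<in> normal_forms \<kappa> S c"
    then obtain w z where t: "t = acts (sorted_list_of_set {i \<in> S. \<kappa> i = Closed}) (muls w (Leaf z))"
      and w: "distinct (w @ [z])" "set (w @ [z]) = {i \<in> S. \<kappa> i = Open}"
      using Open by auto
    have "insert z (set w) = {i \<in> S. \<kappa> i = Open}" using w(2) by simp
    moreover have "S = {i \<in> S. \<kappa> i = Closed} \<union> {i \<in> S. \<kappa> i = Open}"
      using color.exhaust by blast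
    ultimately show "t \<in> LT \<kappa> S c"
      using w(1) assms by (auto simp: labelled_trees_iff t Open proper_acts proper_muls)
  qed
qed

lemma normal_formsD:
  assumes "t \<in> normal_forms \<kappa> S c" "finite S"
  shows "proper \<kappa> c t" "set (leaves t) = S"
  using subsetD[OF normal_forms_subset[OF assms(2)] assms(1)] by (simp_all add: labelled_trees_iff)

lemma acts_permute:
  "proper \<kappa> Open (acts xs t) \<Longrightarrow> mset xs = mset ys \<Longrightarrow> equiv_tree \<kappa> Open (acts xs t) (acts ys t)"
  by (rule equiv_permute[OF act_commute])

lemma com_left_commute:
  assumes p: "proper \<kappa> Closed (com r (com s t))"
  shows "equiv_tree \<kappa> Closed (com r (com s t)) (com s (com r t))"
proof -
  have "equiv_tree \<kappa> Closed (com r (com s t)) (com (com r s) t)"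
    by (rule equiv_sym, rule com_assoc) (use p in \<open>auto simp: Int_Un_distrib Int_Un_distrib2\<close>)
  also have "equiv_tree \<kappa> Closed \<dots> (com (com s r) t)"
    by (intro equiv_node com_commute equiv_refl) (use p in auto)
  also have "equiv_tree \<kappa> Closed \<dots> (com s (com r t))"
    by (rule com_assoc) (use p in auto)
  finally show ?thesis .
qed

text \<open>\<open>equiv_permute\<close> fixes the last leaf. To change it, the new last leaf
  \<open>z\<close> is brought next to the old one, and \<open>com_commute\<close> exchanges the
  two.\<close>

lemma coms_permute_last:
  assumes p: "proper \<kappa> Closed (coms xs (Leaf y))" and m: "mset (xs @ [y]) = mset (ys @ [z])"
  shows "equiv_tree \<kappa> Closed (coms xs (Leaf y)) (coms ys (Leaf z))"
proof (cases "y = z")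
  case True
  then show ?thesis
    using m equiv_permute[OF com_left_commute p, of ys] by simp
next
  case False
  have "z \<in> set (xs @ [y])"
    using arg_cong[OF m, of set_mset] by auto
  then have z: "z \<in> set xs" using False by auto
  define xs' where "xs' = remove1 z xs"
  have 1: "mset xs = mset (xs' @ [z])" using z by (simp add: xs'_def)
  have a: "equiv_tree \<kappa> Closed (coms xs (Leaf y)) (coms (xs' @ [z]) (Leaf y))"
    by (rule equiv_permute[OF com_left_commute p 1])
  then have p': "proper \<kappa> Closed (coms (xs' @ [z]) (Leaf y))"
    by (rule equiv_proper)
  then have c: "equiv_tree \<kappa> Closed (com (Leaf z) (Leaf y)) (com (Leaf y) (Leaf z))"
    by (intro com_commute) (auto simp: proper_coms)
  have b: "equiv_tree \<kappa> Closed (coms (xs' @ [z]) (Leaf y)) (coms (xs' @ [y]) (Leaf z))"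
    using equiv_foldr[OF c, of Closed _ xs'] p' by simp
  then have p'': "proper \<kappa> Closed (coms (xs' @ [y]) (Leaf z))"
    by (rule equiv_proper)
  have 2: "mset (xs' @ [y]) = mset ys" using m 1 by simp
  have "equiv_tree \<kappa> Closed (coms (xs' @ [y]) (Leaf z)) (coms ys (Leaf z))"
    by (rule equiv_permute[OF com_left_commute p'' 2])
  from equiv_trans[OF equiv_trans[OF a b] this] show ?thesis .
qed

lemma normal_form_com:
  assumes s: "s \<in> normal_forms \<kappa> S1 Closed" and t: "t \<in> normal_forms \<kappa> S2 Closed"
    and disj: "S1 \<inter> S2 = {}" "finite S1" "finite S2"
  shows "\<exists>u\<in>normal_forms \<kappa> (S1 \<union> S2) Closed. equiv_tree \<kappa> Closed (com s t) u"
proof -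
  obtain xs y where s': "s = coms xs (Leaf y)" and xs: "xs @ [y] = sorted_list_of_set S1" "\<forall>i\<in>S1. \<kappa> i = Closed"
    using s by auto
  obtain xs' y' where t': "t = coms xs' (Leaf y')" and xs': "xs' @ [y'] = sorted_list_of_set S2" "\<forall>i\<in>S2. \<kappa> i = Closed"
    using t by auto
  have "proper \<kappa> Closed s" "set (leaves s) = S1" "proper \<kappa> Closed t" "set (leaves t) = S2"
    using normal_formsD[OF s disj(2)] normal_formsD[OF t disj(3)] by simp_all
  then have p: "proper \<kappa> Closed (com s t)" using disj by simp
  have "equiv_tree \<kappa> Closed (com (coms xs (Leaf y)) t) (coms xs (com (Leaf y) t))"
    by (rule equiv_push[OF com_assoc]) (use p s' in simp_all)
  also have "coms xs (com (Leaf y) t) = coms (xs @ y # xs') (Leaf y')"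
    by (simp add: t')
  finally have 1: "equiv_tree \<kappa> Closed (com s t) (coms (xs @ y # xs') (Leaf y'))"
    unfolding s' .
  then have p': "proper \<kappa> Closed (coms (xs @ y # xs') (Leaf y'))" by (rule equiv_proper)
  have ne: "sorted_list_of_set (S1 \<union> S2) \<noteq> []"
    using xs(1) disj by (metis Un_empty append_is_Nil_conv finite_UnI list.distinct(1) sorted_list_of_set_eq_Nil_iff sorted_list_of_set_empty)
  define ys z where "ys = butlast (sorted_list_of_set (S1 \<union> S2))" and "z = last (sorted_list_of_set (S1 \<union> S2))"
  have ys: "ys @ [z] = sorted_list_of_set (S1 \<union> S2)" using ne by (simp add: ys_def z_def)
  have "mset ((xs @ y # xs') @ [y']) = mset (sorted_list_of_set S1) + mset (sorted_list_of_set S2)"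
    unfolding xs(1)[symmetric] xs'(1)[symmetric] by simp
  also have "\<dots> = mset (sorted_list_of_set (S1 \<union> S2))"
    by (rule mset_sorted_list_Un[OF disj(2,3,1)])
  finally have "equiv_tree \<kappa> Closed (coms (xs @ y # xs') (Leaf y')) (coms ys (Leaf z))"
    unfolding ys[symmetric] by (rule coms_permute_last[OF p'])
  with 1 have "equiv_tree \<kappa> Closed (com s t) (coms ys (Leaf z))" by (rule equiv_trans)
  moreover have "coms ys (Leaf z) \<in> normal_forms \<kappa> (S1 \<union> S2) Closed"
    using ys xs(2) xs'(2) by auto
  ultimately show ?thesis by blast
qed

lemma normal_form_act:
  assumes s: "s \<in> normal_forms \<kappa> S1 Closed" and t: "t \<in> normal_forms \<kappa> S2 Open"
    and disj: "S1 \<inter> S2 = {}" "finite S1" "finite S2"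
  shows "\<exists>u\<in>normal_forms \<kappa> (S1 \<union> S2) Open. equiv_tree \<kappa> Open (act s t) u"
proof -
  obtain xs y where s': "s = coms xs (Leaf y)" and xs: "xs @ [y] = sorted_list_of_set S1" "\<forall>i\<in>S1. \<kappa> i = Closed"
    using s by auto
  let ?C2 = "{i \<in> S2. \<kappa> i = Closed}" and ?C = "{i \<in> S1 \<union> S2. \<kappa> i = Closed}"
  obtain w z where t': "t = acts (sorted_list_of_set ?C2) (muls w (Leaf z))"
    and w: "distinct (w @ [z])" "set (w @ [z]) = {i \<in> S2. \<kappa> i = Open}"
    using t by auto
  have "proper \<kappa> Closed s" "set (leaves s) = S1" "proper \<kappa> Open t" "set (leaves t) = S2"
    using normal_formsD[OF s disj(2)] normal_formsD[OF t disj(3)] by simp_all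
  then have p: "proper \<kappa> Open (act s t)" using disj by simp
  have "equiv_tree \<kappa> Open (act (coms xs (Leaf y)) t) (acts xs (act (Leaf y) t))"
    by (rule equiv_push[OF act_com]) (use p s' in simp_all)
  also have "acts xs (act (Leaf y) t) = acts (xs @ y # sorted_list_of_set ?C2) (muls w (Leaf z))"
    by (simp add: t')
  finally have 1: "equiv_tree \<kappa> Open (act s t) (acts (xs @ y # sorted_list_of_set ?C2) (muls w (Leaf z)))"
    unfolding s' .
  then have p': "proper \<kappa> Open (acts (xs @ y # sorted_list_of_set ?C2) (muls w (Leaf z)))"
    by (rule equiv_proper)
  have C: "?C = S1 \<union> ?C2" using xs(2) by auto
  have "mset (xs @ y # sorted_list_of_set ?C2) = mset (sorted_list_of_set S1) + mset (sorted_list_of_set ?C2)"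
    unfolding xs(1)[symmetric] by simp
  also have "\<dots> = mset (sorted_list_of_set ?C)"
    unfolding C using disj by (intro mset_sorted_list_Un) auto
  finally have "equiv_tree \<kappa> Open (acts (xs @ y # sorted_list_of_set ?C2) (muls w (Leaf z)))
      (acts (sorted_list_of_set ?C) (muls w (Leaf z)))"
    by (rule acts_permute[OF p'])
  with 1 have "equiv_tree \<kappa> Open (act s t) (acts (sorted_list_of_set ?C) (muls w (Leaf z)))"
    by (rule equiv_trans)
  moreover have "{i \<in> S1 \<union> S2. \<kappa> i = Open} = {i \<in> S2. \<kappa> i = Open}" using xs(2) by auto
  then have "acts (sorted_list_of_set ?C) (muls w (Leaf z)) \<in> normal_forms \<kappa> (S1 \<union> S2) Open"
    using w by auto
  ultimately show ?thesis by blast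
qed

text \<open>The counterpart of \<open>equiv_push\<close> for the second factor of a product.\<close>

lemma mul_acts_right:
  "proper \<kappa> Open (mul s (acts ys t)) \<Longrightarrow> equiv_tree \<kappa> Open (mul s (acts ys t)) (acts ys (mul s t))"
proof (induction ys)
  case Nil
  then show ?case by (simp add: equiv_refl)
next
  case (Cons y ys)
  have 1: "equiv_tree \<kappa> Open (mul s (act (Leaf y) (acts ys t))) (act (Leaf y) (mul s (acts ys t)))"
    using Cons.prems by (intro mul_act_right) simp
  then have p: "proper \<kappa> Open (act (Leaf y) (mul s (acts ys t)))"
    by (rule equiv_proper)
  then have "equiv_tree \<kappa> Open (act (Leaf y) (mul s (acts ys t))) (act (Leaf y) (acts ys (mul s t)))"
    by (intro equiv_node_right[OF p] Cons.IH) simp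
  from equiv_trans[OF 1 this] show ?case by simp
qed

text \<open>Closed leaves are drawn out of both factors before reassociating, since
  \<open>mul_assoc\<close> must meet pure products of open leaves; collected in front, they are
  sorted at the end.\<close>

lemma normal_form_mul:
  assumes s: "s \<in> normal_forms \<kappa> S1 Open" and t: "t \<in> normal_forms \<kappa> S2 Open"
    and disj: "S1 \<inter> S2 = {}" "finite S1" "finite S2"
  shows "\<exists>u\<in>normal_forms \<kappa> (S1 \<union> S2) Open. equiv_tree \<kappa> Open (mul s t) u"
proof -
  let ?C1 = "{i \<in> S1. \<kappa> i = Closed}" and ?C2 = "{i \<in> S2. \<kappa> i = Closed}" and ?C = "{i \<in> S1 \<union> S2. \<kappa> i = Closed}"
  let ?l = sorted_list_of_set
  obtain w z where s': "s = acts (?l ?C1) (muls w (Leaf z))"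
    and w: "distinct (w @ [z])" "set (w @ [z]) = {i \<in> S1. \<kappa> i = Open}"
    using s by auto
  obtain w' z' where t': "t = acts (?l ?C2) (muls w' (Leaf z'))"
    and w': "distinct (w' @ [z'])" "set (w' @ [z']) = {i \<in> S2. \<kappa> i = Open}"
    using t by auto
  let ?m = "muls w (Leaf z)" and ?m' = "muls w' (Leaf z')" and ?w = "w @ z # w'"
  have "proper \<kappa> Open s" "set (leaves s) = S1" "proper \<kappa> Open t" "set (leaves t) = S2"
    using normal_formsD[OF s disj(2)] normal_formsD[OF t disj(3)] by simp_all
  then have p: "proper \<kappa> Open (mul s t)" using disj by simp
  have 1: "equiv_tree \<kappa> Open (mul s t) (acts (?l ?C1) (mul ?m t))"
    unfolding s' by (rule equiv_push[OF mul_act_left]) (use p s' in simp_all)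
  then have p1: "proper \<kappa> Open (acts (?l ?C1) (mul ?m t))" by (rule equiv_proper)
  then have "proper \<kappa> Open (mul ?m t)" unfolding proper_acts by blast
  then have "equiv_tree \<kappa> Open (mul ?m t) (acts (?l ?C2) (mul ?m ?m'))"
    unfolding t' by (rule mul_acts_right)
  then have 2: "equiv_tree \<kappa> Open (acts (?l ?C1) (mul ?m t)) (acts (?l ?C1) (acts (?l ?C2) (mul ?m ?m')))"
    by (rule equiv_foldr) (rule p1)
  then have p2: "proper \<kappa> Open (acts (?l ?C1) (acts (?l ?C2) (mul ?m ?m')))" by (rule equiv_proper)
  then have p3: "proper \<kappa> Open (acts (?l ?C2) (mul ?m ?m'))" unfolding proper_acts by blast
  have "equiv_tree \<kappa> Open (mul ?m ?m') (muls w (mul (Leaf z) ?m'))"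
    by (rule equiv_push[OF mul_assoc]) (use p3 in \<open>unfold proper_acts, blast+\<close>)
  then have 3: "equiv_tree \<kappa> Open (acts (?l ?C1) (acts (?l ?C2) (mul ?m ?m')))
      (acts (?l ?C1) (acts (?l ?C2) (muls w (mul (Leaf z) ?m'))))"
    by (rule equiv_foldr[OF equiv_foldr[OF _ p3] p2])
  have "acts (?l ?C1) (acts (?l ?C2) (muls w (mul (Leaf z) ?m'))) = acts (?l ?C1 @ ?l ?C2) (muls ?w (Leaf z'))"
    by simp
  note 4 = 3[unfolded this]
  then have p4: "proper \<kappa> Open (acts (?l ?C1 @ ?l ?C2) (muls ?w (Leaf z')))" by (rule equiv_proper)
  have C: "?C = ?C1 \<union> ?C2" by auto
  have "mset (?l ?C1 @ ?l ?C2) = mset (?l ?C)"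
    unfolding C mset_append using disj by (intro mset_sorted_list_Un) auto
  then have 5: "equiv_tree \<kappa> Open (acts (?l ?C1 @ ?l ?C2) (muls ?w (Leaf z'))) (acts (?l ?C) (muls ?w (Leaf z')))"
    by (rule acts_permute[OF p4])
  have "equiv_tree \<kappa> Open (mul s t) (acts (?l ?C) (muls ?w (Leaf z')))"
    by (rule equiv_trans[OF equiv_trans[OF equiv_trans[OF 1 2] 4] 5])
  moreover have "set (?w @ [z']) = {i \<in> S1 \<union> S2. \<kappa> i = Open}"
    unfolding set_append Collect_disj_eq Un_iff conj_disj_distribR w(2)[unfolded set_append, symmetric] w'(2)[unfolded set_append, symmetric]
    by auto
  moreover have "distinct (?w @ [z'])"
    using p4 unfolding proper_def leaves_foldr by simp
  ultimately show ?thesis unfolding normal_forms.simps by blast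
qed

end

section \<open>Spanning by normal forms and their independence\<close>

context quadratic_ideal
begin

definition spanned :: "(nat \<Rightarrow> color) \<Rightarrow> nat set \<Rightarrow> color \<Rightarrow> (((lp_gen \<Rightarrow>\<^sub>0 'k) \<Rightarrow> 'k) tree \<Rightarrow>\<^sub>0 'k) \<Rightarrow> bool" where
  "spanned \<kappa> S c f \<longleftrightarrow> (\<exists>h. Poly_Mapping.keys h \<subseteq> normal_forms \<kappa> S c \<and> hat \<kappa> S c (f - h))"

lemma spanned_hat: "hat \<kappa> S c f \<Longrightarrow> spanned \<kappa> S c f"
  unfolding spanned_def by (intro exI[of _ 0]) simp

lemma spanned_add:
  assumes "spanned \<kappa> S c f" "spanned \<kappa> S c g"
  shows "spanned \<kappa> S c (f + g)"
proof -
  obtain h h' where "Poly_Mapping.keys h \<subseteq> normal_forms \<kappa> S c" "hat \<kappa> S c (f - h)"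
    "Poly_Mapping.keys h' \<subseteq> normal_forms \<kappa> S c" "hat \<kappa> S c (g - h')"
    using assms unfolding spanned_def by blast
  moreover have "f - h + (g - h') = f + g - (h + h')" by simp
  ultimately show ?thesis
    unfolding spanned_def by (intro exI[of _ "h + h'"]) (metis hat_add keys_subsetI(1))
qed

lemma spanned_smul:
  assumes "spanned \<kappa> S c f"
  shows "spanned \<kappa> S c (smul k f)"
proof -
  obtain h where "Poly_Mapping.keys h \<subseteq> normal_forms \<kappa> S c" "hat \<kappa> S c (f - h)"
    using assms unfolding spanned_def by blast
  then show ?thesis
    using hat_smul[of \<kappa> S c "f - h" k] unfolding spanned_def
    by (intro exI[of _ "smul k h"]) (simp add: keys_subsetI)
qed

lemma spanned_lin:
  assumes "\<And>x. x \<in> Poly_Mapping.keys f \<Longrightarrow> spanned \<kappa> S c (h x)"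
  shows "spanned \<kappa> S c (lin h f)"
proof -
  have "spanned \<kappa> S c (\<Sum>x\<in>A. smul (Poly_Mapping.lookup f x) (h x))"
    if "finite A" "A \<subseteq> Poly_Mapping.keys f" for A
    using that
    by (induction A rule: finite_induct) (auto intro: spanned_hat hat_zero spanned_add spanned_smul assms)
  then show ?thesis unfolding lin_def by simp
qed

lemma spanned_corolla:
  assumes x: "x \<in> corollas c1 c2 c" and s: "s \<in> normal_forms \<kappa> S1 c1" and t: "t \<in> normal_forms \<kappa> S2 c2"
    and disj: "S1 \<inter> S2 = {}" "finite S1" "finite S2"
  shows "spanned \<kappa> (S1 \<union> S2) c (delta (tree_subst (\<lambda>i. [s, t] ! i) x))"
proof -
  have sp: "spanned \<kappa> (S1 \<union> S2) c (delta u)"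
    if u: "\<exists>v\<in>normal_forms \<kappa> (S1 \<union> S2) c. equiv_tree \<kappa> c u v" for u
  proof -
    obtain v where v: "v \<in> normal_forms \<kappa> (S1 \<union> S2) c" and e: "equiv_tree \<kappa> c u v" using u by blast
    have "set (leaves u) = S1 \<union> S2"
      using e normal_formsD(2)[OF v] disj by (simp add: equiv_tree_def)
    then show ?thesis
      using v e unfolding spanned_def equiv_tree_def by (intro exI[of _ "delta v"]) simp
  qed
  have disj': "S2 \<inter> S1 = {}" using disj by blast
  show ?thesis
  proof (cases "lp_basis c1 c2 c = {}")
    case True
    then have "corollas c1 c2 c = ({} :: ((lp_gen \<Rightarrow>\<^sub>0 'k) \<Rightarrow> 'k) tree set)"
      by (cases c1; cases c2; cases c) auto
    then show ?thesis using x by simp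
  next
    case False
    then consider "c1 = Closed" "c2 = Closed" "c = Closed" | "c1 = Closed" "c2 = Open" "c = Open"
      | "c1 = Open" "c2 = Closed" "c = Open" | "c1 = Open" "c2 = Open" "c = Open"
      by (cases c1; cases c2; cases c) auto
    then show ?thesis
    proof cases
      case 1
      have "\<exists>v\<in>normal_forms \<kappa> (S1 \<union> S2) c. equiv_tree \<kappa> c (com s t) v"
        using normal_form_com[of s \<kappa> S1 t S2] s t disj by (simp only: 1)
      from sp[OF this] show ?thesis using x 1 by simp
    next
      case 2
      have "\<exists>v\<in>normal_forms \<kappa> (S1 \<union> S2) c. equiv_tree \<kappa> c (act s t) v"
        using normal_form_act[of s \<kappa> S1 t S2] s t disj by (simp only: 2)
      from sp[OF this] show ?thesis using x 2 by simp
    next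
      case 3
      have "\<exists>v\<in>normal_forms \<kappa> (S1 \<union> S2) c. equiv_tree \<kappa> c (act t s) v"
        using normal_form_act[of t \<kappa> S2 s S1] s t disj disj' by (simp only: 3 Un_commute)
      from sp[OF this] show ?thesis using x 3 by simp
    next
      case 4
      have 1: "\<exists>v\<in>normal_forms \<kappa> (S1 \<union> S2) c. equiv_tree \<kappa> c (mul s t) v"
        using normal_form_mul[of s \<kappa> S1 t S2] s t disj by (simp only: 4)
      have 2: "\<exists>v\<in>normal_forms \<kappa> (S1 \<union> S2) c. equiv_tree \<kappa> c (mul t s) v"
        using normal_form_mul[of t \<kappa> S2 s S1] s t disj disj' by (simp only: 4 Un_commute)
      have "x = mul (Leaf 0) (Leaf 1) \<or> x = mul (Leaf 1) (Leaf 0)"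
        using x by (simp add: 4)
      then show ?thesis using sp[OF 1] sp[OF 2] by auto
    qed
  qed
qed

lemma spanned_tree: "t \<in> LT \<kappa> S c \<Longrightarrow> spanned \<kappa> S c (delta t)"
proof (induction t arbitrary: S c)
  case (Leaf i)
  then have S: "S = {i}" and c: "\<kappa> i = c" by (auto simp: labelled_trees_iff)
  have "Leaf i \<in> normal_forms \<kappa> S c"
  proof (cases c)
    case Closed
    have "coms [] (Leaf i) \<in> normal_forms \<kappa> S Closed"
      unfolding normal_forms.simps mem_Collect_eq
      by (intro exI[of _ "[]"] exI[of _ i]) (simp add: S c Closed)
    then show ?thesis by (simp add: Closed)
  next
    case Open
    have 1: "{j \<in> S. \<kappa> j = Closed} = {}" and 2: "{j \<in> S. \<kappa> j = Open} = {i}" using S c Open by auto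
    have "Leaf i \<in> normal_forms \<kappa> S Open"
      unfolding normal_forms.simps mem_Collect_eq 1 2
      by (intro exI[of _ "[]"] exI[of _ i]) simp
    then show ?thesis by (simp add: Open)
  qed
  then show ?case
    unfolding spanned_def by (intro exI[of _ "delta (Leaf i)"]) (simp add: hat_zero)
next
  case (Node c1 c2 \<phi> s t)
  let ?S1 = "set (leaves s)" and ?S2 = "set (leaves t)"
  have p: "\<phi> \<in> carrier (gens lp_dual c1 c2 c)" "proper \<kappa> c1 s" "proper \<kappa> c2 t" "?S1 \<inter> ?S2 = {}"
    and S: "S = ?S1 \<union> ?S2"
    using Node.prems by (auto simp: labelled_trees_iff)
  note disj = p(4) finite_set[of "leaves s"] finite_set[of "leaves t"]
  have s: "s \<in> LT \<kappa> ?S1 c1" and t: "t \<in> LT \<kappa> ?S2 c2"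
    using p by (simp_all add: labelled_trees_iff)
  obtain h1 where h1: "Poly_Mapping.keys h1 \<subseteq> normal_forms \<kappa> ?S1 c1" "hat \<kappa> ?S1 c1 (delta s - h1)"
    using Node.IH(1)[OF s] unfolding spanned_def by blast
  obtain h2 where h2: "Poly_Mapping.keys h2 \<subseteq> normal_forms \<kappa> ?S2 c2" "hat \<kappa> ?S2 c2 (delta t - h2)"
    using Node.IH(2)[OF t] unfolding spanned_def by blast
  have k1: "Poly_Mapping.keys h1 \<subseteq> LT \<kappa> ?S1 c1" and k2: "Poly_Mapping.keys h2 \<subseteq> LT \<kappa> ?S2 c2"
    using order_trans[OF h1(1) normal_forms_subset] order_trans[OF h2(1) normal_forms_subset] by simp_all
  let ?n = "\<lambda>F G. lin (\<lambda>s. lin (\<lambda>t. delta (Node c1 c2 \<phi> s t)) G) F"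
  have "spanned \<kappa> S c (delta (Node c1 c2 \<phi> s' t'))" if s': "s' \<in> Poly_Mapping.keys h1" and t': "t' \<in> Poly_Mapping.keys h2" for s' t'
  proof -
    obtain f where f: "Poly_Mapping.keys f \<subseteq> corollas c1 c2 c"
      "delta (Node c1 c2 \<phi> (Leaf 0) (Leaf 1)) - f \<in> N [c1, c2] c"
      using corolla_expansion[OF p(1)] by blast
    have "hat \<kappa> (?S1 \<union> ?S2) c (lin (\<lambda>x. lin (\<lambda>s. lin (\<lambda>t. delta (tree_subst (\<lambda>i. [s, t] ! i) x)) (delta t')) (delta s'))
        (delta (Node c1 c2 \<phi> (Leaf 0) (Leaf 1)) - f))"
      by (rule hat_subst2[OF N_rules(5)[OF f(2)] _ _ disj]) (use s' t' k1 k2 f(2) in auto)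
    then have "hat \<kappa> S c (delta (Node c1 c2 \<phi> s' t') - lin (\<lambda>x. delta (tree_subst (\<lambda>i. [s', t'] ! i) x)) f)"
      by (simp add: S)
    moreover have "spanned \<kappa> S c (lin (\<lambda>x. delta (tree_subst (\<lambda>i. [s', t'] ! i) x)) f)"
      unfolding S by (rule spanned_lin) (use spanned_corolla[OF _ _ _ disj] f(1) h1(1) h2(1) s' t' in blast)
    ultimately show ?thesis
      using spanned_add[OF spanned_hat] by fastforce
  qed
  then have "spanned \<kappa> S c (?n h1 h2)"
    by (intro spanned_lin)
  moreover have "hat \<kappa> S c (?n (delta s - h1) (delta t))"
    unfolding S by (rule hat_node[OF p(1) disj]) (use h1 t hat_keys[OF h1(2)] in auto)
  moreover have "hat \<kappa> S c (?n h1 (delta t - h2))"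
    unfolding S by (rule hat_node[OF p(1) disj k1 hat_keys[OF h2(2)]]) (use h2 in simp)
  \<comment> \<open>Telescoping: the arguments are replaced by combinations of normal forms one
    after the other, and each error lies in the extended ideal.\<close>
  moreover have "delta (Node c1 c2 \<phi> s t) = ?n (delta s - h1) (delta t) + (?n h1 (delta t - h2) + ?n h1 h2)"
    by (simp flip: lin_fun_add)
  ultimately show ?case
    by (metis spanned_add spanned_hat)
qed

lemma word_eval_coms:
  assumes "\<And>i. i \<in> set (xs @ [y]) \<Longrightarrow> cs ! i = Closed"
  shows "word_eval cs (coms xs (Leaf y)) = delta []"
  using assms by (induction xs) (simp_all add: word_input_def)

lemma word_eval_acts_muls:
  assumes "\<And>i. i \<in> set xs \<Longrightarrow> cs ! i = Closed" "\<And>i. i \<in> set (w @ [z]) \<Longrightarrow> cs ! i = Open"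
  shows "word_eval cs (acts xs (muls w (Leaf z))) = delta (w @ [z])"
proof -
  have "word_eval cs (muls w (Leaf z)) = delta (w @ [z])"
    using assms(2) by (induction w) (simp_all add: word_input_def)
  then show ?thesis
    using assms(1) by (induction xs) (simp_all add: word_input_def)
qed

lemma normal_form_word:
  assumes "t \<in> normal_forms (\<lambda>i. cs ! i) {..<length cs} c"
  shows "word_eval cs t = delta (filter (\<lambda>i. cs ! i = Open) (leaves t))"
proof (cases c)
  case Closed
  then obtain xs y where t: "t = coms xs (Leaf y)" and xs: "xs @ [y] = sorted_list_of_set {..<length cs}"
    "\<forall>i\<in>{..<length cs}. cs ! i = Closed"
    using assms by auto
  have "set (xs @ [y]) = {..<length cs}" unfolding xs by simp
  then have "cs ! i = Closed" if "i \<in> set (xs @ [y])" for i using xs(2) that by blast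
  then show ?thesis using word_eval_coms[of xs y cs] by (simp add: t)
next
  case Open
  then obtain w z where t: "t = acts (sorted_list_of_set {i \<in> {..<length cs}. cs ! i = Closed}) (muls w (Leaf z))"
    and w: "set (w @ [z]) = {i \<in> {..<length cs}. cs ! i = Open}"
    using assms by auto
  have "cs ! i = Open" if "i \<in> set (w @ [z])" for i using that unfolding w by simp
  moreover have "cs ! i = Closed" if "i \<in> set (sorted_list_of_set {i \<in> {..<length cs}. cs ! i = Closed})" for i
    using that by simp
  ultimately have "word_eval cs t = delta (w @ [z])"
    unfolding t by (intro word_eval_acts_muls) blast+
  moreover have "filter (\<lambda>i. cs ! i = Open) (leaves t) = w @ [z]"
    using \<open>\<And>i. i \<in> set (w @ [z]) \<Longrightarrow> cs ! i = Open\<close> by (simp add: t)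
  ultimately show ?thesis by simp
qed

lemma normal_form_inj:
  "inj_on (\<lambda>t. filter (\<lambda>i. \<kappa> i = Open) (leaves t)) (normal_forms \<kappa> S c)"
proof (cases c)
  case Closed
  then have "s = t" if "s \<in> normal_forms \<kappa> S c" "t \<in> normal_forms \<kappa> S c" for s t
    using that by (auto simp flip: append1_eq_conv) (metis append1_eq_conv)+
  then show ?thesis by (blast intro: inj_onI)
next
  case Open
  show ?thesis
  proof (rule inj_onI)
    let ?C = "sorted_list_of_set {i \<in> S. \<kappa> i = Closed}"
    fix s t assume "s \<in> normal_forms \<kappa> S c" "t \<in> normal_forms \<kappa> S c"
      and eq: "filter (\<lambda>i. \<kappa> i = Open) (leaves s) = filter (\<lambda>i. \<kappa> i = Open) (leaves t)"
    then obtain w z w' z' where s: "s = acts ?C (muls w (Leaf z))" and w: "set (w @ [z]) = {i \<in> S. \<kappa> i = Open}"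
      and t: "t = acts ?C (muls w' (Leaf z'))" and w': "set (w' @ [z']) = {i \<in> S. \<kappa> i = Open}"
      using Open by auto
    have f: "filter (\<lambda>i. \<kappa> i = Open) (v @ [y]) = v @ [y]" if "set (v @ [y]) = {i \<in> S. \<kappa> i = Open}" for v y
      by (rule filter_True) (use that in blast)
    have "filter (\<lambda>i. \<kappa> i = Open) ?C @ (w @ [z]) = filter (\<lambda>i. \<kappa> i = Open) ?C @ (w' @ [z'])"
      using eq unfolding s t leaves_foldr leaves.simps filter_append f[OF w, unfolded filter_append] f[OF w', unfolded filter_append] .
    then show "s = t" using s t by simp
  qed
qed

text \<open>Modulo the ideal \<open>f\<close> is a combination \<open>h\<close> of normal forms. As
  the ideal lies in the kernel, \<open>h\<close> evaluates to zero as well; distinct normal forms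
  have distinct words, so \<open>h = 0\<close>.\<close>

theorem kernel_in_ideal:
  assumes f: "Poly_Mapping.keys f \<subseteq> s_comp (tree_operad lp_dual) cs c" and ker: "lin (word_eval cs) f = 0"
  shows "f \<in> N cs c"
proof -
  let ?\<kappa> = "\<lambda>i. cs ! i" and ?S = "{..<length cs}"
  let ?W = "\<lambda>t. filter (\<lambda>i. cs ! i = Open) (leaves t)"
  have "spanned ?\<kappa> ?S c (lin delta f)"
    by (rule spanned_lin, rule spanned_tree) (use f in \<open>auto simp: labelled_trees_def well_colored_iff\<close>)
  then obtain h where h: "Poly_Mapping.keys h \<subseteq> normal_forms ?\<kappa> ?S c" and hat: "hat ?\<kappa> ?S c (f - h)"
    unfolding spanned_def by auto
  have "bij_betw (\<lambda>i. i) ?S {..<length cs}" by (simp add: bij_betw_def)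
  then have fh: "f - h \<in> N cs c"
    using hat unfolding hat_def by (auto dest!: spec[of _ "\<lambda>i. i"] spec[of _ cs])
  have "lin (word_eval cs) h = 0"
    using kernel[OF fh] ker by simp
  then have z: "lin (\<lambda>t. delta (?W t)) h = 0"
    using lin_cong[of h "word_eval cs" "\<lambda>t. delta (?W t)"] normal_form_word h by fastforce
  have "h = 0"
  proof (rule poly_mapping_eqI)
    fix t
    show "Poly_Mapping.lookup h t = Poly_Mapping.lookup 0 t"
    proof (cases "t \<in> Poly_Mapping.keys h")
      \<comment> \<open>By injectivity of the words only \<open>t\<close> contributes to the
        coefficient of \<open>?W t\<close>.\<close>
      case True
      have "Poly_Mapping.lookup (lin (\<lambda>t. delta (?W t)) h) (?W t) =
          (\<Sum>s\<in>Poly_Mapping.keys h. if s = t then Poly_Mapping.lookup h s else 0)"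
        unfolding lin_def lookup_sum
        by (rule sum.cong) (use normal_form_inj[of ?\<kappa> ?S c] h True in
          \<open>auto simp: lookup_single when_def dest!: inj_onD\<close>)
      then show ?thesis using z True by simp
    qed (simp add: in_keys_iff)
  qed
  then show ?thesis using fh by simp
qed

end

section \<open>The Ginzburg--Kapranov pairing\<close>

text \<open>The assignment is quantified because renumbering and grafting change it; the kernel for
  a single assignment need not be stable.\<close>

lemma eval_kernel_ideal:
  "operad_ideal (linearization (tree_operad E) :: ('k::field, _) operad)
    (\<lambda>cs c. {f. Poly_Mapping.keys f \<subseteq> s_comp (tree_operad E) cs c \<and> (\<forall>a. lin (eval_tree B a) f = 0)})"
  (is "operad_ideal ?P ?K")
  unfolding operad_ideal_def sub_collection_def
proof (intro conjI allI ballI impI)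
  interpret L: linear_operad ?P by (rule linear_operad_linearization[OF closed_tree_operad])
  fix cs c
  show "submodule (?K cs c) scalars (o_comp ?P cs c)"
    unfolding linearization_simps by (rule submodule_free_moduleI) (auto simp: keys_subsetI simp del: tree_operad_simps)
  fix \<sigma> f assume f: "f \<in> ?K cs c" and \<sigma>: "\<sigma> permutes {..<length cs}"
  have "o_act ?P cs c \<sigma> f \<in> carrier (o_comp ?P (permute_list \<sigma> cs) c)"
    by (rule L.act_closed[OF \<sigma>]) (use f in \<open>simp add: linearization_simps\<close>)
  moreover have "lin (eval_tree B a) (o_act ?P cs c \<sigma> f) = 0" for a
    using f by (simp add: linearization_simps lin_lin eval_tree_relabel)
  ultimately show "o_act ?P cs c \<sigma> f \<in> ?K (permute_list \<sigma> cs) c"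
    by (simp add: linearization_simps del: tree_operad_simps)
next
  interpret L: linear_operad ?P by (rule linear_operad_linearization[OF closed_tree_operad])
  fix cs :: "color list" and c i ds and f g :: "_ \<Rightarrow>\<^sub>0 'k"
  assume i: "i < length cs" and f: "f \<in> carrier (o_comp ?P cs c)" and g: "g \<in> carrier (o_comp ?P ds (cs ! i))"
    and K: "f \<in> ?K cs c \<or> g \<in> ?K ds (cs ! i)"
  have "lin (eval_tree B a) (o_circ ?P cs c i ds f g) = 0" for a
  proof -
    define a' where "a' j = (if j < i then a j else a (j + length ds - 1))" for j
    define u where "u = eval_tree B (\<lambda>k. a (k + i))"
    have eq: "eval_tree B a (graft i (length ds) y x) = eval_tree B (a'(i := u y)) x" for x y
      unfolding eval_tree_graft by (rule eval_tree_cong) (auto simp: a'_def u_def)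
    have 1: "lin (eval_tree B a) (o_circ ?P cs c i ds f g) = lin (\<lambda>x. lin (\<lambda>y. eval_tree B (a'(i := u y)) x) g) f"
      by (simp add: linearization_simps lin_lin eq)
    show ?thesis
      using K
    proof
      assume "f \<in> ?K cs c"
      then show ?thesis unfolding 1 by (subst lin_fun_lin) simp
    next
      assume g0: "g \<in> ?K ds (cs ! i)"
      have "lin (\<lambda>y. eval_tree B (a'(i := u y)) x) g = 0" if "x \<in> Poly_Mapping.keys f" for x
      proof -
        have "x \<in> s_comp (tree_operad E) cs c"
          using that f by (auto simp: linearization_simps simp del: tree_operad_simps)
        then have x: "distinct (leaves x)" "i \<in> set (leaves x)" using i by simp_all
        \<comment> \<open>The inner evaluation vanishes, and by multilinearity a tree with a zero
          input evaluates to zero. Zero is written \<open>lin u 0\<close> so that multilinearity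
          yields this second fact, too.\<close>
        have "lin u g = lin u 0" using g0 by (simp add: u_def)
        then show ?thesis
          using eval_tree_multilinear[OF x, of B a' u g] eval_tree_multilinear[OF x, of B a' u 0] by simp
      qed
      then have "lin (\<lambda>x. lin (\<lambda>y. eval_tree B (a'(i := u y)) x) g) f = lin (\<lambda>x. 0) f"
        by (rule lin_cong)
      then show ?thesis unfolding 1 by simp
    qed
  qed
  then show "o_circ ?P cs c i ds f g \<in> ?K (splice_in cs i ds) c"
    using L.circ_closed[OF i f g] by (simp add: linearization_simps del: tree_operad_simps)
qed

lemma free_rels_carrier:
  assumes "\<And>c1 c2 c e. e \<in> carrier (gens E c1 c2 c) \<Longrightarrow> swap E c1 c2 c e \<in> carrier (gens E c2 c1 c)"
    and "\<And>c1 c2 c e e'. e \<in> carrier (gens E c1 c2 c) \<Longrightarrow> e' \<in> carrier (gens E c1 c2 c) \<Longrightarrow>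
      e \<oplus>\<^bsub>gens E c1 c2 c\<^esub> e' \<in> carrier (gens E c1 c2 c)"
    and "\<And>c1 c2 c e k. e \<in> carrier (gens E c1 c2 c) \<Longrightarrow> k \<odot>\<^bsub>gens E c1 c2 c\<^esub> e \<in> carrier (gens E c1 c2 c)"
    and "f \<in> free_rels E cs c"
  shows "Poly_Mapping.keys f \<subseteq> s_comp (tree_operad E) cs c"
  using assms(4) unfolding free_rels_def
  by (elim UnE CollectE exE conjE) (simp_all add: assms(1-3) keys_subsetI lessThan_Suc insert_commute)

lemma lp_transpose_transpose [simp]: "lin lp_transpose (lin lp_transpose e) = e"
proof -
  have "lin lp_transpose (lp_transpose b) = delta b" for b
    by (cases b) simp_all
  then have "lin (\<lambda>b. lin lp_transpose (lp_transpose b)) e = lin delta e"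
    by (intro lin_cong)
  then show ?thesis by (simp add: lin_lin)
qed

lemma lp_swap_closed:
  assumes "Poly_Mapping.keys e \<subseteq> lp_basis c1 c2 c"
  shows "Poly_Mapping.keys (lin lp_transpose e) \<subseteq> lp_basis c2 c1 c"
proof (rule keys_linD)
  fix b assume "b \<in> Poly_Mapping.keys e"
  then have "b \<in> lp_basis c1 c2 c" using assms by blast
  then show "Poly_Mapping.keys (lp_transpose b) \<subseteq> lp_basis c2 c1 c"
    by (cases c1; cases c2; cases c) auto
qed

lemma lp_dual_swap_closed:
  assumes "\<phi> \<in> carrier (gens (lp_dual :: ('k::field, _) binary) c1 c2 c)"
  shows "swap lp_dual c1 c2 c \<phi> \<in> carrier (gens lp_dual c2 c1 c)"
    and "swap lp_dual c2 c1 c (swap lp_dual c1 c2 c \<phi>) = \<phi>"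
proof -
  have add: "\<phi> (f + g) = \<phi> f + \<phi> g"
    if "Poly_Mapping.keys f \<subseteq> lp_basis c1 c2 c" "Poly_Mapping.keys g \<subseteq> lp_basis c1 c2 c" for f g
    using assms that unfolding lp_dual_carrier by blast
  have sm: "\<phi> (smul k f) = k * \<phi> f" if "Poly_Mapping.keys f \<subseteq> lp_basis c1 c2 c" for f k
    using assms that unfolding lp_dual_carrier by blast
  have out: "\<phi> g = 0" if "\<not> Poly_Mapping.keys g \<subseteq> lp_basis c1 c2 c" for g
    using assms that unfolding lp_dual_carrier by blast
  have sw: "swap lp_dual c1 c2 c \<phi> f = (if Poly_Mapping.keys f \<subseteq> lp_basis c2 c1 c then - \<phi> (lin lp_transpose f) else 0)" for f
    by (simp add: dual_gens_def)
  show "swap lp_dual c1 c2 c \<phi> \<in> carrier (gens lp_dual c2 c1 c)"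
    unfolding lp_dual_carrier sw by (simp add: keys_subsetI add sm lp_swap_closed)
  show "swap lp_dual c2 c1 c (swap lp_dual c1 c2 c \<phi>) = \<phi>"
  proof
    fix f show "swap lp_dual c2 c1 c (swap lp_dual c1 c2 c \<phi>) f = \<phi> f"
      using sw out by (simp add: dual_gens_def[of lp_gens] lp_swap_closed)
  qed
qed

lemma lp_dual_closed:
  assumes "\<phi> \<in> carrier (gens (lp_dual :: ('k::field, _) binary) c1 c2 c)"
  shows "\<psi> \<in> carrier (gens lp_dual c1 c2 c) \<Longrightarrow>
      \<phi> \<oplus>\<^bsub>gens lp_dual c1 c2 c\<^esub> \<psi> \<in> carrier (gens lp_dual c1 c2 c)"
    and "k \<odot>\<^bsub>gens lp_dual c1 c2 c\<^esub> \<phi> \<in> carrier (gens lp_dual c1 c2 c)"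
  using assms unfolding lp_dual_carrier by (simp_all add: algebra_simps)

text \<open>A functional read on all five generators regardless of color. Unlike
  \<open>\<phi>\<close>, which is cut off outside its component, it is linear everywhere, as suits
  the products of an evaluation, which do not see colors.\<close>

definition lp_coef :: "((lp_gen \<Rightarrow>\<^sub>0 'k::field) \<Rightarrow> 'k) \<Rightarrow> (lp_gen \<Rightarrow>\<^sub>0 'k) \<Rightarrow> 'k" where
  "lp_coef \<phi> e = \<phi> (delta L2) * Poly_Mapping.lookup e L2 + \<phi> (delta N02) * Poly_Mapping.lookup e N02
    + \<phi> (delta N02') * Poly_Mapping.lookup e N02' + \<phi> (delta N11) * Poly_Mapping.lookup e N11
    + \<phi> (delta N11') * Poly_Mapping.lookup e N11'"

lemma lp_coef_linear [simp]:
  "lp_coef \<phi> (e + f) = lp_coef \<phi> e + lp_coef \<phi> f" "lp_coef \<phi> (smul k e) = k * lp_coef \<phi> e"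
  by (simp_all add: lp_coef_def lookup_add algebra_simps)

text \<open>The bases of different components are disjoint, so colors that do not match give zero.
  This recovers the test for equal inner colors in \<open>tree_pairing\<close>.\<close>

lemma lp_coef_eq:
  assumes "\<phi> \<in> carrier (gens (lp_dual :: ('k::field, _) binary) c1 c2 c)" "Poly_Mapping.keys e \<subseteq> lp_basis d1 d2 d"
  shows "lp_coef \<phi> e = (if c1 = d1 \<and> c2 = d2 \<and> c = d then \<phi> e else 0)"
proof -
  note z = lp_dual_support[OF assms(1), of _ 1]
  have l: "Poly_Mapping.lookup e b = 0" if "b \<notin> lp_basis d1 d2 d" for b
    using assms(2) that by (auto simp: in_keys_iff)
  show ?thesis
  proof (cases "c1 = d1 \<and> c2 = d2 \<and> c = d")
    case True
    then have k: "Poly_Mapping.keys e \<subseteq> lp_basis c1 c2 c" using assms(2) by simp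
    show ?thesis
    proof (cases "lp_basis c1 c2 c = {}")
      case e: True
      have "\<phi> e = 0" using fun_cong[OF lp_dual_expansion(1)[OF assms(1) e], of e] by simp
      then show ?thesis using True e by (simp add: lp_coef_def z)
    next
      case False
      have 1: "\<phi> e = \<phi> (delta b) * Poly_Mapping.lookup e b" if "lp_basis c1 c2 c = {b}" for b
        using fun_cong[OF lp_dual_expansion(2)[OF assms(1) that], of e] k by (simp add: lp_coord_def)
      have 2: "\<phi> e = \<phi> (delta b) * Poly_Mapping.lookup e b + \<phi> (delta b') * Poly_Mapping.lookup e b'"
        if "lp_basis c1 c2 c = {b, b'}" "b \<noteq> b'" for b b'
        using fun_cong[OF lp_dual_expansion(3)[OF assms(1) that], of e] k by (simp add: lp_coord_def)
      show ?thesis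
        using True False 1[of L2] 1[of N11] 1[of N11'] 2[of N02 N02']
        by (cases c1; cases c2; cases c) (simp_all add: lp_coef_def z)
    qed
  next
    case False
    then show ?thesis
      by (cases c1; cases c2; cases c; cases d1; cases d2; cases d) (simp_all add: lp_coef_def z l)
  qed
qed

section \<open>Trees with three leaves and their comb forms\<close>

lemma leaves_length_pos: "1 \<le> length (leaves t)"
  by (simp add: Suc_le_eq)

lemma leaves_length_1: "length (leaves t) = Suc 0 \<longleftrightarrow> (\<exists>i. t = Leaf i)"
proof (cases t)
  case (Node c1 c2 e u v)
  then have "length (leaves t) \<noteq> Suc 0"
    using leaves_length_pos[of u] leaves_length_pos[of v] unfolding Node leaves.simps length_append by arith
  then show ?thesis using Node by auto
qed simp

lemma leaves_length_2: "length (leaves t) = 2 \<Longrightarrow> \<exists>c1 c2 e i j. t = Node c1 c2 e (Leaf i) (Leaf j)"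
proof (cases t)
  case (Node c1 c2 e u v)
  assume "length (leaves t) = 2"
  then have "length (leaves u) = Suc 0" "length (leaves v) = Suc 0"
    using leaves_length_pos[of u] leaves_length_pos[of v] unfolding Node leaves.simps length_append by arith+
  then show ?thesis using Node by (auto simp: leaves_length_1)
qed simp

lemma tree3_cases:
  assumes t: "t \<in> s_comp (tree_operad E) cs c" and len: "length cs = 3"
  obtains d1 d2 e a b f i j k where
    "(i, j, k) \<in> {(0, 1, 2), (0, 2, 1), (1, 0, 2), (1, 2, 0), (2, 0, 1), (2, 1, 0)}"
    "t = Node d1 d2 e (Node a b f (Leaf i) (Leaf j)) (Leaf k) \<and> d2 = cs ! k \<and>
      f \<in> carrier (gens E a b d1) \<or>
     t = Node d1 d2 e (Leaf k) (Node a b f (Leaf i) (Leaf j)) \<and> d1 = cs ! k \<and>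
      f \<in> carrier (gens E a b d2)"
    "e \<in> carrier (gens E d1 d2 c)" "a = cs ! i" "b = cs ! j"
proof -
  have l: "distinct (leaves t)" "set (leaves t) = {0, 1, 2}" and wc: "well_colored E cs c t"
    using t len by (simp_all add: numeral_3_eq_3 lessThan_Suc insert_commute numeral_2_eq_2)
  have l3: "length (leaves t) = 3"
    using distinct_card[OF l(1)] l(2) by simp
  then obtain d1 d2 e u v where tn: "t = Node d1 d2 e u v"
    by (cases t) auto
  have "length (leaves u) = 2 \<and> length (leaves v) = Suc 0 \<or> length (leaves v) = 2 \<and> length (leaves u) = Suc 0"
    using l3 leaves_length_pos[of u] leaves_length_pos[of v] unfolding tn leaves.simps length_append by arith
  then consider "length (leaves u) = 2" "length (leaves v) = Suc 0" | "length (leaves v) = 2" "length (leaves u) = Suc 0"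
    by blast
  then show thesis
  proof cases
    case 1
    then obtain a b f i j k where uv: "u = Node a b f (Leaf i) (Leaf j)" "v = Leaf k"
      using leaves_length_1 leaves_length_2 by metis
    have d: "distinct [i, j, k]" and s: "{i, j, k} = {0, 1, 2}" using l by (simp_all add: tn uv)
    have "i \<in> {0, 1, 2}" "j \<in> {0, 1, 2}" "k \<in> {0, 1, 2}" unfolding s[symmetric] by simp_all
    then have ijk: "(i, j, k) \<in> {(0, 1, 2), (0, 2, 1), (1, 0, 2), (1, 2, 0), (2, 0, 1), (2, 1, 0)}"
      using d by auto
    show thesis by (rule that[OF ijk, of d1 d2 e a b f]) (use wc in \<open>simp_all add: tn uv\<close>)
  next
    case 2
    then obtain a b f i j k where uv: "v = Node a b f (Leaf i) (Leaf j)" "u = Leaf k"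
      using leaves_length_1 leaves_length_2 by metis
    have d: "distinct [k, i, j]" and s: "{k, i, j} = {0, 1, 2}" using l by (simp_all add: tn uv)
    have "i \<in> {0, 1, 2}" "j \<in> {0, 1, 2}" "k \<in> {0, 1, 2}" unfolding s[symmetric] by simp_all
    then have ijk: "(i, j, k) \<in> {(0, 1, 2), (0, 2, 1), (1, 0, 2), (1, 2, 0), (2, 0, 1), (2, 1, 0)}"
      using d by auto
    show thesis by (rule that[OF ijk, of d1 d2 e a b f]) (use wc in \<open>simp_all add: tn uv\<close>)
  qed
qed

definition other_inputs :: "nat \<Rightarrow> nat \<times> nat" where
  "other_inputs k = (if k = 0 then (1, 2) else if k = 1 then (0, 2) else (0, 1))"

text \<open>A relabelling keeps the outer vertex and transposes the inner one exactly if it reverses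
  the inputs \<open>p < q\<close>; the last clause prepares the equivariance of the pairing.\<close>

lemma comb_form_cases:
  assumes t: "t \<in> s_comp (tree_operad E) cs c" and len: "length cs = 3"
    and closed: "\<And>c1 c2 c e. e \<in> carrier (gens E c1 c2 c) \<Longrightarrow> swap E c1 c2 c e \<in> carrier (gens E c2 c1 c)"
    and invol: "\<And>c1 c2 c e. e \<in> carrier (gens E c1 c2 c) \<Longrightarrow> swap E c2 c1 c (swap E c1 c2 c e) = e"
  obtains d k e f p q where "comb_form E c t = (d, k, e, f)" "k < 3" "(p, q) = other_inputs k"
    "e \<in> carrier (gens E d (cs ! k) c)" "f \<in> carrier (gens E (cs ! p) (cs ! q) d)"
    "\<And>\<pi>. inj \<pi> \<Longrightarrow> comb_form E c (relabel \<pi> t) =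
      (d, \<pi> k, e, if \<pi> p < \<pi> q then f else swap E (cs ! p) (cs ! q) d f)"
proof -
  obtain d1 d2 e a b f i j k where
    ijk: "(i, j, k) \<in> {(0, 1, 2), (0, 2, 1), (1, 0, 2), (1, 2, 0), (2, 0, 1), (2, 1, 0)}"
    and sh: "t = Node d1 d2 e (Node a b f (Leaf i) (Leaf j)) (Leaf k) \<and> d2 = cs ! k \<and>
      f \<in> carrier (gens E a b d1) \<or>
     t = Node d1 d2 e (Leaf k) (Node a b f (Leaf i) (Leaf j)) \<and> d1 = cs ! k \<and>
      f \<in> carrier (gens E a b d2)"
    and e: "e \<in> carrier (gens E d1 d2 c)" "a = cs ! i" "b = cs ! j"
    using tree3_cases[OF t len] by metis
  let ?p = "min i j" and ?q = "max i j"
  have k: "k < 3" "(?p, ?q) = other_inputs k" and ij: "i \<noteq> j"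
    using ijk by (auto simp: other_inputs_def)
  have lt: "\<pi> i < \<pi> j \<longleftrightarrow> \<not> \<pi> j < \<pi> i" if "inj \<pi>" for \<pi> :: "nat \<Rightarrow> nat"
    using injD[OF that, of i j] ij by (metis less_asym linorder_neqE_nat)
  show thesis
    using sh
  proof
    assume s: "t = Node d1 d2 e (Node a b f (Leaf i) (Leaf j)) (Leaf k) \<and> d2 = cs ! k \<and> f \<in> carrier (gens E a b d1)"
    let ?f = "if i < j then f else swap E a b d1 f"
    show thesis
      by (rule that[of d1 k e ?f ?p ?q])
        (use s e k ij lt closed invol in \<open>auto simp: min_def max_def\<close>)
  next
    assume s: "t = Node d1 d2 e (Leaf k) (Node a b f (Leaf i) (Leaf j)) \<and> d1 = cs ! k \<and> f \<in> carrier (gens E a b d2)"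
    let ?f = "if i < j then f else swap E a b d2 f"
    show thesis
      by (rule that[of d2 k "swap E d1 d2 c e" ?f ?p ?q])
        (use s e k ij lt closed invol in \<open>auto simp: min_def max_def\<close>)
  qed
qed

text \<open>Values are placed in the free module on one element, so that the calculus of
  \<open>lin\<close> applies to the pairing.\<close>

lemma pairing_lin:
  "pairing E c f g =
    Poly_Mapping.lookup (lin (\<lambda>t. lin (\<lambda>u. Poly_Mapping.single () (tree_pairing E c t u)) g) f) ()"
  by (simp add: pairing_def lin_def smul_sum lookup_sum mult.assoc sum_distrib_left)

text \<open>
  The pairing with a fixed dual comb \<open>\<phi>(\<psi>(p, q), k)\<close> is an evaluation in an algebra with
  basis \<open>0, \<dots>, 4\<close>: the first three elements are the inputs, \<open>3\<close> collects the coefficient of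
  the inner and \<open>4\<close> that of the outer vertex.
\<close>

definition comb_product ::
  "((lp_gen \<Rightarrow>\<^sub>0 'k::field) \<Rightarrow> 'k) \<Rightarrow> ((lp_gen \<Rightarrow>\<^sub>0 'k) \<Rightarrow> 'k) \<Rightarrow> nat \<Rightarrow> (lp_gen \<Rightarrow>\<^sub>0 'k) \<Rightarrow> nat \<Rightarrow> nat \<Rightarrow> nat \<Rightarrow>\<^sub>0 'k"
  where "comb_product \<phi> \<psi> k e x y =
    Poly_Mapping.single 3 (if (x, y) = other_inputs k then lp_coef \<psi> e
      else if (y, x) = other_inputs k then lp_coef \<psi> (lin lp_transpose e) else 0) +
    Poly_Mapping.single 4 (if x = 3 \<and> y = k then lp_coef \<phi> e
      else if x = k \<and> y = 3 then lp_coef \<phi> (lin lp_transpose e) else 0)"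

lemma nested_if_linear:
  fixes a b c d :: "'k::field"
  shows "(if P then a + b else if Q then c + d else 0) =
    (if P then a else if Q then c else 0) + (if P then b else if Q then d else 0)"
    and "(if P then l * a else if Q then l * c else 0) = l * (if P then a else if Q then c else 0)"
  by simp_all

lemma comb_product_add: "comb_product \<phi> \<psi> k (e + e') x y = comb_product \<phi> \<psi> k e x y + comb_product \<phi> \<psi> k e' x y"
  unfolding comb_product_def lin_add lp_coef_linear nested_if_linear single_add
  by (simp only: ac_simps)

lemma comb_product_smul: "comb_product \<phi> \<psi> k (smul a e) x y = smul a (comb_product \<phi> \<psi> k e x y)"
  unfolding comb_product_def lin_smul lp_coef_linear nested_if_linear smul_algebra smul_single ..

text \<open>\<open>k < 3\<close> keeps the input \<open>k\<close> apart from the marker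
  \<open>3\<close>, so that the two alternatives for the outer vertex exclude each other.\<close>

lemma comb_product_swap:
  assumes "k < 3"
  shows "comb_product \<phi> \<psi> k (lin lp_transpose e) x y = comb_product \<phi> \<psi> k e y x"
proof -
  have "\<not> ((x, y) = other_inputs k \<and> (y, x) = other_inputs k)"
    by (auto simp: other_inputs_def)
  then show ?thesis
    using assms unfolding comb_product_def by (intro arg_cong2[of _ _ _ _ "(+)"]) auto
qed

lemma free_rels_comb_eval:
  assumes "k < 3" "f \<in> free_rels (lp_gens :: ('k::field, _) binary) cs c"
  shows "lin (eval_tree (comb_product \<phi> \<psi> k) a) f = 0"
  using assms(2) unfolding free_rels_def
proof (elim UnE CollectE exE conjE)
  fix c1 c2 e
  assume f: "f = delta (Node c1 c2 e (Leaf 1) (Leaf 0)) - delta (Node c2 c1 (swap lp_gens c1 c2 c e) (Leaf 0) (Leaf 1))"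
  have "lin (\<lambda>x. lin (comb_product \<phi> \<psi> k e x) (a 0)) (a 1) =
      lin (\<lambda>y. lin (\<lambda>x. comb_product \<phi> \<psi> k e x y) (a 1)) (a 0)"
    by (rule lin_fun_lin)
  moreover have "comb_product \<phi> \<psi> k (lin lp_transpose e) x = (\<lambda>y. comb_product \<phi> \<psi> k e y x)" for x
    using comb_product_swap[OF assms(1)] by blast
  ultimately show ?thesis
    by (simp add: f)
next
  fix c1 c2 e e'
  assume f: "f = delta (Node c1 c2 (e \<oplus>\<^bsub>gens lp_gens c1 c2 c\<^esub> e') (Leaf 0) (Leaf 1)) -
      delta (Node c1 c2 e (Leaf 0) (Leaf 1)) - delta (Node c1 c2 e' (Leaf 0) (Leaf 1))"
  have "comb_product \<phi> \<psi> k (e + e') x = (\<lambda>y. comb_product \<phi> \<psi> k e x y + comb_product \<phi> \<psi> k e' x y)" for x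
    using comb_product_add by blast
  then show ?thesis
    by (simp add: f)
next
  fix c1 c2 l e
  assume f: "f = delta (Node c1 c2 (l \<odot>\<^bsub>gens lp_gens c1 c2 c\<^esub> e) (Leaf 0) (Leaf 1)) -
      Poly_Mapping.single (Node c1 c2 e (Leaf 0) (Leaf 1)) l"
  have "comb_product \<phi> \<psi> k (smul l e) x = (\<lambda>y. smul l (comb_product \<phi> \<psi> k e x y))" for x
    using comb_product_smul by blast
  then show ?thesis
    by (simp add: f)
qed

lemma free_ideal_comb_eval:
  assumes "k < 3" "f \<in> free_ideal (lp_gens :: ('k::field, _) binary) cs c"
  shows "lin (eval_tree (comb_product \<phi> \<psi> k) a) f = 0"
proof -
  let ?K = "\<lambda>cs c. {f. Poly_Mapping.keys f \<subseteq> s_comp (tree_operad (lp_gens :: ('k, _) binary)) cs c \<and>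
    (\<forall>a. lin (eval_tree (comb_product \<phi> \<psi> k) a) f = 0)}"
  have "free_rels (lp_gens :: ('k, _) binary) \<le> ?K"
  proof (intro le_funI subsetI)
    fix cs c f assume f: "f \<in> free_rels (lp_gens :: ('k, _) binary) cs c"
    have "Poly_Mapping.keys f \<subseteq> s_comp (tree_operad lp_gens) cs c"
      by (rule free_rels_carrier[OF _ _ _ f]) (auto simp: keys_subsetI lp_swap_closed)
    then show "f \<in> ?K cs c"
      using free_rels_comb_eval[OF assms(1) f] by blast
  qed
  then have "free_ideal (lp_gens :: ('k, _) binary) \<le> ?K"
    unfolding free_ideal_def by (rule ideal_gen_least[OF eval_kernel_ideal])
  then show ?thesis
    using assms(2) unfolding le_fun_def by blast
qed

text \<open>Basis element \<open>4\<close> is reached only from an outer vertex that joins the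
  marker \<open>3\<close> with input \<open>k'\<close>, and \<open>3\<close> only from an inner
  vertex on the two other inputs.\<close>

lemma comb_eval:
  assumes t: "t \<in> s_comp (tree_operad (lp_gens :: ('k::field, _) binary)) cs c" and len: "length cs = 3"
    and k: "k' < 3" and comb: "comb_form lp_gens c t = (d, k, e, f)"
  shows "Poly_Mapping.lookup (eval_tree (comb_product \<phi> \<psi> k') delta t) 4 =
    (if k = k' then lp_coef \<phi> e * lp_coef \<psi> f else 0)"
proof -
  obtain d1 d2 e' a b f' i j l where
    ijl: "(i, j, l) \<in> {(0, 1, 2), (0, 2, 1), (1, 0, 2), (1, 2, 0), (2, 0, 1), (2, 1, 0)}"
    and sh: "t = Node d1 d2 e' (Node a b f' (Leaf i) (Leaf j)) (Leaf l) \<or>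
     t = Node d1 d2 e' (Leaf l) (Node a b f' (Leaf i) (Leaf j))"
    using tree3_cases[OF t len] by metis
  have k': "k' = 0 \<or> k' = 1 \<or> k' = 2" using k by auto
  show ?thesis
    using sh
  proof
    assume t: "t = Node d1 d2 e' (Node a b f' (Leaf i) (Leaf j)) (Leaf l)"
    show ?thesis
      using ijl k' comb unfolding t
      by (elim insertE disjE emptyE) (simp_all add: comb_product_def other_inputs_def lookup_add lookup_single del: single_one)
  next
    assume t: "t = Node d1 d2 e' (Leaf l) (Node a b f' (Leaf i) (Leaf j))"
    show ?thesis
      using ijl k' comb unfolding t
      by (elim insertE disjE emptyE) (simp_all add: comb_product_def other_inputs_def lookup_add lookup_single del: single_one)
  qed
qed

lemma comb_form_lp:
  assumes "t \<in> s_comp (tree_operad (lp_gens :: ('k::field, _) binary)) cs c" "length cs = 3"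
  obtains d k e f p q where "comb_form lp_gens c t = (d, k, e, f)" "k < 3" "(p, q) = other_inputs k"
    "Poly_Mapping.keys e \<subseteq> lp_basis d (cs ! k) c" "Poly_Mapping.keys f \<subseteq> lp_basis (cs ! p) (cs ! q) d"
    "\<And>\<pi>. inj \<pi> \<Longrightarrow> comb_form lp_gens c (relabel \<pi> t) =
      (d, \<pi> k, e, if \<pi> p < \<pi> q then f else lin lp_transpose f)"
proof -
  obtain d k e f p q where "comb_form lp_gens c t = (d, k, e, f)" "k < 3" "(p, q) = other_inputs k"
    "e \<in> carrier (gens lp_gens d (cs ! k) c)" "f \<in> carrier (gens lp_gens (cs ! p) (cs ! q) d)"
    "\<And>\<pi>. inj \<pi> \<Longrightarrow> comb_form lp_gens c (relabel \<pi> t) =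
      (d, \<pi> k, e, if \<pi> p < \<pi> q then f else swap lp_gens (cs ! p) (cs ! q) d f)"
    by (rule comb_form_cases[OF assms]) (auto simp: lp_swap_closed)
  then show thesis by (intro that[of d k e f p q]) simp_all
qed

lemma comb_form_dual:
  assumes "t \<in> s_comp (tree_operad (lp_dual :: ('k::field, _) binary)) cs c" "length cs = 3"
  obtains d k \<phi> \<psi> p q where "comb_form lp_dual c t = (d, k, \<phi>, \<psi>)" "k < 3" "(p, q) = other_inputs k"
    "\<phi> \<in> carrier (gens lp_dual d (cs ! k) c)" "\<psi> \<in> carrier (gens lp_dual (cs ! p) (cs ! q) d)"
    "\<And>\<pi>. inj \<pi> \<Longrightarrow> comb_form lp_dual c (relabel \<pi> t) =
      (d, \<pi> k, \<phi>, if \<pi> p < \<pi> q then \<psi> else swap lp_dual (cs ! p) (cs ! q) d \<psi>)"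
  by (rule comb_form_cases[OF assms lp_dual_swap_closed]) blast+

text \<open>For a fixed dual tree the pairing is, up to sign, the coefficient of \<open>4\<close> in
  a comb evaluation, which kills the free ideal. Hence the pairing descends to classes in its first
  argument; \<open>class_pairing\<close> chooses representatives and depends on this.\<close>

lemma pairing_free_ideal:
  assumes n: "n \<in> free_ideal (lp_gens :: ('k::field, _) binary) cs c"
    and nk: "Poly_Mapping.keys n \<subseteq> s_comp (tree_operad lp_gens) cs c"
    and g: "Poly_Mapping.keys g \<subseteq> s_comp (tree_operad lp_dual) cs c" and len: "length cs = 3"
  shows "pairing lp_gens c n g = 0"
proof -
  have "lin (\<lambda>t. Poly_Mapping.single () (tree_pairing lp_gens c t u)) n = 0" if u: "u \<in> Poly_Mapping.keys g" for u
  proof -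
    have u': "u \<in> s_comp (tree_operad lp_dual) cs c" using u g by blast
    obtain d' k' \<phi> \<psi> p' q' where cu: "comb_form lp_dual c u = (d', k', \<phi>, \<psi>)" "k' < 3" "(p', q') = other_inputs k'"
      "\<phi> \<in> carrier (gens lp_dual d' (cs ! k') c)" "\<psi> \<in> carrier (gens lp_dual (cs ! p') (cs ! q') d')"
      using comb_form_dual[OF u' len] by metis
    let ?ev = "eval_tree (comb_product \<phi> \<psi> k') delta"
    have eq: "tree_pairing lp_gens c t u = (- 1) ^ k' * Poly_Mapping.lookup (?ev t) 4"
      if t: "t \<in> s_comp (tree_operad lp_gens) cs c" for t
    proof -
      obtain d k e f p q where ct: "comb_form lp_gens c t = (d, k, e, f)" "k < 3" "(p, q) = other_inputs k"
        "Poly_Mapping.keys e \<subseteq> lp_basis d (cs ! k) c" "Poly_Mapping.keys f \<subseteq> lp_basis (cs ! p) (cs ! q) d"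
        using comb_form_lp[OF t len] by metis
      have "p = p' \<and> q = q'" if "k = k'"
        using ct(3) cu(3) that by (metis prod.inject)
      then show ?thesis
        unfolding comb_eval[OF t len cu(2) ct(1)] lp_coef_eq[OF cu(4) ct(4)] lp_coef_eq[OF cu(5) ct(5)]
        by (auto simp: tree_pairing_def ct(1) cu(1))
    qed
    have "lin (\<lambda>t. Poly_Mapping.single () (tree_pairing lp_gens c t u)) n =
        Poly_Mapping.single () ((- 1) ^ k' * Poly_Mapping.lookup (lin ?ev n) 4)"
      by (rule poly_mapping_eqI)
        (use eq nk in \<open>auto simp: lin_def lookup_sum sum_distrib_left mult.left_commute subset_iff
          simp del: tree_operad_simps intro!: sum.cong\<close>)
    then show ?thesis
      using free_ideal_comb_eval[OF cu(2) n] by simp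
  qed
  then have "lin (\<lambda>u. lin (\<lambda>t. Poly_Mapping.single () (tree_pairing lp_gens c t u)) n) g = lin (\<lambda>u. 0) g"
    by (rule lin_cong)
  then show ?thesis
    unfolding pairing_lin by (subst lin_fun_lin) simp
qed

text \<open>The signature of \<open>\<pi>\<close> on three letters: \<open>\<pi> 0\<close> counts
  the inversions with the first position, and the second factor accounts for an inversion of the
  other two.\<close>

definition perm_sign :: "(nat \<Rightarrow> nat) \<Rightarrow> 'k::field" where
  "perm_sign \<pi> = (- 1) ^ \<pi> 0 * (if \<pi> 1 < \<pi> 2 then 1 else - 1)"

lemma perm_sign_nonzero: "perm_sign \<pi> \<noteq> (0 :: 'k::field)"
  by (simp add: perm_sign_def)

lemma perm_sign_comb:
  assumes "\<pi> permutes {..<3}" "k < 3" "(p, q) = other_inputs k"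
  shows "(- 1) ^ \<pi> k * (if \<pi> p < \<pi> q then 1 else - 1) = (perm_sign \<pi> * (- 1) ^ k :: 'k::field)"
proof -
  have "\<pi> 0 < 3" "\<pi> 1 < 3" "\<pi> 2 < 3" "\<pi> 0 \<noteq> \<pi> 1" "\<pi> 0 \<noteq> \<pi> 2" "\<pi> 1 \<noteq> \<pi> 2"
    using permutes_in_image[OF assms(1)] inj_eq[OF permutes_inj[OF assms(1)]] by auto
  then have "(\<pi> 0, \<pi> 1, \<pi> 2) \<in> {(0, 1, 2), (0, 2, 1), (1, 0, 2), (1, 2, 0), (2, 0, 1), (2, 1, 0)}"
    unfolding insert_iff empty_iff prod.inject by presburger
  moreover have "(k, p, q) \<in> {(0, 1, 2), (1, 0, 2), (2, 0, 1)}"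
    using assms(2,3) by (auto simp: other_inputs_def)
  ultimately show ?thesis
    unfolding perm_sign_def by (elim insertE emptyE) simp_all
qed

text \<open>Reversing the inner inputs transposes both inner vertices, which costs a minus sign by
  the definition of \<open>dual_gens\<close>; together with the sign of the comb this is the
  signature of \<open>\<pi>\<close>.\<close>

lemma tree_pairing_relabel:
  assumes t: "t \<in> s_comp (tree_operad (lp_gens :: ('k::field, _) binary)) cs c"
    and u: "u \<in> s_comp (tree_operad lp_dual) cs c" and len: "length cs = 3" and \<pi>: "\<pi> permutes {..<3}"
  shows "tree_pairing lp_gens c (relabel \<pi> t) (relabel \<pi> u) = perm_sign \<pi> * tree_pairing lp_gens c t u"
proof -
  have inj: "inj \<pi>" using \<pi> by (rule permutes_inj)
  obtain d k e f p q where ct: "comb_form lp_gens c t = (d, k, e, f)" "k < 3" "(p, q) = other_inputs k"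
    "Poly_Mapping.keys e \<subseteq> lp_basis d (cs ! k) c" "Poly_Mapping.keys f \<subseteq> lp_basis (cs ! p) (cs ! q) d"
    and rt: "\<And>\<pi>. inj \<pi> \<Longrightarrow> comb_form lp_gens c (relabel \<pi> t) = (d, \<pi> k, e, if \<pi> p < \<pi> q then f else lin lp_transpose f)"
    using comb_form_lp[OF t len] by metis
  obtain d' k' \<phi> \<psi> p' q' where cu: "comb_form lp_dual c u = (d', k', \<phi>, \<psi>)" "k' < 3" "(p', q') = other_inputs k'"
    "\<phi> \<in> carrier (gens lp_dual d' (cs ! k') c)" "\<psi> \<in> carrier (gens lp_dual (cs ! p') (cs ! q') d')"
    and ru: "\<And>\<pi>. inj \<pi> \<Longrightarrow> comb_form lp_dual c (relabel \<pi> u) =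
      (d', \<pi> k', \<phi>, if \<pi> p' < \<pi> q' then \<psi> else swap lp_dual (cs ! p') (cs ! q') d' \<psi>)"
    using comb_form_dual[OF u len] by metis
  show ?thesis
  proof (cases "d = d' \<and> k = k'")
    case True
    then have pq: "p' = p" "q' = q" using ct(3) cu(3) by (metis prod.inject)+
    have "swap lp_dual (cs ! p) (cs ! q) d \<psi> (lin lp_transpose f) = - \<psi> f"
      using lp_swap_closed[OF ct(5)] by (simp add: dual_gens_def)
    then have "tree_pairing lp_gens c (relabel \<pi> t) (relabel \<pi> u) =
        ((- 1) ^ \<pi> k * (if \<pi> p < \<pi> q then 1 else - 1)) * \<phi> e * \<psi> f"
      using True by (simp add: tree_pairing_def rt[OF inj] ru[OF inj] pq)
    then show ?thesis
      unfolding perm_sign_comb[OF \<pi> ct(2,3)] using True by (simp add: tree_pairing_def ct(1) cu(1))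
  next
    case False
    then show ?thesis
      using injD[OF inj, of k k'] by (auto simp: tree_pairing_def rt[OF inj] ru[OF inj] ct(1) cu(1))
  qed
qed

lemma pairing_relabel:
  assumes f: "Poly_Mapping.keys f \<subseteq> s_comp (tree_operad (lp_gens :: ('k::field, _) binary)) cs c"
    and g: "Poly_Mapping.keys g \<subseteq> s_comp (tree_operad lp_dual) cs c"
    and len: "length cs = 3" and \<pi>: "\<pi> permutes {..<3}"
  shows "pairing lp_gens c (lin (\<lambda>t. delta (relabel \<pi> t)) f) (lin (\<lambda>t. delta (relabel \<pi> t)) g) =
    perm_sign \<pi> * pairing lp_gens c f g"
proof -
  have "lin (\<lambda>t. lin (\<lambda>u. Poly_Mapping.single () (tree_pairing lp_gens c (relabel \<pi> t) (relabel \<pi> u))) g) f =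
      lin (\<lambda>t. lin (\<lambda>u. smul (perm_sign \<pi>) (Poly_Mapping.single () (tree_pairing lp_gens c t u))) g) f"
    by (intro lin_cong)
      (unfold smul_single, subst tree_pairing_relabel[OF _ _ len \<pi>], use f g in blast, use f g in blast, rule refl)
  also have "\<dots> = smul (perm_sign \<pi>) (lin (\<lambda>t. lin (\<lambda>u. Poly_Mapping.single () (tree_pairing lp_gens c t u)) g) f)"
    by (simp only: lin_fun_smul)
  finally show ?thesis
    unfolding pairing_lin by (simp add: lin_lin)
qed

section \<open>The four relations as coefficients of the evaluation\<close>

definition word_coef :: "((lp_gen \<Rightarrow>\<^sub>0 'k::field) \<Rightarrow> 'k) \<Rightarrow> 'k" where
  "word_coef \<phi> = \<phi> (delta L2) + \<phi> (delta N02) + \<phi> (delta N11) - \<phi> (delta N11')"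

text \<open>Each of the two vertices contributes two orders, which gives four words. With the
  expansion at hand the pairing lemmas reduce to a finite check of trees.\<close>

lemma lookup_word_eval_3:
  fixes \<phi> \<psi> :: "(lp_gen \<Rightarrow>\<^sub>0 'k::field) \<Rightarrow> 'k"
  defines "v \<equiv> \<lambda>cs i. if cs ! i = Open then [i :: nat] else []"
  shows "Poly_Mapping.lookup (word_eval cs (Node d1 d2 \<phi> (Node a b \<psi> (Leaf i) (Leaf j)) (Leaf k))) w =
    (word_coef \<phi> * word_coef \<psi> when v cs i @ v cs j @ v cs k = w) +
    (- word_coef \<phi> * \<psi> (delta N02') when v cs j @ v cs i @ v cs k = w) +
    (- \<phi> (delta N02') * word_coef \<psi> when v cs k @ v cs i @ v cs j = w) +
    (\<phi> (delta N02') * \<psi> (delta N02') when v cs k @ v cs j @ v cs i = w)"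
    and "Poly_Mapping.lookup (word_eval cs (Node d1 d2 \<phi> (Leaf k) (Node a b \<psi> (Leaf i) (Leaf j)))) w =
    (word_coef \<phi> * word_coef \<psi> when v cs k @ v cs i @ v cs j = w) +
    (- word_coef \<phi> * \<psi> (delta N02') when v cs k @ v cs j @ v cs i = w) +
    (- \<phi> (delta N02') * word_coef \<psi> when v cs i @ v cs j @ v cs k = w) +
    (\<phi> (delta N02') * \<psi> (delta N02') when v cs j @ v cs i @ v cs k = w)"
  unfolding v_def word_coef_def[symmetric]
  by (simp_all add: word_product_def word_input_def lookup_add lookup_single when_def mult.commute flip: word_coef_def)

lemma pairing_delta:
  "pairing E c (f + g) (delta u) = pairing E c f (delta u) + pairing E c g (delta u)"
  "pairing E c (f - g) (delta u) = pairing E c f (delta u) - pairing E c g (delta u)"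
  "pairing E c (delta t) (delta u) = tree_pairing E c t u"
  by (simp_all add: pairing_lin lookup_add lookup_minus)

lemma lp_dual_values:
  "\<phi> \<in> carrier (gens (lp_dual :: ('k::field, _) binary) Closed Closed Closed) \<Longrightarrow>
    word_coef \<phi> = \<phi> (delta L2) \<and> \<phi> (delta N02') = 0 \<and> \<phi> (Poly_Mapping.single L2 (- 1)) = - \<phi> (delta L2)"
  "\<phi> \<in> carrier (gens (lp_dual :: ('k::field, _) binary) Open Open Open) \<Longrightarrow>
    word_coef \<phi> = \<phi> (delta N02)"
  "\<phi> \<in> carrier (gens (lp_dual :: ('k::field, _) binary) Closed Open Open) \<Longrightarrow>
    word_coef \<phi> = \<phi> (delta N11) \<and> \<phi> (delta N02') = 0"
  "\<phi> \<in> carrier (gens (lp_dual :: ('k::field, _) binary) Open Closed Open) \<Longrightarrow>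
    word_coef \<phi> = - \<phi> (delta N11') \<and> \<phi> (delta N02') = 0"
  "\<phi> \<in> carrier (gens (lp_dual :: ('k::field, _) binary) c1 c2 c) \<Longrightarrow> lp_basis c1 c2 c = {} \<Longrightarrow>
    word_coef \<phi> = 0 \<and> \<phi> (Poly_Mapping.single b k) = 0"
proof -
  show "\<phi> \<in> carrier (gens (lp_dual :: ('k::field, _) binary) Closed Closed Closed) \<Longrightarrow>
    word_coef \<phi> = \<phi> (delta L2) \<and> \<phi> (delta N02') = 0 \<and> \<phi> (Poly_Mapping.single L2 (- 1)) = - \<phi> (delta L2)"
    using lp_dual_support[of \<phi> Closed Closed Closed] lp_dual_single[of \<phi> Closed Closed Closed L2 "- 1"]
    by (simp add: word_coef_def)
  show "\<phi> \<in> carrier (gens (lp_dual :: ('k::field, _) binary) Open Open Open) \<Longrightarrow> word_coef \<phi> = \<phi> (delta N02)"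
    using lp_dual_support[of \<phi> Open Open Open] by (simp add: word_coef_def)
  show "\<phi> \<in> carrier (gens (lp_dual :: ('k::field, _) binary) Closed Open Open) \<Longrightarrow>
    word_coef \<phi> = \<phi> (delta N11) \<and> \<phi> (delta N02') = 0"
    using lp_dual_support[of \<phi> Closed Open Open] by (simp add: word_coef_def)
  show "\<phi> \<in> carrier (gens (lp_dual :: ('k::field, _) binary) Open Closed Open) \<Longrightarrow>
    word_coef \<phi> = - \<phi> (delta N11') \<and> \<phi> (delta N02') = 0"
    using lp_dual_support[of \<phi> Open Closed Open] by (simp add: word_coef_def)
  show "\<phi> \<in> carrier (gens (lp_dual :: ('k::field, _) binary) c1 c2 c) \<Longrightarrow> lp_basis c1 c2 c = {} \<Longrightarrow>
    word_coef \<phi> = 0 \<and> \<phi> (Poly_Mapping.single b k) = 0"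
    using lp_dual_support[of \<phi> c1 c2 c] by (simp add: word_coef_def)
qed

lemma tree3_induct:
  assumes "u \<in> s_comp (tree_operad E) cs c" "length cs = 3"
    and "\<And>d e f i j k. \<lbrakk>(i, j, k) \<in> {(0, 1, 2), (0, 2, 1), (1, 0, 2), (1, 2, 0), (2, 0, 1), (2, 1, 0)};
      e \<in> carrier (gens E d (cs ! k) c); f \<in> carrier (gens E (cs ! i) (cs ! j) d)\<rbrakk> \<Longrightarrow>
      Q (Node d (cs ! k) e (Node (cs ! i) (cs ! j) f (Leaf i) (Leaf j)) (Leaf k))"
    and "\<And>d e f i j k. \<lbrakk>(i, j, k) \<in> {(0, 1, 2), (0, 2, 1), (1, 0, 2), (1, 2, 0), (2, 0, 1), (2, 1, 0)};
      e \<in> carrier (gens E (cs ! k) d c); f \<in> carrier (gens E (cs ! i) (cs ! j) d)\<rbrakk> \<Longrightarrow>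
      Q (Node (cs ! k) d e (Leaf k) (Node (cs ! i) (cs ! j) f (Leaf i) (Leaf j)))"
  shows "Q u"
  using tree3_cases[OF assms(1,2)] assms(3,4) by metis

lemmas rel_pairing_simps = pairing_delta tree_pairing_def lookup_word_eval_3 lp_dual_swap when_def

text \<open>The third term of the Jacobi sum has comb sign \<open>-1\<close>, and its inner inputs
  descend, so that antisymmetry gives another \<open>-1\<close>. All three combs thus count with
  coefficient 1, as they do in the evaluation to the empty word.\<close>

lemma pairing_jacobi:
  assumes "u \<in> s_comp (tree_operad (lp_dual :: ('k::field, _) binary)) [Closed, Closed, Closed] Closed"
  shows "pairing lp_gens Closed (delta (lie (lie (Leaf 0) (Leaf 1)) (Leaf 2)) + delta (lie (lie (Leaf 1) (Leaf 2)) (Leaf 0))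
    + delta (lie (lie (Leaf 2) (Leaf 0)) (Leaf 1))) (delta u) =
    Poly_Mapping.lookup (word_eval [Closed, Closed, Closed] u) []"
  using assms
proof (rule tree3_induct)
  fix d i j k and \<phi> \<psi> :: "(lp_gen \<Rightarrow>\<^sub>0 'k) \<Rightarrow> 'k"
  let ?cs = "[Closed, Closed, Closed]"
  assume ijk: "(i, j, k) \<in> {(0, 1, 2), (0, 2, 1), (1, 0, 2), (1, 2, 0), (2, 0, 1), (2, 1, 0)}"
    and \<phi>: "\<phi> \<in> carrier (gens lp_dual d (?cs ! k) Closed)" and \<psi>: "\<psi> \<in> carrier (gens lp_dual (?cs ! i) (?cs ! j) d)"
  have c: "?cs ! i = Closed" "?cs ! j = Closed" "?cs ! k = Closed" using ijk by auto
  show "pairing lp_gens Closed (delta (lie (lie (Leaf 0) (Leaf 1)) (Leaf 2)) + delta (lie (lie (Leaf 1) (Leaf 2)) (Leaf 0))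
    + delta (lie (lie (Leaf 2) (Leaf 0)) (Leaf 1))) (delta (Node d (?cs ! k) \<phi> (Node (?cs ! i) (?cs ! j) \<psi> (Leaf i) (Leaf j)) (Leaf k))) =
    Poly_Mapping.lookup (word_eval ?cs (Node d (?cs ! k) \<phi> (Node (?cs ! i) (?cs ! j) \<psi> (Leaf i) (Leaf j)) (Leaf k))) []"
  proof (cases d)
    case Closed
    note v = lp_dual_values(1)[OF \<phi>[unfolded c Closed]] lp_dual_values(1)[OF \<psi>[unfolded c Closed]]
      lp_dual_values(1)[OF lp_dual_swap_closed(1)[OF \<psi>[unfolded c Closed]]]
    show ?thesis
      using ijk by (elim insertE emptyE; elim Pair_inject; hypsubst) (simp_all add: rel_pairing_simps v Closed del: eval_tree.simps)
  next
    case Open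
    note v = lp_dual_values(5)[OF \<psi>[unfolded c Open]]
    show ?thesis
      using ijk by (elim insertE emptyE; elim Pair_inject; hypsubst) (simp_all add: rel_pairing_simps v Open del: eval_tree.simps)
  qed
next
  fix d i j k and \<phi> \<psi> :: "(lp_gen \<Rightarrow>\<^sub>0 'k) \<Rightarrow> 'k"
  let ?cs = "[Closed, Closed, Closed]"
  assume ijk: "(i, j, k) \<in> {(0, 1, 2), (0, 2, 1), (1, 0, 2), (1, 2, 0), (2, 0, 1), (2, 1, 0)}"
    and \<phi>: "\<phi> \<in> carrier (gens lp_dual (?cs ! k) d Closed)" and \<psi>: "\<psi> \<in> carrier (gens lp_dual (?cs ! i) (?cs ! j) d)"
  have c: "?cs ! i = Closed" "?cs ! j = Closed" "?cs ! k = Closed" using ijk by auto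
  show "pairing lp_gens Closed (delta (lie (lie (Leaf 0) (Leaf 1)) (Leaf 2)) + delta (lie (lie (Leaf 1) (Leaf 2)) (Leaf 0))
    + delta (lie (lie (Leaf 2) (Leaf 0)) (Leaf 1))) (delta (Node (?cs ! k) d \<phi> (Leaf k) (Node (?cs ! i) (?cs ! j) \<psi> (Leaf i) (Leaf j)))) =
    Poly_Mapping.lookup (word_eval ?cs (Node (?cs ! k) d \<phi> (Leaf k) (Node (?cs ! i) (?cs ! j) \<psi> (Leaf i) (Leaf j)))) []"
  proof (cases d)
    case Closed
    note v = lp_dual_values(1)[OF \<phi>[unfolded c Closed]] lp_dual_values(1)[OF \<psi>[unfolded c Closed]]
      lp_dual_values(1)[OF lp_dual_swap_closed(1)[OF \<psi>[unfolded c Closed]]]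
    show ?thesis
      using ijk by (elim insertE emptyE; elim Pair_inject; hypsubst) (simp_all add: rel_pairing_simps v Closed del: eval_tree.simps)
  next
    case Open
    note v = lp_dual_values(5)[OF \<psi>[unfolded c Open]]
    show ?thesis
      using ijk by (elim insertE emptyE; elim Pair_inject; hypsubst) (simp_all add: rel_pairing_simps v Open del: eval_tree.simps)
  qed
qed simp_all

text \<open>The comb form of the second term has the transposed outer generator \<open>N02'\<close>,
  on which \<open>word_product\<close> carries the minus sign that this term has in the
  associativity relation.\<close>

lemma pairing_assoc:
  assumes "u \<in> s_comp (tree_operad (lp_dual :: ('k::field, _) binary)) [Open, Open, Open] Open"
  shows "pairing lp_gens Open (delta (prd (prd (Leaf 0) (Leaf 1)) (Leaf 2)) - delta (prd (Leaf 0) (prd (Leaf 1) (Leaf 2)))) (delta u) =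
    Poly_Mapping.lookup (word_eval [Open, Open, Open] u) [0, 1, 2]"
  using assms
proof (rule tree3_induct)
  fix d i j k and \<phi> \<psi> :: "(lp_gen \<Rightarrow>\<^sub>0 'k) \<Rightarrow> 'k"
  let ?cs = "[Open, Open, Open]"
  assume ijk: "(i, j, k) \<in> {(0, 1, 2), (0, 2, 1), (1, 0, 2), (1, 2, 0), (2, 0, 1), (2, 1, 0)}"
    and \<phi>: "\<phi> \<in> carrier (gens lp_dual d (?cs ! k) Open)" and \<psi>: "\<psi> \<in> carrier (gens lp_dual (?cs ! i) (?cs ! j) d)"
  show "pairing lp_gens Open (delta (prd (prd (Leaf 0) (Leaf 1)) (Leaf 2)) - delta (prd (Leaf 0) (prd (Leaf 1) (Leaf 2))))
      (delta (Node d (?cs ! k) \<phi> (Node (?cs ! i) (?cs ! j) \<psi> (Leaf i) (Leaf j)) (Leaf k))) =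
    Poly_Mapping.lookup (word_eval ?cs (Node d (?cs ! k) \<phi> (Node (?cs ! i) (?cs ! j) \<psi> (Leaf i) (Leaf j)) (Leaf k))) [0, 1, 2]"
    using ijk \<phi> \<psi>
    by (elim insertE emptyE; elim Pair_inject; hypsubst; cases d)
      (simp_all add: rel_pairing_simps lp_dual_values del: eval_tree.simps)
next
  fix d i j k and \<phi> \<psi> :: "(lp_gen \<Rightarrow>\<^sub>0 'k) \<Rightarrow> 'k"
  let ?cs = "[Open, Open, Open]"
  assume ijk: "(i, j, k) \<in> {(0, 1, 2), (0, 2, 1), (1, 0, 2), (1, 2, 0), (2, 0, 1), (2, 1, 0)}"
    and \<phi>: "\<phi> \<in> carrier (gens lp_dual (?cs ! k) d Open)" and \<psi>: "\<psi> \<in> carrier (gens lp_dual (?cs ! i) (?cs ! j) d)"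
  show "pairing lp_gens Open (delta (prd (prd (Leaf 0) (Leaf 1)) (Leaf 2)) - delta (prd (Leaf 0) (prd (Leaf 1) (Leaf 2))))
      (delta (Node (?cs ! k) d \<phi> (Leaf k) (Node (?cs ! i) (?cs ! j) \<psi> (Leaf i) (Leaf j)))) =
    Poly_Mapping.lookup (word_eval ?cs (Node (?cs ! k) d \<phi> (Leaf k) (Node (?cs ! i) (?cs ! j) \<psi> (Leaf i) (Leaf j)))) [0, 1, 2]"
    using ijk \<phi> \<psi>
    by (elim insertE emptyE; elim Pair_inject; hypsubst; cases d)
      (simp_all add: rel_pairing_simps lp_dual_values del: eval_tree.simps)
qed simp_all

text \<open>In comb form the first term has outer vertex \<open>N11'\<close>, which
  \<open>word_product\<close> counts negatively, while the other two terms enter the relation with a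
  minus sign; this is the source of the overall sign.\<close>

lemma pairing_derivation:
  assumes "u \<in> s_comp (tree_operad (lp_dual :: ('k::field, _) binary)) [Closed, Open, Open] Open"
  shows "pairing lp_gens Open (delta (der (Leaf 0) (prd (Leaf 1) (Leaf 2))) - delta (prd (der (Leaf 0) (Leaf 1)) (Leaf 2)) - delta (prd (Leaf 1) (der (Leaf 0) (Leaf 2)))) (delta u) =
    - Poly_Mapping.lookup (word_eval [Closed, Open, Open] u) [1, 2]"
  using assms
proof (rule tree3_induct)
  fix d i j k and \<phi> \<psi> :: "(lp_gen \<Rightarrow>\<^sub>0 'k) \<Rightarrow> 'k"
  let ?cs = "[Closed, Open, Open]"
  assume ijk: "(i, j, k) \<in> {(0, 1, 2), (0, 2, 1), (1, 0, 2), (1, 2, 0), (2, 0, 1), (2, 1, 0)}"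
    and \<phi>: "\<phi> \<in> carrier (gens lp_dual d (?cs ! k) Open)" and \<psi>: "\<psi> \<in> carrier (gens lp_dual (?cs ! i) (?cs ! j) d)"
  show "pairing lp_gens Open (delta (der (Leaf 0) (prd (Leaf 1) (Leaf 2))) - delta (prd (der (Leaf 0) (Leaf 1)) (Leaf 2)) - delta (prd (Leaf 1) (der (Leaf 0) (Leaf 2))))
      (delta (Node d (?cs ! k) \<phi> (Node (?cs ! i) (?cs ! j) \<psi> (Leaf i) (Leaf j)) (Leaf k))) =
    - Poly_Mapping.lookup (word_eval ?cs (Node d (?cs ! k) \<phi> (Node (?cs ! i) (?cs ! j) \<psi> (Leaf i) (Leaf j)) (Leaf k))) [1, 2]"
    using ijk \<phi> \<psi>
    by (elim insertE emptyE; elim Pair_inject; hypsubst; cases d)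
      (simp_all add: rel_pairing_simps lp_dual_values del: eval_tree.simps)
next
  fix d i j k and \<phi> \<psi> :: "(lp_gen \<Rightarrow>\<^sub>0 'k) \<Rightarrow> 'k"
  let ?cs = "[Closed, Open, Open]"
  assume ijk: "(i, j, k) \<in> {(0, 1, 2), (0, 2, 1), (1, 0, 2), (1, 2, 0), (2, 0, 1), (2, 1, 0)}"
    and \<phi>: "\<phi> \<in> carrier (gens lp_dual (?cs ! k) d Open)" and \<psi>: "\<psi> \<in> carrier (gens lp_dual (?cs ! i) (?cs ! j) d)"
  show "pairing lp_gens Open (delta (der (Leaf 0) (prd (Leaf 1) (Leaf 2))) - delta (prd (der (Leaf 0) (Leaf 1)) (Leaf 2)) - delta (prd (Leaf 1) (der (Leaf 0) (Leaf 2))))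
      (delta (Node (?cs ! k) d \<phi> (Leaf k) (Node (?cs ! i) (?cs ! j) \<psi> (Leaf i) (Leaf j)))) =
    - Poly_Mapping.lookup (word_eval ?cs (Node (?cs ! k) d \<phi> (Leaf k) (Node (?cs ! i) (?cs ! j) \<psi> (Leaf i) (Leaf j)))) [1, 2]"
    using ijk \<phi> \<psi>
    by (elim insertE emptyE; elim Pair_inject; hypsubst; cases d)
      (simp_all add: rel_pairing_simps lp_dual_values del: eval_tree.simps)
qed simp_all

text \<open>In comb form both nested actions have \<open>N11'\<close> outside. The comb sign
  \<open>-1\<close> of the one with \<open>k = 1\<close> makes up for its opposite sign in the
  relation.\<close>

lemma pairing_lie_action:
  assumes "u \<in> s_comp (tree_operad (lp_dual :: ('k::field, _) binary)) [Closed, Closed, Open] Open"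
  shows "pairing lp_gens Open (delta (der (lie (Leaf 0) (Leaf 1)) (Leaf 2)) - delta (der (Leaf 0) (der (Leaf 1) (Leaf 2))) + delta (der (Leaf 1) (der (Leaf 0) (Leaf 2)))) (delta u) =
    Poly_Mapping.lookup (word_eval [Closed, Closed, Open] u) [2]"
  using assms
proof (rule tree3_induct)
  fix d i j k and \<phi> \<psi> :: "(lp_gen \<Rightarrow>\<^sub>0 'k) \<Rightarrow> 'k"
  let ?cs = "[Closed, Closed, Open]"
  assume ijk: "(i, j, k) \<in> {(0, 1, 2), (0, 2, 1), (1, 0, 2), (1, 2, 0), (2, 0, 1), (2, 1, 0)}"
    and \<phi>: "\<phi> \<in> carrier (gens lp_dual d (?cs ! k) Open)" and \<psi>: "\<psi> \<in> carrier (gens lp_dual (?cs ! i) (?cs ! j) d)"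
  show "pairing lp_gens Open (delta (der (lie (Leaf 0) (Leaf 1)) (Leaf 2)) - delta (der (Leaf 0) (der (Leaf 1) (Leaf 2))) + delta (der (Leaf 1) (der (Leaf 0) (Leaf 2))))
      (delta (Node d (?cs ! k) \<phi> (Node (?cs ! i) (?cs ! j) \<psi> (Leaf i) (Leaf j)) (Leaf k))) =
    Poly_Mapping.lookup (word_eval ?cs (Node d (?cs ! k) \<phi> (Node (?cs ! i) (?cs ! j) \<psi> (Leaf i) (Leaf j)) (Leaf k))) [2]"
    using ijk \<phi> \<psi>
    by (elim insertE emptyE; elim Pair_inject; hypsubst; cases d)
      (simp_all add: rel_pairing_simps lp_dual_values del: eval_tree.simps)
next
  fix d i j k and \<phi> \<psi> :: "(lp_gen \<Rightarrow>\<^sub>0 'k) \<Rightarrow> 'k"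
  let ?cs = "[Closed, Closed, Open]"
  assume ijk: "(i, j, k) \<in> {(0, 1, 2), (0, 2, 1), (1, 0, 2), (1, 2, 0), (2, 0, 1), (2, 1, 0)}"
    and \<phi>: "\<phi> \<in> carrier (gens lp_dual (?cs ! k) d Open)" and \<psi>: "\<psi> \<in> carrier (gens lp_dual (?cs ! i) (?cs ! j) d)"
  show "pairing lp_gens Open (delta (der (lie (Leaf 0) (Leaf 1)) (Leaf 2)) - delta (der (Leaf 0) (der (Leaf 1) (Leaf 2))) + delta (der (Leaf 1) (der (Leaf 0) (Leaf 2))))
      (delta (Node (?cs ! k) d \<phi> (Leaf k) (Node (?cs ! i) (?cs ! j) \<psi> (Leaf i) (Leaf j)))) =
    Poly_Mapping.lookup (word_eval ?cs (Node (?cs ! k) d \<phi> (Leaf k) (Node (?cs ! i) (?cs ! j) \<psi> (Leaf i) (Leaf j)))) [2]"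
    using ijk \<phi> \<psi>
    by (elim insertE emptyE; elim Pair_inject; hypsubst; cases d)
      (simp_all add: rel_pairing_simps lp_dual_values del: eval_tree.simps)
qed simp_all

text \<open>All relations are listed with closed inputs first, so the coefficient is always that of
  the increasing word of open inputs. Of the sign \<open>\<epsilon>\<close> orthogonality only needs
  that it is nonzero.\<close>

lemma lp_rels_pairing:
  assumes r: "r \<in> (lp_rels cs c :: ((lp_gen \<Rightarrow>\<^sub>0 'k::field) tree \<Rightarrow>\<^sub>0 'k) set)"
  obtains \<epsilon> :: "'k::field" where "\<epsilon> \<noteq> 0" "\<And>u. u \<in> s_comp (tree_operad lp_dual) cs c \<Longrightarrow>
    pairing lp_gens c r (delta u) = \<epsilon> * Poly_Mapping.lookup (word_eval cs u) (filter (\<lambda>i. cs ! i = Open) [0, 1, 2])"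
proof -
  consider "cs = [Closed, Closed, Closed]" "c = Closed" | "cs = [Open, Open, Open]" "c = Open"
    | "cs = [Closed, Open, Open]" "c = Open" | "cs = [Closed, Closed, Open]" "c = Open"
    using r by (auto simp: lp_rels_def split: if_splits)
  then show thesis
  proof cases
    case 1
    show thesis
      by (rule that[of 1]) (use r pairing_jacobi in \<open>simp_all add: 1 lp_rels_def del: tree_operad_simps\<close>)
  next
    case 2
    show thesis
      by (rule that[of 1]) (use r pairing_assoc in \<open>simp_all add: 2 lp_rels_def del: tree_operad_simps\<close>)
  next
    case 3
    show thesis
      by (rule that[of "- 1"]) (use r pairing_derivation in \<open>simp_all add: 3 lp_rels_def del: tree_operad_simps\<close>)
  next
    case 4
    show thesis
      by (rule that[of 1]) (use r pairing_lie_action in \<open>simp_all add: 4 lp_rels_def del: tree_operad_simps\<close>)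
  qed
qed

section \<open>The Koszul dual of the operad of Leibniz pairs\<close>

context linear_operad
begin

context
  fixes I :: "'a family"
  assumes I: "operad_ideal P I"
begin

text \<open>The relations of \<open>LP\<close> live in a quotient, while the bound
  \<open>pairing_kernel\<close> for them is found on trees and has to be carried down.\<close>

lemma sub_collection_image:
  assumes S: "sub_collection P S"
  shows "sub_collection (quot_operad P I) (\<lambda>cs c. (\<lambda>a. I cs c +>\<^bsub>o_comp P cs c\<^esub> a) ` S cs c)"
proof -
  have sub: "submodule (S cs c) scalars (o_comp P cs c)" for cs c
    using S unfolding sub_collection_def by blast
  have act: "\<sigma> permutes {..<length cs} \<Longrightarrow> x \<in> S cs c \<Longrightarrow> o_act P cs c \<sigma> x \<in> S (permute_list \<sigma> cs) c" for cs c \<sigma> x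
    using S unfolding sub_collection_def by blast
  have "submodule ((\<lambda>a. I cs c +>\<^bsub>o_comp P cs c\<^esub> a) ` S cs c) scalars (o_comp (quot_operad P I) cs c)" for cs c
  proof -
    interpret M: module scalars "o_comp P cs c" by (rule comp_module)
    interpret J: abelian_subgroup "I cs c" "o_comp P cs c" by (rule ideal_subgroup[OF I])
    let ?Q = "o_comp (quot_operad P I) cs c" and ?q = "\<lambda>a. I cs c +>\<^bsub>o_comp P cs c\<^esub> a"
    interpret Q: abelian_group ?Q by (rule closed_operadD[OF closed_quot_operad[OF I]])
    note E = M.submoduleE[OF sub]
    have c: "a \<in> S cs c \<Longrightarrow> a \<in> carrier (o_comp P cs c)" for a using E(1) by blast
    have z: "\<zero>\<^bsub>o_comp P cs c\<^esub> \<in> S cs c"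
      using sub[of cs c] subgroup.one_closed[of "S cs c" "add_monoid (o_comp P cs c)"] by (simp add: submodule_def)
    have m: "?q (\<ominus>\<^bsub>o_comp P cs c\<^esub> a) = \<ominus>\<^bsub>?Q\<^esub> ?q a" if "a \<in> S cs c" for a
    proof (rule Q.minus_equality[symmetric])
      show "?q (\<ominus>\<^bsub>o_comp P cs c\<^esub> a) \<oplus>\<^bsub>?Q\<^esub> ?q a = \<zero>\<^bsub>?Q\<^esub>"
        using c[OF that] by (simp add: quot_add[OF I] M.l_neg quot_zero[OF I] J.a_subset)
    qed (use c[OF that] in \<open>auto simp: quot_carrier[OF I]\<close>)
    have "subgroup (?q ` S cs c) (add_monoid ?Q)"
    proof (rule group.subgroupI[OF Q.a_group])
      show "?q ` S cs c \<subseteq> carrier (add_monoid ?Q)"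
        using E(1) by (auto simp: quot_carrier[OF I])
      show "?q ` S cs c \<noteq> {}" using z by blast
    next
      fix x assume "x \<in> ?q ` S cs c"
      then show "inv\<^bsub>add_monoid ?Q\<^esub> x \<in> ?q ` S cs c"
        using m E(3) by (auto simp flip: a_inv_def m)
    next
      fix x y assume "x \<in> ?q ` S cs c" "y \<in> ?q ` S cs c"
      then show "x \<otimes>\<^bsub>add_monoid ?Q\<^esub> y \<in> ?q ` S cs c"
        using E(5) by (auto simp: quot_add[OF I] c)
    qed
    moreover have "k \<odot>\<^bsub>?Q\<^esub> x \<in> ?q ` S cs c" if "x \<in> ?q ` S cs c" for k x
      using that E(4)[of k] by (auto simp: quot_smult[OF I] c)
    ultimately show ?thesis
      by (auto simp: submodule_def submodule_axioms_def)
  qed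
  moreover have "S cs c \<subseteq> carrier (o_comp P cs c)" for cs c
    using module.submoduleE(1)[OF comp_module sub] .
  ultimately show ?thesis
    unfolding sub_collection_def using act by (auto simp: quot_act[OF I] subset_iff)
qed

lemma operad_ideal_image:
  assumes K: "operad_ideal P K"
  shows "operad_ideal (quot_operad P I) (\<lambda>cs c. (\<lambda>a. I cs c +>\<^bsub>o_comp P cs c\<^esub> a) ` K cs c)"
proof -
  have "sub_collection (quot_operad P I) (\<lambda>cs c. (\<lambda>a. I cs c +>\<^bsub>o_comp P cs c\<^esub> a) ` K cs c)"
    using K unfolding operad_ideal_def by (intro sub_collection_image) blast
  then show ?thesis
    unfolding operad_ideal_def
  proof (intro conjI allI ballI impI)
    fix cs c i ds x y
    let ?q = "\<lambda>cs c a. I cs c +>\<^bsub>o_comp P cs c\<^esub> a"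
    assume i: "i < length cs" and x: "x \<in> carrier (o_comp (quot_operad P I) cs c)"
      and y: "y \<in> carrier (o_comp (quot_operad P I) ds (cs ! i))"
      and "x \<in> ?q cs c ` K cs c \<or> y \<in> ?q ds (cs ! i) ` K ds (cs ! i)"
    then obtain a b where ab: "a \<in> carrier (o_comp P cs c)" "b \<in> carrier (o_comp P ds (cs ! i))"
      "x = ?q cs c a" "y = ?q ds (cs ! i) b" "a \<in> K cs c \<or> b \<in> K ds (cs ! i)"
      using operad_idealD(6)[OF K] unfolding quot_carrier[OF I] by blast
    then have "o_circ P cs c i ds a b \<in> K (splice_in cs i ds) c"
      using operad_idealD(3,4)[OF K i] by blast
    then show "o_circ (quot_operad P I) cs c i ds x y \<in> ?q (splice_in cs i ds) c ` K (splice_in cs i ds) c"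
      using ab i by (simp add: quot_circ[OF I])
  qed
qed

end

end

interpretation trees: linear_operad "linearization (tree_operad E) :: ('k::field, 'e tree \<Rightarrow>\<^sub>0 'k) operad" for E
  by (rule linear_operad_linearization[OF closed_tree_operad])

interpretation words: linear_operad "linearization word_operad :: ('k::field, _) operad"
  by (rule linear_operad_linearization[OF closed_word_operad])

section \<open>The kernel of word evaluation and the free operad on the dual generators\<close>

definition word_kernel :: "(((lp_gen \<Rightarrow>\<^sub>0 'k::field) \<Rightarrow> 'k) tree \<Rightarrow>\<^sub>0 'k) family" where
  "word_kernel cs c = {f. Poly_Mapping.keys f \<subseteq> s_comp (tree_operad lp_dual) cs c \<and> lin (word_eval cs) f = 0}"

lemma word_kernel_ideal:
  "operad_ideal (linearization (tree_operad lp_dual) :: ('k::field, _) operad) word_kernel"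
proof -
  have eq: "word_kernel = (\<lambda>cs c. {x \<in> carrier (o_comp (linearization (tree_operad lp_dual) :: ('k, _) operad) cs c).
      lin (word_eval cs) x = \<zero>\<^bsub>o_comp (linearization word_operad) cs c\<^esub>})"
    by (intro ext) (simp add: word_kernel_def linearization_simps del: tree_operad_simps word_operad_simps)
  show ?thesis
    unfolding eq by (rule trees.operad_ideal_kernel[OF words.linear_operad_axioms operad_map_word_eval])
qed

lemma free_rels_word_kernel: "free_rels (lp_dual :: ('k::field, _) binary) \<le> word_kernel"
proof (intro le_funI subsetI)
  fix cs c f assume f: "f \<in> free_rels (lp_dual :: ('k, _) binary) cs c"
  have "Poly_Mapping.keys f \<subseteq> s_comp (tree_operad lp_dual) cs c"
    by (rule free_rels_carrier[OF lp_dual_swap_closed(1) lp_dual_closed(1) lp_dual_closed(2) f])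
  then show "f \<in> word_kernel cs c"
    using word_eval_free_rels[OF f] by (simp add: word_kernel_def del: tree_operad_simps)
qed

lemma free_ideal_dual: "operad_ideal (linearization (tree_operad lp_dual) :: ('k::field, _) operad) (free_ideal lp_dual)"
  unfolding free_ideal_def by (rule trees.operad_ideal_ideal_gen[OF word_kernel_ideal free_rels_word_kernel])

lemma free_ideal_word_kernel: "free_ideal (lp_dual :: ('k::field, _) binary) \<le> word_kernel"
  unfolding free_ideal_def by (rule ideal_gen_least[OF word_kernel_ideal free_rels_word_kernel])

text \<open>\<open>operad_ideal_ideal_gen\<close> asks for some ideal containing the relations. A
  kernel of comb evaluations is one for any choice of functionals, which are therefore left
  \<open>undefined\<close>.\<close>

lemma free_ideal_lp: "operad_ideal (linearization (tree_operad lp_gens) :: ('k::field, _) operad) (free_ideal lp_gens)"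
  unfolding free_ideal_def
proof (rule trees.operad_ideal_ideal_gen[OF eval_kernel_ideal[of lp_gens "comb_product undefined undefined 0"]], intro le_funI subsetI)
  fix cs c f assume f: "f \<in> free_rels (lp_gens :: ('k, _) binary) cs c"
  have "Poly_Mapping.keys f \<subseteq> s_comp (tree_operad lp_gens) cs c"
    by (rule free_rels_carrier[OF _ _ _ f]) (auto simp: keys_subsetI lp_swap_closed)
  then show "f \<in> {f. Poly_Mapping.keys f \<subseteq> s_comp (tree_operad lp_gens) cs c \<and>
      (\<forall>a. lin (eval_tree (comb_product undefined undefined 0) a) f = 0)}"
    using free_rels_comb_eval[OF zero_less_numeral f] by blast
qed

text \<open>The kernel satisfies its own bounds. The interpretation gives access to
  \<open>word_kernel.normal_forms\<close>, which supply a tree for every word in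
  \<open>word_tree_ex\<close>.\<close>

interpretation word_kernel: quadratic_ideal "word_kernel :: (((lp_gen \<Rightarrow>\<^sub>0 'k::field) \<Rightarrow> 'k) tree \<Rightarrow>\<^sub>0 'k) family"
proof
  show "operad_ideal (linearization (tree_operad lp_dual)) (word_kernel :: (((lp_gen \<Rightarrow>\<^sub>0 'k) \<Rightarrow> 'k) tree \<Rightarrow>\<^sub>0 'k) family)"
    by (rule word_kernel_ideal)
  show "f \<in> word_kernel cs c" if "f \<in> free_rels (lp_dual :: ('k, _) binary) cs c" for f cs c
    using free_rels_word_kernel that unfolding le_fun_def by blast
qed (simp_all add: word_kernel_def del: tree_operad_simps)

lemma word_tree_ex:
  assumes w: "w \<in> s_comp word_operad cs c"
  shows "\<exists>t\<in>s_comp (tree_operad (lp_dual :: ('k::field, _) binary)) cs c. word_eval cs t = delta w"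
proof -
  let ?\<kappa> = "\<lambda>i. cs ! i" and ?S = "{..<length cs}"
  have w': "distinct w" "set w = {i \<in> ?S. cs ! i = Open}" "w = [] \<longleftrightarrow> c = Closed" "cs \<noteq> []"
    using w by (auto simp: open_inputs_def)
  have "\<exists>t\<in>(word_kernel.normal_forms ?\<kappa> ?S c :: ((lp_gen \<Rightarrow>\<^sub>0 'k) \<Rightarrow> 'k) tree set). filter (\<lambda>i. cs ! i = Open) (leaves t) = w"
  proof (cases c)
    case Closed
    let ?xs = "[0..<length cs]"
    have cl: "\<forall>i\<in>?S. cs ! i = Closed" using w' Closed color.exhaust by (metis (mono_tags, lifting) empty_iff list.set(1) mem_Collect_eq)
    have xs: "butlast ?xs @ [last ?xs] = sorted_list_of_set ?S"
    proof -
      have "butlast ?xs @ [last ?xs] = ?xs"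
        by (rule append_butlast_last_id) (use w'(4) in simp)
      also have "?xs = sorted_list_of_set ?S" by (simp add: lessThan_atLeast0)
      finally show ?thesis .
    qed
    let ?t = "foldr (\<lambda>x. com (Leaf x)) (butlast ?xs) (Leaf (last ?xs)) :: ((lp_gen \<Rightarrow>\<^sub>0 'k) \<Rightarrow> 'k) tree"
    have "?t \<in> word_kernel.normal_forms ?\<kappa> ?S c"
      unfolding Closed word_kernel.normal_forms.simps using xs cl by blast
    moreover have "filter (\<lambda>i. cs ! i = Open) (leaves ?t) = w"
    proof -
      have "leaves ?t = sorted_list_of_set ?S" using xs by simp
      then have "set (leaves ?t) = ?S" by (simp only: set_sorted_list_of_set finite_lessThan)
      then have "\<forall>i\<in>set (leaves ?t). cs ! i \<noteq> Open" unfolding Ball_def using cl by (metis color.distinct(1))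
      then have "filter (\<lambda>i. cs ! i = Open) (leaves ?t) = []" unfolding filter_empty_conv .
      moreover have "w = []" using w'(3) Closed by simp
      ultimately show ?thesis by (rule trans[OF _ sym])
    qed
    ultimately show ?thesis by blast
  next
    case Open
    then have ne: "w \<noteq> []" using w'(3) by simp
    let ?C = "sorted_list_of_set {i \<in> ?S. cs ! i = Closed}"
    let ?t = "foldr (\<lambda>x. act (Leaf x)) ?C (foldr (\<lambda>x. mul (Leaf x)) (butlast w) (Leaf (last w))) :: ((lp_gen \<Rightarrow>\<^sub>0 'k) \<Rightarrow> 'k) tree"
    have bl: "butlast w @ [last w] = w" using ne by simp
    have nf: "?t \<in> word_kernel.normal_forms ?\<kappa> ?S c"
      unfolding Open word_kernel.normal_forms.simps mem_Collect_eq
      by (intro exI[of _ "butlast w"] exI[of _ "last w"] conjI refl, unfold bl, rule w'(1), rule w'(2))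
    have l: "leaves ?t = ?C @ w" using bl by simp
    have C: "filter (\<lambda>i. cs ! i = Open) ?C = []" by (auto simp: filter_empty_conv)
    have W: "filter (\<lambda>i. cs ! i = Open) w = w" by (rule filter_True) (use w'(2) in blast)
    have "filter (\<lambda>i. cs ! i = Open) (leaves ?t) = w" unfolding l filter_append C W by simp
    then show ?thesis using nf by (rule bexI)
  qed
  then obtain t :: "((lp_gen \<Rightarrow>\<^sub>0 'k) \<Rightarrow> 'k) tree" where t: "t \<in> word_kernel.normal_forms ?\<kappa> ?S c" "filter (\<lambda>i. cs ! i = Open) (leaves t) = w"
    by blast
  have "t \<in> word_kernel.LT ?\<kappa> ?S c"
    using word_kernel.normal_forms_subset[of ?S] t(1) by blast
  then have "t \<in> s_comp (tree_operad lp_dual) cs c"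
    by (auto simp: labelled_trees_def well_colored_iff)
  moreover have "word_eval cs t = delta w"
    using word_kernel.normal_form_word[OF t(1)] t(2) by simp
  ultimately show ?thesis by blast
qed

lemma dual_class_mem:
  "f' \<in> free_class (lp_dual :: ('k::field, _) binary) cs c f \<longleftrightarrow> (\<exists>n\<in>free_ideal lp_dual cs c. f' = n + f)"
  by (auto simp: free_class_def linearization_simps free_module_coset)

lemma lp_class_mem:
  "f' \<in> free_class (lp_gens :: ('k::field, _) binary) cs c f \<longleftrightarrow> (\<exists>n\<in>free_ideal lp_gens cs c. f' = n + f)"
  by (auto simp: free_class_def linearization_simps free_module_coset)

lemma dual_class_word_eval:
  assumes "f' \<in> free_class (lp_dual :: ('k::field, _) binary) cs c f"
  shows "lin (word_eval cs) f' = lin (word_eval cs) f"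
proof -
  obtain n where "n \<in> free_ideal lp_dual cs c" "f' = n + f" using assms dual_class_mem by blast
  then show ?thesis
    using free_ideal_word_kernel unfolding le_fun_def word_kernel_def by auto
qed

lemma dual_carrier:
  "carrier (o_comp (free_operad (lp_dual :: ('k::field, _) binary)) cs c) =
    free_class lp_dual cs c ` {f. Poly_Mapping.keys f \<subseteq> s_comp (tree_operad lp_dual) cs c}"
  unfolding free_operad_def trees.quot_carrier[OF free_ideal_dual]
  by (simp add: free_class_def[abs_def] linearization_simps del: tree_operad_simps)

lemma dual_class_self: "Poly_Mapping.keys f \<subseteq> s_comp (tree_operad lp_dual) cs c \<Longrightarrow>
    f \<in> free_class (lp_dual :: ('k::field, _) binary) cs c f"
  unfolding free_class_def by (rule trees.coset_self[OF free_ideal_dual]) (simp add: linearization_simps del: tree_operad_simps)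

lemma lp_class_self: "Poly_Mapping.keys f \<subseteq> s_comp (tree_operad lp_gens) cs c \<Longrightarrow>
    f \<in> free_class (lp_gens :: ('k::field, _) binary) cs c f"
  unfolding free_class_def by (rule trees.coset_self[OF free_ideal_lp]) (simp add: linearization_simps del: tree_operad_simps)

text \<open>Independent of the choice, because the free ideal evaluates to zero
  (\<open>dual_class_word_eval\<close>).\<close>

definition class_word_eval ::
  "color list \<Rightarrow> color \<Rightarrow> (((lp_gen \<Rightarrow>\<^sub>0 'k::field) \<Rightarrow> 'k) tree \<Rightarrow>\<^sub>0 'k) set \<Rightarrow> nat list \<Rightarrow>\<^sub>0 'k" where
  "class_word_eval cs c Y = lin (word_eval cs) (SOME f. f \<in> Y)"

lemma class_word_eval_class:
  assumes "Poly_Mapping.keys f \<subseteq> s_comp (tree_operad lp_dual) cs c"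
  shows "class_word_eval cs c (free_class (lp_dual :: ('k::field, _) binary) cs c f) = lin (word_eval cs) f"
  unfolding class_word_eval_def
  by (rule dual_class_word_eval[of _ cs c f]) (rule someI[of _ f], rule dual_class_self[OF assms])

lemma operad_map_class_word_eval:
  "operad_map (free_operad (lp_dual :: ('k::field, _) binary)) (linearization word_operad) class_word_eval"
proof -
  have "operad_map (quot_operad (linearization (tree_operad lp_dual) :: ('k, _) operad) (free_ideal lp_dual))
      (linearization word_operad) (\<lambda>cs c A. lin (word_eval cs) (SOME a. a \<in> A))"
    by (rule trees.operad_map_quot[OF free_ideal_dual operad_map_word_eval])
      (rule dual_class_word_eval, simp add: free_class_def)
  then show ?thesis
    unfolding free_operad_def class_word_eval_def[abs_def] .
qed

lemma lookup_lin_inj: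
  assumes "inj h"
  shows "Poly_Mapping.lookup (lin (\<lambda>x. delta (h x)) f) (h y) = Poly_Mapping.lookup f y"
proof -
  have "Poly_Mapping.lookup (lin (\<lambda>x. delta (h x)) f) (h y) =
      (\<Sum>x\<in>Poly_Mapping.keys f. if x = y then Poly_Mapping.lookup f x else 0)"
    unfolding lin_def lookup_sum
    by (rule sum.cong) (auto simp: lookup_single when_def dest: injD[OF assms])
  then show ?thesis by (simp add: in_keys_iff)
qed

lemma pairing_lp_rel:
  assumes r: "r \<in> (lp_rels cs c :: ((lp_gen \<Rightarrow>\<^sub>0 'k::field) tree \<Rightarrow>\<^sub>0 'k) set)"
  obtains \<epsilon> :: "'k::field" where "\<epsilon> \<noteq> 0" "\<And>g. Poly_Mapping.keys g \<subseteq> s_comp (tree_operad lp_dual) cs c \<Longrightarrow>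
    pairing lp_gens c r g = \<epsilon> * Poly_Mapping.lookup (lin (word_eval cs) g) (filter (\<lambda>i. cs ! i = Open) [0, 1, 2])"
proof -
  obtain \<epsilon> :: 'k where \<epsilon>: "\<epsilon> \<noteq> 0" "\<And>u. u \<in> s_comp (tree_operad lp_dual) cs c \<Longrightarrow>
    pairing lp_gens c r (delta u) = \<epsilon> * Poly_Mapping.lookup (word_eval cs u) (filter (\<lambda>i. cs ! i = Open) [0, 1, 2])"
    using lp_rels_pairing[OF r] by blast
  have "pairing lp_gens c r g = \<epsilon> * Poly_Mapping.lookup (lin (word_eval cs) g) (filter (\<lambda>i. cs ! i = Open) [0, 1, 2])"
    if g: "Poly_Mapping.keys g \<subseteq> s_comp (tree_operad lp_dual) cs c" for g
  proof -
    have "pairing lp_gens c r g = (\<Sum>u\<in>Poly_Mapping.keys g. Poly_Mapping.lookup g u * pairing lp_gens c r (delta u))"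
      unfolding pairing_lin by (subst lin_fun_lin) (simp add: lin_def[of _ g] lookup_sum)
    also have "\<dots> = (\<Sum>u\<in>Poly_Mapping.keys g. Poly_Mapping.lookup g u *
        (\<epsilon> * Poly_Mapping.lookup (word_eval cs u) (filter (\<lambda>i. cs ! i = Open) [0, 1, 2])))"
      by (intro sum.cong arg_cong2[of _ _ _ _ "(*)"] \<epsilon>(2)) (use g in auto)
    also have "\<dots> = \<epsilon> * Poly_Mapping.lookup (lin (word_eval cs) g) (filter (\<lambda>i. cs ! i = Open) [0, 1, 2])"
      by (simp add: lin_def lookup_sum sum_distrib_left mult.left_commute)
    finally show ?thesis .
  qed
  with \<epsilon>(1) show thesis by (rule that)
qed

section \<open>The relations of Leibniz pairs and their orthogonal\<close>

lemma lp_rels_keys: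
  "r \<in> (lp_rels cs c :: ((lp_gen \<Rightarrow>\<^sub>0 'k::field) tree \<Rightarrow>\<^sub>0 'k) set) \<Longrightarrow>
    length cs = 3 \<and> Poly_Mapping.keys r \<subseteq> s_comp (tree_operad lp_gens) cs c"
  by (auto simp: lp_rels_def split: if_splits)
    (auto simp: lessThan_Suc insert_commute numeral_2_eq_2 dest!: subsetD[OF keys_add] subsetD[OF keys_minus_subset])

text \<open>An upper bound for the relations of \<open>LP\<close> that avoids describing the span of
  their permuted copies. The pairing is meaningful on trees of weight two, which have three leaves;
  in other arities the condition is void.\<close>

definition pairing_kernel :: "((lp_gen \<Rightarrow>\<^sub>0 'k::field) tree \<Rightarrow>\<^sub>0 'k) family" where
  "pairing_kernel cs c = {f. Poly_Mapping.keys f \<subseteq> s_comp (tree_operad lp_gens) cs c \<and>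
    (length cs = 3 \<longrightarrow> (\<forall>g\<in>word_kernel cs c. pairing lp_gens c f g = 0))}"

lemma inv_permutes:
  assumes "\<sigma> permutes {..<n}"
  shows "inv_into UNIV \<sigma> permutes {..<n}" "inv_into UNIV (inv_into UNIV \<sigma>) = \<sigma>"
  using permutes_inv[OF assms] permutes_inv_inv[OF assms] by simp_all

lemma permute_list_inv:
  assumes "\<sigma> permutes {..<length cs}"
  shows "permute_list (inv_into UNIV \<sigma>) (permute_list \<sigma> cs) = cs"
proof (rule nth_equalityI)
  fix i assume "i < length (permute_list (inv_into UNIV \<sigma>) (permute_list \<sigma> cs))"
  then show "permute_list (inv_into UNIV \<sigma>) (permute_list \<sigma> cs) ! i = cs ! i"
    using inv_permutes[OF assms] permutes_lessThanD(1-4)[OF assms, of i] assms by (simp add: nth_permute_list)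
qed simp

lemma relabel_inv_cancel:
  assumes "\<pi> permutes {..<n}"
  shows "lin (\<lambda>t. delta (relabel \<pi> t)) (lin (\<lambda>t. delta (relabel (inv_into UNIV \<pi>) t)) f) = f"
proof -
  have "\<pi> \<circ> inv_into UNIV \<pi> = (\<lambda>j. j)"
    using permutes_inv_o[OF assms] by (auto simp: fun_eq_iff)
  then show ?thesis by (simp add: lin_lin)
qed

lemma pairing_add: "pairing E c (f + f') g = pairing E c f g + pairing E c f' g"
  by (simp add: pairing_lin lookup_add)

lemma word_kernel_act:
  assumes g: "g \<in> word_kernel (permute_list \<sigma> cs) c" and \<sigma>: "\<sigma> permutes {..<length cs}"
  shows "lin (\<lambda>t. delta (relabel \<sigma> t)) g \<in> word_kernel cs c"
proof -
  have "inv_into UNIV \<sigma> permutes {..<length (permute_list \<sigma> cs)}" using inv_permutes(1)[OF \<sigma>] by simp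
  from operad_idealD(2)[OF word_kernel_ideal this g]
  show ?thesis by (simp add: linearization_simps permute_list_inv[OF \<sigma>] inv_permutes(2)[OF \<sigma>])
qed

lemma pairing_kernel_sub_collection:
  "sub_collection (linearization (tree_operad lp_gens) :: ('k::field, _) operad) pairing_kernel"
  unfolding sub_collection_def
proof (intro conjI allI ballI impI)
  fix cs c
  show "submodule (pairing_kernel cs c) scalars (o_comp (linearization (tree_operad lp_gens) :: ('k, _) operad) cs c)"
    unfolding linearization_simps pairing_kernel_def
    by (rule submodule_free_moduleI) (auto simp: keys_subsetI pairing_lin lookup_add simp del: tree_operad_simps)
next
  fix cs c \<sigma> and f :: "(lp_gen \<Rightarrow>\<^sub>0 'k) tree \<Rightarrow>\<^sub>0 'k"
  assume f: "f \<in> pairing_kernel cs c" and \<sigma>: "\<sigma> permutes {..<length cs}"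
  let ?P = "linearization (tree_operad lp_gens) :: ('k, _) operad" and ?\<pi> = "inv_into UNIV \<sigma>"
  have k: "Poly_Mapping.keys f \<subseteq> s_comp (tree_operad lp_gens) cs c" using f by (simp add: pairing_kernel_def)
  have eq: "o_act ?P cs c \<sigma> f = lin (\<lambda>t. delta (relabel ?\<pi> t)) f" by (simp add: linearization_simps)
  have "o_act ?P cs c \<sigma> f \<in> carrier (o_comp ?P (permute_list \<sigma> cs) c)"
    by (rule trees.act_closed[OF \<sigma>]) (use k in \<open>simp add: linearization_simps del: tree_operad_simps\<close>)
  moreover have "pairing lp_gens c (o_act ?P cs c \<sigma> f) g = 0"
    if len: "length cs = 3" and g: "g \<in> word_kernel (permute_list \<sigma> cs) c" for g
  proof -
    let ?g = "lin (\<lambda>t. delta (relabel \<sigma> t)) g"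
    have \<pi>: "?\<pi> permutes {..<3}" and inv: "inv_into UNIV ?\<pi> = \<sigma>" using inv_permutes[OF \<sigma>] len by simp_all
    have g': "?g \<in> word_kernel cs c" by (rule word_kernel_act[OF g \<sigma>])
    have "g = lin (\<lambda>t. delta (relabel ?\<pi> t)) ?g"
      using relabel_inv_cancel[OF \<pi>, of g] unfolding inv by simp
    then have "pairing lp_gens c (o_act ?P cs c \<sigma> f) g = perm_sign ?\<pi> * pairing lp_gens c f ?g"
      unfolding eq using pairing_relabel[OF k _ len \<pi>, of ?g] g' by (simp add: word_kernel_def del: tree_operad_simps)
    then show ?thesis using f g' len by (simp add: pairing_kernel_def del: tree_operad_simps)
  qed
  ultimately show "o_act ?P cs c \<sigma> f \<in> pairing_kernel (permute_list \<sigma> cs) c"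
    by (simp add: pairing_kernel_def linearization_simps del: tree_operad_simps)
qed

lemma lp_rels_pairing_kernel: "lp_rels cs c \<subseteq> (pairing_kernel cs c :: (_ \<Rightarrow>\<^sub>0 'k::field) set)"
proof
  fix r assume r: "r \<in> (lp_rels cs c :: ((lp_gen \<Rightarrow>\<^sub>0 'k) tree \<Rightarrow>\<^sub>0 'k) set)"
  obtain \<epsilon> :: 'k where "\<And>g. Poly_Mapping.keys g \<subseteq> s_comp (tree_operad lp_dual) cs c \<Longrightarrow>
    pairing lp_gens c r g = \<epsilon> * Poly_Mapping.lookup (lin (word_eval cs) g) (filter (\<lambda>i. cs ! i = Open) [0, 1, 2])"
    using pairing_lp_rel[OF r] by metis
  then have "pairing lp_gens c r g = 0" if "g \<in> word_kernel cs c" for g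
    using that by (simp add: word_kernel_def del: tree_operad_simps)
  then show "r \<in> pairing_kernel cs c"
    using lp_rels_keys[OF r] by (simp add: pairing_kernel_def del: tree_operad_simps)
qed

lemma LP_relations_subset:
  "snd (LP :: ('k::field, _) quadratic) cs c \<subseteq> free_class lp_gens cs c ` pairing_kernel cs c"
proof -
  have "sub_collection (free_operad lp_gens :: ('k, _) operad) (\<lambda>cs c. free_class lp_gens cs c ` pairing_kernel cs c)"
    using trees.sub_collection_image[OF free_ideal_lp pairing_kernel_sub_collection]
    by (simp add: free_operad_def free_class_def[abs_def])
  moreover have "(\<lambda>cs c. free_class lp_gens cs c ` lp_rels cs c) \<le>
      (\<lambda>cs c. free_class (lp_gens :: ('k, _) binary) cs c ` pairing_kernel cs c)"
    using lp_rels_pairing_kernel by (intro le_funI image_mono)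
  ultimately have "snd (LP :: ('k, _) quadratic) \<le> (\<lambda>cs c. free_class lp_gens cs c ` pairing_kernel cs c)"
    unfolding LP_def snd_conv sub_collection_gen_def by (intro Inf_lower) simp
  then show ?thesis unfolding le_fun_def by blast
qed

text \<open>The corresponding lower bound. Permuted copies of the four relations are enough of them
  for \<open>orthogonal_subset_kernel\<close>, since every word of arity three is tested by
  one.\<close>

lemma LP_relations_act:
  assumes r: "r \<in> (lp_rels cs c :: ((lp_gen \<Rightarrow>\<^sub>0 'k::field) tree \<Rightarrow>\<^sub>0 'k) set)" and \<sigma>: "\<sigma> permutes {..<length cs}"
  shows "free_class lp_gens (permute_list \<sigma> cs) c (lin (\<lambda>t. delta (relabel (inv_into UNIV \<sigma>) t)) r)
    \<in> snd (LP :: ('k, _) quadratic) (permute_list \<sigma> cs) c"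
proof -
  have "o_act (free_operad lp_gens) cs c \<sigma> (free_class lp_gens cs c r) \<in> J (permute_list \<sigma> cs) c"
    if "sub_collection (free_operad (lp_gens :: ('k, _) binary)) J" "(\<lambda>cs c. free_class lp_gens cs c ` lp_rels cs c) \<le> J" for J
  proof -
    have "free_class lp_gens cs c r \<in> J cs c" using that(2) r unfolding le_fun_def by blast
    then show ?thesis using that(1) \<sigma> unfolding sub_collection_def by blast
  qed
  then have "o_act (free_operad lp_gens) cs c \<sigma> (free_class lp_gens cs c r) \<in> snd (LP :: ('k, _) quadratic) (permute_list \<sigma> cs) c"
    unfolding LP_def snd_conv sub_collection_gen_def by simp
  also have "o_act (free_operad lp_gens) cs c \<sigma> (free_class lp_gens cs c r) =
      free_class lp_gens (permute_list \<sigma> cs) c (o_act (linearization (tree_operad lp_gens)) cs c \<sigma> r)"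
    unfolding free_operad_def free_class_def
    by (rule trees.quot_act[OF free_ideal_lp \<sigma>]) (use lp_rels_keys[OF r] in \<open>simp add: linearization_simps del: tree_operad_simps\<close>)
  finally show ?thesis by (simp add: linearization_simps)
qed

text \<open>\<open>class_pairing\<close> evaluates at chosen representatives. The first may be
  replaced by \<open>f\<close> because the pairing kills the free ideal; the second remains an
  unknown \<open>g'\<close>, but as a member of the class of \<open>g\<close> it has the same word
  evaluation, which is what the applications use.\<close>

lemma class_pairing_eq:
  assumes f: "Poly_Mapping.keys f \<subseteq> s_comp (tree_operad lp_gens) cs c"
    and g: "Poly_Mapping.keys g \<subseteq> s_comp (tree_operad lp_dual) cs c" and len: "length cs = 3"
  obtains g' where "g' \<in> free_class (lp_dual :: ('k::field, _) binary) cs c g"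
    "Poly_Mapping.keys g' \<subseteq> s_comp (tree_operad lp_dual) cs c"
    "class_pairing lp_gens c (free_class lp_gens cs c f) (free_class lp_dual cs c g) = pairing lp_gens c f g'"
proof -
  let ?U = "free_class (lp_gens :: ('k, _) binary) cs c f" and ?Y = "free_class (lp_dual :: ('k, _) binary) cs c g"
  define f' g' where "f' = (SOME f. f \<in> ?U)" and "g' = (SOME g. g \<in> ?Y)"
  have "f' \<in> ?U" unfolding f'_def by (rule someI[of _ f]) (rule lp_class_self[OF f])
  then obtain n where n: "n \<in> free_ideal lp_gens cs c" "f' = n + f" using lp_class_mem by blast
  have g': "g' \<in> ?Y" unfolding g'_def by (rule someI[of _ g]) (rule dual_class_self[OF g])
  then obtain m where m: "m \<in> free_ideal lp_dual cs c" "g' = m + g" using dual_class_mem by blast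
  have "Poly_Mapping.keys m \<subseteq> s_comp (tree_operad lp_dual) cs c"
    using operad_idealD(6)[OF free_ideal_dual m(1)] by (simp add: linearization_simps del: tree_operad_simps)
  then have kg: "Poly_Mapping.keys g' \<subseteq> s_comp (tree_operad lp_dual) cs c"
    using g unfolding m(2) by (rule keys_subsetI(1))
  have "Poly_Mapping.keys n \<subseteq> s_comp (tree_operad lp_gens) cs c"
    using operad_idealD(6)[OF free_ideal_lp n(1)] by (simp add: linearization_simps del: tree_operad_simps)
  then have "pairing lp_gens c n g' = 0"
    by (rule pairing_free_ideal[OF n(1) _ kg len])
  then have "class_pairing lp_gens c ?U ?Y = pairing lp_gens c f g'"
    unfolding class_pairing_def f'_def[symmetric] g'_def[symmetric] by (simp add: n(2) pairing_add)
  then show thesis by (rule that[OF g' kg])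
qed

lemma tree_weight: "length (leaves t) = Suc (weight t)"
  by (induction t) simp_all

lemma kernel_subset_orthogonal:
  assumes len: "length cs = 3" and g: "g \<in> word_kernel cs c"
  shows "free_class lp_dual cs c g \<in> orthogonal (LP :: ('k::field, _) quadratic) cs c"
proof -
  have k: "Poly_Mapping.keys g \<subseteq> s_comp (tree_operad (lp_dual :: ('k, _) binary)) cs c"
    and ev: "lin (word_eval cs) g = 0" using g by (simp_all add: word_kernel_def)
  have "weight t = 2" if "t \<in> Poly_Mapping.keys g" for t
  proof -
    have "distinct (leaves t)" "set (leaves t) = {..<3}" using that k len by auto
    then have "length (leaves t) = 3" using distinct_card by fastforce
    then show ?thesis by (simp add: tree_weight)
  qed
  then have "free_class lp_dual cs c g \<in> weight_part lp_dual 2 cs c"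
    unfolding weight_part_def dual_carrier using k dual_class_self[OF k] by blast
  moreover have "class_pairing lp_gens c U (free_class lp_dual cs c g) = 0" if U: "U \<in> snd (LP :: ('k, _) quadratic) cs c" for U
  proof -
    obtain f where f: "f \<in> pairing_kernel cs c" "U = free_class lp_gens cs c f"
      using U LP_relations_subset by blast
    have "Poly_Mapping.keys f \<subseteq> s_comp (tree_operad lp_gens) cs c" using f by (simp add: pairing_kernel_def)
    then obtain g' where g': "g' \<in> free_class (lp_dual :: ('k, _) binary) cs c g"
      "Poly_Mapping.keys g' \<subseteq> s_comp (tree_operad lp_dual) cs c"
      "class_pairing lp_gens c U (free_class lp_dual cs c g) = pairing lp_gens c f g'"
      using class_pairing_eq[OF _ k len] unfolding f(2) by metis
    have "g' \<in> word_kernel cs c"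
      using g'(2) dual_class_word_eval[OF g'(1)] ev by (simp add: word_kernel_def del: tree_operad_simps)
    then show ?thesis using f(1) len g'(3) by (simp add: pairing_kernel_def del: tree_operad_simps)
  qed
  ultimately show ?thesis by (simp add: orthogonal_def LP_def)
qed

text \<open>Placing the closed inputs first and then the open ones in the order of \<open>w\<close>
  leads to one of the four components in which \<open>lp_rels\<close> has a relation, and turns
  \<open>w\<close> into the increasing word.\<close>

lemma word_renumbering:
  assumes w: "w \<in> s_comp word_operad cs c" and len: "length cs = 3"
  obtains \<pi> r where "\<pi> permutes {..<3}" "r \<in> (lp_rels (permute_list \<pi> cs) c :: ((lp_gen \<Rightarrow>\<^sub>0 'k::field) tree \<Rightarrow>\<^sub>0 'k) set)"
    "w = map \<pi> (filter (\<lambda>i. permute_list \<pi> cs ! i = Open) [0, 1, 2])"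
proof -
  have w': "distinct w" "set w = {i. i < 3 \<and> cs ! i = Open}" "w = [] \<longleftrightarrow> c = Closed"
    using w len by (auto simp: open_inputs_def)
  define u where "u = filter (\<lambda>i. cs ! i = Closed) [0, 1, 2]"
  have "set [0, 1, 2 :: nat] = {..<3}"
    by (simp add: numeral_3_eq_3 numeral_2_eq_2 lessThan_Suc insert_commute)
  then have u: "set u = {i. i < 3 \<and> cs ! i = Closed}"
    unfolding u_def set_filter by simp
  have "distinct u" by (simp add: u_def)
  moreover have "set u \<inter> set w = {}" unfolding u w'(2) by auto
  ultimately have dist: "distinct (u @ w)" using w'(1) by simp
  have set: "set (u @ w) = {..<3}"
  proof (rule Set.set_eqI)
    fix i show "i \<in> set (u @ w) \<longleftrightarrow> i \<in> {..<3}"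
      unfolding set_append Un_iff u w'(2) by (cases "cs ! i") simp_all
  qed
  have l: "length (u @ w) = 3" using distinct_card[OF dist] set by simp
  define \<pi> where "\<pi> j = (if j < 3 then (u @ w) ! j else j)" for j
  have "bij_betw (\<lambda>j. (u @ w) ! j) {..<3} {..<3}"
    by (rule bij_betw_nth[OF dist]) (simp_all only: l set)
  then have "bij_betw \<pi> {..<3} {..<3}"
    by (rule bij_betw_cong[THEN iffD1, rotated]) (simp add: \<pi>_def)
  then have \<pi>: "\<pi> permutes {..<3}" by (rule bij_imp_permutes) (simp add: \<pi>_def)
  have map\<pi>: "map \<pi> [0, 1, 2] = u @ w"
    by (rule nth_equalityI) (use l in \<open>auto simp: \<pi>_def less_Suc_eq numeral_3_eq_3 numeral_2_eq_2\<close>)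
  have "permute_list \<pi> cs = map (\<lambda>i. cs ! i) (map \<pi> [0, 1, 2])"
    by (simp add: permute_list_def len numeral_3_eq_3 numeral_2_eq_2)
  then have bs: "permute_list \<pi> cs = replicate (length u) Closed @ replicate (length w) Open"
    unfolding map\<pi> using u w'(2) by (auto intro!: map_replicate_const[THEN trans] simp flip: map_replicate_const)
  have "\<exists>r. r \<in> (lp_rels (permute_list \<pi> cs) c :: ((lp_gen \<Rightarrow>\<^sub>0 'k::field) tree \<Rightarrow>\<^sub>0 'k) set)"
  proof -
    have "length u + length w = 3" using l by simp
    then consider "length u = 3" "length w = 0" | "length u = 2" "length w = 1" | "length u = 1" "length w = 2"
      | "length u = 0" "length w = 3" by linarith
    then show ?thesis
      unfolding bs lp_rels_def using w'(3)
      by cases (cases c; auto simp: numeral_3_eq_3 numeral_2_eq_2)+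
  qed
  moreover have "w = map \<pi> (filter (\<lambda>i. permute_list \<pi> cs ! i = Open) [0, 1, 2])"
  proof -
    have "filter (\<lambda>i. permute_list \<pi> cs ! i = Open) [0, 1, 2] = filter ((\<lambda>i. cs ! i = Open) \<circ> \<pi>) [0, 1, 2]"
      by (rule filter_cong) (use \<pi> len in \<open>auto simp: nth_permute_list\<close>)
    then have "map \<pi> (filter (\<lambda>i. permute_list \<pi> cs ! i = Open) [0, 1, 2]) = filter (\<lambda>i. cs ! i = Open) (u @ w)"
      unfolding map\<pi>[symmetric] filter_map by simp
    moreover have "filter (\<lambda>i. cs ! i = Open) u = []" using u by (auto simp: filter_empty_conv)
    moreover have "filter (\<lambda>i. cs ! i = Open) w = w" by (rule filter_True) (use w'(2) in blast)
    ultimately show ?thesis by simp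
  qed
  ultimately show thesis using that[OF \<pi>] by blast
qed

text \<open>Each coefficient of the evaluation is, up to a nonzero factor, the pairing with a
  permuted relation, so orthogonality makes all of them vanish.\<close>

lemma orthogonal_subset_kernel:
  assumes Y: "Y \<in> orthogonal (LP :: ('k::field, _) quadratic) cs c"
  obtains g where "g \<in> word_kernel cs c" "Y = free_class lp_dual cs c g"
proof -
  have Y': "Y \<in> weight_part lp_dual 2 cs c" and orth: "\<And>U. U \<in> snd (LP :: ('k, _) quadratic) cs c \<Longrightarrow> class_pairing lp_gens c U Y = 0"
    using Y by (simp_all add: orthogonal_def LP_def)
  then obtain g f where g: "Poly_Mapping.keys g \<subseteq> s_comp (tree_operad lp_dual) cs c" "Y = free_class lp_dual cs c g"
    and f: "f \<in> Y" "\<forall>t\<in>Poly_Mapping.keys f. weight t = 2"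
    unfolding weight_part_def dual_carrier by blast
  have "lin (word_eval cs) g = 0"
  proof (cases "length cs = 3")
    \<comment> \<open>Trees of weight two have three leaves, so in other arities a weight two
      representative is zero.\<close>
    case False
    obtain n where n: "n \<in> free_ideal lp_dual cs c" "f = n + g" using f(1) g(2) dual_class_mem by blast
    have "Poly_Mapping.keys n \<subseteq> s_comp (tree_operad lp_dual) cs c"
      using operad_idealD(6)[OF free_ideal_dual n(1)] by (simp add: linearization_simps del: tree_operad_simps)
    then have kf: "Poly_Mapping.keys f \<subseteq> s_comp (tree_operad lp_dual) cs c"
      using g(1) unfolding n(2) by (rule keys_subsetI(1))
    have "Poly_Mapping.keys f = {}"
    proof (rule ccontr)
      assume "Poly_Mapping.keys f \<noteq> {}"
      then obtain t where t: "t \<in> Poly_Mapping.keys f" by blast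
      then have "distinct (leaves t)" "set (leaves t) = {..<length cs}" using kf by auto
      then have "length (leaves t) = length cs" using distinct_card by fastforce
      then show False using f(2) t False by (simp add: tree_weight)
    qed
    then have "f = 0" by (intro poly_mapping_eqI) (metis empty_iff in_keys_iff lookup_zero)
    then show ?thesis using dual_class_word_eval[of f cs c g] f(1) g(2) by simp
  next
    case len: True
    show ?thesis
    proof (rule poly_mapping_eqI)
      fix w
      show "Poly_Mapping.lookup (lin (word_eval cs) g) w = Poly_Mapping.lookup 0 w"
      proof (cases "w \<in> s_comp word_operad cs c")
        case False
        have "lin (word_eval cs) g \<in> carrier (o_comp (linearization word_operad) cs c)"
          by (rule operad_mapD(1)[OF operad_map_word_eval]) (use g in \<open>simp add: linearization_simps del: tree_operad_simps\<close>)
        then have "Poly_Mapping.keys (lin (word_eval cs) g) \<subseteq> s_comp word_operad cs c"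
          by (simp add: linearization_simps del: word_operad_simps)
        then show ?thesis using False by (auto simp: in_keys_iff simp del: word_operad_simps)
      next
        case True
        obtain \<pi> and r :: "(lp_gen \<Rightarrow>\<^sub>0 'k) tree \<Rightarrow>\<^sub>0 'k" where \<pi>: "\<pi> permutes {..<3}" and r: "r \<in> lp_rels (permute_list \<pi> cs) c"
          and w: "w = map \<pi> (filter (\<lambda>i. permute_list \<pi> cs ! i = Open) [0, 1, 2])"
          using word_renumbering[OF True len] by metis
        let ?bs = "permute_list \<pi> cs" and ?\<sigma> = "inv_into UNIV \<pi>"
        let ?w = "filter (\<lambda>i. ?bs ! i = Open) [0, 1, 2]"
        let ?r = "lin (\<lambda>t. delta (relabel \<pi> t)) r"
        have \<pi>': "\<pi> permutes {..<length cs}" and \<sigma>: "?\<sigma> permutes {..<length ?bs}"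
          using \<pi> inv_permutes(1)[OF \<pi>] len by simp_all
        have inv: "inv_into UNIV ?\<sigma> = \<pi>" and perm: "permute_list ?\<sigma> ?bs = cs"
          using inv_permutes(2)[OF \<pi>] permute_list_inv[OF \<pi>'] by simp_all
        have U: "free_class lp_gens cs c ?r \<in> snd (LP :: ('k, _) quadratic) cs c"
          using LP_relations_act[OF r \<sigma>] unfolding inv perm .
        have kr: "Poly_Mapping.keys r \<subseteq> s_comp (tree_operad lp_gens) ?bs c" using lp_rels_keys[OF r] by blast
        have "?r \<in> carrier (o_comp (linearization (tree_operad lp_gens)) cs c)"
          using trees.act_closed[OF \<sigma>, of r lp_gens c] kr unfolding perm
          by (simp add: linearization_simps inv del: tree_operad_simps(1,3,4))
        then have kr': "Poly_Mapping.keys ?r \<subseteq> s_comp (tree_operad lp_gens) cs c"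
          by (simp add: linearization_simps del: tree_operad_simps)
        obtain g' where g': "g' \<in> free_class (lp_dual :: ('k, _) binary) cs c g"
          "Poly_Mapping.keys g' \<subseteq> s_comp (tree_operad lp_dual) cs c" "pairing lp_gens c ?r g' = 0"
          using class_pairing_eq[OF kr' g(1) len] orth[OF U] unfolding g(2) by metis
        let ?g = "lin (\<lambda>t. delta (relabel ?\<sigma> t)) g'"
        have g'c: "g' \<in> carrier (o_comp (linearization (tree_operad lp_dual)) cs c)"
          using g'(2) by (simp add: linearization_simps del: tree_operad_simps)
        have act: "o_act (linearization (tree_operad lp_dual)) cs c \<pi> g' = ?g" by (simp add: linearization_simps)
        have kg: "Poly_Mapping.keys ?g \<subseteq> s_comp (tree_operad lp_dual) ?bs c"
          using trees.act_closed[OF \<pi>' g'c] unfolding act by (simp add: linearization_simps del: tree_operad_simps)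
        \<comment> \<open>The permutation is moved across the pairing, at the cost of its sign, to
          reach the relation \<open>r\<close> in its listed component.\<close>
        have "lin (\<lambda>t. delta (relabel \<pi> t)) ?g = g'" by (rule relabel_inv_cancel[OF \<pi>])
        then have "perm_sign \<pi> * pairing lp_gens c r ?g = 0"
          using pairing_relabel[OF kr kg _ \<pi>] g'(3) len by simp
        then have p0: "pairing lp_gens c r ?g = 0" by (simp add: perm_sign_nonzero)
        obtain \<epsilon> :: 'k where \<epsilon>: "\<epsilon> \<noteq> 0" "pairing lp_gens c r ?g = \<epsilon> * Poly_Mapping.lookup (lin (word_eval ?bs) ?g) ?w"
          using pairing_lp_rel[OF r] kg by metis
        then have "Poly_Mapping.lookup (lin (word_eval ?bs) ?g) ?w = 0" using p0 by simp
        moreover have "lin (word_eval ?bs) ?g = lin (\<lambda>w. delta (map ?\<sigma> w)) (lin (word_eval cs) g')"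
          using operad_mapD(4)[OF operad_map_word_eval \<pi>' g'c] unfolding act by (simp add: linearization_simps)
        moreover have "?w = map ?\<sigma> w"
          unfolding w using permutes_lessThanD(2)[OF \<pi>] by (simp add: comp_def)
        moreover have "inj (map ?\<sigma>)"
          using permutes_lessThanD(5)[OF \<pi>] by (simp add: inj_mapI)
        ultimately have "Poly_Mapping.lookup (lin (word_eval cs) g') w = 0"
          using lookup_lin_inj by metis
        then show ?thesis using dual_class_word_eval[OF g'(1)] by simp
      qed
    qed
  qed
  then have "g \<in> word_kernel cs c" using g(1) by (simp add: word_kernel_def del: tree_operad_simps)
  then show thesis using g(2) by (rule that)
qed

text \<open>For the inclusion of the kernel in the generated ideal, an arbitrary ideal above the
  orthogonal is pulled back to trees, where \<open>kernel_in_ideal\<close> applies.\<close>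

lemma ideal_gen_orthogonal:
  "ideal_gen (free_operad lp_dual) (orthogonal (LP :: ('k::field, _) quadratic)) =
    (\<lambda>cs c. free_class lp_dual cs c ` word_kernel cs c)"
proof (rule antisym)
  have "operad_ideal (free_operad (lp_dual :: ('k, _) binary)) (\<lambda>cs c. free_class lp_dual cs c ` word_kernel cs c)"
    using trees.operad_ideal_image[OF free_ideal_dual word_kernel_ideal]
    by (simp add: free_operad_def free_class_def[abs_def])
  then show "ideal_gen (free_operad lp_dual) (orthogonal (LP :: ('k, _) quadratic)) \<le>
      (\<lambda>cs c. free_class lp_dual cs c ` word_kernel cs c)"
    by (rule ideal_gen_least) (auto intro!: le_funI elim!: orthogonal_subset_kernel)
  have "(\<lambda>cs c. free_class lp_dual cs c ` word_kernel cs c) \<le> J"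
    if J: "operad_ideal (free_operad (lp_dual :: ('k, _) binary)) J" and orth: "orthogonal (LP :: ('k, _) quadratic) \<le> J" for J
  proof -
    let ?T = "linearization (tree_operad lp_dual) :: ('k, _) operad"
    define N where "N = (\<lambda>cs c. {a \<in> carrier (o_comp ?T cs c). free_class lp_dual cs c a \<in> J cs c})"
    have N: "operad_ideal ?T N"
      using trees.operad_ideal_preimage[OF free_ideal_dual J[unfolded free_operad_def]]
      by (simp add: N_def free_class_def)
    \<comment> \<open>The preimage \<open>N\<close> may exceed the kernel; intersecting brings it
      under the upper bound that \<open>quadratic_ideal\<close> demands.\<close>
    let ?M = "Inf {N, word_kernel}"
    have M: "f \<in> ?M cs c \<longleftrightarrow> f \<in> word_kernel cs c \<and> free_class lp_dual cs c f \<in> J cs c" for f cs c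
      by (auto simp: N_def word_kernel_def linearization_simps simp del: tree_operad_simps)
    have "quadratic_ideal ?M"
    proof
      show "operad_ideal ?T ?M"
        by (rule trees.operad_ideal_Inf) (use N word_kernel_ideal in auto)
    next
      fix f cs c assume f: "f \<in> free_rels (lp_dual :: ('k, _) binary) cs c"
      then have f': "f \<in> free_ideal lp_dual cs c"
        using ideal_gen_upper[of "free_rels lp_dual" ?T] unfolding free_ideal_def le_fun_def by blast
      have "free_class lp_dual cs c f = free_ideal lp_dual cs c"
      proof -
        interpret S: abelian_subgroup "free_ideal (lp_dual :: ('k, _) binary) cs c" "o_comp ?T cs c"
          by (rule trees.ideal_subgroup[OF free_ideal_dual])
        show ?thesis
          unfolding free_class_def
          by (rule S.a_coset_join2[OF operad_idealD(6)[OF free_ideal_dual f'] S.a_subgroup f'])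
      qed
      moreover have "\<zero>\<^bsub>o_comp (free_operad (lp_dual :: ('k, _) binary)) cs c\<^esub> \<in> J cs c"
        using operad_idealD(1)[OF J, of cs c] subgroup.one_closed[of "J cs c"] by (simp add: submodule_def) fastforce
      ultimately have "free_class lp_dual cs c f \<in> J cs c"
        by (simp add: free_operad_def trees.quot_zero[OF free_ideal_dual])
      then show "f \<in> ?M cs c"
        using free_rels_word_kernel f unfolding M le_fun_def by blast
    next
      fix cs :: "color list" and c and f :: "((lp_gen \<Rightarrow>\<^sub>0 'k) \<Rightarrow> 'k) tree \<Rightarrow>\<^sub>0 'k"
      assume len: "length cs = 3" and "Poly_Mapping.keys f \<subseteq> s_comp (tree_operad lp_dual) cs c"
        "lin (word_eval cs) f = 0"
      then have f: "f \<in> word_kernel cs c" by (simp add: word_kernel_def)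
      then show "f \<in> ?M cs c"
        using kernel_subset_orthogonal[OF len f] orth unfolding M le_fun_def by blast
    next
      fix f :: "((lp_gen \<Rightarrow>\<^sub>0 'k) \<Rightarrow> 'k) tree \<Rightarrow>\<^sub>0 'k" and cs c
      assume "f \<in> ?M cs c"
      then show "lin (word_eval cs) f = 0" unfolding M by (simp add: word_kernel_def)
    qed
    then interpret M: quadratic_ideal ?M .
    show ?thesis
    proof (intro le_funI image_subsetI)
      fix cs c and f :: "((lp_gen \<Rightarrow>\<^sub>0 'k) \<Rightarrow> 'k) tree \<Rightarrow>\<^sub>0 'k"
      assume "f \<in> word_kernel cs c"
      then have "f \<in> ?M cs c"
        by (intro M.kernel_in_ideal) (simp_all add: word_kernel_def del: tree_operad_simps)
      then show "free_class lp_dual cs c f \<in> J cs c" unfolding M by blast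
    qed
  qed
  then show "(\<lambda>cs c. free_class lp_dual cs c ` word_kernel cs c) \<le>
      ideal_gen (free_operad lp_dual) (orthogonal (LP :: ('k, _) quadratic))"
    unfolding ideal_gen_def by (intro Inf_greatest) blast
qed

theorem koszul_dual_LP: "linearization word_operad \<cong>\<^sub>o koszul_dual (LP :: ('k::field, _) quadratic)"
proof -
  have "fst (LP :: ('k, _) quadratic) = lp_gens" by (simp add: LP_def)
  then have eq: "koszul_dual (LP :: ('k, _) quadratic) =
      quot_operad (free_operad lp_dual) (\<lambda>cs c. free_class lp_dual cs c ` word_kernel cs c)"
    by (simp add: koszul_dual_def quadratic_operad_def ideal_gen_orthogonal)
  show ?thesis
    unfolding eq
  proof (rule operad_iso_quot_kernel[OF _ words.closed_operad operad_map_class_word_eval])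
    show "closed_operad (free_operad (lp_dual :: ('k, _) binary))"
      unfolding free_operad_def by (rule trees.closed_quot_operad[OF free_ideal_dual])
  next
    fix cs c
    show "free_class lp_dual cs c ` word_kernel cs c = {x \<in> carrier (o_comp (free_operad (lp_dual :: ('k, _) binary)) cs c).
        class_word_eval cs c x = \<zero>\<^bsub>o_comp (linearization word_operad) cs c\<^esub>}"
      unfolding dual_carrier by (auto simp: word_kernel_def class_word_eval_class linearization_simps simp del: tree_operad_simps word_operad_simps)
    show "carrier (o_comp (linearization word_operad) cs c) \<subseteq>
        class_word_eval cs c ` carrier (o_comp (free_operad (lp_dual :: ('k, _) binary)) cs c)"
    proof
      fix v :: "nat list \<Rightarrow>\<^sub>0 'k" assume "v \<in> carrier (o_comp (linearization word_operad) cs c)"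
      then have v: "Poly_Mapping.keys v \<subseteq> s_comp word_operad cs c" by (simp add: linearization_simps del: word_operad_simps)
      obtain t where t: "\<And>w. w \<in> s_comp word_operad cs c \<Longrightarrow> t w \<in> s_comp (tree_operad (lp_dual :: ('k, _) binary)) cs c \<and> word_eval cs (t w) = delta w"
        using word_tree_ex[of _ cs c] by metis
      let ?f = "lin (\<lambda>w. delta (t w)) v"
      have k: "Poly_Mapping.keys ?f \<subseteq> s_comp (tree_operad lp_dual) cs c"
        by (rule keys_linD) (use t v in auto)
      have "lin (word_eval cs) ?f = lin delta v"
        unfolding lin_lin by (rule lin_cong) (use t v in auto)
      then have "class_word_eval cs c (free_class lp_dual cs c ?f) = v"
        by (simp add: class_word_eval_class[OF k])
      moreover have "free_class lp_dual cs c ?f \<in> carrier (o_comp (free_operad (lp_dual :: ('k, _) binary)) cs c)"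
        unfolding dual_carrier using k by (intro imageI CollectI)
      ultimately show "v \<in> class_word_eval cs c ` carrier (o_comp (free_operad (lp_dual :: ('k, _) binary)) cs c)"
        by (intro image_eqI[OF sym])
    qed
  qed
qed

section \<open>The swiss-cheese operad\<close>

lemma cnj_disk: "cnj ` disk_of p = ball (cnj (fst p)) (snd p)"
proof -
  have "dist (cnj a) b = dist a (cnj b)" for a b
    by (metis complex_cnj_cnj complex_cnj_diff complex_mod_cnj dist_norm)
  then show ?thesis
    by (auto simp: disk_of_def image_iff intro!: bexI[of _ "cnj _"])
qed

lemma cnj_disk_iff: "snd p > 0 \<Longrightarrow> cnj ` disk_of p = disk_of p \<longleftrightarrow> Im (fst p) = 0"
  unfolding cnj_disk unfolding disk_of_def
  by (auto simp: ball_eq_ball_iff complex_eq_iff)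

lemma disk_configs_iff:
  "p \<in> disk_configs n \<longleftrightarrow> p \<in> extensional {..<n} \<and> (\<forall>i<n. snd (p i) > 0 \<and> disk_of (p i) \<subseteq> ball 0 1) \<and>
    (\<forall>i<n. \<forall>j<n. i \<noteq> j \<longrightarrow> disk_of (p i) \<inter> disk_of (p j) = {})"
  by (simp add: disk_configs_def)

definition sc_colors :: "color list \<Rightarrow> color \<Rightarrow> bool" where
  "sc_colors cs c \<longleftrightarrow> (case c of Closed \<Rightarrow> cs \<noteq> [] \<and> set cs \<subseteq> {Closed} | Open \<Rightarrow> Open \<in> set cs)"

text \<open>Conjugation invariance is expressed by a real center, which is equivalent for positive
  radius (\<open>cnj_disk_iff\<close>). The condition concerns one disk at a time, which suits
  gluing and moving.\<close>

definition sc_placed :: "color list \<Rightarrow> color \<Rightarrow> nat \<Rightarrow> little_disk \<Rightarrow> bool" where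
  "sc_placed cs c i d \<longleftrightarrow> c = Closed \<or>
    (if cs ! i = Open then Im (fst d) = 0 else disk_of d \<subseteq> {z. Im z > 0})"

lemma sc_space_iff:
  "p \<in> sc_space cs c \<longleftrightarrow> p \<in> disk_configs (length cs) \<and> sc_colors cs c \<and> (\<forall>i<length cs. sc_placed cs c i (p i))"
proof (cases c)
  case Closed
  then show ?thesis by (auto simp: sc_space_def sc_colors_def sc_placed_def)
next
  case Open
  have "(cs ! i = Open \<longrightarrow> cnj ` disk_of (p i) = disk_of (p i)) \<and> (cs ! i = Closed \<longrightarrow> disk_of (p i) \<subseteq> {z. Im z > 0}) \<longleftrightarrow>
      sc_placed cs c i (p i)" if "p \<in> disk_configs (length cs)" "i < length cs" for i
    using that cnj_disk_iff[of "p i"] Open by (cases "cs ! i") (auto simp: sc_placed_def disk_configs_iff)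
  then show ?thesis
    using Open by (auto simp: sc_space_def sc_colors_def)
qed

text \<open>The embedding of the unit disk for which a little disk stands; \<open>glue_disk\<close>
  is the composite of two such embeddings.\<close>

definition glue_point :: "little_disk \<Rightarrow> complex \<Rightarrow> complex" where
  "glue_point d z = fst d + of_real (snd d) * z"

definition glue_disk :: "little_disk \<Rightarrow> little_disk \<Rightarrow> little_disk" where
  "glue_disk d e = (glue_point d (fst e), snd d * snd e)"

lemma disk_glue_eq: "disk_glue i m p q = (\<lambda>k. if k < i then p k
    else if k < i + m then glue_disk (p i) (q (k - i)) else p (k + 1 - m))"
  by (auto simp: disk_glue_def glue_disk_def glue_point_def)

lemma disk_of_glue:
  assumes "snd d > 0"
  shows "disk_of (glue_disk d e) = glue_point d ` disk_of e"
proof -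
  define h where "h z = (z - fst d) / of_real (snd d)" for z
  have D: "dist (glue_point d x) (glue_point d y) = snd d * dist x y" for x y
    using assms by (simp add: glue_point_def dist_norm norm_mult flip: right_diff_distrib)
  have h: "glue_point d (h z) = z" for z
    using assms by (simp add: glue_point_def h_def)
  show ?thesis
  proof (intro equalityI subsetI)
    fix z assume "z \<in> disk_of (glue_disk d e)"
    then have "dist (glue_point d (fst e)) (glue_point d (h z)) < snd d * snd e"
      by (simp add: disk_of_def glue_disk_def h)
    then have "h z \<in> disk_of e" using assms by (simp add: D disk_of_def)
    then show "z \<in> glue_point d ` disk_of e" by (rule image_eqI[of z "glue_point d" "h z" "disk_of e", OF h[symmetric]])
  next
    fix z assume "z \<in> glue_point d ` disk_of e"
    then show "z \<in> disk_of (glue_disk d e)" using assms by (auto simp: disk_of_def glue_disk_def D)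
  qed
qed

lemma glue_point_inj: "snd d > 0 \<Longrightarrow> glue_point d x = glue_point d y \<longleftrightarrow> x = y"
  by (simp add: glue_point_def)

lemma disk_of_glue_subset:
  assumes "snd d > 0" "disk_of e \<subseteq> ball 0 1"
  shows "disk_of (glue_disk d e) \<subseteq> disk_of d"
proof -
  have "disk_of d = glue_point d ` ball 0 1"
    using disk_of_glue[OF assms(1), of "(0, 1)"] by (simp add: glue_disk_def glue_point_def disk_of_def)
  then show ?thesis using assms by (auto simp: disk_of_glue)
qed

lemma glue_configs:
  assumes p: "p \<in> disk_configs n" and q: "q \<in> disk_configs m" and i: "i < n" and m: "0 < m"
  shows "disk_glue i m p q \<in> disk_configs (n + m - 1)"
proof -
  have pE: "p k = undefined" if "k \<ge> n" for k
    using p that by (simp add: disk_configs_iff extensional_def)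
  have pp: "snd (p k) > 0" "disk_of (p k) \<subseteq> ball 0 1" if "k < n" for k
    using p that by (simp_all add: disk_configs_iff)
  have pd: "disk_of (p k) \<inter> disk_of (p l) = {}" if "k < n" "l < n" "k \<noteq> l" for k l
    using p that by (simp add: disk_configs_iff)
  have qq: "snd (q k) > 0" "disk_of (q k) \<subseteq> ball 0 1" if "k < m" for k
    using q that by (simp_all add: disk_configs_iff)
  have qd: "disk_of (q k) \<inter> disk_of (q l) = {}" if "k < m" "l < m" "k \<noteq> l" for k l
    using q that by (simp add: disk_configs_iff)
  let ?g = "disk_glue i m p q"
  \<comment> \<open>The disk of \<open>p\<close> that contains disk \<open>k\<close> of the glued
    configuration. Disks with different sources are disjoint because of \<open>p\<close>; two disks
    with the same source both come from \<open>q\<close> and are disjoint because of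
    \<open>q\<close>.\<close>
  define src where "src k = (if k < i then k else if k < i + m then i else k + 1 - m)" for k
  have src: "src k < n" if "k < n + m - 1" for k
    using that i m by (auto simp: src_def)
  have sub: "disk_of (?g k) \<subseteq> disk_of (p (src k))" if "k < n + m - 1" for k
    using disk_of_glue_subset[OF pp(1)[OF i] qq(2)] by (auto simp: disk_glue_eq src_def)
  have disj: "disk_of (?g k) \<inter> disk_of (?g l) = {}" if kl: "k < n + m - 1" "l < n + m - 1" "k \<noteq> l" for k l
  proof (cases "src k = src l")
    case False
    then show ?thesis using pd[OF src[OF kl(1)] src[OF kl(2)]] sub[OF kl(1)] sub[OF kl(2)] by blast
  next
    case True
    then have "i \<le> k \<and> k < i + m \<and> i \<le> l \<and> l < i + m"
      using kl(3) m by (auto simp: src_def split: if_splits)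
    then have eq: "?g k = glue_disk (p i) (q (k - i))" "?g l = glue_disk (p i) (q (l - i))"
      and lt: "k - i < m" "l - i < m" "k - i \<noteq> l - i"
      using kl(3) by (auto simp: disk_glue_eq)
    show ?thesis
      unfolding eq disk_of_glue[OF pp(1)[OF i]] using qd[OF lt] glue_point_inj[OF pp(1)[OF i]] by auto
  qed
  have pos: "snd (?g k) > 0" if "k < n + m - 1" for k
    using that src[OF that] pp(1) pp(1)[OF i] qq(1)[of "k - i"] by (auto simp: disk_glue_eq src_def glue_disk_def)
  have ext: "?g \<in> extensional {..<n + m - 1}"
    using i m pE by (auto simp: extensional_def disk_glue_eq)
  show ?thesis
    unfolding disk_configs_iff using ext pos disj sub src pp(2) by blast
qed

lemma closed_SC_vor: "closed_set_operad SC_vor"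
  unfolding closed_set_operad_def
proof (intro conjI allI ballI impI)
  fix cs c \<sigma> p assume p: "p \<in> s_comp SC_vor cs c" and \<sigma>: "\<sigma> permutes {..<length cs}"
  note L = permutes_lessThanD[OF \<sigma>]
  have p': "p \<in> sc_space cs c" using p by (simp add: SC_vor_def)
  have \<sigma>ge: "\<sigma> j = j" if "\<not> j < length cs" for j
    using \<sigma> that by (simp add: permutes_def)
  have inj: "\<sigma> i = \<sigma> j \<longleftrightarrow> i = j" for i j using L(2) by metis
  have "p \<circ> \<sigma> \<in> disk_configs (length cs)"
    using p' L(3) inj \<sigma>ge by (auto simp: sc_space_iff disk_configs_iff extensional_def)
  moreover have "sc_colors (permute_list \<sigma> cs) c"
    using p' \<sigma> permute_list_nonempty[of cs \<sigma>]
    by (cases c) (auto simp: sc_space_iff sc_colors_def set_permute_list)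
  moreover have "sc_placed (permute_list \<sigma> cs) c i ((p \<circ> \<sigma>) i)" if "i < length cs" for i
    using p' that L(3) \<sigma> by (simp add: sc_space_iff sc_placed_def nth_permute_list)
  ultimately show "s_act SC_vor cs c \<sigma> p \<in> s_comp SC_vor (permute_list \<sigma> cs) c"
    by (simp add: SC_vor_def sc_space_iff)
next
  fix cs :: "color list" and c i ds p q
  assume i: "i < length cs" and "p \<in> s_comp SC_vor cs c" "q \<in> s_comp SC_vor ds (cs ! i)"
  then have p: "p \<in> sc_space cs c" and q: "q \<in> sc_space ds (cs ! i)" by (simp_all add: SC_vor_def)
  let ?g = "disk_glue i (length ds) p q" and ?m = "length ds"
  have pc: "p \<in> disk_configs (length cs)" "sc_colors cs c" and pp: "\<And>k. k < length cs \<Longrightarrow> sc_placed cs c k (p k)"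
    using p by (simp_all add: sc_space_iff)
  have qc: "q \<in> disk_configs ?m" "sc_colors ds (cs ! i)" and qp: "\<And>k. k < ?m \<Longrightarrow> sc_placed ds (cs ! i) k (q k)"
    using q by (simp_all add: sc_space_iff)
  have m: "0 < ?m" using qc(2) by (cases "cs ! i") (auto simp: sc_colors_def)
  have set: "set cs = set (take i cs) \<union> {cs ! i} \<union> set (drop (Suc i) cs)"
    using arg_cong[OF id_take_nth_drop[OF i], of set] by simp
  have pos: "snd (p i) > 0" using pc i by (simp add: disk_configs_iff)
  have "sc_colors (splice_in cs i ds) c"
    using pc(2) qc(2) m set by (cases c; cases "cs ! i") (auto simp: sc_colors_def splice_in_def)
  moreover have "sc_placed (splice_in cs i ds) c k (?g k)" if k: "k < length (splice_in cs i ds)" for k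
  proof -
    consider "k < i" | "i \<le> k" "k < i + ?m" | "i + ?m \<le> k" by linarith
    then show ?thesis
    proof cases
      case 1
      then show ?thesis using pp[of k] i by (simp add: sc_placed_def nth_splice_in disk_glue_eq)
    next
      case 3
      then have "k + 1 - ?m < length cs" using k i m by (simp add: length_splice_in)
      then show ?thesis using pp[of "k + 1 - ?m"] i 3 m by (simp add: sc_placed_def nth_splice_in disk_glue_eq)
    next
      case 2
      then have km: "k - i < ?m" and eq: "?g k = glue_disk (p i) (q (k - i))" "splice_in cs i ds ! k = ds ! (k - i)"
        using i by (auto simp: disk_glue_eq nth_splice_in)
      show ?thesis
      proof (cases "c = Closed")
        case False
        have qsub: "disk_of (q (k - i)) \<subseteq> ball 0 1" using qc km by (simp add: disk_configs_iff)
        show ?thesis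
        proof (cases "cs ! i")
          case Closed
          then have "set ds \<subseteq> {Closed}" using qc(2) by (simp add: sc_colors_def)
          then have "ds ! (k - i) \<noteq> Open" using nth_mem[OF km] by (metis color.distinct(1) singletonD subsetD)
          moreover have "disk_of (p i) \<subseteq> {z. Im z > 0}"
            using pp[OF i] False Closed by (simp add: sc_placed_def)
          ultimately show ?thesis
            using disk_of_glue_subset[OF pos qsub] by (auto simp: sc_placed_def eq)
        next
          case Open
          \<comment> \<open>With a real center the embedding scales imaginary parts by a positive
            factor, so it preserves real centers and the upper half plane.\<close>
          then have re: "Im (fst (p i)) = 0" using pp[OF i] False by (simp add: sc_placed_def)
          have im: "Im (glue_point (p i) z) = snd (p i) * Im z" for z
            using re by (simp add: glue_point_def)
          have "sc_placed ds Open (k - i) (q (k - i))" using qp[OF km] Open by simp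
          then show ?thesis
          proof (cases "ds ! (k - i) = Open")
            case True
            then show ?thesis
              using \<open>sc_placed ds Open (k - i) (q (k - i))\<close> by (simp add: sc_placed_def eq im glue_disk_def)
          next
            case False
            then have "disk_of (q (k - i)) \<subseteq> {z. Im z > 0}"
              using \<open>sc_placed ds Open (k - i) (q (k - i))\<close> by (simp add: sc_placed_def)
            then have "disk_of (glue_disk (p i) (q (k - i))) \<subseteq> {z. Im z > 0}"
              unfolding disk_of_glue[OF pos] using pos by (auto simp: im)
            then show ?thesis using False by (simp add: sc_placed_def eq)
          qed
        qed
      qed (simp add: sc_placed_def)
    qed
  qed
  ultimately show "s_circ SC_vor cs c i ds p q \<in> s_comp SC_vor (splice_in cs i ds) c"
    using glue_configs[OF pc(1) qc(1) i m] i by (simp add: SC_vor_def sc_space_iff length_splice_in)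
next
  fix c show "s_unit SC_vor c \<in> s_comp SC_vor [c] c"
    by (cases c) (auto simp: SC_vor_def sc_space_iff disk_configs_iff sc_colors_def sc_placed_def extensional_def disk_of_def)
qed

section \<open>Words read off from configurations\<close>

definition disk_word :: "color list \<Rightarrow> (nat \<Rightarrow> little_disk) \<Rightarrow> nat list" where
  "disk_word cs p = sort_key (\<lambda>i. Re (fst (p i))) (filter (\<lambda>i. cs ! i = Open) [0..<length cs])"

lemma set_disk_word [simp]: "set (disk_word cs p) = open_inputs cs"
  by (auto simp: disk_word_def open_inputs_def)

lemma distinct_disk_word [simp]: "distinct (disk_word cs p)"
  by (simp add: disk_word_def)

lemma disk_word_eqI:
  assumes "set w = open_inputs cs" "sorted_wrt (\<lambda>i j. Re (fst (p i)) < Re (fst (p j))) w"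
  shows "disk_word cs p = w"
proof -
  let ?k = "\<lambda>i. Re (fst (p i))"
  have s: "sorted_wrt (<) (map ?k w)" using assms(2) by (simp add: sorted_wrt_map)
  then have d: "distinct (map ?k w)" "sorted (map ?k w)" by (simp_all add: strict_sorted_iff)
  have set: "set (filter (\<lambda>i. cs ! i = Open) [0..<length cs]) = set w"
    using assms(1) by (auto simp: open_inputs_def)
  have "mset (filter (\<lambda>i. cs ! i = Open) [0..<length cs]) = mset w"
    using d(1) set set_eq_iff_mset_eq_distinct[of "filter (\<lambda>i. cs ! i = Open) [0..<length cs]" w] by (simp add: distinct_map)
  then show ?thesis
    unfolding disk_word_def by (rule sort_key_inj_key_eq) (use d set in \<open>simp_all add: distinct_map\<close>)
qed

lemma disk_center: "snd d > 0 \<Longrightarrow> fst d \<in> disk_of d"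
  by (simp add: disk_of_def)

lemma sc_centers_distinct:
  assumes "p \<in> sc_space cs c" "i < length cs" "j < length cs" "i \<noteq> j"
  shows "fst (p i) \<noteq> fst (p j)"
  using assms disk_center[of "p i"] disk_center[of "p j"] by (fastforce simp: sc_space_iff disk_configs_iff)

lemma sc_open_center:
  assumes "p \<in> sc_space cs c" "i \<in> open_inputs cs"
  shows "i < length cs" "c = Open" "Im (fst (p i)) = 0"
proof -
  show i: "i < length cs" using assms by (simp add: open_inputs_def)
  have "cs ! i = Open" using assms by (simp add: open_inputs_def)
  then show c: "c = Open"
    using assms(1) nth_mem[OF i] by (cases c) (auto simp: sc_space_iff sc_colors_def)
  show "Im (fst (p i)) = 0"
    using assms(1) i c \<open>cs ! i = Open\<close> by (auto simp: sc_space_iff sc_placed_def)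
qed

lemma sc_open_separate:
  assumes "p \<in> sc_space cs c" "i \<in> open_inputs cs" "j \<in> open_inputs cs" "i \<noteq> j"
  shows "Re (fst (p i)) \<noteq> Re (fst (p j))"
  using sc_centers_distinct[OF assms(1) _ _ assms(4)] sc_open_center[OF assms(1,2)] sc_open_center[OF assms(1,3)]
  by (auto simp: complex_eq_iff)

lemma sorted_disk_word:
  assumes "p \<in> sc_space cs c"
  shows "sorted_wrt (\<lambda>i j. Re (fst (p i)) < Re (fst (p j))) (disk_word cs p)"
proof -
  let ?k = "\<lambda>i. Re (fst (p i))"
  have "inj_on ?k (open_inputs cs)"
    by (rule inj_onI) (use sc_open_separate[OF assms] in blast)
  then have "distinct (map ?k (disk_word cs p))" by (simp add: distinct_map)
  moreover have "sorted (map ?k (disk_word cs p))" by (simp add: disk_word_def)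
  ultimately show ?thesis
    unfolding sorted_wrt_map[symmetric, of "(<)" ?k] by (simp add: strict_sorted_iff)
qed

lemma disk_word_comp:
  assumes "p \<in> sc_space cs c"
  shows "disk_word cs p \<in> s_comp word_operad cs c"
proof -
  have col: "sc_colors cs c" using assms by (simp add: sc_space_iff)
  have ne: "cs \<noteq> []" using col by (cases c) (auto simp: sc_colors_def)
  have "open_inputs cs = {} \<longleftrightarrow> c = Closed"
    using col by (cases c) (auto simp: sc_colors_def open_inputs_def in_set_conv_nth subset_iff)
  then show ?thesis using ne by (auto simp flip: set_disk_word[of cs p] simp del: set_disk_word)
qed

lemma sorted_wrt_concat_map:
  assumes "\<And>j. j \<in> set w \<Longrightarrow> sorted_wrt R (f j)"
    and "sorted_wrt (\<lambda>j k. \<forall>x\<in>set (f j). \<forall>y\<in>set (f k). R x y) w"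
  shows "sorted_wrt R (concat (map f w))"
  using assms by (induction w) (auto simp: sorted_wrt_append)

text \<open>A disk glued in keeps its center within the old disk, and disjoint disks with real
  centers are at least the sum of their radii apart; so letters from different old disks keep their
  order. Within disk \<open>i\<close> the gluing map is increasing on real parts.\<close>

lemma disk_word_glue:
  assumes i: "i < length cs" and p: "p \<in> sc_space cs c" and q: "q \<in> sc_space ds (cs ! i)"
  shows "disk_word (splice_in cs i ds) (disk_glue i (length ds) p q) =
    subst_word i (length ds) (disk_word ds q) (disk_word cs p)"
proof (rule disk_word_eqI)
  let ?m = "length ds" and ?g = "disk_glue i (length ds) p q" and ?w = "disk_word cs p" and ?v = "disk_word ds q"
  have "s_circ word_operad cs c i ds ?w ?v \<in> s_comp word_operad (splice_in cs i ds) c"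
    using closed_word_operad i disk_word_comp[OF p] disk_word_comp[OF q] unfolding closed_set_operad_def by blast
  then show "set (subst_word i ?m ?v ?w) = open_inputs (splice_in cs i ds)" by simp
  have pos: "snd (p k) > 0" if "k < length cs" for k using p that by (simp add: sc_space_iff disk_configs_iff)
  have vm: "k < ?m" if "k \<in> set ?v" for k using that by (simp add: open_inputs_def)
  have m: "0 < ?m" using disk_word_comp[OF q] by auto
  have left: "?g j = p j" if "j < i" for j using that by (simp add: disk_glue_eq)
  have right: "?g (j + ?m - 1) = p j" if "j > i" for j
  proof -
    have "\<not> j + ?m - 1 < i" "\<not> j + ?m - 1 < i + ?m" "j + ?m - 1 + 1 - ?m = j" using that m by linarith+
    then show ?thesis by (simp only: disk_glue_eq if_False)
  qed
  have mid: "?g (k + i) = glue_disk (p i) (q k)" if "k \<in> set ?v" for k using vm[OF that] by (simp add: disk_glue_eq)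
  have glued: "\<bar>Re (fst (?g x)) - Re (fst (p j))\<bar> < snd (p j)"
    if j: "j \<in> set ?w" and x: "x \<in> set (subst_letter i ?m ?v j)" for j x
  proof -
    have jn: "j < length cs" using j by (simp add: open_inputs_def)
    have "fst (?g x) \<in> disk_of (p j)"
    proof (cases "j = i")
      case True
      then obtain k where k: "k \<in> set ?v" "x = k + i" using x by (auto simp: subst_letter_def)
      have "snd (q k) > 0" "disk_of (q k) \<subseteq> ball 0 1"
        using q vm[OF k(1)] by (simp_all add: sc_space_iff disk_configs_iff)
      then have "disk_of (glue_disk (p i) (q k)) \<subseteq> disk_of (p i)"
        using disk_of_glue_subset[OF pos[OF i]] by blast
      moreover have "fst (glue_disk (p i) (q k)) \<in> disk_of (glue_disk (p i) (q k))"
        by (rule disk_center) (use pos[OF i] \<open>snd (q k) > 0\<close> in \<open>simp add: glue_disk_def\<close>)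
      ultimately show ?thesis using mid[OF k(1)] k(2) True by auto
    next
      case False
      then have "?g x = p j" using x left right by (auto simp: subst_letter_def split: if_splits)
      then show ?thesis using disk_center[OF pos[OF jn]] by simp
    qed
    then have "cmod (fst (?g x) - fst (p j)) < snd (p j)" by (simp add: disk_of_def dist_norm norm_minus_commute)
    then show ?thesis using abs_Re_le_cmod[of "fst (?g x) - fst (p j)"] by simp
  qed
  show "sorted_wrt (\<lambda>x y. Re (fst (?g x)) < Re (fst (?g y))) (subst_word i ?m ?v ?w)"
    unfolding subst_word_def
  proof (rule sorted_wrt_concat_map)
    fix j assume j: "j \<in> set ?w"
    show "sorted_wrt (\<lambda>x y. Re (fst (?g x)) < Re (fst (?g y))) (subst_letter i ?m ?v j)"
    proof (cases "j = i")
      case True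
      have "sorted_wrt (\<lambda>x y. Re (fst (?g (x + i))) < Re (fst (?g (y + i)))) ?v"
        by (rule sorted_wrt_mono_rel[OF _ sorted_disk_word[OF q]])
          (use pos[OF i] in \<open>simp add: mid glue_disk_def glue_point_def\<close>)
      then show ?thesis using True by (simp add: subst_letter_def sorted_wrt_map)
    qed (simp add: subst_letter_def)
  next
    show "sorted_wrt (\<lambda>j k. \<forall>x\<in>set (subst_letter i ?m ?v j). \<forall>y\<in>set (subst_letter i ?m ?v k).
        Re (fst (?g x)) < Re (fst (?g y))) ?w"
    proof (rule sorted_wrt_mono_rel[OF _ sorted_disk_word[OF p]], intro ballI)
      fix j k x y assume j: "j \<in> set ?w" and k: "k \<in> set ?w" and lt: "Re (fst (p j)) < Re (fst (p k))"
        and x: "x \<in> set (subst_letter i ?m ?v j)" and y: "y \<in> set (subst_letter i ?m ?v k)"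
      have jk: "j < length cs" "k < length cs" "j \<noteq> k" using j k lt by (auto simp: open_inputs_def)
      have im: "Im (fst (p j)) = 0" "Im (fst (p k)) = 0" using sc_open_center(3)[OF p] j k by simp_all
      have disj: "disk_of (p j) \<inter> disk_of (p k) = {}" using p jk by (simp add: sc_space_iff disk_configs_iff)
      have sep: "snd (p j) + snd (p k) \<le> Re (fst (p k)) - Re (fst (p j))"
      proof (rule ccontr)
        let ?d = "Re (fst (p k)) - Re (fst (p j))" and ?a = "snd (p j)" and ?b = "snd (p k)"
        assume "\<not> ?a + ?b \<le> ?d"
        then have d: "?d < ?a + ?b" "?d > 0" "?a > 0" "?b > 0" using lt pos jk by simp_all
        \<comment> \<open>The point dividing the segment between the centers in the ratio of the
          radii; if the centers were too close, it would lie in both disks.\<close>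
        let ?z = "complex_of_real (Re (fst (p j)) + ?d * ?a / (?a + ?b))"
        have "?d * ?a / (?a + ?b) < ?a" "?d * ?b / (?a + ?b) < ?b"
          using d by (simp_all add: pos_divide_less_eq mult.commute)
        moreover have "?d - ?d * ?a / (?a + ?b) = ?d * ?b / (?a + ?b)"
          using d by (simp add: field_simps)
        moreover have "0 < ?d * ?a / (?a + ?b)" "0 < ?d * ?b / (?a + ?b)" using d by simp_all
        moreover have "fst (p j) = complex_of_real (Re (fst (p j)))" "fst (p k) = complex_of_real (Re (fst (p k)))"
          using im by (simp_all add: complex_eq_iff)
        then have "cmod (fst (p j) - ?z) = \<bar>?d * ?a / (?a + ?b)\<bar>" "cmod (fst (p k) - ?z) = \<bar>?d - ?d * ?a / (?a + ?b)\<bar>"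
          by (metis (no_types, opaque_lifting) abs_minus_cancel add_diff_cancel_left' minus_diff_eq norm_of_real of_real_diff)
            (metis (no_types, opaque_lifting) diff_diff_eq norm_of_real of_real_diff \<open>fst (p k) = complex_of_real (Re (fst (p k)))\<close>)
        ultimately have "?z \<in> disk_of (p j) \<inter> disk_of (p k)"
          by (simp add: disk_of_def dist_norm)
        then show False using disj by simp
      qed
      show "Re (fst (?g x)) < Re (fst (?g y))"
        using glued[OF j x] glued[OF k y] sep unfolding abs_less_iff by linarith
    qed
  qed
qed

lemma operad_map_disk_word:
  "operad_map (linearization SC_vor :: ('k::field, _) operad) (linearization word_operad)
    (\<lambda>cs c. lin (\<lambda>p. delta (disk_word cs p)))"
proof (rule operad_map_lin[OF closed_SC_vor closed_word_operad])
  fix cs c p assume p: "p \<in> s_comp SC_vor cs c"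
  then have p': "p \<in> sc_space cs c" by (simp add: SC_vor_def)
  show "Poly_Mapping.keys (delta (disk_word cs p) :: _ \<Rightarrow>\<^sub>0 'k) \<subseteq> s_comp word_operad cs c"
    using disk_word_comp[OF p'] by (simp del: word_operad_simps)
  fix \<sigma> assume \<sigma>: "\<sigma> permutes {..<length cs}"
  have "disk_word (permute_list \<sigma> cs) (p \<circ> \<sigma>) = map (inv_into UNIV \<sigma>) (disk_word cs p)"
  proof (rule disk_word_eqI)
    show "set (map (inv_into UNIV \<sigma>) (disk_word cs p)) = open_inputs (permute_list \<sigma> cs)"
      by (simp add: open_inputs_permute[OF \<sigma>])
    show "sorted_wrt (\<lambda>i j. Re (fst ((p \<circ> \<sigma>) i)) < Re (fst ((p \<circ> \<sigma>) j))) (map (inv_into UNIV \<sigma>) (disk_word cs p))"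
      using sorted_disk_word[OF p'] by (simp add: sorted_wrt_map permutes_lessThanD(1)[OF \<sigma>])
  qed
  then show "(delta (disk_word (permute_list \<sigma> cs) (s_act SC_vor cs c \<sigma> p)) :: _ \<Rightarrow>\<^sub>0 'k) =
      o_act (linearization word_operad) cs c \<sigma> (delta (disk_word cs p))"
    by (simp add: SC_vor_def linearization_simps)
next
  fix cs :: "color list" and c i ds p q
  assume "i < length cs" "p \<in> s_comp SC_vor cs c" "q \<in> s_comp SC_vor ds (cs ! i)"
  then show "(delta (disk_word (splice_in cs i ds) (s_circ SC_vor cs c i ds p q)) :: _ \<Rightarrow>\<^sub>0 'k) =
      o_circ (linearization word_operad) cs c i ds (delta (disk_word cs p)) (delta (disk_word ds q))"
    using disk_word_glue[of i cs p c q ds] by (simp add: SC_vor_def linearization_simps)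
next
  fix c show "(delta (disk_word [c] (s_unit SC_vor c)) :: _ \<Rightarrow>\<^sub>0 'k) = delta (s_unit word_operad c)"
    by (cases c) (simp_all add: disk_word_def)
qed

section \<open>Path components of swiss-cheese configurations\<close>

definition mk_config :: "nat \<Rightarrow> (nat \<Rightarrow> complex) \<Rightarrow> (nat \<Rightarrow> real) \<Rightarrow> nat \<Rightarrow> little_disk" where
  "mk_config n z r = (\<lambda>i. if i < n then (z i, r i) else undefined)"

text \<open>The condition on centers alone under which disks of a small common radius around them
  form a configuration.\<close>

definition sc_centers :: "color list \<Rightarrow> color \<Rightarrow> (nat \<Rightarrow> complex) \<Rightarrow> bool" where
  "sc_centers cs c z \<longleftrightarrow> sc_colors cs c \<and>
    (\<forall>i<length cs. z i \<in> ball 0 1 \<and> (c = Open \<longrightarrow> (if cs ! i = Open then Im (z i) = 0 else Im (z i) > 0))) \<and>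
    (\<forall>i<length cs. \<forall>j<length cs. i \<noteq> j \<longrightarrow> z i \<noteq> z j)"

lemma sc_space_shrink:
  assumes p: "p \<in> sc_space cs c" and ext: "p' \<in> extensional {..<length cs}"
    and sub: "\<And>i. i < length cs \<Longrightarrow> fst (p' i) = fst (p i) \<and> 0 < snd (p' i) \<and> snd (p' i) \<le> snd (p i)"
  shows "p' \<in> sc_space cs c"
proof -
  have d: "disk_of (p' i) \<subseteq> disk_of (p i)" if "i < length cs" for i
    using sub[OF that] by (simp add: disk_of_def subset_ball)
  have pc: "disk_of (p i) \<subseteq> ball 0 1" "sc_placed cs c i (p i)" if "i < length cs" for i
    using p that by (simp_all add: sc_space_iff disk_configs_iff)
  have pd: "disk_of (p i) \<inter> disk_of (p j) = {}" if "i < length cs" "j < length cs" "i \<noteq> j" for i j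
    using p that by (simp add: sc_space_iff disk_configs_iff)
  have "sc_colors cs c" using p by (simp add: sc_space_iff)
  moreover have "disk_of (p' i) \<inter> disk_of (p' j) = {}" if "i < length cs" "j < length cs" "i \<noteq> j" for i j
    using pd[OF that] d[OF that(1)] d[OF that(2)] by blast
  moreover have "sc_placed cs c i (p' i)" if "i < length cs" for i
    using pc(2)[OF that] d[OF that] sub[OF that] by (auto simp: sc_placed_def split: if_splits)
  ultimately show ?thesis
    unfolding sc_space_iff disk_configs_iff using ext sub order_trans[OF d pc(1)] by blast
qed

lemma sc_centers_of:
  assumes p: "p \<in> sc_space cs c"
  shows "sc_centers cs c (\<lambda>i. fst (p i))"
proof -
  have "fst (p i) \<in> ball 0 1 \<and> (c = Open \<longrightarrow> (if cs ! i = Open then Im (fst (p i)) = 0 else Im (fst (p i)) > 0))"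
    if "i < length cs" for i
  proof -
    have "snd (p i) > 0" "disk_of (p i) \<subseteq> ball 0 1" "sc_placed cs c i (p i)"
      using p that by (simp_all add: sc_space_iff disk_configs_iff)
    then show ?thesis using disk_center[of "p i"] by (auto simp: sc_placed_def)
  qed
  then show ?thesis
    using p sc_centers_distinct[OF p] unfolding sc_centers_def sc_space_iff by blast
qed

lemma small_disks:
  assumes z: "sc_centers cs c z" and e: "0 < e"
    and "\<And>i. i < length cs \<Longrightarrow> e \<le> 1 - cmod (z i)"
    and "\<And>i j. i < length cs \<Longrightarrow> j < length cs \<Longrightarrow> i \<noteq> j \<Longrightarrow> 2 * e \<le> cmod (z i - z j)"
    and "\<And>i. i < length cs \<Longrightarrow> c = Open \<Longrightarrow> cs ! i = Closed \<Longrightarrow> e \<le> Im (z i)"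
  shows "mk_config (length cs) z (\<lambda>_. e) \<in> sc_space cs c"
proof -
  have "ball (z i) e \<subseteq> ball 0 1" if "i < length cs" for i
  proof
    fix x assume "x \<in> ball (z i) e"
    then have "cmod (x - z i) < e" by (simp add: dist_norm norm_minus_commute)
    then have "cmod x < 1" using norm_triangle_ineq[of "x - z i" "z i"] assms(3)[OF that] by simp
    then show "x \<in> ball 0 1" by simp
  qed
  moreover have "ball (z i) e \<inter> ball (z j) e = {}" if "i < length cs" "j < length cs" "i \<noteq> j" for i j
  proof (rule ccontr)
    assume "ball (z i) e \<inter> ball (z j) e \<noteq> {}"
    then obtain x where "dist (z i) x < e" "dist (z j) x < e" by auto
    then have "dist (z i) (z j) < 2 * e" using dist_triangle2[of "z i" "z j" x] by simp
    then show False using assms(4)[OF that] by (simp add: dist_norm)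
  qed
  moreover have "sc_placed cs c i (z i, e)" if i: "i < length cs" for i
  proof (cases "c = Closed")
    case False
    then have c: "c = Open" by (cases c) simp_all
    show ?thesis
    proof (cases "cs ! i")
      case Open
      then show ?thesis using z i c by (simp add: sc_placed_def sc_centers_def)
    next
      case Closed
      have "Im x > 0" if "x \<in> ball (z i) e" for x
      proof -
        have "\<bar>Im (x - z i)\<bar> < e"
          using abs_Im_le_cmod[of "x - z i"] that by (simp add: dist_norm norm_minus_commute)
        then show ?thesis using assms(5)[OF i c Closed] by simp
      qed
      then show ?thesis using Closed by (auto simp: sc_placed_def disk_of_def)
    qed
  qed (simp add: sc_placed_def)
  ultimately show ?thesis
    using e z by (simp add: sc_space_iff disk_configs_iff mk_config_def disk_of_def sc_centers_def extensional_def)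
qed

text \<open>A positive continuous function on a compact interval has a positive minimum. The form
  with \<open>at_right 0\<close> lets finitely many such bounds be combined without naming their
  minimum.\<close>

lemma eventually_below_continuous:
  fixes f :: "real \<Rightarrow> real"
  assumes "continuous_on {0..1} f" "\<And>t. t \<in> {0..1} \<Longrightarrow> 0 < f t"
  shows "\<forall>\<^sub>F e in at_right 0. \<forall>t\<in>{0..1}. e \<le> f t"
proof -
  obtain s where s: "s \<in> {0..1}" "\<And>t. t \<in> {0..1} \<Longrightarrow> f s \<le> f t"
    using continuous_attains_inf[of "{0..1::real}" f] assms(1) by auto
  have "\<forall>\<^sub>F e in at_right 0. e \<in> {0<..<f s}"
    by (rule eventually_at_right_real) (rule assms(2)[OF s(1)])
  then show ?thesis
    by (rule eventually_mono) (use s(2) in fastforce)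
qed

text \<open>One radius serves for the whole motion: the finitely many distances to the unit circle,
  between centers and from closed centers to the real axis are positive and continuous in
  \<open>t\<close>.\<close>

lemma small_disks_eventually:
  assumes cont: "\<And>i. i < length cs \<Longrightarrow> continuous_on {0..1} (\<lambda>t. Z t i)"
    and z: "\<And>t. t \<in> {0..1 :: real} \<Longrightarrow> sc_centers cs c (Z t)"
  shows "\<forall>\<^sub>F e in at_right 0. \<forall>t\<in>{0..1}. mk_config (length cs) (Z t) (\<lambda>_. e) \<in> sc_space cs c"
proof -
  let ?n = "length cs"
  have 1: "\<forall>\<^sub>F e in at_right 0. \<forall>i\<in>{..<?n}. \<forall>t\<in>{0..1}. e \<le> 1 - cmod (Z t i)"
  proof (rule eventually_ball_finite, simp, intro ballI eventually_below_continuous)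
    fix i assume "i \<in> {..<?n}"
    then show "continuous_on {0..1} (\<lambda>t. 1 - cmod (Z t i))" by (intro continuous_intros cont) simp
    fix t :: real assume "t \<in> {0..1}"
    then show "0 < 1 - cmod (Z t i)" using z[of t] \<open>i \<in> {..<?n}\<close> by (simp add: sc_centers_def)
  qed
  have 2: "\<forall>\<^sub>F e in at_right 0. \<forall>ij\<in>{ij \<in> {..<?n} \<times> {..<?n}. fst ij \<noteq> snd ij}. \<forall>t\<in>{0..1}.
      e \<le> cmod (Z t (fst ij) - Z t (snd ij)) / 2"
  proof (rule eventually_ball_finite, simp, intro ballI eventually_below_continuous)
    fix ij assume ij: "ij \<in> {ij \<in> {..<?n} \<times> {..<?n}. fst ij \<noteq> snd ij}"
    then show "continuous_on {0..1} (\<lambda>t. cmod (Z t (fst ij) - Z t (snd ij)) / 2)"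
      by (intro continuous_intros cont) auto
    fix t :: real assume "t \<in> {0..1}"
    then show "0 < cmod (Z t (fst ij) - Z t (snd ij)) / 2"
      using z[of t] ij by (auto simp: sc_centers_def)
  qed
  have 3: "\<forall>\<^sub>F e in at_right 0. \<forall>i\<in>{i \<in> {..<?n}. c = Open \<and> cs ! i = Closed}. \<forall>t\<in>{0..1}. e \<le> Im (Z t i)"
  proof (rule eventually_ball_finite, simp, intro ballI eventually_below_continuous)
    fix i assume i: "i \<in> {i \<in> {..<?n}. c = Open \<and> cs ! i = Closed}"
    then show "continuous_on {0..1} (\<lambda>t. Im (Z t i))" by (intro continuous_intros cont) simp
    fix t :: real assume "t \<in> {0..1}"
    then show "0 < Im (Z t i)" using z[of t] i by (simp add: sc_centers_def)
  qed
  have 4: "\<forall>\<^sub>F e :: real in at_right 0. 0 < e"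
    by (simp add: eventually_at_right_less)
  show ?thesis
    using 1 2 3 4
  proof eventually_elim
    case (elim e)
    show ?case
    proof
      fix t :: real assume t: "t \<in> {0..1}"
      show "mk_config ?n (Z t) (\<lambda>_. e) \<in> sc_space cs c"
      proof (rule small_disks[OF z[OF t] elim(4)])
        fix i j assume ij: "i < ?n" "j < ?n" "i \<noteq> j"
        have "e \<le> cmod (Z t (fst (i, j)) - Z t (snd (i, j))) / 2"
          by (rule bspec[OF bspec[OF elim(2)] t]) (use ij in simp)
        then show "2 * e \<le> cmod (Z t i - Z t j)" by simp
      qed (use elim t in auto)
    qed
  qed
qed

lemma path_mk_config:
  assumes "\<And>i. i < n \<Longrightarrow> continuous_on {0..1} (\<lambda>t. Z t i)" "\<And>i. i < n \<Longrightarrow> continuous_on {0..1} (\<lambda>t. r t i)"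
  shows "path (\<lambda>t. mk_config n (Z t) (r t))"
  unfolding path_def
proof (rule continuous_on_coordinatewise_then_product)
  fix i
  show "continuous_on {0..1} (\<lambda>t. mk_config n (Z t) (r t) i)"
    using assms by (cases "i < n") (auto simp: mk_config_def intro!: continuous_intros)
qed

lemma move_disks:
  assumes cont: "\<And>i. i < length cs \<Longrightarrow> continuous_on {0..1} (\<lambda>t. Z t i)"
    and z: "\<And>t. t \<in> {0..1 :: real} \<Longrightarrow> sc_centers cs c (Z t)"
  shows "\<forall>\<^sub>F e in at_right 0. path_component (sc_space cs c)
    (mk_config (length cs) (Z 0) (\<lambda>_. e)) (mk_config (length cs) (Z 1) (\<lambda>_. e))"
proof (rule eventually_mono[OF small_disks_eventually[OF assms]])
  fix e assume elim: "\<forall>t\<in>{0..1}. mk_config (length cs) (Z t) (\<lambda>_. e) \<in> sc_space cs c"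
  show "path_component (sc_space cs c) (mk_config (length cs) (Z 0) (\<lambda>_. e)) (mk_config (length cs) (Z 1) (\<lambda>_. e))"
    unfolding path_component_def
  proof (intro exI conjI)
    show "path (\<lambda>t. mk_config (length cs) (Z t) (\<lambda>_. e))"
      by (rule path_mk_config) (simp_all add: cont)
  qed (use elim in \<open>auto simp: path_image_def pathstart_def pathfinish_def\<close>)
qed

lemma shrink_disks:
  assumes p: "p \<in> sc_space cs c" and e: "0 < e" "\<And>i. i < length cs \<Longrightarrow> e \<le> snd (p i)"
  shows "path_component (sc_space cs c) p (mk_config (length cs) (\<lambda>i. fst (p i)) (\<lambda>_. e))"
proof -
  let ?n = "length cs" and ?r = "\<lambda>t i. (1 - t) * snd (p i) + t * e"
  let ?\<gamma> = "\<lambda>t. mk_config ?n (\<lambda>i. fst (p i)) (?r t)"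
  have pos: "0 < snd (p i)" if "i < ?n" for i using p that by (simp add: sc_space_iff disk_configs_iff)
  have ext: "p i = undefined" if "\<not> i < ?n" for i using p that by (simp add: sc_space_iff disk_configs_iff extensional_def)
  have img: "?\<gamma> t \<in> sc_space cs c" if t: "t \<in> {0..1}" for t
  proof (rule sc_space_shrink[OF p])
    fix i assume i: "i < ?n"
    have "0 < ?r t i"
    proof (cases "t = 0")
      case False
      then have "0 < t * e" "0 \<le> (1 - t) * snd (p i)" using t e pos[OF i] by auto
      then show ?thesis by linarith
    qed (use pos[OF i] in simp)
    moreover have "t * e \<le> t * snd (p i)" using t e(2)[OF i] by (intro mult_left_mono) auto
    then have "?r t i \<le> snd (p i)" by (simp add: algebra_simps)
    ultimately show "fst (?\<gamma> t i) = fst (p i) \<and> 0 < snd (?\<gamma> t i) \<and> snd (?\<gamma> t i) \<le> snd (p i)"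
      using i by (simp add: mk_config_def)
  qed (simp add: mk_config_def extensional_def)
  show ?thesis
    unfolding path_component_def
  proof (intro exI conjI)
    show "path ?\<gamma>" by (rule path_mk_config) (auto intro!: continuous_intros)
    show "path_image ?\<gamma> \<subseteq> sc_space cs c" using img by (auto simp: path_image_def)
    show "pathstart ?\<gamma> = p" using ext by (auto simp: pathstart_def mk_config_def)
    show "pathfinish ?\<gamma> = mk_config ?n (\<lambda>i. fst (p i)) (\<lambda>_. e)" by (simp add: pathfinish_def mk_config_def fun_eq_iff)
  qed
qed

section \<open>Paths between configurations with equal words\<close>

lemma sorted_wrt_both:
  "\<lbrakk>sorted_wrt R w; sorted_wrt R' w; i \<in> set w; j \<in> set w; i \<noteq> j\<rbrakk> \<Longrightarrow> R i j \<and> R' i j \<or> R j i \<and> R' j i"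
  by (induction w) auto

text \<open>
  The straight line from one position of the closed disks to another may lead to collisions, but
  after extending its parameter to complex numbers these occur at finitely many values only,
  which can be avoided by a path from \<open>0\<close> to \<open>1\<close>.
\<close>

lemma complex_parameter_path:
  fixes z z' :: "nat \<Rightarrow> complex"
  assumes A: "finite A" and D: "open D" "convex D"
    and zD: "\<And>i. i \<in> A \<Longrightarrow> z i \<in> D \<and> z' i \<in> D"
    and ne: "\<And>i j. i \<in> A \<Longrightarrow> j \<in> A \<Longrightarrow> i \<noteq> j \<Longrightarrow> z i \<noteq> z j \<and> z' i \<noteq> z' j"
  obtains g where "path g" "pathstart g = 0" "pathfinish g = 1"
    "\<And>t i. t \<in> {0..1} \<Longrightarrow> i \<in> A \<Longrightarrow> (1 - g t) * z i + g t * z' i \<in> D"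
    "\<And>t i j. t \<in> {0..1} \<Longrightarrow> i \<in> A \<Longrightarrow> j \<in> A \<Longrightarrow> i \<noteq> j \<Longrightarrow>
      (1 - g t) * z i + g t * z' i \<noteq> (1 - g t) * z j + g t * z' j"
proof -
  let ?l = "\<lambda>i t. (1 - t) * z i + t * z' i"
  \<comment> \<open>The parameters for which all points stay in \<open>D\<close>: a finite
    intersection of preimages of \<open>D\<close> under affine maps, hence open and convex.\<close>
  define W where "W = (\<Inter>i\<in>A. ?l i -` D)"
  define B where "B = (\<Union>(i, j)\<in>{ij \<in> A \<times> A. fst ij \<noteq> snd ij}. {t. ?l i t = ?l j t})"
  have "open (?l i -` D)" for i
    by (rule open_vimage[OF D(1)]) (intro continuous_intros)
  then have "open W" unfolding W_def using A by (intro open_INT) auto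
  moreover have "convex (?l i -` D)" for i
  proof (rule convexI)
    fix x y :: complex and u v :: real
    assume xy: "x \<in> ?l i -` D" "y \<in> ?l i -` D" and uv: "0 \<le> u" "0 \<le> v" "u + v = 1"
    have v: "complex_of_real v = 1 - complex_of_real u"
      using uv(3) by (metis add_diff_cancel_left' of_real_1 of_real_diff)
    have "?l i (u *\<^sub>R x + v *\<^sub>R y) = u *\<^sub>R ?l i x + v *\<^sub>R ?l i y"
      unfolding scaleR_conv_of_real v by (simp add: algebra_simps)
    then show "u *\<^sub>R x + v *\<^sub>R y \<in> ?l i -` D"
      using convexD[OF D(2) _ _ uv] xy by simp
  qed
  then have "convex W" unfolding W_def by (intro convex_INT)
  then have "connected W" by (rule convex_connected)
  moreover have "finite B"
    unfolding B_def
  proof (rule finite_UN_I)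
    show "finite {ij \<in> A \<times> A. fst ij \<noteq> snd ij}" using A by simp
    fix ij assume ij: "ij \<in> {ij \<in> A \<times> A. fst ij \<noteq> snd ij}"
    obtain i j where [simp]: "ij = (i, j)" by (cases ij)
    have n: "z i \<noteq> z j" using ne ij by auto
    \<comment> \<open>The difference of two points is affine in \<open>t\<close> and nonzero at
      \<open>0\<close>, so it vanishes at most once.\<close>
    have "{t. ?l i t = ?l j t} \<subseteq> {(z i - z j) / ((z i - z j) - (z' i - z' j))}"
    proof
      fix t assume "t \<in> {t. ?l i t = ?l j t}"
      then have e: "t * ((z i - z j) - (z' i - z' j)) = z i - z j" by (simp add: algebra_simps)
      then have "(z i - z j) - (z' i - z' j) \<noteq> 0" using n by auto
      then show "t \<in> {(z i - z j) / ((z i - z j) - (z' i - z' j))}" using e by (simp add: field_simps)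
    qed
    then show "finite (case ij of (i, j) \<Rightarrow> {t. ?l i t = ?l j t})" by (simp add: finite_subset)
  qed
  \<comment> \<open>The complex parameters have real dimension two, so an open connected set stays
    path connected when finitely many points are removed.\<close>
  ultimately have "path_connected (W - B)"
    by (intro path_connected_open_diff_countable) (simp_all add: countable_finite)
  moreover have "0 \<in> W - B" "1 \<in> W - B" using zD ne by (auto simp: W_def B_def)
  ultimately obtain g where g: "path g" "path_image g \<subseteq> W - B" "pathstart g = 0" "pathfinish g = 1"
    unfolding path_connected_def by blast
  have "g t \<in> W - B" if "t \<in> {0..1}" for t
    using subsetD[OF g(2), of "g t"] that by (simp add: path_image_def)
  then show thesis
    by (intro that[OF g(1,3,4)]) (auto simp: W_def B_def)
qed

text \<open>The path has three legs: shrink all disks to radius \<open>e\<close>, move the centers,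
  and enlarge again. The radius must be small for both configurations and for the whole
  motion.\<close>

lemma sc_path_component:
  assumes p: "p \<in> sc_space cs c" and p': "p' \<in> sc_space cs c" and word: "disk_word cs p = disk_word cs p'"
  shows "path_component (sc_space cs c) p p'"
proof -
  let ?n = "length cs"
  define z z' where "z i = fst (p i)" and "z' i = fst (p' i)" for i
  have cz: "sc_centers cs c z" and cz': "sc_centers cs c z'"
    unfolding z_def z'_def by (rule sc_centers_of[OF p], rule sc_centers_of[OF p'])
  have col: "sc_colors cs c" using cz by (simp add: sc_centers_def)
  define A where "A = {i. i < ?n \<and> cs ! i = Closed}"
  \<comment> \<open>For an open output the closed centers are kept in the upper half of the disk,
    where they cannot meet the open centers on the real line.\<close>
  define D where "D = (if c = Closed then ball 0 1 else ball 0 1 \<inter> {z. Im z > 0})"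
  have D: "open D" "convex D"
    by (auto simp: D_def open_halfspace_Im_gt convex_halfspace_Im_gt intro!: convex_Int)
  have c: "c = Closed \<or> c = Open" by (cases c) simp_all
  have zD: "z i \<in> D \<and> z' i \<in> D" if "i \<in> A" for i
    using that cz cz' c by (auto simp: A_def D_def sc_centers_def)
  have ne: "z i \<noteq> z j \<and> z' i \<noteq> z' j" if "i < ?n" "j < ?n" "i \<noteq> j" for i j
    using that cz cz' by (simp add: sc_centers_def)
  obtain g where g: "path g" "pathstart g = 0" "pathfinish g = 1"
    "\<And>t i. t \<in> {0..1} \<Longrightarrow> i \<in> A \<Longrightarrow> (1 - g t) * z i + g t * z' i \<in> D"
    "\<And>t i j. t \<in> {0..1} \<Longrightarrow> i \<in> A \<Longrightarrow> j \<in> A \<Longrightarrow> i \<noteq> j \<Longrightarrow>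
      (1 - g t) * z i + g t * z' i \<noteq> (1 - g t) * z j + g t * z' j"
    using complex_parameter_path[of A D z z'] D zD ne by (auto simp: A_def)
  \<comment> \<open>The complex parameter \<open>g\<close> moves the closed centers only; the real
    parameter \<open>t\<close> keeps the open centers real.\<close>
  define Z where "Z t i = (if cs ! i = Closed then (1 - g t) * z i + g t * z' i
    else (1 - complex_of_real t) * z i + complex_of_real t * z' i)" for t i
  have cont: "continuous_on {0..1} (\<lambda>t. Z t i)" for i
    unfolding Z_def using g(1) by (cases "cs ! i = Closed") (auto simp: path_def intro!: continuous_intros)
  have Z01: "Z 0 = z" "Z 1 = z'"
    using g(2,3) by (auto simp: Z_def pathstart_def pathfinish_def)
  have centers: "sc_centers cs c (Z t)" if t: "t \<in> {0..1}" for t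
  proof -
    have cl: "Z t i \<in> D" if "i < ?n" "cs ! i = Closed" for i
      using g(4)[OF t, of i] that by (simp add: A_def Z_def)
    have opn: "c = Open \<and> Z t i \<in> ball 0 1 \<and> Im (Z t i) = 0 \<and> Re (Z t i) = (1 - t) * Re (z i) + t * Re (z' i)"
      if i: "i < ?n" "cs ! i = Open" for i
    proof -
      have o: "c = Open" "Im (z i) = 0" "Im (z' i) = 0"
        using sc_open_center[OF p, of i] sc_open_center[OF p', of i] i by (simp_all add: open_inputs_def z_def z'_def)
      have "z i \<in> ball 0 1" "z' i \<in> ball 0 1" using cz cz' i by (simp_all add: sc_centers_def)
      then have "(1 - t) *\<^sub>R z i + t *\<^sub>R z' i \<in> ball 0 1"
        using t by (intro convexD[OF convex_ball]) auto
      moreover have "(1 - t) *\<^sub>R z i + t *\<^sub>R z' i = Z t i" using i by (simp add: Z_def scaleR_conv_of_real)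
      ultimately show ?thesis using o i by (simp add: Z_def)
    qed
    have "Z t i \<noteq> Z t j" if ij: "i < ?n" "j < ?n" "i \<noteq> j" for i j
    proof (cases "cs ! i"; cases "cs ! j")
      assume "cs ! i = Closed" "cs ! j = Closed"
      then show ?thesis using g(5)[OF t, of i j] ij by (simp add: A_def Z_def)
    next
      assume a: "cs ! i = Closed" "cs ! j = Open"
      then have "Im (Z t i) > 0" "Im (Z t j) = 0" using cl[of i] opn[of j] ij by (auto simp: D_def)
      then show ?thesis by auto
    next
      assume a: "cs ! i = Open" "cs ! j = Closed"
      then have "Im (Z t j) > 0" "Im (Z t i) = 0" using cl[of j] opn[of i] ij by (auto simp: D_def)
      then show ?thesis by auto
    next
      assume a: "cs ! i = Open" "cs ! j = Open"
      then have "i \<in> set (disk_word cs p)" "j \<in> set (disk_word cs p)" using ij by (simp_all add: open_inputs_def)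
      from sorted_wrt_both[OF sorted_disk_word[OF p] sorted_disk_word[OF p', folded word] this ij(3)]
      have o: "Re (z i) < Re (z j) \<and> Re (z' i) < Re (z' j) \<or> Re (z j) < Re (z i) \<and> Re (z' j) < Re (z' i)"
        by (simp add: z_def z'_def)
      \<comment> \<open>Equal words mean equal orders at both ends, and convex combinations preserve
        strict inequalities; for \<open>t = 0\<close> the strictness must come from the first
        summand.\<close>
      have lt: "(1 - t) * a + t * a' < (1 - t) * b + t * b'" if "a < b" "a' < b'" for a a' b b' :: real
      proof (cases "t = 0")
        case False
        then have "t * a' < t * b'" "(1 - t) * a \<le> (1 - t) * b" using t that by (auto intro: mult_left_mono)
        then show ?thesis by linarith
      qed (use that in simp)
      have "Re (Z t i) \<noteq> Re (Z t j)"
        using o lt[of "Re (z i)" "Re (z j)" "Re (z' i)" "Re (z' j)"] lt[of "Re (z j)" "Re (z i)" "Re (z' j)" "Re (z' i)"]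
          opn[OF ij(1) a(1)] opn[OF ij(2) a(2)] by auto
      then show ?thesis by auto
    qed
    moreover have "Z t i \<in> ball 0 1 \<and> (c = Open \<longrightarrow> (if cs ! i = Open then Im (Z t i) = 0 else Im (Z t i) > 0))"
      if "i < ?n" for i
      using cl[OF that] opn[OF that] by (cases "cs ! i") (auto simp: D_def split: if_splits)
    ultimately show ?thesis using col by (simp add: sc_centers_def)
  qed
  have below: "\<forall>\<^sub>F e in at_right 0. \<forall>i\<in>{..<?n}. e \<le> snd (q i)" if q: "q \<in> sc_space cs c" for q
  proof (rule eventually_ball_finite, simp, intro ballI)
    fix i assume "i \<in> {..<?n}"
    then have "0 < snd (q i)" using q by (simp add: sc_space_iff disk_configs_iff)
    then have "\<forall>\<^sub>F e in at_right 0. e \<in> {0<..<snd (q i)}" by (rule eventually_at_right_real)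
    then show "\<forall>\<^sub>F e in at_right 0. e \<le> snd (q i)" by (rule eventually_mono) simp
  qed
  have "\<forall>\<^sub>F e :: real in at_right 0. 0 < e" by (simp add: eventually_at_right_less)
  moreover have "\<forall>\<^sub>F e in at_right 0. path_component (sc_space cs c)
      (mk_config ?n (Z 0) (\<lambda>_. e)) (mk_config ?n (Z 1) (\<lambda>_. e))"
    by (rule move_disks) (rule cont, erule centers)
  moreover note below[OF p] below[OF p']
  ultimately have "\<forall>\<^sub>F e :: real in at_right 0. path_component (sc_space cs c) p p'"
  proof eventually_elim
    case (elim e)
    have "path_component (sc_space cs c) p (mk_config ?n z (\<lambda>_. e))"
      unfolding z_def using elim by (intro shrink_disks[OF p]) auto
    moreover have "path_component (sc_space cs c) p' (mk_config ?n z' (\<lambda>_. e))"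
      unfolding z'_def using elim by (intro shrink_disks[OF p']) auto
    moreover have "path_component (sc_space cs c) (mk_config ?n z (\<lambda>_. e)) (mk_config ?n z' (\<lambda>_. e))"
      using elim unfolding Z01 by simp
    ultimately show ?case
      using path_component_trans path_component_sym by metis
  qed
  \<comment> \<open>The statement no longer mentions \<open>e\<close>; as the filter is nontrivial,
    it holds for some \<open>e\<close>.\<close>
  then have "\<exists>e :: real. path_component (sc_space cs c) p p'"
    by (rule eventually_happens'[OF trivial_limit_at_right_real])
  then show ?thesis by simp
qed

text \<open>Open centers have distinct real parts throughout a path, so by the intermediate value
  theorem no two of them can change order.\<close>

lemma sc_path_word:
  assumes "path_component (sc_space cs c) p p'"
  shows "disk_word cs p = disk_word cs p'"
proof -
  obtain g where g: "path g" "path_image g \<subseteq> sc_space cs c" "pathstart g = p" "pathfinish g = p'"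
    using assms unfolding path_component_def by blast
  have sp: "g t \<in> sc_space cs c" if "t \<in> {0..1}" for t using g(2) that by (auto simp: path_image_def)
  have p: "g 0 = p" "g 1 = p'" using g(3,4) by (simp_all add: pathstart_def pathfinish_def)
  have "sorted_wrt (\<lambda>i j. Re (fst (p' i)) < Re (fst (p' j))) (disk_word cs p)"
  proof (rule sorted_wrt_mono_rel[OF _ sorted_disk_word])
    show "p \<in> sc_space cs c" using sp[of 0] p by simp
    fix i j assume ij: "i \<in> set (disk_word cs p)" "j \<in> set (disk_word cs p)" and lt: "Re (fst (p i)) < Re (fst (p j))"
    let ?d = "\<lambda>t. Re (fst (g t j)) - Re (fst (g t i))"
    have c: "continuous_on {0..1} (\<lambda>t. g t k)" for k
      using g(1) unfolding path_def by (rule continuous_on_product_then_coordinatewise)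
    have "continuous_on {0..1} ?d" by (intro continuous_intros c)
    moreover have "?d t \<noteq> 0" if "t \<in> {0..1}" for t
      using sc_open_separate[OF sp[OF that], of j i] ij lt by auto
    ultimately have "\<not> ?d 1 \<le> 0"
      using IVT2'[of ?d 1 0 0] lt p by fastforce
    then show "Re (fst (p' i)) < Re (fst (p' j))" using p by simp
  qed
  then show ?thesis by (intro disk_word_eqI[symmetric]) simp_all
qed

lemma disk_word_surj:
  assumes w: "w \<in> s_comp word_operad cs c"
  shows "\<exists>p\<in>sc_space cs c. disk_word cs p = w"
proof -
  let ?n = "length cs"
  have w': "distinct w" "set w = open_inputs cs" "w = [] \<longleftrightarrow> c = Closed" "cs \<noteq> []" using w by simp_all
  \<comment> \<open>The position of a letter in \<open>w\<close>.\<close>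
  define k where "k = inv_into {..<length w} (\<lambda>a. w ! a)"
  have inj: "inj_on (\<lambda>a. w ! a) {..<length w}" using w'(1) by (simp add: inj_on_nth)
  have kw: "k (w ! a) = a" if "a < length w" for a using inv_into_f_f[OF inj, of a] that by (simp add: k_def)
  have wk: "k i < length w \<and> w ! k i = i" if "i < ?n" "cs ! i = Open" for i
  proof -
    have "i \<in> (\<lambda>a. w ! a) ` {..<length w}"
      using w'(2) that by (auto simp: open_inputs_def set_conv_nth image_iff)
    then show ?thesis using inv_into_into[of i "\<lambda>a. w ! a" "{..<length w}"] f_inv_into_f[of i "\<lambda>a. w ! a" "{..<length w}"]
      by (simp add: k_def)
  qed
  \<comment> \<open>Open centers lie on the real axis and increase with the position in
    \<open>w\<close>; closed ones lie on the positive imaginary axis, where the summand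
    \<open>2\<close> keeps the one with index \<open>0\<close> off the unit circle.\<close>
  define z where "z i = (if cs ! i = Open then complex_of_real (1 - 1 / (real (k i) + 2)) else Complex 0 (1 / (real i + 2)))" for i
  have no: "cs ! i = Closed" if "c = Closed" "i < ?n" for i
    using that w'(2,3) by (cases "cs ! i") (auto simp: open_inputs_def)
  have col: "sc_colors cs c"
  proof (cases c)
    case Closed
    have "x = Closed" if x: "x \<in> set cs" for x
    proof -
      obtain i where "i < ?n" "cs ! i = x" using x unfolding in_set_conv_nth by (elim exE conjE)
      then show ?thesis using no[OF Closed, of i] by simp
    qed
    then have "set cs \<subseteq> {Closed}" by (intro subsetI) simp
    then show ?thesis using w'(4) Closed by (simp add: sc_colors_def)
  next
    case Open
    then have "w ! 0 \<in> open_inputs cs" using w'(2,3) nth_mem[of 0 w] by simp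
    then have "Open \<in> set cs" using nth_mem[of "w ! 0" cs] by (simp add: open_inputs_def)
    then show ?thesis using Open by (simp add: sc_colors_def)
  qed
  have "z i \<noteq> z j" if ij: "i < ?n" "j < ?n" "i \<noteq> j" for i j
  proof (cases "cs ! i"; cases "cs ! j")
    assume o: "cs ! i = Open" "cs ! j = Open"
    then have "k i \<noteq> k j" using wk[of i] wk[of j] ij by metis
    then have "1 / (real (k i) + 2) \<noteq> 1 / (real (k j) + 2)" by (simp add: field_simps)
    then show ?thesis using o by (simp add: z_def del: of_real_diff of_real_divide)
  next
    assume o: "cs ! i = Closed" "cs ! j = Closed"
    then show ?thesis using ij by (simp add: z_def field_simps)
  next
    assume o: "cs ! i = Open" "cs ! j = Closed"
    then have "Im (z i) = 0" "Im (z j) > 0" by (simp_all add: z_def)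
    then show ?thesis by auto
  next
    assume o: "cs ! i = Closed" "cs ! j = Open"
    then have "Im (z j) = 0" "Im (z i) > 0" by (simp_all add: z_def)
    then show ?thesis by auto
  qed
  moreover have "z i \<in> ball 0 1 \<and> (c = Open \<longrightarrow> (if cs ! i = Open then Im (z i) = 0 else Im (z i) > 0))" if "i < ?n" for i
  proof (cases "cs ! i = Open")
    case True
    have "\<bar>1 - 1 / (real (k i) + 2)\<bar> < 1" by (simp add: abs_less_iff field_simps)
    then have "cmod (z i) < 1" using True by (simp only: z_def simp_thms if_True norm_of_real)
    then show ?thesis using True by (simp add: z_def)
  next
    case False
    have "cmod (z i) = 1 / (real i + 2)" using False by (simp add: z_def complex_norm)
    then show ?thesis using False by (simp add: z_def)
  qed
  ultimately have cz: "sc_centers cs c z" using col by (simp add: sc_centers_def)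
  have "\<forall>\<^sub>F e in at_right 0. \<forall>t\<in>{0..1::real}. mk_config ?n z (\<lambda>_. e) \<in> sc_space cs c"
    using small_disks_eventually[of cs "\<lambda>_. z" c] cz by simp
  then have "\<exists>e. \<forall>t\<in>{0..1::real}. mk_config ?n z (\<lambda>_. e) \<in> sc_space cs c"
    by (rule eventually_happens'[OF trivial_limit_at_right_real])
  then obtain e where e: "mk_config ?n z (\<lambda>_. e) \<in> sc_space cs c" by force
  have "disk_word cs (mk_config ?n z (\<lambda>_. e)) = w"
  proof (rule disk_word_eqI[OF w'(2)], unfold sorted_wrt_iff_nth_less, intro allI impI)
    fix a b assume ab: "a < b" "b < length w"
    have "w ! a \<in> open_inputs cs" "w ! b \<in> open_inputs cs" using ab w'(2) nth_mem by (metis order.strict_trans)+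
    moreover have "1 / (real b + 2) < 1 / (real a + 2)" using ab by (simp add: field_simps)
    ultimately show "Re (fst (mk_config ?n z (\<lambda>_. e) (w ! a))) < Re (fst (mk_config ?n z (\<lambda>_. e) (w ! b)))"
      using ab kw by (simp add: mk_config_def open_inputs_def z_def)
  qed
  then show ?thesis using e by blast
qed

text \<open>Two configurations of a component have the same word exactly if a path joins them, so
  the boundaries of paths span the kernel of the word map.\<close>

theorem H0_SC_vor: "linearization word_operad \<cong>\<^sub>o (H0 SC_vor :: ('k::field, _) operad)"
  unfolding H0_def
proof (rule operad_iso_quot_kernel[OF _ words.closed_operad operad_map_disk_word])
  interpret SC: linear_operad "linearization SC_vor :: ('k, _) operad"
    by (rule linear_operad_linearization[OF closed_SC_vor])
  show "closed_operad (linearization SC_vor :: ('k, _) operad)" by (rule SC.closed_operad)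
  fix cs c
  let ?W = "lin (\<lambda>p. delta (disk_word cs p)) :: _ \<Rightarrow> _ \<Rightarrow>\<^sub>0 'k"
  obtain P where P: "\<And>w. w \<in> s_comp word_operad cs c \<Longrightarrow> P w \<in> sc_space cs c \<and> disk_word cs (P w) = w"
    using disk_word_surj[of _ cs c] by metis
  have SC: "s_comp SC_vor = sc_space" by (simp add: SC_vor_def)
  show "carrier (o_comp (linearization word_operad) cs c) \<subseteq>
      ?W ` carrier (o_comp (linearization SC_vor :: ('k, _) operad) cs c)"
  proof
    fix v :: "nat list \<Rightarrow>\<^sub>0 'k" assume "v \<in> carrier (o_comp (linearization word_operad) cs c)"
    then have v: "Poly_Mapping.keys v \<subseteq> s_comp word_operad cs c" by (simp add: linearization_simps del: word_operad_simps)
    have "?W (lin (\<lambda>w. delta (P w)) v) = lin delta v"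
      unfolding lin_lin by (rule lin_cong) (use P v in auto)
    moreover have "Poly_Mapping.keys (lin (\<lambda>w. delta (P w)) v) \<subseteq> sc_space cs c"
      by (rule keys_linD) (use P v in auto)
    ultimately show "v \<in> ?W ` carrier (o_comp (linearization SC_vor :: ('k, _) operad) cs c)"
      by (intro image_eqI[of v ?W "lin (\<lambda>w. delta (P w)) v"]) (simp_all add: linearization_simps SC)
  qed
  let ?G = "{delta (pathfinish \<gamma>) - delta (pathstart \<gamma>) :: _ \<Rightarrow>\<^sub>0 'k | \<gamma>. path \<gamma> \<and> path_image \<gamma> \<subseteq> sc_space cs c}"
  let ?K = "{f. Poly_Mapping.keys f \<subseteq> sc_space cs c \<and> ?W f = 0}"
  have K: "submodule ?K scalars (free_module (sc_space cs c))"
    by (rule submodule_free_moduleI) (auto simp: keys_subsetI)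
  have "?G \<subseteq> ?K"
  proof safe
    fix \<gamma> :: "real \<Rightarrow> nat \<Rightarrow> little_disk" assume \<gamma>: "path \<gamma>" "path_image \<gamma> \<subseteq> sc_space cs c"
    then have "path_component (sc_space cs c) (pathstart \<gamma>) (pathfinish \<gamma>)" unfolding path_component_def by blast
    then show "?W (delta (pathfinish \<gamma>) - delta (pathstart \<gamma>)) = 0"
      using sc_path_word by fastforce
    fix q assume q: "q \<in> Poly_Mapping.keys (delta (pathfinish \<gamma>) - delta (pathstart \<gamma>) :: _ \<Rightarrow>\<^sub>0 'k)"
    have "Poly_Mapping.keys (delta (pathfinish \<gamma>) - delta (pathstart \<gamma>) :: _ \<Rightarrow>\<^sub>0 'k) \<subseteq> sc_space cs c"
      by (rule keys_subsetI(2)) (use \<gamma>(2) pathstart_in_path_image pathfinish_in_path_image in auto)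
    then show "q \<in> sc_space cs c" using q by blast
  qed
  then have "boundaries0 SC_vor cs c \<subseteq> ?K"
    unfolding boundaries0_def module_span_def SC by (intro hull_minimal K)
  moreover have "?K \<subseteq> boundaries0 SC_vor cs c"
  proof
    fix f assume "f \<in> ?K"
    then have f: "Poly_Mapping.keys f \<subseteq> sc_space cs c" "?W f = 0" by simp_all
    \<comment> \<open>Each point is compared with the chosen point \<open>P\<close> of the same
      word. The differences are boundaries, and the remaining combination of chosen points vanishes
      because it depends on \<open>?W f = 0\<close> only.\<close>
    have "f \<in> N" if N: "submodule N scalars (free_module (sc_space cs c))" "?G \<subseteq> N" for N
    proof -
      have "delta p - delta (P (disk_word cs p)) \<in> N" if p: "p \<in> Poly_Mapping.keys f" for p
      proof -
        have p': "p \<in> sc_space cs c" using f p by blast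
        have "path_component (sc_space cs c) (P (disk_word cs p)) p"
          by (rule sc_path_component[OF _ p']) (use P[OF disk_word_comp[OF p']] in simp_all)
        then obtain \<gamma> where \<gamma>: "path \<gamma>" "path_image \<gamma> \<subseteq> sc_space cs c"
            "pathstart \<gamma> = P (disk_word cs p)" "pathfinish \<gamma> = p"
          unfolding path_component_def by (elim exE conjE)
        show ?thesis
          by (rule subsetD[OF N(2)], rule CollectI, rule exI[of _ \<gamma>], simp only: \<gamma> simp_thms)
      qed
      then have "lin (\<lambda>p. delta p - delta (P (disk_word cs p))) f \<in> N" by (rule submodule_lin[OF N(1)])
      moreover have "lin (\<lambda>p. delta (P (disk_word cs p))) f = lin (\<lambda>w. delta (P w)) (?W f)" by (simp add: lin_lin)
      ultimately show ?thesis using f(2) by simp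
    qed
    then show "f \<in> boundaries0 SC_vor cs c"
      unfolding boundaries0_def module_span_def SC hull_def
      by (intro InterI, elim CollectE conjE)
  qed
  ultimately show "boundaries0 SC_vor cs c = {x \<in> carrier (o_comp (linearization SC_vor :: ('k, _) operad) cs c).
      ?W x = \<zero>\<^bsub>o_comp (linearization word_operad) cs c\<^esub>}"
    by (auto simp: linearization_simps SC)
qed

text \<open>Both isomorphisms start at the operad of words, so the first one is inverted.\<close>

theorem lemma4p2p2:
  shows "koszul_dual (LP :: ('k::field_char_0, lp_gen \<Rightarrow>\<^sub>0 'k) quadratic) \<cong>\<^sub>o H0 SC_vor"
  by (rule operad_iso_trans[OF operad_iso_sym[OF words.closed_operad koszul_dual_LP] H0_SC_vor])

end
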